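(* Let $K$ be an algebraically closed field with $\mathrm{char}\,K\neq2$, let $A$ be a finite-dimensional gr-basic superalgebra over $K$, and let $\mathscr S_A=(D_i,\,{}_jM_i)_{i,j\in I}$ be its superspecies. Then $A$ is graded isomorphic to $T(\mathscr S_A)/\mathscr I$ for some admissible graded ideal $\mathscr I$ of $T(\mathscr S_A)$. Furthermore, if $A$ is gr-hereditary, then $\mathscr S_A$ is acyclic and $A$ is graded isomorphic to $T(\mathscr S_A)$.
   Context: A superalgebra is a $\mathbb Z_2$-graded associative unital $K$-algebra. Graded (left) modules $M=M_{\bar0}\oplus M_{\bar1}$ satisfy $A_gM_h\subseteq M_{g+h}$; graded morphisms preserve degree; graded isomorphic means isomorphic by a degree-preserving algebra isomorphism. A graded submodule is gr-maximal if the quotient by it is nonzero with no proper nonzero graded submodules. $J:=J_{\mathbb Z_2}(A)$ is the intersection of all gr-maximal submodules of ${}_AA$ (a graded ideal). A gr-division superalgebra is one in which every nonzero homogeneous element is invertible. A finite-dimensional superalgebra $A$ is gr-basic if $A/J$ is a direct sum of gr-division superalgebras. A finite-dimensional superalgebra is gr-hereditary if all its graded left ideals are gr-projective (projective in the category of graded modules). A superspecies $\mathscr S=(D_i,\,{}_jM_i)_{i,j\in I}$, $I=\{1,\dots,n\}$, is a collection of finite-dimensional gr-division superalgebras $D_i$ and finite-dimensional graded $D_j$-$D_i$-bimodules ${}_jM_i$ on which $K$ acts centrally. The superspecies $\mathscr S_A$ of a finite-dimensional gr-basic superalgebra $A$ is defined by $A/J=\bigoplus_{i=1}^nD_i$ with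 $D_i$ gr-division superalgebras, and $J/J^2=\bigoplus_{i,j\in I}{}_jM_i$, where ${}_jM_i$ is the graded $D_j$-$D_i$-bimodule component of the graded $A/J$-bimodule $J/J^2$ (i.e. ${}_jM_i=1_{D_j}(J/J^2)1_{D_i}$). For a superalgebra $R$ and graded $R$-$R$-bimodule $M$, $T(R,M)=\bigoplus_{i\ge0}M^{\otimes_Ri}$ (with $M^{\otimes_R0}=R$) is the tensor algebra with the induced $\mathbb Z_2$-grading. $T(\mathscr S):=T(R,M)$ with $R=\bigoplus_{i\in I}D_i$ and $M=\bigoplus_{i,j\in I}{}_jM_i$. A graded ideal $\mathscr I$ of $T(R,M)$ is admissible if $(\bigoplus_{i\ge1}M^{\otimes_Ri})^t\subseteq\mathscr I\subseteq(\bigoplus_{i\ge1}M^{\otimes_Ri})^2$ for some $t\ge2$. $\mathscr S$ is acyclic if $T(\mathscr S)$ is finite-dimensional. *)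

theory Defs
  imports
    "HOL-Library.Z2"
    "HOL-Algebra.Algebra"
    "Jordan_Normal_Form.Missing_VectorSpace"
begin

section \<open>Superalgebras and graded modules\<close>

text \<open>
  One record type serves for superalgebras over \<open>K\<close> (with \<^const>\<open>smult\<close> the action of \<open>K\<close>) and for
  graded left modules over a superalgebra \<open>A\<close> (with \<^const>\<open>smult\<close> the action of \<open>A\<close>, the fields
  \<^const>\<open>monoid.mult\<close> and \<^const>\<open>one\<close> being ignored).  Degrees are elements of the type \<^typ>\<open>bit\<close>,
  the integers modulo 2.
\<close>

record ('r, 'm) gmodule = "('r, 'm) module" +
  hcomp :: "bit \<Rightarrow> 'm set"

definition grading :: "('r, 'm, 'x) gmodule_scheme \<Rightarrow> bool" where
  "grading M \<longleftrightarrow>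
     (\<forall>g. subgroup (hcomp M g) (add_monoid M)) \<and>
     (\<forall>x \<in> carrier M. \<exists>!p. p \<in> hcomp M 0 \<times> hcomp M 1 \<and> x = fst p \<oplus>\<^bsub>M\<^esub> snd p)"

locale superalgebra = vs: vectorspace K A + ring A
  for K :: "('k, 'x) ring_scheme" and A :: "('k, 'a, 'y) gmodule_scheme" +
  assumes smult_mult_l:
      "\<lbrakk>c \<in> carrier K; x \<in> carrier A; y \<in> carrier A\<rbrakk> \<Longrightarrow>
        (c \<odot>\<^bsub>A\<^esub> x) \<otimes>\<^bsub>A\<^esub> y = c \<odot>\<^bsub>A\<^esub> (x \<otimes>\<^bsub>A\<^esub> y)"
    and smult_mult_r:
      "\<lbrakk>c \<in> carrier K; x \<in> carrier A; y \<in> carrier A\<rbrakk> \<Longrightarrow>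
        x \<otimes>\<^bsub>A\<^esub> (c \<odot>\<^bsub>A\<^esub> y) = c \<odot>\<^bsub>A\<^esub> (x \<otimes>\<^bsub>A\<^esub> y)"
    and grading: "grading A"
    and hcomp_smult:
      "\<lbrakk>c \<in> carrier K; x \<in> hcomp A g\<rbrakk> \<Longrightarrow> c \<odot>\<^bsub>A\<^esub> x \<in> hcomp A g"
    and hcomp_mult:
      "\<lbrakk>x \<in> hcomp A g; y \<in> hcomp A h\<rbrakk> \<Longrightarrow> x \<otimes>\<^bsub>A\<^esub> y \<in> hcomp A (g + h)"

definition superalgebra_iso ::
    "('k, 'x) ring_scheme \<Rightarrow> ('k, 'a, 'y) gmodule_scheme \<Rightarrow> ('k, 'b, 'z) gmodule_scheme
      \<Rightarrow> ('a \<Rightarrow> 'b) set" where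
  "superalgebra_iso K A B =
     {h \<in> ring_iso A B.
        (\<forall>c \<in> carrier K. \<forall>x \<in> carrier A. h (c \<odot>\<^bsub>A\<^esub> x) = c \<odot>\<^bsub>B\<^esub> h x) \<and>
        (\<forall>g. h ` hcomp A g \<subseteq> hcomp B g)}"

definition graded_isomorphic ::
    "('k, 'x) ring_scheme \<Rightarrow> ('k, 'a, 'y) gmodule_scheme \<Rightarrow> ('k, 'b, 'z) gmodule_scheme \<Rightarrow> bool" where
  "graded_isomorphic K A B \<longleftrightarrow> superalgebra_iso K A B \<noteq> {}"

definition gr_division :: "('k, 'x) ring_scheme \<Rightarrow> ('k, 'a, 'y) gmodule_scheme \<Rightarrow> bool" where
  "gr_division K D \<longleftrightarrow> superalgebra K D \<and> \<one>\<^bsub>D\<^esub> \<noteq> \<zero>\<^bsub>D\<^esub> \<and>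
     (\<forall>g. \<forall>x \<in> hcomp D g. x \<noteq> \<zero>\<^bsub>D\<^esub> \<longrightarrow> x \<in> Units D)"

locale graded_module = ring A + M?: abelian_group M
  for A :: "('k, 'a, 'y) gmodule_scheme" and M :: "('a, 'm, 'z) gmodule_scheme" +
  assumes act_closed:
      "\<lbrakk>a \<in> carrier A; x \<in> carrier M\<rbrakk> \<Longrightarrow> a \<odot>\<^bsub>M\<^esub> x \<in> carrier M"
    and act_add_l:
      "\<lbrakk>a \<in> carrier A; b \<in> carrier A; x \<in> carrier M\<rbrakk> \<Longrightarrow>
        (a \<oplus>\<^bsub>A\<^esub> b) \<odot>\<^bsub>M\<^esub> x = a \<odot>\<^bsub>M\<^esub> x \<oplus>\<^bsub>M\<^esub> b \<odot>\<^bsub>M\<^esub> x"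
    and act_add_r:
      "\<lbrakk>a \<in> carrier A; x \<in> carrier M; y \<in> carrier M\<rbrakk> \<Longrightarrow>
        a \<odot>\<^bsub>M\<^esub> (x \<oplus>\<^bsub>M\<^esub> y) = a \<odot>\<^bsub>M\<^esub> x \<oplus>\<^bsub>M\<^esub> a \<odot>\<^bsub>M\<^esub> y"
    and act_assoc:
      "\<lbrakk>a \<in> carrier A; b \<in> carrier A; x \<in> carrier M\<rbrakk> \<Longrightarrow>
        (a \<otimes>\<^bsub>A\<^esub> b) \<odot>\<^bsub>M\<^esub> x = a \<odot>\<^bsub>M\<^esub> (b \<odot>\<^bsub>M\<^esub> x)"
    and act_one: "x \<in> carrier M \<Longrightarrow> \<one>\<^bsub>A\<^esub> \<odot>\<^bsub>M\<^esub> x = x"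
    and grading: "grading M"
    and hcomp_act:
      "\<lbrakk>a \<in> hcomp A g; x \<in> hcomp M h\<rbrakk> \<Longrightarrow> a \<odot>\<^bsub>M\<^esub> x \<in> hcomp M (g + h)"

definition graded_hom ::
    "('k, 'a, 'y) gmodule_scheme \<Rightarrow> ('a, 'm, 'z) gmodule_scheme \<Rightarrow> ('a, 'n, 'w) gmodule_scheme
      \<Rightarrow> ('m \<Rightarrow> 'n) set" where
  "graded_hom A M N =
     {h \<in> carrier M \<rightarrow> carrier N.
        (\<forall>x \<in> carrier M. \<forall>y \<in> carrier M. h (x \<oplus>\<^bsub>M\<^esub> y) = h x \<oplus>\<^bsub>N\<^esub> h y) \<and>
        (\<forall>a \<in> carrier A. \<forall>x \<in> carrier M. h (a \<odot>\<^bsub>M\<^esub> x) = a \<odot>\<^bsub>N\<^esub> h x) \<and>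
        (\<forall>g. h ` hcomp M g \<subseteq> hcomp N g)}"

text \<open>The left module \<open>\<^sub>AA\<close>; its graded submodules are the graded left ideals of \<open>A\<close>.\<close>

definition regular_module :: "('k, 'a, 'y) gmodule_scheme \<Rightarrow> ('a, 'a) gmodule" where
  "regular_module A =
     \<lparr>carrier = carrier A, monoid.mult = monoid.mult A, one = \<one>\<^bsub>A\<^esub>, ring.zero = \<zero>\<^bsub>A\<^esub>, ring.add = ring.add A,
      smult = monoid.mult A, hcomp = hcomp A\<rparr>"

definition graded_subset :: "('r, 'm, 'x) gmodule_scheme \<Rightarrow> 'm set \<Rightarrow> bool" where
  "graded_subset M N \<longleftrightarrow>
     (\<forall>x \<in> N. \<exists>y \<in> N \<inter> hcomp M 0. \<exists>z \<in> N \<inter> hcomp M 1. x = y \<oplus>\<^bsub>M\<^esub> z)"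

definition graded_submodule ::
    "('k, 'a, 'y) gmodule_scheme \<Rightarrow> ('a, 'm, 'z) gmodule_scheme \<Rightarrow> 'm set \<Rightarrow> bool" where
  "graded_submodule A M N \<longleftrightarrow>
     subgroup N (add_monoid M) \<and>
     (\<forall>a \<in> carrier A. \<forall>x \<in> N. a \<odot>\<^bsub>M\<^esub> x \<in> N) \<and>
     graded_subset M N"

text \<open>Restriction to a homogeneous subgroup, and quotient by it.  The quotient is used both for modules
  and, when \<open>N\<close> is a graded ideal of a superalgebra \<open>M\<close>, for algebras (where it extends
  \<^const>\<open>FactRing\<close>).\<close>

definition gsub :: "('r, 'm, 'x) gmodule_scheme \<Rightarrow> 'm set \<Rightarrow> ('r, 'm, 'x) gmodule_scheme" where
  "gsub M N = M\<lparr>carrier := N, hcomp := (\<lambda>g. hcomp M g \<inter> N)\<rparr>"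

definition gquot :: "('r, 'm, 'x) gmodule_scheme \<Rightarrow> 'm set \<Rightarrow> ('r, 'm set) gmodule" where
  "gquot M N =
     \<lparr>carrier = carrier (M Quot N), monoid.mult = monoid.mult (M Quot N), one = \<one>\<^bsub>M Quot N\<^esub>,
      ring.zero = \<zero>\<^bsub>M Quot N\<^esub>, ring.add = ring.add (M Quot N),
      smult = (\<lambda>a U. \<Union>x\<in>U. N +>\<^bsub>M\<^esub> (a \<odot>\<^bsub>M\<^esub> x)),
      hcomp = (\<lambda>g. (\<lambda>x. N +>\<^bsub>M\<^esub> x) ` hcomp M g)\<rparr>"

definition graded_ideal :: "('k, 'a, 'y) gmodule_scheme \<Rightarrow> 'a set \<Rightarrow> bool" where
  "graded_ideal A I \<longleftrightarrow> ideal I A \<and> graded_subset A I"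

primrec ideal_power :: "('a, 'x) ring_scheme \<Rightarrow> 'a set \<Rightarrow> nat \<Rightarrow> 'a set" where
  "ideal_power R I 0 = carrier R"
| "ideal_power R I (Suc n) = ideal_prod R (ideal_power R I n) I"


section \<open>The graded Jacobson radical, gr-basic and gr-hereditary superalgebras\<close>

definition gr_simple ::
    "('k, 'a, 'y) gmodule_scheme \<Rightarrow> ('a, 'm, 'z) gmodule_scheme \<Rightarrow> bool" where
  "gr_simple A M \<longleftrightarrow> carrier M \<noteq> {\<zero>\<^bsub>M\<^esub>} \<and>
     (\<forall>N. graded_submodule A M N \<longrightarrow> N = {\<zero>\<^bsub>M\<^esub>} \<or> N = carrier M)"

definition gr_maximal ::
    "('k, 'a, 'y) gmodule_scheme \<Rightarrow> ('a, 'm, 'z) gmodule_scheme \<Rightarrow> 'm set \<Rightarrow> bool" where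
  "gr_maximal A M N \<longleftrightarrow> graded_submodule A M N \<and> gr_simple A (gquot M N)"

definition gr_radical :: "('k, 'a, 'y) gmodule_scheme \<Rightarrow> 'a set" where
  "gr_radical A = {x \<in> carrier A. \<forall>N. gr_maximal A (regular_module A) N \<longrightarrow> x \<in> N}"

definition superalgebra_sum :: "'i set \<Rightarrow> ('i \<Rightarrow> ('k, 'd) gmodule) \<Rightarrow> ('k, 'i \<Rightarrow> 'd) gmodule" where
  "superalgebra_sum I D =
     \<lparr>carrier = (\<Pi>\<^sub>E i\<in>I. carrier (D i)),
      monoid.mult = (\<lambda>x y. \<lambda>i\<in>I. x i \<otimes>\<^bsub>D i\<^esub> y i),
      one = (\<lambda>i\<in>I. \<one>\<^bsub>D i\<^esub>),
      ring.zero = (\<lambda>i\<in>I. \<zero>\<^bsub>D i\<^esub>),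
      ring.add = (\<lambda>x y. \<lambda>i\<in>I. x i \<oplus>\<^bsub>D i\<^esub> y i),
      smult = (\<lambda>c x. \<lambda>i\<in>I. c \<odot>\<^bsub>D i\<^esub> x i),
      hcomp = (\<lambda>g. \<Pi>\<^sub>E i\<in>I. hcomp (D i) g)\<rparr>"

text \<open>\<open>B = D\<^sub>1 \<oplus> \<dots> \<oplus> D\<^sub>n\<close> as an internal direct sum of superalgebras: every \<open>D i\<close> is a subset of \<open>B\<close>
  with the inherited structure, except that it has an identity element of its own.\<close>

definition gr_division_decomp ::
    "('k, 'x) ring_scheme \<Rightarrow> ('k, 'b) gmodule \<Rightarrow> nat \<Rightarrow> (nat \<Rightarrow> ('k, 'b) gmodule) \<Rightarrow> bool" where
  "gr_division_decomp K B n D \<longleftrightarrow>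
     (\<forall>i \<in> {1..n}. carrier (D i) \<subseteq> carrier B \<and>
        D i = (gsub B (carrier (D i)))\<lparr>one := \<one>\<^bsub>D i\<^esub>\<rparr> \<and> gr_division K (D i)) \<and>
     (\<lambda>d. \<Oplus>\<^bsub>B\<^esub>i\<in>{1..n}. d i) \<in> superalgebra_iso K (superalgebra_sum {1..n} D) B"

definition gr_basic :: "('k, 'x) ring_scheme \<Rightarrow> ('k, 'a, 'y) gmodule_scheme \<Rightarrow> bool" where
  "gr_basic K A \<longleftrightarrow> (\<exists>n D. gr_division_decomp K (gquot A (gr_radical A)) n D)"

text \<open>
  Projectivity in the category of graded left \<open>A\<close>-modules: lifting along epimorphisms, which are the
  surjective morphisms.  HOL cannot quantify over all types of module elements, so the test modules
  \<open>M\<close>, \<open>N\<close> range over all graded modules with elements of type \<^typ>\<open>'a \<Rightarrow> 'a\<close>.  This is no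
  restriction for a module \<open>P\<close> with elements of type \<^typ>\<open>'a\<close> over an algebra with elements of type
  \<^typ>\<open>'a\<close>: the type contains a copy of \<open>P\<close> (constant functions) and of the graded free module on the
  homogeneous elements of \<open>P\<close> (finitely supported functions from \<open>P\<close> to \<open>A\<close>).  Lifting the identity of
  \<open>P\<close> along the canonical map between these makes \<open>P\<close> a graded direct summand of a graded free
  module, hence gives lifting for arbitrary \<open>M\<close>, \<open>N\<close>.
\<close>

definition gr_projective ::
    "('k, 'a, 'y) gmodule_scheme \<Rightarrow> ('a, 'a, 'z) gmodule_scheme \<Rightarrow> bool" where
  "gr_projective A P \<longleftrightarrow> graded_module A P \<and>
     (\<forall>(M :: ('a, 'a \<Rightarrow> 'a) gmodule) (N :: ('a, 'a \<Rightarrow> 'a) gmodule) q f.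
        graded_module A M \<and> graded_module A N \<and>
        q \<in> graded_hom A M N \<and> q ` carrier M = carrier N \<and> f \<in> graded_hom A P N \<longrightarrow>
        (\<exists>h \<in> graded_hom A P M. \<forall>x \<in> carrier P. q (h x) = f x))"

definition gr_hereditary :: "('k, 'a, 'y) gmodule_scheme \<Rightarrow> bool" where
  "gr_hereditary A \<longleftrightarrow>
     (\<forall>L. graded_submodule A (regular_module A) L \<longrightarrow>
        gr_projective A (gsub (regular_module A) L))"


section \<open>Tensor algebras of graded bimodules\<close>

record ('r, 's, 'm) gbimodule = "('r, 'm) gmodule" +
  rsmult :: "'m \<Rightarrow> 's \<Rightarrow> 'm"

text \<open>
  For \<open>n \<ge> 1\<close> the tensor power \<open>M\<^bsup>\<otimes>n\<^esup>\<close> over \<open>R\<close> is the free abelian group on the words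
  \<open>x\<^sub>1 \<dots> x\<^sub>n\<close> of elements of \<open>M\<close>, modulo additivity in each letter and
  \<open>x\<^sub>1 \<dots> (x\<^sub>k r) x\<^bsub>k+1\<^esub> \<dots> x\<^sub>n = x\<^sub>1 \<dots> x\<^sub>k (r x\<^bsub>k+1\<^esub>) \<dots> x\<^sub>n\<close> for \<open>r \<in> R\<close>.
\<close>

definition tensor_words :: "('r, 's, 'm, 'y) gbimodule_scheme \<Rightarrow> nat \<Rightarrow> 'm list set" where
  "tensor_words M n = {w. length w = n \<and> set w \<subseteq> carrier M}"

definition tensor_free ::
    "('r, 's, 'm, 'y) gbimodule_scheme \<Rightarrow> nat \<Rightarrow> ('m list \<Rightarrow>\<^sub>0 int) monoid" where
  "tensor_free M n = free_Abelian_group (tensor_words M n)"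

definition tensor_rels ::
    "('r, 'x) ring_scheme \<Rightarrow> ('r, 'r, 'm, 'y) gbimodule_scheme \<Rightarrow> nat \<Rightarrow> ('m list \<Rightarrow>\<^sub>0 int) set" where
  "tensor_rels R M n =
     {frag_of (u @ [x \<oplus>\<^bsub>M\<^esub> y] @ v) - frag_of (u @ [x] @ v) - frag_of (u @ [y] @ v) | u x y v.
        u @ [x] @ v \<in> tensor_words M n \<and> y \<in> carrier M} \<union>
     {frag_of (u @ [rsmult M x r, y] @ v) - frag_of (u @ [x, r \<odot>\<^bsub>M\<^esub> y] @ v) | u x r y v.
        u @ [x, y] @ v \<in> tensor_words M n \<and> r \<in> carrier R}"

definition tensor_null ::
    "('r, 'x) ring_scheme \<Rightarrow> ('r, 'r, 'm, 'y) gbimodule_scheme \<Rightarrow> nat \<Rightarrow> ('m list \<Rightarrow>\<^sub>0 int) set" where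
  "tensor_null R M n = generate (tensor_free M n) (tensor_rels R M n)"

definition tensor_power ::
    "('r, 'x) ring_scheme \<Rightarrow> ('r, 'r, 'm, 'y) gbimodule_scheme \<Rightarrow> nat \<Rightarrow> ('m list \<Rightarrow>\<^sub>0 int) set monoid" where
  "tensor_power R M n = tensor_free M n Mod tensor_null R M n"

abbreviation tensor_class ::
    "('r, 'x) ring_scheme \<Rightarrow> ('r, 'r, 'm, 'y) gbimodule_scheme \<Rightarrow> nat \<Rightarrow> ('m list \<Rightarrow>\<^sub>0 int)
      \<Rightarrow> ('m list \<Rightarrow>\<^sub>0 int) set" where
  "tensor_class R M n a \<equiv> tensor_null R M n #>\<^bsub>tensor_free M n\<^esub> a"

definition tensor_hcomp ::
    "('r, 'x) ring_scheme \<Rightarrow> ('r, 'r, 'm, 'y) gbimodule_scheme \<Rightarrow> nat \<Rightarrow> bit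
      \<Rightarrow> ('m list \<Rightarrow>\<^sub>0 int) set set" where
  "tensor_hcomp R M n g =
     {tensor_class R M n a | a.
        Poly_Mapping.keys a \<subseteq>
          {w \<in> tensor_words M n. \<exists>ds. list_all2 (\<lambda>x d. x \<in> hcomp M d) w ds \<and> sum_list ds = g}}"

text \<open>The concatenation product \<open>M\<^bsup>\<otimes>m\<^esup> \<times> M\<^bsup>\<otimes>n\<^esup> \<rightarrow> M\<^bsup>\<otimes>(m+n)\<^esup>\<close> and the two actions of \<open>R\<close> on
  \<open>M\<^bsup>\<otimes>n\<^esup>\<close>, for \<open>m, n \<ge> 1\<close>, computed on representatives.\<close>

definition tensor_mult ::
    "('r, 'x) ring_scheme \<Rightarrow> ('r, 'r, 'm, 'y) gbimodule_scheme \<Rightarrow> nat \<Rightarrow> nat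
      \<Rightarrow> ('m list \<Rightarrow>\<^sub>0 int) set \<Rightarrow> ('m list \<Rightarrow>\<^sub>0 int) set \<Rightarrow> ('m list \<Rightarrow>\<^sub>0 int) set" where
  "tensor_mult R M m n U V =
     (\<Union>a\<in>U. \<Union>b\<in>V. tensor_class R M (m + n)
        (frag_extend (\<lambda>u. frag_extend (\<lambda>v. frag_of (u @ v)) b) a))"

definition tensor_lact ::
    "('r, 'x) ring_scheme \<Rightarrow> ('r, 'r, 'm, 'y) gbimodule_scheme \<Rightarrow> nat
      \<Rightarrow> 'r \<Rightarrow> ('m list \<Rightarrow>\<^sub>0 int) set \<Rightarrow> ('m list \<Rightarrow>\<^sub>0 int) set" where
  "tensor_lact R M n r U =
     (\<Union>a\<in>U. tensor_class R M n (frag_extend (\<lambda>w. frag_of ((r \<odot>\<^bsub>M\<^esub> hd w) # tl w)) a))"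

definition tensor_ract ::
    "('r, 'x) ring_scheme \<Rightarrow> ('r, 'r, 'm, 'y) gbimodule_scheme \<Rightarrow> nat
      \<Rightarrow> ('m list \<Rightarrow>\<^sub>0 int) set \<Rightarrow> 'r \<Rightarrow> ('m list \<Rightarrow>\<^sub>0 int) set" where
  "tensor_ract R M n U r =
     (\<Union>a\<in>U. tensor_class R M n (frag_extend (\<lambda>w. frag_of (butlast w @ [rsmult M (last w) r])) a))"

text \<open>
  An element \<open>(r, f)\<close> of \<open>T(R, M)\<close> consists of its component \<open>r\<close> in \<open>M\<^bsup>\<otimes>0\<^esup> = R\<close> and of its components
  \<open>f n\<close> in \<open>M\<^bsup>\<otimes>n\<^esup>\<close>, \<open>n \<ge> 1\<close>, almost all zero.  The groups \<^const>\<open>tensor_power\<close> and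
  \<^const>\<open>sum_group\<close> are written multiplicatively.
\<close>

definition tensor_pos ::
    "('r, 'x) ring_scheme \<Rightarrow> ('r, 'r, 'm, 'y) gbimodule_scheme
      \<Rightarrow> (nat \<Rightarrow> ('m list \<Rightarrow>\<^sub>0 int) set) monoid" where
  "tensor_pos R M = sum_group {1..} (tensor_power R M)"

definition tensor_algebra ::
    "('k, 'r, 'x) gmodule_scheme \<Rightarrow> ('r, 'r, 'm, 'y) gbimodule_scheme
      \<Rightarrow> ('k, 'r \<times> (nat \<Rightarrow> ('m list \<Rightarrow>\<^sub>0 int) set)) gmodule" where
  "tensor_algebra R M =
     \<lparr>carrier = carrier R \<times> carrier (tensor_pos R M),
      monoid.mult = (\<lambda>(r, f) (s, g).
        (r \<otimes>\<^bsub>R\<^esub> s,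
         \<lambda>n\<in>{1..}.
           tensor_lact R M n r (g n)
           \<otimes>\<^bsub>tensor_power R M n\<^esub> tensor_ract R M n (f n) s
           \<otimes>\<^bsub>tensor_power R M n\<^esub>
             (\<Otimes>\<^bsub>tensor_power R M n\<^esub>i\<in>{1..<n}. tensor_mult R M i (n - i) (f i) (g (n - i))))),
      one = (\<one>\<^bsub>R\<^esub>, \<one>\<^bsub>tensor_pos R M\<^esub>),
      ring.zero = (\<zero>\<^bsub>R\<^esub>, \<one>\<^bsub>tensor_pos R M\<^esub>),
      ring.add = (\<lambda>(r, f) (s, g). (r \<oplus>\<^bsub>R\<^esub> s, f \<otimes>\<^bsub>tensor_pos R M\<^esub> g)),
      smult = (\<lambda>c (r, f). (c \<odot>\<^bsub>R\<^esub> r, \<lambda>n\<in>{1..}. tensor_lact R M n (c \<odot>\<^bsub>R\<^esub> \<one>\<^bsub>R\<^esub>) (f n))),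
      hcomp = (\<lambda>g. {(r, f). r \<in> hcomp R g \<and> f \<in> carrier (tensor_pos R M) \<and>
                            (\<forall>n\<ge>1. f n \<in> tensor_hcomp R M n g)})\<rparr>"

definition tensor_pos_ideal ::
    "('k, 'r, 'x) gmodule_scheme \<Rightarrow> ('r, 'r, 'm, 'y) gbimodule_scheme
      \<Rightarrow> ('r \<times> (nat \<Rightarrow> ('m list \<Rightarrow>\<^sub>0 int) set)) set" where
  "tensor_pos_ideal R M = {\<zero>\<^bsub>R\<^esub>} \<times> carrier (tensor_pos R M)"

definition admissible ::
    "('k, 'r, 'x) gmodule_scheme \<Rightarrow> ('r, 'r, 'm, 'y) gbimodule_scheme
      \<Rightarrow> ('r \<times> (nat \<Rightarrow> ('m list \<Rightarrow>\<^sub>0 int) set)) set \<Rightarrow> bool" where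
  "admissible R M I \<longleftrightarrow>
     graded_ideal (tensor_algebra R M) I \<and>
     (\<exists>t\<ge>2. ideal_power (tensor_algebra R M) (tensor_pos_ideal R M) t \<subseteq> I) \<and>
     I \<subseteq> ideal_power (tensor_algebra R M) (tensor_pos_ideal R M) 2"


section \<open>Superspecies\<close>

text \<open>
  \<open>bimod S j i\<close> is the \<open>D\<^sub>j\<close>-\<open>D\<^sub>i\<close>-bimodule \<open>\<^sub>jM\<^sub>i\<close>; the indices range over \<open>{1..num S}\<close>.  The record
  carries the data only.  For the superspecies of a finite-dimensional superalgebra (below) the
  bimodule axioms, finite-dimensionality and centrality of \<open>K\<close> are inherited from \<open>A\<close>.
\<close>

record ('k, 'd, 'm) superspecies =
  num :: nat
  divalg :: "nat \<Rightarrow> ('k, 'd) gmodule"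
  bimod :: "nat \<Rightarrow> nat \<Rightarrow> ('d, 'd, 'm) gbimodule"

definition species_ring :: "('k, 'd, 'm) superspecies \<Rightarrow> ('k, nat \<Rightarrow> 'd) gmodule" where
  "species_ring S = superalgebra_sum {1..num S} (divalg S)"

definition species_bimodule ::
    "('k, 'd, 'm) superspecies \<Rightarrow> (nat \<Rightarrow> 'd, nat \<Rightarrow> 'd, nat \<times> nat \<Rightarrow> 'm) gbimodule" where
  "species_bimodule S =
     (let P = {1..num S} \<times> {1..num S}; M = (\<lambda>(j, i). bimod S j i) in
     \<lparr>carrier = (\<Pi>\<^sub>E p\<in>P. carrier (M p)),
      monoid.mult = undefined,
      one = undefined,
      ring.zero = (\<lambda>p\<in>P. \<zero>\<^bsub>M p\<^esub>),
      ring.add = (\<lambda>x y. \<lambda>p\<in>P. x p \<oplus>\<^bsub>M p\<^esub> y p),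
      smult = (\<lambda>r x. \<lambda>p\<in>P. r (fst p) \<odot>\<^bsub>M p\<^esub> x p),
      hcomp = (\<lambda>g. \<Pi>\<^sub>E p\<in>P. hcomp (M p) g),
      rsmult = (\<lambda>x r. \<lambda>p\<in>P. rsmult (M p) (x p) (r (snd p)))\<rparr>)"

abbreviation species_tensor_algebra ::
    "('k, 'd, 'm) superspecies
      \<Rightarrow> ('k, (nat \<Rightarrow> 'd) \<times> (nat \<Rightarrow> ((nat \<times> nat \<Rightarrow> 'm) list \<Rightarrow>\<^sub>0 int) set)) gmodule" where
  "species_tensor_algebra S \<equiv> tensor_algebra (species_ring S) (species_bimodule S)"

definition acyclic_species :: "('k, 'x) ring_scheme \<Rightarrow> ('k, 'd, 'm) superspecies \<Rightarrow> bool" where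
  "acyclic_species K S \<longleftrightarrow> vectorspace.fin_dim K (species_tensor_algebra S)"

text \<open>\<open>J/J\<^sup>2\<close> as a bimodule over \<open>A/J\<close>: both actions multiply representatives in \<open>A\<close>.\<close>

definition radical_bimodule ::
    "('k, 'a, 'y) gmodule_scheme \<Rightarrow> ('a set, 'a set, 'a set) gbimodule" where
  "radical_bimodule A =
     (let J = gr_radical A; J2 = ideal_prod A J J; Q = gquot (gsub A J) J2 in
     \<lparr>carrier = carrier Q, monoid.mult = undefined, one = undefined, ring.zero = \<zero>\<^bsub>Q\<^esub>, ring.add = ring.add Q,
      smult = rcoset_mult A J2, hcomp = hcomp Q, rsmult = rcoset_mult A J2\<rparr>)"

text \<open>
  \<open>S\<close> is the superspecies of \<open>A\<close> formed with respect to a chosen enumeration \<open>D\<^sub>1, \<dots>, D\<^sub>n\<close> of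
  the summands of \<open>A/J\<close>; the \<open>D\<^sub>i\<close> themselves are unique up to order.
\<close>

definition superspecies_of ::
    "('k, 'x) ring_scheme \<Rightarrow> ('k, 'a, 'y) gmodule_scheme \<Rightarrow> ('k, 'a set, 'a set) superspecies \<Rightarrow> bool"
  where
  "superspecies_of K A S \<longleftrightarrow>
     gr_division_decomp K (gquot A (gr_radical A)) (num S) (divalg S) \<and>
     (\<forall>j \<in> {1..num S}. \<forall>i \<in> {1..num S}.
        bimod S j i =
          (let Q = radical_bimodule A in
           gsub Q {rsmult Q (\<one>\<^bsub>divalg S j\<^esub> \<odot>\<^bsub>Q\<^esub> m) \<one>\<^bsub>divalg S i\<^esub> | m. m \<in> carrier Q}))"

end

(*
  The tensor algebra T of the superspecies maps to A as soon as A/J lifts to a graded subalgebra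
  (Wedderburn-Malcev: lift homogeneous orthogonal idempotents f_i, and odd u_i with u_i^2 = f_i, along
  the nilpotent ideal J; 2 is invertible and K is algebraically closed, so these span a copy of A/J) and
  J -> J/J^2 has a section that is linear on both sides over this copy (average over its separability
  idempotent).  The map is onto because J is nilpotent, and comparing degrees modulo J and J^2 shows that
  its kernel is admissible.

  If J is gr-projective, choose a homogeneous basis b of the image V of the section over the copy of A/J and
  split the surjection from the direct sum of the A f_b to J that sends (a_b) to the sum of the a_b b.  Its
  kernel X satisfies X <= J^k F for all k, hence X = 0: the b are independent over A.  Elements of the
  positive part of T are uniquely sums of t_b b, so by induction on the degree the map from T has no kernel.
*)

theory Submission
  imports Defs
begin

section \<open>The tensor algebra of a bimodule\<close>

text \<open>The tensor algebra, the ring R and the bimodule M are raw records on cosets and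
  functions, so their laws have to be earned. For T they are checked on additive generators. For R
  and M they are pulled back along injections into A: R is identified with the lifted subalgebra
  \<open>wedd\<close>, M with the image \<open>V\<close> of the section, and every computation with
  entries becomes one with Peirce corners f_j x f_i. Over an algebraically closed field a
  gr-division superalgebra has even part K and odd part 0 or K u with u u = 1. So a lift consists of
  idempotents and square roots only, and both come from one Newton iteration for square roots, an
  idempotent e being encoded by the involution 1 - 2e. A missing odd generator is recorded as u = 0,
  which keeps both cases in one formula. The powers of J in the hereditary case arise from the
  projection 1 - h \<open>sig\<close> of F onto X, where h splits the surjection \<open>sig\<close>.
  Independence of the b modulo J^2 puts X into J F. The projection is A-linear and fixes X, so x in
  X is the sum of the x_b times the projected unit vectors, and each application gains one factor
  from J.\<close>

locale bimodule = R: ring R + M: abelian_group M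
  for R :: "('k, 'r, 'x) gmodule_scheme" and M :: "('r, 'r, 'm, 'y) gbimodule_scheme" +
  assumes lact_closed [simp, intro]:
      "[| r \<in> carrier R; x \<in> carrier M |] ==> r \<odot>\<^bsub>M\<^esub> x \<in> carrier M"
    and lact_add_l:
      "[| r \<in> carrier R; s \<in> carrier R; x \<in> carrier M |] ==>
        (r \<oplus>\<^bsub>R\<^esub> s) \<odot>\<^bsub>M\<^esub> x = r \<odot>\<^bsub>M\<^esub> x \<oplus>\<^bsub>M\<^esub> s \<odot>\<^bsub>M\<^esub> x"
    and lact_add_r:
      "[| r \<in> carrier R; x \<in> carrier M; y \<in> carrier M |] ==>
        r \<odot>\<^bsub>M\<^esub> (x \<oplus>\<^bsub>M\<^esub> y) = r \<odot>\<^bsub>M\<^esub> x \<oplus>\<^bsub>M\<^esub> r \<odot>\<^bsub>M\<^esub> y"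
    and lact_assoc:
      "[| r \<in> carrier R; s \<in> carrier R; x \<in> carrier M |] ==>
        (r \<otimes>\<^bsub>R\<^esub> s) \<odot>\<^bsub>M\<^esub> x = r \<odot>\<^bsub>M\<^esub> (s \<odot>\<^bsub>M\<^esub> x)"
    and lact_one: "x \<in> carrier M ==> \<one>\<^bsub>R\<^esub> \<odot>\<^bsub>M\<^esub> x = x"
    and ract_closed [simp, intro]:
      "[| r \<in> carrier R; x \<in> carrier M |] ==> rsmult M x r \<in> carrier M"
    and ract_add_r:
      "[| r \<in> carrier R; s \<in> carrier R; x \<in> carrier M |] ==>
        rsmult M x (r \<oplus>\<^bsub>R\<^esub> s) = rsmult M x r \<oplus>\<^bsub>M\<^esub> rsmult M x s"
    and ract_add_l:
      "[| r \<in> carrier R; x \<in> carrier M; y \<in> carrier M |] ==>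
        rsmult M (x \<oplus>\<^bsub>M\<^esub> y) r = rsmult M x r \<oplus>\<^bsub>M\<^esub> rsmult M y r"
    and ract_assoc:
      "[| r \<in> carrier R; s \<in> carrier R; x \<in> carrier M |] ==>
        rsmult M x (r \<otimes>\<^bsub>R\<^esub> s) = rsmult M (rsmult M x r) s"
    and ract_one: "x \<in> carrier M ==> rsmult M x \<one>\<^bsub>R\<^esub> = x"
    and lact_ract:
      "[| r \<in> carrier R; s \<in> carrier R; x \<in> carrier M |] ==>
        rsmult M (r \<odot>\<^bsub>M\<^esub> x) s = r \<odot>\<^bsub>M\<^esub> rsmult M x s"
begin

section \<open>Tensor powers: pure tensors generate them, and additive maps on words descend\<close>

abbreviation F where "F \<equiv> tensor_free M"
abbreviation N where "N \<equiv> tensor_null R M"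
abbreviation P where "P \<equiv> tensor_power R M"
abbreviation cl where "cl \<equiv> tensor_class R M"
abbreviation W where "W \<equiv> tensor_words M"

lemma comm_group_free: "comm_group (F n)"
  by (simp add: tensor_free_def abelian_free_Abelian_group)

lemma carrier_free: "a \<in> carrier (F n) \<longleftrightarrow> Poly_Mapping.keys a \<subseteq> W n"
  by (simp add: tensor_free_def)

lemma keys_frag_of_diff3:
  "Poly_Mapping.keys (frag_of a - frag_of b - frag_of c) \<subseteq> {a, b, c}"
  by (rule order_trans[OF keys_diff]) (use keys_diff[of "frag_of a" "frag_of b"] in auto)

lemma tensor_rels_subset: "tensor_rels R M n \<subseteq> carrier (F n)"
proof
  fix z assume "z \<in> tensor_rels R M n"
  then consider (add) u x y v where "z = frag_of (u @ [x \<oplus>\<^bsub>M\<^esub> y] @ v) - frag_of (u @ [x] @ v) - frag_of (u @ [y] @ v)"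
      "u @ [x] @ v \<in> W n" "y \<in> carrier M"
    | (bal) u x r y v where "z = frag_of (u @ [rsmult M x r, y] @ v) - frag_of (u @ [x, r \<odot>\<^bsub>M\<^esub> y] @ v)"
      "u @ [x, y] @ v \<in> W n" "r \<in> carrier R"
    unfolding tensor_rels_def by blast
  then show "z \<in> carrier (F n)"
  proof cases
    case add
    then have "{u @ [x \<oplus>\<^bsub>M\<^esub> y] @ v, u @ [x] @ v, u @ [y] @ v} \<subseteq> W n"
      by (auto simp: tensor_words_def)
    then show ?thesis
      unfolding carrier_free add(1) using keys_frag_of_diff3 by (rule order_trans[rotated])
  next
    case bal
    then have "{u @ [rsmult M x r, y] @ v, u @ [x, r \<odot>\<^bsub>M\<^esub> y] @ v} \<subseteq> W n"
      by (auto simp: tensor_words_def)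
    then show ?thesis
      unfolding carrier_free bal(1) using keys_diff[of "frag_of (u @ [rsmult M x r, y] @ v)"] by fastforce
  qed
qed

lemma null_subgroup: "subgroup (N n) (F n)"
  unfolding tensor_null_def
  by (intro group.generate_is_subgroup comm_group.axioms(2) comm_group_free tensor_rels_subset)

lemma null_normal: "N n \<lhd> F n"
  by (rule comm_group.subgroup_imp_normal[OF comm_group_free null_subgroup])

lemma comm_group_power: "comm_group (P n)"
  unfolding tensor_power_def
  by (rule comm_group.abelian_FactGroup[OF comm_group_free null_subgroup])

lemma group_power [simp]: "group (P n)"
  using comm_group_power by (rule comm_group.axioms(2))

lemma null_zero: "0 \<in> N n"
  using subgroup.one_closed[OF null_subgroup[of n]] by (simp add: tensor_free_def)

lemma null_carrier: "a \<in> N n ==> Poly_Mapping.keys a \<subseteq> W n"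
  using subgroup.subset[OF null_subgroup[of n]] carrier_free by blast

lemma null_add: "a \<in> N n ==> b \<in> N n ==> a + b \<in> N n"
  using subgroup.m_closed[OF null_subgroup[of n], of a b] by (simp add: tensor_free_def)

lemma null_minus: "a \<in> N n ==> - a \<in> N n"
  using subgroup.m_inv_closed[OF null_subgroup[of n], of a] null_carrier[of a n] by (simp add: tensor_free_def)

lemma null_diff: "a \<in> N n ==> b \<in> N n ==> a - b \<in> N n"
  using null_add[of a n "-b"] null_minus[of b n] by simp

lemma class_def': "cl n a = (\<lambda>x. x + a) ` N n"
  by (auto simp: r_coset_def tensor_free_def)

lemma class_memD: "b \<in> cl n a ==> b - a \<in> N n"
  by (auto simp: class_def')

lemma class_self: "a \<in> cl n a"
  using null_zero by (auto simp: class_def' image_iff intro!: bexI[of _ 0])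

lemma class_eqI: "a - b \<in> N n ==> cl n a = cl n b"
proof -
  assume ab: "a - b \<in> N n"
  have "x + a \<in> (\<lambda>x. x + b) ` N n" if "x \<in> N n" for x
    using null_add[OF that ab] by (auto simp: image_iff intro!: bexI[of _ "x + (a - b)"])
  moreover have "x + b \<in> (\<lambda>x. x + a) ` N n" if "x \<in> N n" for x
    using null_diff[OF that ab] by (auto simp: image_iff intro!: bexI[of _ "x - (a - b)"])
  ultimately show ?thesis unfolding class_def' by blast
qed

lemma class_carrier: "Poly_Mapping.keys a \<subseteq> W n ==> cl n a \<in> carrier (P n)"
  unfolding tensor_power_def FactGroup_def RCOSETS_def
  using carrier_free by auto

lemma power_elem:
  assumes "U \<in> carrier (P n)" obtains a where "Poly_Mapping.keys a \<subseteq> W n" "U = cl n a"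
  using assms unfolding tensor_power_def FactGroup_def RCOSETS_def
  using carrier_free by auto

lemma one_power: "\<one>\<^bsub>P n\<^esub> = cl n 0"
  unfolding tensor_power_def FactGroup_def class_def' by simp

lemma class_mult:
  assumes "Poly_Mapping.keys a \<subseteq> W n" "Poly_Mapping.keys b \<subseteq> W n"
  shows "cl n a \<otimes>\<^bsub>P n\<^esub> cl n b = cl n (a + b)"
  using normal.rcos_sum[OF null_normal, of a n b] assms
  by (simp add: tensor_power_def FactGroup_def carrier_free) (simp add: tensor_free_def)

lemma keys_add': "Poly_Mapping.keys a \<subseteq> S ==> Poly_Mapping.keys b \<subseteq> S ==> Poly_Mapping.keys (a + b) \<subseteq> S"
  using keys_add[of a b] by blast

lemma keys_diff': "Poly_Mapping.keys a \<subseteq> S ==> Poly_Mapping.keys b \<subseteq> S ==> Poly_Mapping.keys (a - b) \<subseteq> S"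
  using keys_diff[of a b] by blast

lemma keys_frag_extend':
  "[| \<And>w. w \<in> Poly_Mapping.keys a ==> Poly_Mapping.keys (g w) \<subseteq> S |] ==> Poly_Mapping.keys (frag_extend g a) \<subseteq> S"
  using keys_frag_extend[of g a] by blast

lemma null_rel_add:
  assumes "set u \<subseteq> carrier M" "set v \<subseteq> carrier M" "x \<in> carrier M" "y \<in> carrier M"
    "n = Suc (length u + length v)"
  shows "frag_of (u @ [x \<oplus>\<^bsub>M\<^esub> y] @ v) - frag_of (u @ [x] @ v) - frag_of (u @ [y] @ v) \<in> N n"
  unfolding tensor_null_def tensor_rels_def
  by (rule generate.incl, rule UnI1, rule CollectI, intro exI conjI, rule refl)
    (use assms in \<open>auto simp: tensor_words_def\<close>)

lemma null_rel_bal: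
  assumes "set u \<subseteq> carrier M" "set v \<subseteq> carrier M" "x \<in> carrier M" "y \<in> carrier M" "r \<in> carrier R"
    "n = Suc (Suc (length u + length v))"
  shows "frag_of (u @ [rsmult M x r, y] @ v) - frag_of (u @ [x, r \<odot>\<^bsub>M\<^esub> y] @ v) \<in> N n"
  unfolding tensor_null_def tensor_rels_def
  by (rule generate.incl, rule UnI2, rule CollectI, intro exI conjI, rule refl)
    (use assms in \<open>auto simp: tensor_words_def\<close>)

text \<open>Zero and differences already produce inverses and sums, so a property closed under these
  need only be checked on the two families of relations. Well-definedness of the operations on
  tensor powers, and of maps out of them, rests on this rule.\<close>

lemma null_induct [consumes 1, case_names zero diff add bal]:
  assumes "z \<in> N n"
   and zero: "Q 0"
   and diff: "\<And>a b. Q a ==> Q b ==> Q (a - b)"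
   and add: "\<And>u v x y. [| set u \<subseteq> carrier M; set v \<subseteq> carrier M; x \<in> carrier M; y \<in> carrier M;
    n = Suc (length u + length v) |] ==>
     Q (frag_of (u @ [x \<oplus>\<^bsub>M\<^esub> y] @ v) - frag_of (u @ [x] @ v) - frag_of (u @ [y] @ v))"
   and bal: "\<And>u v x y r. [| set u \<subseteq> carrier M; set v \<subseteq> carrier M; x \<in> carrier M; y \<in> carrier M; r \<in> carrier R;
    n = Suc (Suc (length u + length v)) |] ==>
     Q (frag_of (u @ [rsmult M x r, y] @ v) - frag_of (u @ [x, r \<odot>\<^bsub>M\<^esub> y] @ v))"
  shows "Q z"
proof -
  have rel: "Q h" if "h \<in> tensor_rels R M n" for h
    using that unfolding tensor_rels_def tensor_words_def by (auto intro: add[simplified] bal[simplified])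
  have neg: "Q (- a)" if "Q a" for a using diff[OF zero that] by simp
  have plus: "Q (a + b)" if "Q a" "Q b" for a b using diff[OF that(1) neg[OF that(2)]] by simp
  show ?thesis
    using assms(1) unfolding tensor_null_def
  proof (induction rule: generate.induct)
    case one then show ?case using zero by (simp add: tensor_free_def)
  next
    case (incl h) then show ?case by (rule rel)
  next
    case (inv h)
    then have "Poly_Mapping.keys h \<subseteq> W n" using tensor_rels_subset carrier_free by blast
    then have "inv\<^bsub>F n\<^esub> h = - h" by (simp add: tensor_free_def)
    then show ?case using neg[OF rel[OF inv]] by simp
  next
    case (eng h1 h2) then show ?case using plus by (simp add: tensor_free_def)
  qed
qed

text \<open>The pure tensor of the letters of \<open>w\<close>; its tensor degree is the length of
  the word. These elements generate \<open>P n\<close> as a group, which is the content of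
  \<open>power_hom_ext\<close> and \<open>power_induct\<close>.\<close>

definition om :: "'m list => ('m list \<Rightarrow>\<^sub>0 int) set" where "om w = cl (length w) (frag_of w)"

lemma om_closed [simp]: "set w \<subseteq> carrier M ==> om w \<in> carrier (P (length w))"
  unfolding om_def by (rule class_carrier) (simp add: tensor_words_def)

lemma om_closed' : "set w \<subseteq> carrier M ==> length w = n ==> om w \<in> carrier (P n)"
  using om_closed by blast

lemma om_add:
  assumes "set u \<subseteq> carrier M" "set v \<subseteq> carrier M" "x \<in> carrier M" "y \<in> carrier M"
    "n = Suc (length u + length v)"
  shows "om (u @ [x \<oplus>\<^bsub>M\<^esub> y] @ v) = om (u @ [x] @ v) \<otimes>\<^bsub>P n\<^esub> om (u @ [y] @ v)"
proof -
  have "om (u @ [x] @ v) \<otimes>\<^bsub>P n\<^esub> om (u @ [y] @ v) = cl n (frag_of (u @ [x] @ v) + frag_of (u @ [y] @ v))"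
    unfolding om_def using assms by (subst class_mult[symmetric]) (auto simp: tensor_words_def)
  also have "\<dots> = om (u @ [x \<oplus>\<^bsub>M\<^esub> y] @ v)"
    unfolding om_def
    using class_eqI[of "frag_of (u @ [x \<oplus>\<^bsub>M\<^esub> y] @ v)" "frag_of (u @ [x] @ v) + frag_of (u @ [y] @ v)" n]
     null_rel_add[OF assms] assms(5) by (simp add: algebra_simps)
  finally show ?thesis by simp
qed

lemma om_bal:
  assumes "set u \<subseteq> carrier M" "set v \<subseteq> carrier M" "x \<in> carrier M" "y \<in> carrier M" "r \<in> carrier R"
  shows "om (u @ [rsmult M x r, y] @ v) = om (u @ [x, r \<odot>\<^bsub>M\<^esub> y] @ v)"
  unfolding om_def using class_eqI[OF null_rel_bal[OF assms refl]] by simp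

lemma power_hom_ext:
  assumes "group G" "f \<in> hom (P n) G" "g \<in> hom (P n) G"
    "\<And>w. set w \<subseteq> carrier M ==> length w = n ==> f (om w) = g (om w)" "U \<in> carrier (P n)"
  shows "f U = g U"
proof -
  interpret f: group_hom "P n" G f using assms by (simp add: group_hom_def group_hom_axioms_def)
  interpret g: group_hom "P n" G g using assms by (simp add: group_hom_def group_hom_axioms_def)
  obtain a where a: "Poly_Mapping.keys a \<subseteq> W n" "U = cl n a" using power_elem[OF assms(5)] .
  have "f (cl n a) = g (cl n a)"
    using a(1)
  proof (rule free_Abelian_group_induct)
    show "f (cl n 0) = g (cl n 0)" using f.hom_one g.hom_one by (simp add: one_power)
  next
    fix x y assume *: "Poly_Mapping.keys x \<subseteq> W n" "Poly_Mapping.keys y \<subseteq> W n"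
      "f (cl n x) = g (cl n x)" "f (cl n y) = g (cl n y)"
    have d: "Poly_Mapping.keys (x - y) \<subseteq> W n" using * keys_diff' by blast
    \<comment> \<open>Induction on a free abelian group runs over differences, while a homomorphism
      is known on products. So \<open>x\<close> is written as \<open>(x - y) + y\<close>, and the
      factor for \<open>y\<close> is cancelled in \<open>G\<close>.\<close>
    have m: "cl n x = cl n (x - y) \<otimes>\<^bsub>P n\<^esub> cl n y" using class_mult[OF d *(2)] by simp
    have "f (cl n (x - y)) \<otimes>\<^bsub>G\<^esub> f (cl n y) = g (cl n (x - y)) \<otimes>\<^bsub>G\<^esub> f (cl n y)"
      using *(3,4) f.hom_mult g.hom_mult d *(2) unfolding m by (simp add: class_carrier)
    then show "f (cl n (x - y)) = g (cl n (x - y))"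
      using group.right_cancel[OF assms(1)] f.hom_closed g.hom_closed class_carrier d *(2) by metis
  next
    fix w assume "w \<in> W n"
    then show "f (cl n (frag_of w)) = g (cl n (frag_of w))"
      using assms(4)[of w] by (auto simp: om_def tensor_words_def)
  qed
  then show ?thesis using a by simp
qed

lemma power_induct [consumes 1, case_names one mult om]:
  assumes "U \<in> carrier (P n)" "Q \<one>\<^bsub>P n\<^esub>"
    "\<And>U V. [| U \<in> carrier (P n); V \<in> carrier (P n); Q U; Q V |] ==> Q (U \<otimes>\<^bsub>P n\<^esub> inv\<^bsub>P n\<^esub> V)"
    "\<And>w. set w \<subseteq> carrier M ==> length w = n ==> Q (om w)"
  shows "Q U"
proof -
  obtain a where a: "Poly_Mapping.keys a \<subseteq> W n" "U = cl n a" using power_elem[OF assms(1)] .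
  have "Q (cl n a)"
    using a(1)
  proof (rule free_Abelian_group_induct)
    show "Q (cl n 0)" using assms(2) by (simp add: one_power)
  next
    fix x y assume *: "Poly_Mapping.keys x \<subseteq> W n" "Poly_Mapping.keys y \<subseteq> W n" "Q (cl n x)" "Q (cl n y)"
    have d: "Poly_Mapping.keys (x - y) \<subseteq> W n" using * keys_diff' by blast
    have m: "cl n x = cl n (x - y) \<otimes>\<^bsub>P n\<^esub> cl n y" using class_mult[OF d *(2)] by simp
    then have "cl n (x - y) = cl n x \<otimes>\<^bsub>P n\<^esub> inv\<^bsub>P n\<^esub> cl n y"
      using group.inv_solve_right[OF group_power] class_carrier d * by metis
    then show "Q (cl n (x - y))" using assms(3) * class_carrier by metis
  next
    fix w assume "w \<in> W n"
    then show "Q (cl n (frag_of w))"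
      using assms(4)[of w] by (auto simp: om_def tensor_words_def)
  qed
  then show ?thesis using a by simp
qed

end

lemma (in comm_group) hom_mult_fun:
  assumes "f \<in> hom H G" "g \<in> hom H G"
  shows "(\<lambda>x. f x \<otimes> g x) \<in> hom H G"
  using assms by (auto simp: hom_def Pi_def m_ac)

section \<open>The two actions of R and the concatenation product on tensor powers\<close>

context bimodule begin

text \<open>A map given on words passes to tensor powers once it respects additivity in each letter
  and balancing over \<open>R\<close>, up to \<open>N m\<close>; additivity of
  \<open>frag_extend\<close> takes care of the rest of the generated subgroup.\<close>

lemma frag_extend_null:
  assumes "\<And>u v x y. [| set u \<subseteq> carrier M; set v \<subseteq> carrier M; x \<in> carrier M; y \<in> carrier M;
    n = Suc (length u + length v) |] ==> g (u @ [x \<oplus>\<^bsub>M\<^esub> y] @ v) - g (u @ [x] @ v) - g (u @ [y] @ v) \<in> N m"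
   and "\<And>u v x y r. [| set u \<subseteq> carrier M; set v \<subseteq> carrier M; x \<in> carrier M; y \<in> carrier M; r \<in> carrier R;
    n = Suc (Suc (length u + length v)) |] ==> g (u @ [rsmult M x r, y] @ v) - g (u @ [x, r \<odot>\<^bsub>M\<^esub> y] @ v) \<in> N m"
   and "z \<in> N n"
  shows "frag_extend g z \<in> N m"
  using assms(3)
proof (induction rule: null_induct[consumes 1, case_names zero diff add bal])
  case zero then show ?case by (simp add: null_zero)
next
  case (diff a b) then show ?case by (simp add: frag_extend_diff null_diff)
next
  case (add u v x y) then show ?case using assms(1)[OF add] by (simp only: frag_extend_diff frag_extend_of)
next
  case (bal u v x y r) then show ?case using assms(2)[OF bal] by (simp only: frag_extend_diff frag_extend_of)
qed

text \<open>Operations on tensor powers are defined as unions over all representatives. When the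
  null subgroup is preserved, all representatives give the same coset, so the union collapses to the
  value on any one of them.\<close>

lemma induced_class:
  assumes null: "\<And>z. z \<in> N n ==> frag_extend g z \<in> N m"
  shows "(\<Union>b \<in> cl n a. cl m (frag_extend g b)) = cl m (frag_extend g a)"
proof -
  have "cl m (frag_extend g b) = cl m (frag_extend g a)" if "b \<in> cl n a" for b
    using null[OF class_memD[OF that]] by (intro class_eqI) (simp add: frag_extend_diff)
  then show ?thesis using class_self[of a n] by blast
qed

lemma induced_hom:
  assumes null: "\<And>z. z \<in> N n ==> frag_extend g z \<in> N m"
    and g: "\<And>w. w \<in> W n ==> Poly_Mapping.keys (g w) \<subseteq> W m"
  shows "(\<lambda>U. \<Union>b \<in> U. cl m (frag_extend g b)) \<in> hom (P n) (P m)"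
proof -
  have ic: "(\<Union>b \<in> cl n a. cl m (frag_extend g b)) = cl m (frag_extend g a)" for a
    using null by (rule induced_class)
  show ?thesis
proof (rule homI)
  fix U assume "U \<in> carrier (P n)"
  then obtain a where a: "Poly_Mapping.keys a \<subseteq> W n" "U = cl n a" by (rule power_elem)
  have "Poly_Mapping.keys (frag_extend g a) \<subseteq> W m"
    by (rule keys_frag_extend') (use a g in blast)
  then show "(\<Union>b \<in> U. cl m (frag_extend g b)) \<in> carrier (P m)"
    unfolding a ic by (rule class_carrier)
next
  fix U V assume "U \<in> carrier (P n)" "V \<in> carrier (P n)"
  then obtain a b where a: "Poly_Mapping.keys a \<subseteq> W n" "U = cl n a" and b: "Poly_Mapping.keys b \<subseteq> W n" "V = cl n b"
    using power_elem by metis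
  have k: "Poly_Mapping.keys (frag_extend g a) \<subseteq> W m" "Poly_Mapping.keys (frag_extend g b) \<subseteq> W m"
    by (rule keys_frag_extend', use a b g in blast)+
  show "(\<Union>b \<in> U \<otimes>\<^bsub>P n\<^esub> V. cl m (frag_extend g b)) =
     (\<Union>b \<in> U. cl m (frag_extend g b)) \<otimes>\<^bsub>P m\<^esub> (\<Union>b \<in> V. cl m (frag_extend g b))"
    unfolding a(2) b(2) class_mult[OF a(1) b(1)] ic class_mult[OF k]
    by (simp add: frag_extend_add)
qed
qed

definition lword :: "'r => 'm list => 'm list" where "lword r w = (r \<odot>\<^bsub>M\<^esub> hd w) # tl w"
definition rword :: "'r => 'm list => 'm list" where "rword r w = butlast w @ [rsmult M (last w) r]"

lemma lword_Cons [simp]: "lword r (x # w) = (r \<odot>\<^bsub>M\<^esub> x) # w"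
  by (simp add: lword_def)

lemma rword_snoc [simp]: "rword r (w @ [x]) = w @ [rsmult M x r]"
  by (simp add: rword_def)

lemma lword_append: "w \<noteq> [] ==> lword r (w @ v) = lword r w @ v"
  by (cases w) auto

lemma rword_append: "w \<noteq> [] ==> rword r (v @ w) = v @ rword r w"
  by (cases w rule: rev_cases) (auto simp: rword_def butlast_append)

lemma lword_closed: "[| r \<in> carrier R; set w \<subseteq> carrier M; w \<noteq> [] |] ==> set (lword r w) \<subseteq> carrier M"
  by (cases w) auto

lemma rword_closed: "[| r \<in> carrier R; set w \<subseteq> carrier M; w \<noteq> [] |] ==> set (rword r w) \<subseteq> carrier M"
  by (cases w rule: rev_cases) auto

lemma length_lword [simp]: "w \<noteq> [] ==> length (lword r w) = length w"
  by (cases w) auto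

lemma length_rword [simp]: "w \<noteq> [] ==> length (rword r w) = length w"
  by (cases w rule: rev_cases) auto

lemma lact_null:
  assumes r: "r \<in> carrier R" and n: "1 \<le> n" and z: "z \<in> N n"
  shows "frag_extend (\<lambda>w. frag_of (lword r w)) z \<in> N n"
proof (rule frag_extend_null[OF _ _ z])
  fix u v x y assume *: "set u \<subseteq> carrier M" "set v \<subseteq> carrier M" "x \<in> carrier M" "y \<in> carrier M"
    "n = Suc (length u + length v)"
  show "frag_of (lword r (u @ [x \<oplus>\<^bsub>M\<^esub> y] @ v)) - frag_of (lword r (u @ [x] @ v)) - frag_of (lword r (u @ [y] @ v)) \<in> N n"
  \<comment> \<open>The scalar acts on the first letter only. If the relation starts there, it is
    absorbed by additivity of the action; otherwise it changes \<open>u\<close> and leaves the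
    relation intact.\<close>
  proof (cases "u = []")
    case True
    then show ?thesis using null_rel_add[of "[]" v "r \<odot>\<^bsub>M\<^esub> x" "r \<odot>\<^bsub>M\<^esub> y" n] * r by (simp add: lact_add_r)
  next
    case False
    then show ?thesis using null_rel_add[of "lword r u" v x y n] * r lword_closed[OF r *(1)]
      by (simp add: lword_append)
  qed
next
  fix u v x y s assume *: "set u \<subseteq> carrier M" "set v \<subseteq> carrier M" "x \<in> carrier M" "y \<in> carrier M" "s \<in> carrier R"
    "n = Suc (Suc (length u + length v))"
  show "frag_of (lword r (u @ [rsmult M x s, y] @ v)) - frag_of (lword r (u @ [x, s \<odot>\<^bsub>M\<^esub> y] @ v)) \<in> N n"
  \<comment> \<open>For a balancing relation at the front, the first letter also carries the right
    factor \<open>s\<close>; here the commuting of the two actions enters.\<close>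
  proof (cases "u = []")
    case True
    then show ?thesis using null_rel_bal[of "[]" v "r \<odot>\<^bsub>M\<^esub> x" y s n] * r by (simp add: lact_ract)
  next
    case False
    then show ?thesis using null_rel_bal[of "lword r u" v x y s n] * r lword_closed[OF r *(1)]
      by (simp add: lword_append)
  qed
qed

lemma ract_null:
  assumes r: "r \<in> carrier R" and n: "1 \<le> n" and z: "z \<in> N n"
  shows "frag_extend (\<lambda>w. frag_of (rword r w)) z \<in> N n"
proof (rule frag_extend_null[OF _ _ z])
  fix u v x y assume *: "set u \<subseteq> carrier M" "set v \<subseteq> carrier M" "x \<in> carrier M" "y \<in> carrier M"
    "n = Suc (length u + length v)"
  show "frag_of (rword r (u @ [x \<oplus>\<^bsub>M\<^esub> y] @ v)) - frag_of (rword r (u @ [x] @ v)) - frag_of (rword r (u @ [y] @ v)) \<in> N n"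
  proof (cases "v = []")
    case True
    then show ?thesis using null_rel_add[of u "[]" "rsmult M x r" "rsmult M y r" n] * r by (simp add: ract_add_l)
  next
    case False
    then have "rword r (u @ [t] @ v) = u @ [t] @ rword r v" for t
      using rword_append[of v r "u @ [t]"] by simp
    then show ?thesis using null_rel_add[of u "rword r v" x y n] * r rword_closed[OF r *(2)] False
      by simp
  qed
next
  fix u v x y s assume *: "set u \<subseteq> carrier M" "set v \<subseteq> carrier M" "x \<in> carrier M" "y \<in> carrier M" "s \<in> carrier R"
    "n = Suc (Suc (length u + length v))"
  show "frag_of (rword r (u @ [rsmult M x s, y] @ v)) - frag_of (rword r (u @ [x, s \<odot>\<^bsub>M\<^esub> y] @ v)) \<in> N n"
  proof (cases "v = []")
    case True
    have "rword r (u @ [a, b]) = u @ [a, rsmult M b r]" for a b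
      using rword_snoc[of r "u @ [a]" b] by simp
    then show ?thesis using True null_rel_bal[of u "[]" x "rsmult M y r" s n] * r by (simp add: lact_ract)
  next
    case False
    then have "rword r (u @ [a, b] @ v) = u @ [a, b] @ rword r v" for a b
      using rword_append[of v r "u @ [a, b]"] by simp
    then show ?thesis using null_rel_bal[of u "rword r v" x y s n] * r rword_closed[OF r *(2)] False
      by simp
  qed
qed

abbreviation la where "la \<equiv> tensor_lact R M"
abbreviation ra where "ra \<equiv> tensor_ract R M"
abbreviation tm where "tm \<equiv> tensor_mult R M"

lemma lact_eq: "la n r = (\<lambda>U. \<Union>a\<in>U. cl n (frag_extend (\<lambda>w. frag_of (lword r w)) a))"
  unfolding tensor_lact_def lword_def ..

lemma ract_eq: "ra n U r = (\<Union>a\<in>U. cl n (frag_extend (\<lambda>w. frag_of (rword r w)) a))"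
  unfolding tensor_ract_def rword_def ..

lemma la_hom:
  assumes r: "r \<in> carrier R" and n: "1 \<le> n"
  shows "la n r \<in> hom (P n) (P n)"
  unfolding lact_eq
proof (rule induced_hom)
  show "frag_extend (\<lambda>w. frag_of (lword r w)) z \<in> N n" if "z \<in> N n" for z
    by (rule lact_null[OF r n that])
  show "Poly_Mapping.keys (frag_of (lword r w)) \<subseteq> W n" if "w \<in> W n" for w
    using that n lword_closed[OF r, of w] by (cases "w = []") (auto simp: tensor_words_def)
qed

lemma ra_hom:
  assumes r: "r \<in> carrier R" and n: "1 \<le> n"
  shows "(\<lambda>U. ra n U r) \<in> hom (P n) (P n)"
  unfolding ract_eq
proof (rule induced_hom)
  show "frag_extend (\<lambda>w. frag_of (rword r w)) z \<in> N n" if "z \<in> N n" for z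
    by (rule ract_null[OF r n that])
  show "Poly_Mapping.keys (frag_of (rword r w)) \<subseteq> W n" if "w \<in> W n" for w
    using that n rword_closed[OF r, of w] by (cases "w = []") (auto simp: tensor_words_def)
qed

lemma la_om: "[| r \<in> carrier R; w \<noteq> []; length w = n |] ==> la n r (om w) = om (lword r w)"
  unfolding lact_eq om_def
  by (hypsubst, subst induced_class, rule lact_null) (auto simp: Suc_le_eq)

lemma ra_om: "[| r \<in> carrier R; w \<noteq> []; length w = n |] ==> ra n (om w) r = om (rword r w)"
  unfolding ract_eq om_def
  by (hypsubst, subst induced_class, rule ract_null) (auto simp: Suc_le_eq)

lemma la_add:
  assumes "r \<in> carrier R" "s \<in> carrier R" "1 \<le> n" "U \<in> carrier (P n)"
  shows "la n (r \<oplus>\<^bsub>R\<^esub> s) U = la n r U \<otimes>\<^bsub>P n\<^esub> la n s U"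
proof (rule power_hom_ext[OF group_power _ _ _ assms(4)])
  show "la n (r \<oplus>\<^bsub>R\<^esub> s) \<in> hom (P n) (P n)" using assms by (simp add: la_hom)
  show "(\<lambda>U. la n r U \<otimes>\<^bsub>P n\<^esub> la n s U) \<in> hom (P n) (P n)"
    using assms by (simp add: comm_group.hom_mult_fun comm_group_power la_hom)
  fix w assume w: "set w \<subseteq> carrier M" "length w = n"
  then obtain x t where "w = x # t" using assms(3) by (cases w) auto
  then show "la n (r \<oplus>\<^bsub>R\<^esub> s) (om w) = la n r (om w) \<otimes>\<^bsub>P n\<^esub> la n s (om w)"
    using w assms om_add[of "[]" t "r \<odot>\<^bsub>M\<^esub> x" "s \<odot>\<^bsub>M\<^esub> x" n] by (simp add: la_om lact_add_l)
qed

lemma ra_add: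
  assumes "r \<in> carrier R" "s \<in> carrier R" "1 \<le> n" "U \<in> carrier (P n)"
  shows "ra n U (r \<oplus>\<^bsub>R\<^esub> s) = ra n U r \<otimes>\<^bsub>P n\<^esub> ra n U s"
proof (rule power_hom_ext[OF group_power _ _ _ assms(4)])
  show "(\<lambda>U. ra n U (r \<oplus>\<^bsub>R\<^esub> s)) \<in> hom (P n) (P n)" using assms by (simp add: ra_hom)
  show "(\<lambda>U. ra n U r \<otimes>\<^bsub>P n\<^esub> ra n U s) \<in> hom (P n) (P n)"
    using assms by (simp add: comm_group.hom_mult_fun comm_group_power ra_hom)
  fix w assume w: "set w \<subseteq> carrier M" "length w = n"
  then obtain x t where "w = t @ [x]" using assms(3) by (cases w rule: rev_cases) auto
  then show "ra n (om w) (r \<oplus>\<^bsub>R\<^esub> s) = ra n (om w) r \<otimes>\<^bsub>P n\<^esub> ra n (om w) s"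
    using w assms om_add[of t "[]" "rsmult M x r" "rsmult M x s" n] by (simp add: ra_om ract_add_r)
qed

text \<open>Bilinear extension of the concatenation of words. Additivity in the first argument is
  built in; additivity in the second takes an induction over the first, see
  \<open>mulw_diff_r\<close>.\<close>

definition mulw :: "('m list \<Rightarrow>\<^sub>0 int) => ('m list \<Rightarrow>\<^sub>0 int) => ('m list \<Rightarrow>\<^sub>0 int)" where
  "mulw a b = frag_extend (\<lambda>u. frag_extend (\<lambda>v. frag_of (u @ v)) b) a"

lemma mulw_diff_l: "mulw (a - a') b = mulw a b - mulw a' b"
  by (simp add: mulw_def frag_extend_diff)

lemma mulw_diff_r: "mulw a (b - b') = mulw a b - mulw a b'"
proof -
  have "Poly_Mapping.keys a \<subseteq> UNIV" by simp
  then show ?thesis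
    by (induction a rule: frag_induction) (auto simp: mulw_def frag_extend_diff)
qed

lemma mulw_add_l: "mulw (a + a') b = mulw a b + mulw a' b"
  by (simp add: mulw_def frag_extend_add)

lemma mulw_add_r: "mulw a (b + b') = mulw a b + mulw a b'"
  using mulw_diff_r[of a b "-b'"] mulw_diff_r[of a 0 b'] mulw_diff_r[of a b' b'] by simp

lemma mulw_of [simp]: "mulw (frag_of u) (frag_of v) = frag_of (u @ v)"
  by (simp add: mulw_def)

lemma mulw_keys:
  assumes "Poly_Mapping.keys a \<subseteq> W m" "Poly_Mapping.keys b \<subseteq> W n"
  shows "Poly_Mapping.keys (mulw a b) \<subseteq> W (m + n)"
  unfolding mulw_def
  by (rule keys_frag_extend', rule keys_frag_extend') (use assms in \<open>fastforce simp: tensor_words_def\<close>)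

text \<open>By additivity on the right only a single word \<open>w\<close> has to be appended, and a
  relation followed by a fixed word is again a relation, with \<open>v @ w\<close> in place of
  \<open>v\<close>.\<close>

lemma mulw_null_l:
  assumes a: "a \<in> N m" and b: "Poly_Mapping.keys b \<subseteq> W n"
  shows "mulw a b \<in> N (m + n)"
  using b
proof (rule free_Abelian_group_induct)
  show "mulw a 0 \<in> N (m + n)" using mulw_diff_r[of a 0 0] null_zero by simp
next
  fix x y assume "mulw a x \<in> N (m + n)" "mulw a y \<in> N (m + n)"
  then show "mulw a (x - y) \<in> N (m + n)" by (simp add: mulw_diff_r null_diff)
next
  fix w assume w: "w \<in> W n"
  have "frag_extend (\<lambda>u. frag_of (u @ w)) a \<in> N (m + n)"
  proof (rule frag_extend_null[OF _ _ a])
    fix u v x y assume *: "set u \<subseteq> carrier M" "set v \<subseteq> carrier M" "x \<in> carrier M" "y \<in> carrier M"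
      "m = Suc (length u + length v)"
    show "frag_of ((u @ [x \<oplus>\<^bsub>M\<^esub> y] @ v) @ w) - frag_of ((u @ [x] @ v) @ w) - frag_of ((u @ [y] @ v) @ w) \<in> N (m + n)"
      using null_rel_add[of u "v @ w" x y] * w by (simp add: tensor_words_def add.assoc)
  next
    fix u v x y r assume *: "set u \<subseteq> carrier M" "set v \<subseteq> carrier M" "x \<in> carrier M" "y \<in> carrier M" "r \<in> carrier R"
      "m = Suc (Suc (length u + length v))"
    show "frag_of ((u @ [rsmult M x r, y] @ v) @ w) - frag_of ((u @ [x, r \<odot>\<^bsub>M\<^esub> y] @ v) @ w) \<in> N (m + n)"
      using null_rel_bal[of u "v @ w" x y] * w by (simp add: tensor_words_def add.assoc)
  qed
  then show "mulw a (frag_of w) \<in> N (m + n)" by (simp add: mulw_def)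
qed

lemma mulw_null_r:
  assumes b: "b \<in> N n" and a: "Poly_Mapping.keys a \<subseteq> W m"
  shows "mulw a b \<in> N (m + n)"
  using a
proof (rule free_Abelian_group_induct)
  show "mulw 0 b \<in> N (m + n)" by (simp add: mulw_def null_zero)
next
  fix x y assume "mulw x b \<in> N (m + n)" "mulw y b \<in> N (m + n)"
  then show "mulw (x - y) b \<in> N (m + n)" by (simp add: mulw_diff_l null_diff)
next
  fix w assume w: "w \<in> W m"
  have "frag_extend (\<lambda>u. frag_of (w @ u)) b \<in> N (m + n)"
  proof (rule frag_extend_null[OF _ _ b])
    fix u v x y assume *: "set u \<subseteq> carrier M" "set v \<subseteq> carrier M" "x \<in> carrier M" "y \<in> carrier M"
      "n = Suc (length u + length v)"
    show "frag_of (w @ u @ [x \<oplus>\<^bsub>M\<^esub> y] @ v) - frag_of (w @ u @ [x] @ v) - frag_of (w @ u @ [y] @ v) \<in> N (m + n)"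
      using null_rel_add[of "w @ u" v x y] * w by (simp add: tensor_words_def add.assoc)
  next
    fix u v x y r assume *: "set u \<subseteq> carrier M" "set v \<subseteq> carrier M" "x \<in> carrier M" "y \<in> carrier M" "r \<in> carrier R"
      "n = Suc (Suc (length u + length v))"
    show "frag_of (w @ u @ [rsmult M x r, y] @ v) - frag_of (w @ u @ [x, r \<odot>\<^bsub>M\<^esub> y] @ v) \<in> N (m + n)"
      using null_rel_bal[of "w @ u" v x y] * w by (simp add: tensor_words_def add.assoc)
  qed
  then show "mulw (frag_of w) b \<in> N (m + n)" by (simp add: mulw_def)
qed

lemma tm_class:
  assumes a: "Poly_Mapping.keys a \<subseteq> W m" and b: "Poly_Mapping.keys b \<subseteq> W n"
  shows "tm m n (cl m a) (cl n b) = cl (m + n) (mulw a b)"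
proof -
  have "cl (m + n) (mulw a' b') = cl (m + n) (mulw a b)" if ab: "a' \<in> cl m a" "b' \<in> cl n b" for a' b'
  proof (rule class_eqI)
    have "b' = (b' - b) + b" by simp
    then have "Poly_Mapping.keys b' \<subseteq> W n"
      using keys_add'[OF null_carrier[OF class_memD[OF ab(2)]] b] by simp
    then have "mulw (a' - a) b' \<in> N (m + n)" "mulw a (b' - b) \<in> N (m + n)"
      using mulw_null_l[OF class_memD[OF ab(1)]] mulw_null_r[OF class_memD[OF ab(2)] a] by auto
    \<comment> \<open>The splitting \<open>a' b' - a b = (a' - a) b' + a (b' - b)\<close>. The first
      term contains the primed factor, whose support had to be controlled for that reason.\<close>
    then have "mulw (a' - a) b' + mulw a (b' - b) \<in> N (m + n)" by (rule null_add)
    then show "mulw a' b' - mulw a b \<in> N (m + n)" by (simp add: mulw_diff_l mulw_diff_r)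
  qed
  then show ?thesis
    unfolding tensor_mult_def mulw_def[symmetric] using class_self[of a m] class_self[of b n] by blast
qed

lemma tm_om:
  "[| set u \<subseteq> carrier M; set v \<subseteq> carrier M; length u = m; length v = n |] ==> tm m n (om u) (om v) = om (u @ v)"
  unfolding om_def by (auto simp: tm_class tensor_words_def)

lemma tm_hom_l:
  assumes "V \<in> carrier (P n)" shows "(\<lambda>U. tm m n U V) \<in> hom (P m) (P (m + n))"
proof -
  obtain b where b: "Poly_Mapping.keys b \<subseteq> W n" "V = cl n b" using power_elem[OF assms] .
  show ?thesis
  proof (rule homI)
    fix U assume "U \<in> carrier (P m)"
    then show "tm m n U V \<in> carrier (P (m + n))"
      by (rule power_elem) (use b in \<open>simp add: tm_class class_carrier mulw_keys\<close>)
  next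
    fix U U' assume "U \<in> carrier (P m)" "U' \<in> carrier (P m)"
    then obtain a a' where "Poly_Mapping.keys a \<subseteq> W m" "U = cl m a" "Poly_Mapping.keys a' \<subseteq> W m" "U' = cl m a'"
      by (metis power_elem)
    then show "tm m n (U \<otimes>\<^bsub>P m\<^esub> U') V = tm m n U V \<otimes>\<^bsub>P (m + n)\<^esub> tm m n U' V"
      using b by (simp add: tm_class class_mult mulw_keys keys_add' mulw_add_l)
  qed
qed

lemma tm_hom_r:
  assumes "V \<in> carrier (P m)" shows "(\<lambda>U. tm m n V U) \<in> hom (P n) (P (m + n))"
proof -
  obtain b where b: "Poly_Mapping.keys b \<subseteq> W m" "V = cl m b" using power_elem[OF assms] .
  show ?thesis
  proof (rule homI)
    fix U assume "U \<in> carrier (P n)"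
    then show "tm m n V U \<in> carrier (P (m + n))"
      by (rule power_elem) (use b in \<open>simp add: tm_class class_carrier mulw_keys\<close>)
  next
    fix U U' assume "U \<in> carrier (P n)" "U' \<in> carrier (P n)"
    then obtain a a' where "Poly_Mapping.keys a \<subseteq> W n" "U = cl n a" "Poly_Mapping.keys a' \<subseteq> W n" "U' = cl n a'"
      by (metis power_elem)
    then show "tm m n V (U \<otimes>\<^bsub>P n\<^esub> U') = tm m n V U \<otimes>\<^bsub>P (m + n)\<^esub> tm m n V U'"
      using b by (simp add: tm_class class_mult mulw_keys keys_add' mulw_add_r)
  qed
qed

end

section \<open>The direct sum of all tensor powers as a ring\<close>

lemma comm_group_sum_group:
  assumes "\<And>i. i \<in> I ==> comm_group (G i)" shows "comm_group (sum_group I G)"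
proof -
  have g: "\<And>i. i \<in> I ==> group (G i)" using assms comm_group.axioms(2) by blast
  show ?thesis
  proof (rule group.group_comm_groupI)
    fix x y assume "x \<in> carrier (sum_group I G)" "y \<in> carrier (sum_group I G)"
    then show "x \<otimes>\<^bsub>sum_group I G\<^esub> y = y \<otimes>\<^bsub>sum_group I G\<^esub> x"
      using assms g by (auto simp: carrier_sum_group PiE_iff comm_group_def intro!: restrict_ext comm_monoid.m_comm)
  qed (use g in simp)
qed

context bimodule begin

abbreviation T where "T \<equiv> tensor_algebra R M"
abbreviation T_mult (infixl "\<otimes>\<^sub>T" 70) where "x \<otimes>\<^sub>T y \<equiv> x \<otimes>\<^bsub>T\<^esub> y"
abbreviation T_add (infixl "\<oplus>\<^sub>T" 65) where "x \<oplus>\<^sub>T y \<equiv> x \<oplus>\<^bsub>T\<^esub> y"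
abbreviation TP where "TP \<equiv> tensor_pos R M"

lemma carrier_TP: "carrier TP = {f \<in> \<Pi>\<^sub>E n\<in>{1..}. carrier (P n). finite {n \<in> {1..}. f n \<noteq> \<one>\<^bsub>P n\<^esub>}}"
  unfolding tensor_pos_def by (simp add: carrier_sum_group)

lemma comm_group_TP: "comm_group TP"
  unfolding tensor_pos_def by (rule comm_group_sum_group) (rule comm_group_power)

lemma one_TP: "\<one>\<^bsub>TP\<^esub> = (\<lambda>n\<in>{1..}. \<one>\<^bsub>P n\<^esub>)"
  by (simp add: tensor_pos_def)

lemma mult_TP: "f \<otimes>\<^bsub>TP\<^esub> g = (\<lambda>n\<in>{1..}. f n \<otimes>\<^bsub>P n\<^esub> g n)"
  by (simp add: tensor_pos_def)

lemma carrier_T: "carrier T = carrier R \<times> carrier TP"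
  by (simp add: tensor_algebra_def)

lemma zero_T: "\<zero>\<^bsub>T\<^esub> = (\<zero>\<^bsub>R\<^esub>, \<one>\<^bsub>TP\<^esub>)"
  by (simp add: tensor_algebra_def)

lemma one_T: "\<one>\<^bsub>T\<^esub> = (\<one>\<^bsub>R\<^esub>, \<one>\<^bsub>TP\<^esub>)"
  by (simp add: tensor_algebra_def)

lemma add_T: "x \<oplus>\<^sub>T y = (fst x \<oplus>\<^bsub>R\<^esub> fst y, snd x \<otimes>\<^bsub>TP\<^esub> snd y)"
  by (simp add: tensor_algebra_def case_prod_beta)

text \<open>The degree \<open>n\<close> part of the convolution product. Degree 0 is
  \<open>R\<close> itself, so the two outer terms of the convolution appear as actions of
  \<open>R\<close>, and only the terms with \<open>0 < i < n\<close> are tensor products.\<close>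

definition mcomp where
  "mcomp n x y = la n (fst x) (snd y n) \<otimes>\<^bsub>P n\<^esub> ra n (snd x n) (fst y)
     \<otimes>\<^bsub>P n\<^esub> finprod (P n) (\<lambda>i. tm i (n - i) (snd x i) (snd y (n - i))) {1..<n}"

lemma mult_T: "x \<otimes>\<^sub>T y = (fst x \<otimes>\<^bsub>R\<^esub> fst y, \<lambda>n\<in>{1..}. mcomp n x y)"
  unfolding tensor_algebra_def mcomp_def by (simp add: case_prod_beta)

lemma T_fst: "x \<in> carrier T ==> fst x \<in> carrier R"
  by (auto simp: carrier_T)

lemma T_snd: "x \<in> carrier T ==> 1 \<le> n ==> snd x n \<in> carrier (P n)"
  by (auto simp: carrier_T carrier_TP)

lemma T_fin: "x \<in> carrier T ==> finite {n \<in> {1..}. snd x n \<noteq> \<one>\<^bsub>P n\<^esub>}"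
  by (auto simp: carrier_T carrier_TP)

lemma T_ext:
  assumes "x \<in> carrier T" "y \<in> carrier T" "fst x = fst y" "\<And>n. 1 \<le> n ==> snd x n = snd y n"
  shows "x = y"
proof -
  have "snd x \<in> extensional {1..}" "snd y \<in> extensional {1..}"
    using assms(1,2) by (auto simp: carrier_T carrier_TP PiE_def)
  then have "snd x = snd y" using assms(4) by (intro extensionalityI) auto
  then show ?thesis using assms(3) by (simp add: prod_eq_iff)
qed

lemma abelian_group_T: "abelian_group T"
proof -
  interpret TP: comm_group TP by (rule comm_group_TP)
  show ?thesis
  proof (rule abelian_groupI)
    fix x assume x: "x \<in> carrier T"
    then have "(\<ominus>\<^bsub>R\<^esub> fst x, inv\<^bsub>TP\<^esub> snd x) \<in> carrier T"
       "(\<ominus>\<^bsub>R\<^esub> fst x, inv\<^bsub>TP\<^esub> snd x) \<oplus>\<^sub>T x = \<zero>\<^bsub>T\<^esub>"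
      by (auto simp: carrier_T add_T zero_T R.l_neg)
    then show "\<exists>y\<in>carrier T. y \<oplus>\<^sub>T x = \<zero>\<^bsub>T\<^esub>" by blast
  qed (auto simp: carrier_T add_T zero_T R.a_ac TP.m_ac)
qed

lemma snd_zero [simp]: "1 \<le> n ==> snd \<zero>\<^bsub>T\<^esub> n = \<one>\<^bsub>P n\<^esub>"
  by (simp add: zero_T one_TP)

lemma snd_add [simp]: "1 \<le> n ==> snd (x \<oplus>\<^sub>T y) n = snd x n \<otimes>\<^bsub>P n\<^esub> snd y n"
  by (simp add: add_T mult_TP)

lemma fst_add [simp]: "fst (x \<oplus>\<^sub>T y) = fst x \<oplus>\<^bsub>R\<^esub> fst y"
  by (simp add: add_T)

lemma la_closed [simp]: "[| r \<in> carrier R; 1 \<le> n; U \<in> carrier (P n) |] ==> la n r U \<in> carrier (P n)"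
  using la_hom hom_in_carrier by metis

lemma ra_closed [simp]: "[| r \<in> carrier R; 1 \<le> n; U \<in> carrier (P n) |] ==> ra n U r \<in> carrier (P n)"
  using ra_hom hom_in_carrier by metis

lemma tm_closed: "[| U \<in> carrier (P i); V \<in> carrier (P j); i + j = n |] ==> tm i j U V \<in> carrier (P n)"
  by (drule tm_hom_l[of V j i], drule (1) hom_in_carrier) simp

lemma la_mult: "[| r \<in> carrier R; 1 \<le> n; U \<in> carrier (P n); V \<in> carrier (P n) |] ==>
   la n r (U \<otimes>\<^bsub>P n\<^esub> V) = la n r U \<otimes>\<^bsub>P n\<^esub> la n r V"
  by (drule (1) la_hom, drule (2) hom_mult)

lemma ra_mult: "[| r \<in> carrier R; 1 \<le> n; U \<in> carrier (P n); V \<in> carrier (P n) |] ==>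
   ra n (U \<otimes>\<^bsub>P n\<^esub> V) r = ra n U r \<otimes>\<^bsub>P n\<^esub> ra n V r"
  by (drule (1) ra_hom, drule (2) hom_mult)

lemma la_1 [simp]: "[| r \<in> carrier R; 1 \<le> n |] ==> la n r \<one>\<^bsub>P n\<^esub> = \<one>\<^bsub>P n\<^esub>"
  by (drule (1) la_hom, drule hom_one) simp_all

lemma ra_1 [simp]: "[| r \<in> carrier R; 1 \<le> n |] ==> ra n \<one>\<^bsub>P n\<^esub> r = \<one>\<^bsub>P n\<^esub>"
  by (drule (1) ra_hom, drule hom_one) simp_all

lemma la_0 [simp]: assumes "1 \<le> n" "U \<in> carrier (P n)" shows "la n \<zero>\<^bsub>R\<^esub> U = \<one>\<^bsub>P n\<^esub>"
  using la_add[of "\<zero>\<^bsub>R\<^esub>" "\<zero>\<^bsub>R\<^esub>" n U] assms by (simp add: group.r_cancel_one')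

lemma ra_0 [simp]: assumes "1 \<le> n" "U \<in> carrier (P n)" shows "ra n U \<zero>\<^bsub>R\<^esub> = \<one>\<^bsub>P n\<^esub>"
  using ra_add[of "\<zero>\<^bsub>R\<^esub>" "\<zero>\<^bsub>R\<^esub>" n U] assms by (simp add: group.r_cancel_one')

lemma tm_1_l: "V \<in> carrier (P j) ==> i + j = n ==> tm i j \<one>\<^bsub>P i\<^esub> V = \<one>\<^bsub>P n\<^esub>"
  by (drule tm_hom_l[of V j i], drule hom_one) simp_all

lemma tm_1_r: "V \<in> carrier (P i) ==> i + j = n ==> tm i j V \<one>\<^bsub>P j\<^esub> = \<one>\<^bsub>P n\<^esub>"
  by (drule tm_hom_r[of V i j], drule hom_one) simp_all

lemma tm_1_l': "V \<in> carrier (P (n - i)) ==> i < n ==> tm i (n - i) \<one>\<^bsub>P i\<^esub> V = \<one>\<^bsub>P n\<^esub>"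
  by (rule tm_1_l) auto

lemma tm_1_r': "V \<in> carrier (P i) ==> i < n ==> tm i (n - i) V \<one>\<^bsub>P (n - i)\<^esub> = \<one>\<^bsub>P n\<^esub>"
  by (rule tm_1_r) auto

lemma tm_mult_l: "[| U \<in> carrier (P i); U' \<in> carrier (P i); V \<in> carrier (P j); i + j = n |] ==>
   tm i j (U \<otimes>\<^bsub>P i\<^esub> U') V = tm i j U V \<otimes>\<^bsub>P n\<^esub> tm i j U' V"
  by (drule tm_hom_l[of V j i], drule (2) hom_mult) simp

lemma tm_mult_r: "[| U \<in> carrier (P j); U' \<in> carrier (P j); V \<in> carrier (P i); i + j = n |] ==>
   tm i j V (U \<otimes>\<^bsub>P j\<^esub> U') = tm i j V U \<otimes>\<^bsub>P n\<^esub> tm i j V U'"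
  by (drule tm_hom_r[of V i j], drule (2) hom_mult) simp

lemma prod_term_closed:
  "[| x \<in> carrier T; y \<in> carrier T |] ==> (\<lambda>i. tm i (n - i) (snd x i) (snd y (n - i))) \<in> {1..<n} \<rightarrow> carrier (P n)"
  by (auto simp: tm_closed[of _ _ _ _ n] T_snd)

lemma mcomp_closed: "[| x \<in> carrier T; y \<in> carrier T; 1 \<le> n |] ==> mcomp n x y \<in> carrier (P n)"
proof -
  assume *: "x \<in> carrier T" "y \<in> carrier T" "1 \<le> n"
  interpret P: comm_group "P n" by (rule comm_group_power)
  show ?thesis unfolding mcomp_def
    using prod_term_closed[OF *(1,2)] * by (auto simp: T_fst T_snd)
qed

lemma mcomp_add_l:
  assumes x: "x \<in> carrier T" and x': "x' \<in> carrier T" and y: "y \<in> carrier T" and n: "1 \<le> n"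
  shows "mcomp n (x \<oplus>\<^sub>T x') y = mcomp n x y \<otimes>\<^bsub>P n\<^esub> mcomp n x' y"
proof -
  interpret P: comm_group "P n" by (rule comm_group_power)
  have "finprod (P n) (\<lambda>i. tm i (n - i) (snd (x \<oplus>\<^sub>T x') i) (snd y (n - i))) {1..<n}
     = finprod (P n) (\<lambda>i. tm i (n - i) (snd x i) (snd y (n - i)) \<otimes>\<^bsub>P n\<^esub> tm i (n - i) (snd x' i) (snd y (n - i))) {1..<n}"
    using x x' y by (intro P.finprod_cong') (auto simp: tm_mult_l[of _ _ _ _ _ n] T_snd tm_closed[of _ _ _ _ n])
  also have "\<dots> = finprod (P n) (\<lambda>i. tm i (n - i) (snd x i) (snd y (n - i))) {1..<n}
     \<otimes>\<^bsub>P n\<^esub> finprod (P n) (\<lambda>i. tm i (n - i) (snd x' i) (snd y (n - i))) {1..<n}"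
    by (rule P.finprod_multf[OF prod_term_closed[OF x y] prod_term_closed[OF x' y]])
  finally show ?thesis
    unfolding mcomp_def using assms prod_term_closed[OF x y] prod_term_closed[OF x' y]
    by (simp add: T_fst T_snd la_add ra_mult P.m_ac)
qed

lemma mcomp_add_r:
  assumes x: "x \<in> carrier T" and x': "x' \<in> carrier T" and y: "y \<in> carrier T" and n: "1 \<le> n"
  shows "mcomp n y (x \<oplus>\<^sub>T x') = mcomp n y x \<otimes>\<^bsub>P n\<^esub> mcomp n y x'"
proof -
  interpret P: comm_group "P n" by (rule comm_group_power)
  have "finprod (P n) (\<lambda>i. tm i (n - i) (snd y i) (snd (x \<oplus>\<^sub>T x') (n - i))) {1..<n}
     = finprod (P n) (\<lambda>i. tm i (n - i) (snd y i) (snd x (n - i)) \<otimes>\<^bsub>P n\<^esub> tm i (n - i) (snd y i) (snd x' (n - i))) {1..<n}"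
    using x x' y by (intro P.finprod_cong') (auto simp: tm_mult_r[of _ _ _ _ _ n] T_snd tm_closed[of _ _ _ _ n])
  also have "\<dots> = finprod (P n) (\<lambda>i. tm i (n - i) (snd y i) (snd x (n - i))) {1..<n}
     \<otimes>\<^bsub>P n\<^esub> finprod (P n) (\<lambda>i. tm i (n - i) (snd y i) (snd x' (n - i))) {1..<n}"
    by (rule P.finprod_multf[OF prod_term_closed[OF y x] prod_term_closed[OF y x']])
  finally show ?thesis
    unfolding mcomp_def using assms prod_term_closed[OF y x] prod_term_closed[OF y x']
    by (simp add: T_fst T_snd ra_add la_mult P.m_ac)
qed

lemma mult_T_closed:
  assumes x: "x \<in> carrier T" and y: "y \<in> carrier T"
  shows "x \<otimes>\<^sub>T y \<in> carrier T"
proof -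
  let ?X = "{n \<in> {1..}. snd x n \<noteq> \<one>\<^bsub>P n\<^esub>}" and ?Y = "{n \<in> {1..}. snd y n \<noteq> \<one>\<^bsub>P n\<^esub>}"
  \<comment> \<open>Supports add: a degree occurring in the product occurs in one factor, multiplied
    by the degree 0 part of the other, or is a sum of degrees from both. The set on the right is
    finite.\<close>
  have "n \<in> ?X \<union> ?Y \<union> (\<lambda>(i, j). i + j) ` (?X \<times> ?Y)" if n: "1 \<le> n" "mcomp n x y \<noteq> \<one>\<^bsub>P n\<^esub>" for n
  proof (rule ccontr)
    assume *: "n \<notin> ?X \<union> ?Y \<union> (\<lambda>(i, j). i + j) ` (?X \<times> ?Y)"
    interpret P: comm_group "P n" by (rule comm_group_power)
    have "tm i (n - i) (snd x i) (snd y (n - i)) = \<one>\<^bsub>P n\<^esub>" if i: "i \<in> {1..<n}" for i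
    proof (cases "snd x i = \<one>\<^bsub>P i\<^esub>")
      case True then show ?thesis using i T_snd[OF y] by (simp add: tm_1_l' Suc_le_eq)
    next
      case False
      have "snd y (n - i) = \<one>\<^bsub>P (n - i)\<^esub>"
      proof (rule ccontr)
        assume "snd y (n - i) \<noteq> \<one>\<^bsub>P (n - i)\<^esub>"
        then have "(i, n - i) \<in> ?X \<times> ?Y" using i False by auto
        then have "i + (n - i) \<in> (\<lambda>(i, j). i + j) ` (?X \<times> ?Y)" by (rule rev_image_eqI) simp
        then show False using * i by simp
      qed
      then show ?thesis using i T_snd[OF x] by (simp add: tm_1_r' Suc_le_eq)
    qed
    then have "finprod (P n) (\<lambda>i. tm i (n - i) (snd x i) (snd y (n - i))) {1..<n} = \<one>\<^bsub>P n\<^esub>"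
      by (rule P.finprod_one_eqI)
    then have "mcomp n x y = \<one>\<^bsub>P n\<^esub>"
      unfolding mcomp_def using * n T_fst x y by simp
    then show False using n by simp
  qed
  then have "{n \<in> {1..}. (\<lambda>n\<in>{1..}. mcomp n x y) n \<noteq> \<one>\<^bsub>P n\<^esub>} \<subseteq> ?X \<union> ?Y \<union> (\<lambda>(i, j). i + j) ` (?X \<times> ?Y)"
    by fastforce
  then have "finite {n \<in> {1..}. (\<lambda>n\<in>{1..}. mcomp n x y) n \<noteq> \<one>\<^bsub>P n\<^esub>}"
    by (rule finite_subset) (intro finite_UnI finite_imageI finite_cartesian_product T_fin x y)
  then show ?thesis
    unfolding mult_T using x y mcomp_closed by (auto simp: carrier_T carrier_TP)
qed

lemma fst_mult [simp]: "fst (x \<otimes>\<^sub>T y) = fst x \<otimes>\<^bsub>R\<^esub> fst y"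
  by (simp add: mult_T)

lemma snd_mult: "1 \<le> n ==> snd (x \<otimes>\<^sub>T y) n = mcomp n x y"
  by (simp add: mult_T)

lemma T_add_closed: "x \<in> carrier T ==> y \<in> carrier T ==> x \<oplus>\<^sub>T y \<in> carrier T"
  using abelian_group_T by (simp add: abelian_group.axioms(1) abelian_monoid.a_closed)

lemma T_l_distr:
  assumes "x \<in> carrier T" "x' \<in> carrier T" "y \<in> carrier T"
  shows "(x \<oplus>\<^sub>T x') \<otimes>\<^sub>T y = x \<otimes>\<^sub>T y \<oplus>\<^sub>T x' \<otimes>\<^sub>T y"
  by (rule T_ext) (use assms in \<open>auto simp: mult_T_closed T_add_closed T_fst R.l_distr snd_mult mcomp_add_l\<close>)

lemma T_r_distr:
  assumes "x \<in> carrier T" "x' \<in> carrier T" "y \<in> carrier T"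
  shows "y \<otimes>\<^sub>T (x \<oplus>\<^sub>T x') = y \<otimes>\<^sub>T x \<oplus>\<^sub>T y \<otimes>\<^sub>T x'"
  by (rule T_ext) (use assms in \<open>auto simp: mult_T_closed T_add_closed T_fst R.r_distr snd_mult mcomp_add_r\<close>)

text \<open>With \<open>single\<close>, the inclusions of degree 0 and of one positive degree. On
  such elements the convolution has at most one nontrivial term, so products in \<open>T\<close> are
  computed here.\<close>

definition rho :: "'r => 'r \<times> (nat => ('m list \<Rightarrow>\<^sub>0 int) set)" where
  "rho r = (r, \<one>\<^bsub>TP\<^esub>)"

definition single :: "nat => ('m list \<Rightarrow>\<^sub>0 int) set => 'r \<times> (nat => ('m list \<Rightarrow>\<^sub>0 int) set)" where
  "single n U = (\<zero>\<^bsub>R\<^esub>, \<lambda>k\<in>{1..}. if k = n then U else \<one>\<^bsub>P k\<^esub>)"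

abbreviation omT where "omT w \<equiv> single (length w) (om w)"

lemma rho_simps [simp]: "fst (rho r) = r" "1 \<le> n ==> snd (rho r) n = \<one>\<^bsub>P n\<^esub>"
  by (simp_all add: rho_def one_TP)

lemma single_simps [simp]: "fst (single n U) = \<zero>\<^bsub>R\<^esub>"
  "1 \<le> k ==> snd (single n U) k = (if k = n then U else \<one>\<^bsub>P k\<^esub>)"
  by (simp_all add: single_def)

lemma rho_closed [simp]: "r \<in> carrier R ==> rho r \<in> carrier T"
  using comm_group.axioms(2)[OF comm_group_TP] by (simp add: rho_def carrier_T monoid.one_closed group_def)

lemma single_closed [simp]:
  assumes "1 \<le> n" "U \<in> carrier (P n)" shows "single n U \<in> carrier T"
proof -
  have "finite {k \<in> {1..}. (\<lambda>k\<in>{1..}. if k = n then U else \<one>\<^bsub>P k\<^esub>) k \<noteq> \<one>\<^bsub>P k\<^esub>}"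
    by (rule finite_subset[of _ "{n}"]) auto
  moreover have "\<one>\<^bsub>P k\<^esub> \<in> carrier (P k)" for k using group_power by (simp add: group.is_monoid monoid.one_closed)
  ultimately show ?thesis using assms by (auto simp: single_def carrier_T carrier_TP)
qed

lemma single_add:
  "[| 1 \<le> n; U \<in> carrier (P n); V \<in> carrier (P n) |] ==> single n (U \<otimes>\<^bsub>P n\<^esub> V) = single n U \<oplus>\<^sub>T single n V"
proof (rule T_ext)
  have "\<one>\<^bsub>P k\<^esub> \<otimes>\<^bsub>P k\<^esub> \<one>\<^bsub>P k\<^esub> = \<one>\<^bsub>P k\<^esub>" for k using group_power by (simp add: group.is_monoid)
  then show "[| 1 \<le> n; U \<in> carrier (P n); V \<in> carrier (P n); 1 \<le> k |] ==>
     snd (single n (U \<otimes>\<^bsub>P n\<^esub> V)) k = snd (single n U \<oplus>\<^sub>T single n V) k" for k by simp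
qed (auto simp: T_add_closed group.is_monoid monoid.m_closed)

lemma rho_add: "[| r \<in> carrier R; s \<in> carrier R |] ==> rho (r \<oplus>\<^bsub>R\<^esub> s) = rho r \<oplus>\<^sub>T rho s"
  by (rule T_ext) (auto simp: T_add_closed group.is_monoid)

lemma single_one: "1 \<le> n ==> single n \<one>\<^bsub>P n\<^esub> = \<zero>\<^bsub>T\<^esub>"
  by (simp add: single_def zero_T one_TP) (rule restrict_ext, simp)

lemma rho_zero: "rho \<zero>\<^bsub>R\<^esub> = \<zero>\<^bsub>T\<^esub>"
  by (simp add: rho_def zero_T)

lemma finprod_all_one: "(\<And>i. i \<in> A ==> f i = \<one>\<^bsub>P n\<^esub>) ==> finprod (P n) f A = \<one>\<^bsub>P n\<^esub>"
proof -
  interpret P: comm_group "P n" by (rule comm_group_power)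
  assume "\<And>i. i \<in> A ==> f i = \<one>\<^bsub>P n\<^esub>" then show ?thesis by (rule P.finprod_one_eqI)
qed

lemma power_simps [simp]:
  "\<one>\<^bsub>P n\<^esub> \<in> carrier (P n)" "U \<in> carrier (P n) ==> \<one>\<^bsub>P n\<^esub> \<otimes>\<^bsub>P n\<^esub> U = U" "U \<in> carrier (P n) ==> U \<otimes>\<^bsub>P n\<^esub> \<one>\<^bsub>P n\<^esub> = U"
  using group_power[of n] by (simp_all add: group.is_monoid)

lemma finprod_rho_l: "y \<in> carrier T ==>
   finprod (P n) (\<lambda>i. tm i (n - i) (snd (rho r) i) (snd y (n - i))) {Suc 0..<n} = \<one>\<^bsub>P n\<^esub>"
  by (rule finprod_all_one) (simp add: Suc_le_eq tm_1_l' T_snd)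

lemma finprod_rho_r: "y \<in> carrier T ==>
   finprod (P n) (\<lambda>i. tm i (n - i) (snd y i) (snd (rho r) (n - i))) {Suc 0..<n} = \<one>\<^bsub>P n\<^esub>"
  by (rule finprod_all_one) (simp add: Suc_le_eq tm_1_r' T_snd)

lemma rho_rho: "[| r \<in> carrier R; s \<in> carrier R |] ==> rho r \<otimes>\<^sub>T rho s = rho (r \<otimes>\<^bsub>R\<^esub> s)"
  by (rule T_ext) (auto simp: mult_T_closed snd_mult mcomp_def finprod_rho_l)

lemma rho_single: "[| r \<in> carrier R; 1 \<le> n; U \<in> carrier (P n) |] ==> rho r \<otimes>\<^sub>T single n U = single n (la n r U)"
  by (rule T_ext) (auto simp: mult_T_closed snd_mult mcomp_def finprod_rho_l)

lemma single_rho: "[| r \<in> carrier R; 1 \<le> n; U \<in> carrier (P n) |] ==> single n U \<otimes>\<^sub>T rho r = single n (ra n U r)"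
  by (rule T_ext) (auto simp: mult_T_closed snd_mult mcomp_def finprod_rho_r)

lemma single_single:
  assumes "1 \<le> m" "U \<in> carrier (P m)" "1 \<le> n" "V \<in> carrier (P n)"
  shows "single m U \<otimes>\<^sub>T single n V = single (m + n) (tm m n U V)"
proof (rule T_ext)
  have tm: "tm m n U V \<in> carrier (P (m + n))" using assms by (simp add: tm_closed)
  show "single m U \<otimes>\<^sub>T single n V \<in> carrier T" using assms by (simp add: mult_T_closed)
  show "single (m + n) (tm m n U V) \<in> carrier T" using assms tm by simp
  show "fst (single m U \<otimes>\<^sub>T single n V) = fst (single (m + n) (tm m n U V))" by simp
  fix k :: nat assume k: "1 \<le> k"
  interpret P: comm_group "P k" by (rule comm_group_power)
  let ?f = "\<lambda>i. tm i (k - i) (snd (single m U) i) (snd (single n V) (k - i))"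
  \<comment> \<open>Among the pairs of degrees adding up to \<open>k\<close> only
    \<open>(m, n)\<close> can contribute; in every other term one of the two factors is
    trivial.\<close>
  have "finprod (P k) ?f {1..<k} = (if k = m + n then tm m n U V else \<one>\<^bsub>P k\<^esub>)"
  proof (cases "k = m + n")
    case True
    have f: "?f i = (if m = i then tm m n U V else \<one>\<^bsub>P k\<^esub>)" if "i \<in> {1..<k}" for i
      using that True assms by (auto intro!: tm_1_l)
    have "finprod (P k) ?f {1..<k} = finprod (P k) (\<lambda>i. if m = i then tm m n U V else \<one>\<^bsub>P k\<^esub>) {1..<k}"
      using f tm True by (intro P.finprod_cong') auto
    also have "\<dots> = tm m n U V"
      using True assms tm by (intro P.finprod_singleton) auto
    finally show ?thesis using True by simp
  next
    case False
    have "?f i = \<one>\<^bsub>P k\<^esub>" if "i \<in> {1..<k}" for i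
      using that False assms by (cases "i = m") (auto intro!: tm_1_l tm_1_r)
    then have "finprod (P k) ?f {1..<k} = \<one>\<^bsub>P k\<^esub>" by (rule finprod_all_one)
    then show ?thesis using False by simp
  qed
  then show "snd (single m U \<otimes>\<^sub>T single n V) k = snd (single (m + n) (tm m n U V)) k"
    using assms k tm by (auto simp: snd_mult mcomp_def)
qed

lemma omT_closed [simp]: "[| set w \<subseteq> carrier M; w \<noteq> [] |] ==> omT w \<in> carrier T"
  by (cases w) (auto intro!: single_closed om_closed')

lemma rho_omT: "[| r \<in> carrier R; set w \<subseteq> carrier M; w \<noteq> [] |] ==> rho r \<otimes>\<^sub>T omT w = omT (lword r w)"
  by (cases w) (auto simp: rho_single om_closed' la_om)

lemma omT_rho: "[| r \<in> carrier R; set w \<subseteq> carrier M; w \<noteq> [] |] ==> omT w \<otimes>\<^sub>T rho r = omT (rword r w)"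
  using length_greater_0_conv[of w] by (auto simp: single_rho om_closed' ra_om Suc_le_eq)

lemma omT_omT: "[| set u \<subseteq> carrier M; u \<noteq> []; set w \<subseteq> carrier M; w \<noteq> [] |] ==> omT u \<otimes>\<^sub>T omT w = omT (u @ w)"
  using length_greater_0_conv[of w] length_greater_0_conv[of u] by (auto simp: single_single om_closed' tm_om Suc_le_eq)

lemma omT_add:
  assumes "set u \<subseteq> carrier M" "set v \<subseteq> carrier M" "x \<in> carrier M" "y \<in> carrier M"
  shows "omT (u @ [x \<oplus>\<^bsub>M\<^esub> y] @ v) = omT (u @ [x] @ v) \<oplus>\<^sub>T omT (u @ [y] @ v)"
  using om_add[OF assms refl] single_add[of "Suc (length u + length v)" "om (u @ [x] @ v)" "om (u @ [y] @ v)"] assms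
  by (simp add: om_closed')

lemma omT_bal:
  assumes "set u \<subseteq> carrier M" "set v \<subseteq> carrier M" "x \<in> carrier M" "y \<in> carrier M" "r \<in> carrier R"
  shows "omT (u @ [rsmult M x r, y] @ v) = omT (u @ [x, r \<odot>\<^bsub>M\<^esub> y] @ v)"
  using om_bal[OF assms] by simp

end

context bimodule begin

lemma om_zero:
  assumes "set t \<subseteq> carrier M" shows "om (\<zero>\<^bsub>M\<^esub> # t) = \<one>\<^bsub>P (Suc (length t))\<^esub>"
  using om_add[of "[]" t "\<zero>\<^bsub>M\<^esub>" "\<zero>\<^bsub>M\<^esub>" "Suc (length t)"] assms om_closed'[of "\<zero>\<^bsub>M\<^esub> # t"]
  by (simp add: group.r_cancel_one')

text \<open>A sign can be absorbed into the first letter. Hence sums of pure tensors exhaust a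
  tensor power of positive degree, and \<open>T_induct\<close> gets by without a case for
  negatives.\<close>

lemma inv_om:
  assumes "set t \<subseteq> carrier M" "x \<in> carrier M"
  shows "inv\<^bsub>P (Suc (length t))\<^esub> om (x # t) = om ((\<ominus>\<^bsub>M\<^esub> x) # t)"
proof (rule group.inv_equality[OF group_power])
  show "om ((\<ominus>\<^bsub>M\<^esub> x) # t) \<otimes>\<^bsub>P (Suc (length t))\<^esub> om (x # t) = \<one>\<^bsub>P (Suc (length t))\<^esub>"
    using om_add[of "[]" t "\<ominus>\<^bsub>M\<^esub> x" x "Suc (length t)"] assms om_zero[OF assms(1)] by (simp add: M.l_neg)
qed (use assms in \<open>auto intro!: om_closed'\<close>)

lemma T_zero_closed [simp]: "\<zero>\<^bsub>T\<^esub> \<in> carrier T"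
  using rho_closed[of "\<zero>\<^bsub>R\<^esub>"] by (simp add: rho_zero)

lemma T_induct [consumes 1, case_names zero add rho om]:
  assumes x: "x \<in> carrier T" and zero: "Q \<zero>\<^bsub>T\<^esub>"
    and add: "\<And>x y. [| x \<in> carrier T; y \<in> carrier T; Q x; Q y |] ==> Q (x \<oplus>\<^sub>T y)"
    and rho: "\<And>r. r \<in> carrier R ==> Q (rho r)"
    and om: "\<And>w. [| set w \<subseteq> carrier M; w \<noteq> [] |] ==> Q (omT w)"
  shows "Q x"
proof -
  have single: "Q (single n U)" if n: "1 \<le> n" and U: "U \<in> carrier (P n)" for n U
  proof -
    interpret P: comm_group "P n" by (rule comm_group_power)
    \<comment> \<open>The claim is doubled to \<open>U\<close> and its inverse because
      \<open>power_induct\<close> produces quotients, while \<open>Q\<close> is only assumed to be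
      closed under sums.\<close>
    from U have "Q (single n U) \<and> Q (single n (inv\<^bsub>P n\<^esub> U))"
    proof (induction rule: power_induct)
      case one then show ?case using zero n by (simp add: single_one)
    next
      case (mult U V)
      then show ?case using n by (simp add: single_add add P.inv_mult)
    next
      case (om w)
      then obtain y t where w: "w = y # t" using n by (cases w) auto
      have "inv\<^bsub>P n\<^esub> om w = om ((\<ominus>\<^bsub>M\<^esub> y) # t)" using om inv_om[of t y] w by auto
      then show ?case using om assms(5)[of w] assms(5)[of "(\<ominus>\<^bsub>M\<^esub> y) # t"] w by auto
    qed
    then show ?thesis ..
  qed
  have pos: "Q y" if "finite F" "y \<in> carrier T" "fst y = \<zero>\<^bsub>R\<^esub>" "{n \<in> {1..}. snd y n \<noteq> \<one>\<^bsub>P n\<^esub>} \<subseteq> F" for F y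
    using that
  proof (induction F arbitrary: y rule: finite_induct)
    case empty
    have "y = \<zero>\<^bsub>T\<^esub>" by (rule T_ext) (use empty in \<open>auto\<close>, simp add: zero_T)
    then show ?case using zero by simp
  next
    case (insert n F)
    show ?case
    proof (cases "1 \<le> n")
      case False
      then show ?thesis using insert by (intro insert.IH) auto
    next
      case True
      \<comment> \<open>One degree of the support is erased; \<open>y\<close> is recovered by adding
        back its component in degree \<open>n\<close>.\<close>
      define y' where "y' = (\<zero>\<^bsub>R\<^esub>, (snd y)(n := \<one>\<^bsub>P n\<^esub>))"
      have fin: "{k \<in> {1..}. snd y' k \<noteq> \<one>\<^bsub>P k\<^esub>} \<subseteq> F" using insert.prems(3) by (auto simp: y'_def)
      have y': "y' \<in> carrier T"
        using insert.prems(1) True finite_subset[OF fin insert.hyps(1)]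
        by (auto simp: y'_def carrier_T carrier_TP PiE_iff extensional_def)
      have "y = y' \<oplus>\<^sub>T single n (snd y n)"
        using insert.prems True y' T_snd[OF insert.prems(1)]
        by (intro T_ext) (auto simp: T_add_closed y'_def)
      moreover have "Q y'" using insert.IH[OF y' _ fin] by (simp add: y'_def)
      ultimately show ?thesis
        using add[OF y' single_closed[OF True T_snd[OF insert.prems(1) True]]]
         single[OF True T_snd[OF insert.prems(1) True]] by metis
    qed
  qed
  define y where "y = (\<zero>\<^bsub>R\<^esub>, snd x)"
  have y: "y \<in> carrier T" using x by (auto simp: y_def carrier_T)
  have "x = rho (fst x) \<oplus>\<^sub>T y"
    using x T_snd[OF x] T_fst[OF x] by (intro T_ext) (auto simp: T_add_closed y, auto simp: y_def)
  moreover have "Q y" by (rule pos[OF T_fin[OF x] y]) (auto simp: y_def)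
  ultimately show ?thesis using add[OF rho_closed y] rho T_fst[OF x] by metis
qed

lemma T_mult_zero:
  assumes x: "x \<in> carrier T"
  shows "x \<otimes>\<^sub>T \<zero>\<^bsub>T\<^esub> = \<zero>\<^bsub>T\<^esub>" "\<zero>\<^bsub>T\<^esub> \<otimes>\<^sub>T x = \<zero>\<^bsub>T\<^esub>"
proof -
  interpret T: abelian_group T by (rule abelian_group_T)
  show "x \<otimes>\<^sub>T \<zero>\<^bsub>T\<^esub> = \<zero>\<^bsub>T\<^esub>" using T_r_distr[of "\<zero>\<^bsub>T\<^esub>" "\<zero>\<^bsub>T\<^esub>" x] x mult_T_closed[of x "\<zero>\<^bsub>T\<^esub>"] by simp
  show "\<zero>\<^bsub>T\<^esub> \<otimes>\<^sub>T x = \<zero>\<^bsub>T\<^esub>" using T_l_distr[of "\<zero>\<^bsub>T\<^esub>" "\<zero>\<^bsub>T\<^esub>" x] x mult_T_closed[of "\<zero>\<^bsub>T\<^esub>" x] by simp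
qed

text \<open>Additive generators of \<open>T\<close>. Identities that are additive in every argument
  are verified on these alone.\<close>

inductive_set gens where
  "r \<in> carrier R ==> rho r \<in> gens"
| "set w \<subseteq> carrier M ==> w \<noteq> [] ==> omT w \<in> gens"

lemma gens_closed: "x \<in> gens ==> x \<in> carrier T"
  by (induction rule: gens.induct) auto

text \<open>A scalar crosses the junction of two words. Among the cases of associativity on
  generators, this is the one that needs the balancing relation.\<close>

lemma omT_rho_omT:
  assumes "r \<in> carrier R" "set u \<subseteq> carrier M" "u \<noteq> []" "set v \<subseteq> carrier M" "v \<noteq> []"
  shows "omT (rword r u @ v) = omT (u @ lword r v)"
proof -
  obtain x s where u: "u = s @ [x]" using assms by (cases u rule: rev_cases) auto
  obtain y t where v: "v = y # t" using assms by (cases v) auto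
  show ?thesis using omT_bal[of s t x y r] assms unfolding u v by simp
qed

lemma lword_rword:
  assumes "r \<in> carrier R" "s \<in> carrier R" "set w \<subseteq> carrier M" "w \<noteq> []"
  shows "rword s (lword r w) = lword r (rword s w)"
proof (cases w)
  case (Cons x t)
  show ?thesis
  proof (cases t rule: rev_cases)
    case Nil then show ?thesis using assms Cons rword_snoc[of s "[]"] by (simp add: lact_ract)
  next
    case (snoc u y) then show ?thesis using assms Cons rword_snoc[of s "x # u"] rword_snoc[of s "(r \<odot>\<^bsub>M\<^esub> x) # u"] by simp
  qed
qed (use assms in simp)

lemma lword_lword: "[| r \<in> carrier R; s \<in> carrier R; set w \<subseteq> carrier M; w \<noteq> [] |] ==>
    lword r (lword s w) = lword (r \<otimes>\<^bsub>R\<^esub> s) w"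
  by (cases w) (auto simp: lact_assoc)

lemma rword_rword: "[| r \<in> carrier R; s \<in> carrier R; set w \<subseteq> carrier M; w \<noteq> [] |] ==>
    rword s (rword r w) = rword (r \<otimes>\<^bsub>R\<^esub> s) w"
  by (cases w rule: rev_cases) (auto simp: ract_assoc)

lemma lword_one: "[| set w \<subseteq> carrier M; w \<noteq> [] |] ==> lword \<one>\<^bsub>R\<^esub> w = w"
  by (cases w) (auto simp: lact_one)

lemma rword_one: "[| set w \<subseteq> carrier M; w \<noteq> [] |] ==> rword \<one>\<^bsub>R\<^esub> w = w"
  by (cases w rule: rev_cases) (auto simp: ract_one)

lemma nonempty_words [simp]: "w \<noteq> [] ==> lword r w \<noteq> []" "w \<noteq> [] ==> rword r w \<noteq> []"
  by (auto simp: lword_def rword_def)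

lemma gens_assoc:
  assumes "x \<in> gens" "y \<in> gens" "z \<in> gens"
  shows "(x \<otimes>\<^sub>T y) \<otimes>\<^sub>T z = x \<otimes>\<^sub>T (y \<otimes>\<^sub>T z)"
proof -
  \<comment> \<open>An opaque name for pure tensors keeps the simplifier from rewriting
    \<open>length w\<close> inside \<open>omT w\<close>, which would hide the pattern of the product
    rules.\<close>
  define G where "G w = omT w" for w
  note G = rho_omT[folded G_def] omT_rho[folded G_def] omT_omT[folded G_def] omT_rho_omT[folded G_def]
  note simps = G rho_rho rword_closed lword_closed lword_lword rword_rword lword_rword
    lword_append rword_append R.m_assoc
  have gen: "(\<exists>r. a = rho r \<and> r \<in> carrier R) \<or> (\<exists>w. a = G w \<and> set w \<subseteq> carrier M \<and> w \<noteq> [])" if "a \<in> gens" for a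
    using that by (cases rule: gens.cases) (auto simp: G_def)
  show ?thesis
    using gen[OF assms(1)] gen[OF assms(2)] gen[OF assms(3)]
    by (elim disjE exE; elim conjE; simp add: simps)
qed

lemma T_assoc:
  assumes "x \<in> carrier T" "y \<in> carrier T" "z \<in> carrier T"
  shows "(x \<otimes>\<^sub>T y) \<otimes>\<^sub>T z = x \<otimes>\<^sub>T (y \<otimes>\<^sub>T z)"
proof -
  note cl = mult_T_closed T_add_closed gens_closed T_mult_zero T_l_distr T_r_distr
  \<comment> \<open>Both sides are additive in each argument, so the arguments are extended from
    generators to all of \<open>T\<close> one at a time: \<open>z\<close>, then \<open>y\<close>,
    then \<open>x\<close>.\<close>
  have 1: "(x \<otimes>\<^sub>T y) \<otimes>\<^sub>T z = x \<otimes>\<^sub>T (y \<otimes>\<^sub>T z)" if "x \<in> gens" "y \<in> gens" "z \<in> carrier T" for x y z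
    using that(3)
    by (induction rule: T_induct) (use that(1,2) in \<open>auto simp: cl intro!: gens_assoc gens.intros\<close>)
  have 2: "(x \<otimes>\<^sub>T y) \<otimes>\<^sub>T z = x \<otimes>\<^sub>T (y \<otimes>\<^sub>T z)" if "x \<in> gens" "y \<in> carrier T" "z \<in> carrier T" for x y z
    using that(2)
    by (induction rule: T_induct) (use that(1,3) in \<open>auto simp: cl intro!: 1 gens.intros\<close>)
  show ?thesis
    using assms(1)
    by (induction rule: T_induct) (use assms(2,3) in \<open>auto simp: cl intro!: 2 gens.intros\<close>)
qed

lemma T_one:
  assumes "x \<in> carrier T"
  shows "\<one>\<^bsub>T\<^esub> \<otimes>\<^sub>T x = x" "x \<otimes>\<^sub>T \<one>\<^bsub>T\<^esub> = x"
proof -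
  have one: "\<one>\<^bsub>T\<^esub> = rho \<one>\<^bsub>R\<^esub>" by (simp add: one_T rho_def)
  have "rho \<one>\<^bsub>R\<^esub> \<otimes>\<^sub>T x = x \<and> x \<otimes>\<^sub>T rho \<one>\<^bsub>R\<^esub> = x"
    using assms
    by (induction rule: T_induct) (auto simp: T_mult_zero T_l_distr T_r_distr rho_rho rho_omT omT_rho lword_one rword_one)
  then show "\<one>\<^bsub>T\<^esub> \<otimes>\<^sub>T x = x" "x \<otimes>\<^sub>T \<one>\<^bsub>T\<^esub> = x" by (simp_all add: one)
qed

lemma ring_T: "ring T"
proof (rule ringI)
  show "Group.monoid T"
    by (rule Group.monoid.intro) (auto simp: mult_T_closed T_assoc T_one, simp add: one_T flip: rho_def)
qed (auto simp: abelian_group_T T_l_distr T_r_distr)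

end

section \<open>The universal property of the tensor algebra\<close>

locale tensor_lift = bimodule R M + A: ring A
  for R :: "('k, 'r, 'x) gmodule_scheme" and M :: "('r, 'r, 'm, 'y) gbimodule_scheme"
    and A :: "('k, 'a, 'z) gmodule_scheme" (structure) +
  fixes \<sigma> :: "'r => 'a" and \<tau> :: "'m => 'a"
  assumes sigma_hom: "\<sigma> \<in> ring_hom R A"
    and tau_closed [simp]: "x \<in> carrier M ==> \<tau> x \<in> carrier A"
    and tau_add: "[| x \<in> carrier M; y \<in> carrier M |] ==> \<tau> (x \<oplus>\<^bsub>M\<^esub> y) = \<tau> x \<oplus> \<tau> y"
    and tau_lact: "[| r \<in> carrier R; x \<in> carrier M |] ==> \<tau> (r \<odot>\<^bsub>M\<^esub> x) = \<sigma> r \<otimes> \<tau> x"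
    and tau_ract: "[| r \<in> carrier R; x \<in> carrier M |] ==> \<tau> (rsmult M x r) = \<tau> x \<otimes> \<sigma> r"
begin

lemma sigma_closed [simp]: "r \<in> carrier R ==> \<sigma> r \<in> carrier A"
  by (rule ring_hom_closed[OF sigma_hom])

abbreviation G where "G \<equiv> add_monoid A"

primrec wval :: "'m list => 'a" where
  "wval [] = \<one>"
| "wval (x # w) = \<tau> x \<otimes> wval w"

lemma wval_closed [simp]: "set w \<subseteq> carrier M ==> wval w \<in> carrier A"
  by (induction w) auto

lemma wval_append: "[| set u \<subseteq> carrier M; set v \<subseteq> carrier M |] ==> wval (u @ v) = wval u \<otimes> wval v"
  by (induction u) (auto simp: A.m_assoc)

lemma wval_add:
  assumes "set u \<subseteq> carrier M" "set v \<subseteq> carrier M" "x \<in> carrier M" "y \<in> carrier M"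
  shows "wval (u @ [x \<oplus>\<^bsub>M\<^esub> y] @ v) = wval (u @ [x] @ v) \<oplus> wval (u @ [y] @ v)"
  using assms by (simp add: wval_append tau_add A.l_distr A.r_distr)

lemma wval_bal:
  assumes "set u \<subseteq> carrier M" "set v \<subseteq> carrier M" "x \<in> carrier M" "y \<in> carrier M" "r \<in> carrier R"
  shows "wval (u @ [rsmult M x r, y] @ v) = wval (u @ [x, r \<odot>\<^bsub>M\<^esub> y] @ v)"
  using assms by (simp add: wval_append tau_lact tau_ract A.m_assoc)

lemma comm_group_G: "comm_group G"
  by (rule A.a_comm_group)

text \<open>The product of the letters in \<open>A\<close> is additive in each letter and balanced
  over \<open>R\<close>, because \<open>\<tau>\<close> is a bimodule map along
  \<open>\<sigma>\<close>. The homomorphism from the free abelian group therefore kills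
  \<open>N n\<close> and factors through the tensor power.\<close>

lemma phi_exists: "\<exists>h. h \<in> hom (P n) G \<and> (\<forall>w. set w \<subseteq> carrier M \<longrightarrow> length w = n \<longrightarrow> h (om w) = wval w)"
proof -
  have "wval ` W n \<subseteq> carrier G" by (auto simp: tensor_words_def)
  then obtain h where h: "h \<in> hom (free_Abelian_group (W n)) G" "\<And>w. w \<in> W n ==> h (frag_of w) = wval w"
    using comm_group.free_Abelian_group_universal[OF comm_group_G] by blast
  then have h': "h \<in> hom (F n) G" by (simp add: tensor_free_def)
  have gh: "group_hom (F n) G h"
    using h' comm_group_free[of n] by (simp add: group_hom_def group_hom_axioms_def comm_group.axioms(2)[OF comm_group_G] comm_group.axioms(2))
  interpret h: group_hom "F n" G h by (rule gh)
  have diff: "h (a - b) = h a \<ominus> h b" if "Poly_Mapping.keys a \<subseteq> W n" "Poly_Mapping.keys b \<subseteq> W n" for a b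
  proof -
    have "h (a \<otimes>\<^bsub>F n\<^esub> inv\<^bsub>F n\<^esub> b) = h a \<otimes>\<^bsub>G\<^esub> inv\<^bsub>G\<^esub> h b"
      using that by (subst h.hom_mult) (auto simp: carrier_free, simp add: tensor_free_def subset_iff)
    moreover have "a \<otimes>\<^bsub>F n\<^esub> inv\<^bsub>F n\<^esub> b = a - b" using that by (simp add: tensor_free_def)
    ultimately show ?thesis by (simp add: a_minus_def a_inv_def)
  qed
  have wcl: "frag_of w \<in> carrier (F n)" if "w \<in> W n" for w using that by (simp add: carrier_free)
  have hc: "Poly_Mapping.keys a \<subseteq> W n ==> h a \<in> carrier A" for a
    using h.hom_closed[of a] by (simp add: carrier_free)
  have null: "N n \<subseteq> kernel (F n) G h"
  proof
    fix z assume "z \<in> N n"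
    then have "Poly_Mapping.keys z \<subseteq> W n \<and> h z = \<zero>"
    proof (induction rule: null_induct)
      case zero then show ?case using h.hom_one by (simp add: tensor_free_def)
    next
      case (diff a b) then show ?case using \<open>\<And>a b. _ ==> _ ==> h (a - b) = _\<close> by (auto simp: keys_diff' )
    next
      case (add u v x y)
      then have w: "u @ [x \<oplus>\<^bsub>M\<^esub> y] @ v \<in> W n" "u @ [x] @ v \<in> W n" "u @ [y] @ v \<in> W n"
        by (auto simp: tensor_words_def)
      let ?a = "frag_of (u @ [x \<oplus>\<^bsub>M\<^esub> y] @ v)" and ?b = "frag_of (u @ [x] @ v)" and ?c = "frag_of (u @ [y] @ v)"
      have k: "Poly_Mapping.keys ?a \<subseteq> W n" "Poly_Mapping.keys ?b \<subseteq> W n" "Poly_Mapping.keys ?c \<subseteq> W n"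
        "Poly_Mapping.keys (?a - ?b) \<subseteq> W n"
        using w by (simp_all only: keys_frag_of keys_diff' insert_subset empty_subsetI simp_thms)
      have "h (?a - ?b - ?c) = wval (u @ [x \<oplus>\<^bsub>M\<^esub> y] @ v) \<ominus> wval (u @ [x] @ v) \<ominus> wval (u @ [y] @ v)"
        using diff k h(2) w by metis
      also have "\<dots> = \<zero>"
        unfolding wval_add[OF add(1-4)]
      proof -
        have "wval (u @ [x] @ v) \<in> carrier A" "wval (u @ [y] @ v) \<in> carrier A" using add by auto
        then show "wval (u @ [x] @ v) \<oplus> wval (u @ [y] @ v) \<ominus> wval (u @ [x] @ v) \<ominus> wval (u @ [y] @ v) = \<zero>"
          by algebra
      qed
      finally show ?case using keys_diff'[OF k(4,3)] by blast
    next
      case (bal u v x y r)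
      then have w: "u @ [rsmult M x r, y] @ v \<in> W n" "u @ [x, r \<odot>\<^bsub>M\<^esub> y] @ v \<in> W n"
        by (auto simp: tensor_words_def)
      let ?a = "frag_of (u @ [rsmult M x r, y] @ v)" and ?b = "frag_of (u @ [x, r \<odot>\<^bsub>M\<^esub> y] @ v)"
      have k: "Poly_Mapping.keys ?a \<subseteq> W n" "Poly_Mapping.keys ?b \<subseteq> W n"
        using w by (simp_all only: keys_frag_of keys_diff' insert_subset empty_subsetI simp_thms)
      have "h (?a - ?b) = wval (u @ [rsmult M x r, y] @ v) \<ominus> wval (u @ [x, r \<odot>\<^bsub>M\<^esub> y] @ v)"
        using diff k h(2) w by metis
      also have "\<dots> = \<zero>"
        unfolding wval_bal[OF bal(1-5)] using bal by (simp add: A.minus_eq A.r_neg)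
      finally show ?case using keys_diff'[OF k] by blast
    qed
    then show "z \<in> kernel (F n) G h" by (simp add: kernel_def carrier_free)
  qed
  obtain g where g: "g \<in> hom (F n Mod N n) G" "\<And>a. a \<in> carrier (F n) ==> g (cl n a) = h a"
    using h.FactGroup_universal_kernel[OF null_normal null] by blast
  have "g (om w) = wval w" if "set w \<subseteq> carrier M" "length w = n" for w
    using that g(2)[of "frag_of w"] h(2)[of w] by (auto simp: om_def carrier_free tensor_words_def)
  then show ?thesis using g(1) by (auto simp: tensor_power_def)
qed

definition \<phi> where "\<phi> n = (SOME h. h \<in> hom (P n) G \<and> (\<forall>w. set w \<subseteq> carrier M \<longrightarrow> length w = n \<longrightarrow> h (om w) = wval w))"

lemma phi_hom: "\<phi> n \<in> hom (P n) G"
  unfolding \<phi>_def using someI_ex[OF phi_exists] by (rule conjunct1)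

lemma phi_om: "set w \<subseteq> carrier M ==> length w = n ==> \<phi> n (om w) = wval w"
  unfolding \<phi>_def using someI_ex[OF phi_exists[of n]] by blast

lemma phi_closed [simp]: "U \<in> carrier (P n) ==> \<phi> n U \<in> carrier A"
  using hom_in_carrier[OF phi_hom] by fastforce

lemma phi_one [simp]: "\<phi> n \<one>\<^bsub>P n\<^esub> = \<zero>"
  using hom_one[OF phi_hom group_power] comm_group.axioms(2)[OF comm_group_G] by simp

text \<open>The sum over the infinite index set is a genuine finite sum on \<open>T\<close>, as
  almost all components are trivial and \<open>\<phi> n\<close> maps the trivial class to zero. The
  additive group of \<open>A\<close> is written multiplicatively to match
  \<open>tensor_pos\<close>.\<close>

definition \<Phi> where "\<Phi> x = \<sigma> (fst x) \<oplus> gfinprod G (\<lambda>n. \<phi> n (snd x n)) {1..}"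

lemma pos_hom: "(\<lambda>f. gfinprod G (\<lambda>n. \<phi> n (f n)) {1..}) \<in> hom TP G"
  unfolding tensor_pos_def by (rule comm_group.hom_group_sum[OF comm_group_G phi_hom]) simp

lemma pos_closed [simp]: "x \<in> carrier T ==> gfinprod G (\<lambda>n. \<phi> n (snd x n)) {1..} \<in> carrier A"
  using hom_in_carrier[OF pos_hom, of "snd x"] by (auto simp: carrier_T)

lemmas pos_closed' = pos_closed[simplified]

lemma Phi_closed [simp]: "x \<in> carrier T ==> \<Phi> x \<in> carrier A"
  by (simp add: \<Phi>_def T_fst pos_closed')

lemma Phi_add:
  assumes x: "x \<in> carrier T" and y: "y \<in> carrier T" shows "\<Phi> (x \<oplus>\<^sub>T y) = \<Phi> x \<oplus> \<Phi> y"
proof -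
  have "snd x \<in> carrier TP" "snd y \<in> carrier TP" using x y by (auto simp: carrier_T)
  then have "gfinprod G (\<lambda>n. \<phi> n (snd (x \<oplus>\<^sub>T y) n)) {1..} =
     gfinprod G (\<lambda>n. \<phi> n (snd x n)) {1..} \<oplus> gfinprod G (\<lambda>n. \<phi> n (snd y n)) {1..}"
    using hom_mult[OF pos_hom, of "snd x" "snd y"] by (simp add: add_T)
  then show ?thesis
    using x y by (simp add: \<Phi>_def T_fst ring_hom_add[OF sigma_hom] A.a_ac pos_closed')
qed

lemma Phi_rho: "r \<in> carrier R ==> \<Phi> (rho r) = \<sigma> r"
proof -
  have "gfinprod G (\<lambda>n. \<phi> n (snd (rho r) n)) {1..} = \<zero>"
    using hom_one[OF pos_hom] comm_group.axioms(2)[OF comm_group_TP] comm_group.axioms(2)[OF comm_group_G] by (simp add: rho_def)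
  moreover assume "r \<in> carrier R"
  ultimately show ?thesis by (simp add: \<Phi>_def)
qed

lemma Phi_single:
  assumes n: "1 \<le> n" "U \<in> carrier (P n)"
  shows "\<Phi> (single n U) = \<phi> n U"
proof -
  have "gfinprod G (\<lambda>k. \<phi> k (snd (single n U) k)) {1..} = gfinprod G (\<lambda>k. \<phi> k (snd (single n U) k)) {n}"
    using n by (intro comm_monoid.gfinprod_mono_neutral_cong_right[OF comm_group.axioms(1)[OF comm_group_G]]) auto
  also have "\<dots> = \<phi> n U" using n using comm_monoid.gfinprod_insert[OF comm_group.axioms(1)[OF comm_group_G], of "{}" "\<lambda>k. \<phi> k (snd (single n U) k)" n] by simp
  finally show ?thesis
    using n ring_hom_zero[OF sigma_hom R.ring_axioms A.ring_axioms] by (simp add: \<Phi>_def)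
qed

lemma Phi_omT: "[| set w \<subseteq> carrier M; w \<noteq> [] |] ==> \<Phi> (omT w) = wval w"
  by (cases w) (auto simp: Phi_single om_closed' phi_om)

lemma wval_lword: "[| r \<in> carrier R; set w \<subseteq> carrier M; w \<noteq> [] |] ==> wval (lword r w) = \<sigma> r \<otimes> wval w"
  by (cases w) (auto simp: tau_lact A.m_assoc)

lemma wval_rword: "[| r \<in> carrier R; set w \<subseteq> carrier M; w \<noteq> [] |] ==> wval (rword r w) = wval w \<otimes> \<sigma> r"
  by (cases w rule: rev_cases) (auto simp: tau_ract wval_append A.m_assoc)

lemma Phi_zero: "\<Phi> \<zero>\<^bsub>T\<^esub> = \<zero>"
  using Phi_rho[of "\<zero>\<^bsub>R\<^esub>"] ring_hom_zero[OF sigma_hom R.ring_axioms A.ring_axioms] by (simp add: rho_zero)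

lemma Phi_gens_mult:
  assumes "x \<in> gens" "y \<in> gens" shows "\<Phi> (x \<otimes>\<^sub>T y) = \<Phi> x \<otimes> \<Phi> y"
proof -
  define E where "E w = omT w" for w
  note E = rho_omT[folded E_def] omT_rho[folded E_def] omT_omT[folded E_def] Phi_omT[folded E_def]
  note simps = E rho_rho rword_closed lword_closed Phi_rho wval_lword wval_rword wval_append ring_hom_mult[OF sigma_hom]
  have gen: "(\<exists>r. a = rho r \<and> r \<in> carrier R) \<or> (\<exists>w. a = E w \<and> set w \<subseteq> carrier M \<and> w \<noteq> [])" if "a \<in> gens" for a
    using that by (cases rule: gens.cases) (auto simp: E_def)
  show ?thesis
    using gen[OF assms(1)] gen[OF assms(2)]
    by (elim disjE exE; elim conjE; simp add: simps)
qed

lemma Phi_mult: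
  assumes x: "x \<in> carrier T" and y: "y \<in> carrier T" shows "\<Phi> (x \<otimes>\<^sub>T y) = \<Phi> x \<otimes> \<Phi> y"
proof -
  note cl = mult_T_closed T_add_closed gens_closed T_mult_zero T_l_distr T_r_distr Phi_add Phi_zero A.l_distr A.r_distr
  \<comment> \<open>As for associativity, both sides are biadditive; equality on generators is
    extended in \<open>y\<close> and afterwards in \<open>x\<close>.\<close>
  have 1: "\<Phi> (x \<otimes>\<^sub>T y) = \<Phi> x \<otimes> \<Phi> y" if "x \<in> gens" "y \<in> carrier T" for x y
    using that(2)
    by (induction rule: T_induct) (use that(1) in \<open>auto simp: cl intro!: Phi_gens_mult gens.intros\<close>)
  show ?thesis
    using x by (induction rule: T_induct) (use y in \<open>auto simp: cl intro!: 1 gens.intros\<close>)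
qed

lemma Phi_hom: "\<Phi> \<in> ring_hom T A"
proof (rule ring_hom_memI)
  show "\<Phi> \<one>\<^bsub>T\<^esub> = \<one>"
    using Phi_rho[of "\<one>\<^bsub>R\<^esub>"] ring_hom_one[OF sigma_hom] by (simp add: one_T flip: rho_def)
qed (simp_all add: Phi_mult Phi_add)

end

section \<open>Graded algebras and presentations\<close>

lemma bit_cases: "(g::bit) = 0 \<or> g = 1"
  by (cases g) auto

section \<open>Homogeneous components modulo 2\<close>

locale graded_group = abelian_group M for M :: "('r, 'm, 'x) gmodule_scheme" (structure) +
  assumes grading_M: "grading M"
begin

lemma hcomp_subgroup: "subgroup (hcomp M g) (add_monoid M)"
  using grading_M by (simp add: grading_def)

lemma hcomp_carrier: "x \<in> hcomp M g ==> x \<in> carrier M"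
  using subgroup.subset[OF hcomp_subgroup[of g]] by auto

lemma hcomp_add [intro]: "x \<in> hcomp M g ==> y \<in> hcomp M g ==> x \<oplus> y \<in> hcomp M g"
  using subgroup.m_closed[OF hcomp_subgroup[of g]] by simp

lemma hcomp_zero [intro, simp]: "\<zero> \<in> hcomp M g"
  using subgroup.one_closed[OF hcomp_subgroup[of g]] by simp

lemma hcomp_inv [intro]: "x \<in> hcomp M g ==> \<ominus> x \<in> hcomp M g"
  using subgroup.m_inv_closed[OF hcomp_subgroup[of g], of x] by (simp add: a_inv_def)

lemma hcomp_minus [intro]: "x \<in> hcomp M g ==> y \<in> hcomp M g ==> x \<ominus> y \<in> hcomp M g"
  by (simp add: a_minus_def hcomp_add hcomp_inv)

lemma hcomp_unique:
  assumes "a \<in> hcomp M 0" "a' \<in> hcomp M 0" "b \<in> hcomp M 1" "b' \<in> hcomp M 1" "a \<oplus> b = a' \<oplus> b'"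
  shows "a = a'" "b = b'"
proof -
  have "a \<oplus> b \<in> carrier M" using assms hcomp_carrier by blast
  then have "\<exists>!p. p \<in> hcomp M 0 \<times> hcomp M 1 \<and> a \<oplus> b = fst p \<oplus> snd p"
    using grading_M by (simp add: grading_def)
  then have "(a, b) = (a', b')" by (rule ex1E) (use assms in auto)
  then show "a = a'" "b = b'" by auto
qed

text \<open>Projection to a homogeneous component. With it, gradedness of a subset becomes closure
  under \<open>part\<close>, and uniqueness of the decomposition becomes additivity of
  \<open>part\<close>.\<close>

definition part :: "bit => 'm => 'm" where
  "part g x = (let p = (THE p. p \<in> hcomp M 0 \<times> hcomp M 1 \<and> x = fst p \<oplus> snd p) in if g = 0 then fst p else snd p)"

lemma part_aux:
  assumes "x \<in> carrier M"
  shows "part 0 x \<in> hcomp M 0 \<and> part 1 x \<in> hcomp M 1 \<and> x = part 0 x \<oplus> part 1 x"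
proof -
  let ?p = "THE p. p \<in> hcomp M 0 \<times> hcomp M 1 \<and> x = fst p \<oplus> snd p"
  have "\<exists>!p. p \<in> hcomp M 0 \<times> hcomp M 1 \<and> x = fst p \<oplus> snd p"
    using grading_M assms by (simp add: grading_def)
  then have "?p \<in> hcomp M 0 \<times> hcomp M 1 \<and> x = fst ?p \<oplus> snd ?p"
    by (rule theI')
  then show ?thesis by (auto simp: part_def Let_def)
qed

lemma part_hcomp [simp]: "x \<in> carrier M ==> part g x \<in> hcomp M g"
  using part_aux[of x] bit_cases[of g] by auto

lemma part_closed [simp]: "x \<in> carrier M ==> part g x \<in> carrier M"
  using hcomp_carrier part_hcomp by blast

lemma part_sum: "x \<in> carrier M ==> x = part 0 x \<oplus> part 1 x"
  using part_aux by blast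

lemma part_sum': "x \<in> carrier M ==> x = part g x \<oplus> part (g + 1) x"
  using part_aux[of x] bit_cases[of g] a_comm[of "part 0 x" "part 1 x"] by auto

lemma part_unique:
  assumes "a \<in> hcomp M g" "b \<in> hcomp M (g + 1)"
  shows "part g (a \<oplus> b) = a" "part (g + 1) (a \<oplus> b) = b"
proof -
  have c: "a \<in> carrier M" "b \<in> carrier M" using assms hcomp_carrier by blast+
  have "part g (a \<oplus> b) = a \<and> part (g + 1) (a \<oplus> b) = b"
  proof (cases "g = 0")
    case True
    then show ?thesis using assms part_aux[of "a \<oplus> b"] c hcomp_unique[of "part 0 (a \<oplus> b)" a "part 1 (a \<oplus> b)" b] by auto
  next
    case False
    then have "g = 1" using bit_cases by blast
    then show ?thesis using assms part_aux[of "a \<oplus> b"] c a_comm[of a b] hcomp_unique[of "part 0 (a \<oplus> b)" b "part 1 (a \<oplus> b)" a] by auto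
  qed
  then show "part g (a \<oplus> b) = a" "part (g + 1) (a \<oplus> b) = b" by auto
qed

lemma part_same [simp]: "a \<in> hcomp M g ==> part g a = a"
  using part_unique(1)[of a g \<zero>] hcomp_carrier[of a g] by simp

lemma part_other: "a \<in> hcomp M g ==> part (g + 1) a = \<zero>"
  using part_unique(2)[of a g \<zero>] hcomp_carrier[of a g] by simp

lemma part_other': "a \<in> hcomp M g ==> h \<noteq> g ==> part h a = \<zero>"
  using part_other[of a g] bit_cases[of g] bit_cases[of h] by auto

lemma part_add:
  assumes x: "x \<in> carrier M" and y: "y \<in> carrier M" shows "part g (x \<oplus> y) = part g x \<oplus> part g y"
proof -
  have "x \<oplus> y = (part g x \<oplus> part (g + 1) x) \<oplus> (part g y \<oplus> part (g + 1) y)"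
    using part_sum'[OF x, of g] part_sum'[OF y, of g] by metis
  also have "\<dots> = (part g x \<oplus> part g y) \<oplus> (part (g + 1) x \<oplus> part (g + 1) y)"
    using x y by (simp add: a_ac)
  finally have e: "x \<oplus> y = (part g x \<oplus> part g y) \<oplus> (part (g + 1) x \<oplus> part (g + 1) y)" .
  show ?thesis unfolding e using x y by (intro part_unique(1)) auto
qed

lemma part_inv: "x \<in> carrier M ==> part g (\<ominus> x) = \<ominus> part g x"
proof -
  assume x: "x \<in> carrier M"
  have "part g (\<ominus> x) \<oplus> part g x = part g (\<ominus> x \<oplus> x)" using x by (simp add: part_add)
  also have "\<dots> = \<zero>" using x by (simp add: l_neg)
  finally show ?thesis using x by (metis minus_equality part_closed a_inv_closed)
qed

lemma part_minus: "x \<in> carrier M ==> y \<in> carrier M ==> part g (x \<ominus> y) = part g x \<ominus> part g y"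
  by (simp add: a_minus_def part_add part_inv)

lemma hcomp_disjoint: "x \<in> hcomp M g ==> x \<in> hcomp M (g + 1) ==> x = \<zero>"
  using part_same[of x "g + 1"] part_other[of x g] by simp

lemma graded_subsetD:
  assumes "graded_subset M N" "N \<subseteq> carrier M" "x \<in> N" shows "part g x \<in> N"
proof -
  obtain y z where "y \<in> N \<inter> hcomp M 0" "z \<in> N \<inter> hcomp M 1" "x = y \<oplus> z"
    using assms unfolding graded_subset_def by blast
  then show ?thesis using part_unique[of y 0 z] bit_cases[of g] by auto
qed

lemma graded_subsetI:
  assumes "N \<subseteq> carrier M" "\<And>x g. x \<in> N ==> part g x \<in> N" shows "graded_subset M N"
  unfolding graded_subset_def
proof
  fix x assume x: "x \<in> N"
  then have "x \<in> carrier M" using assms(1) by blast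
  then show "\<exists>y\<in>N \<inter> hcomp M 0. \<exists>z\<in>N \<inter> hcomp M 1. x = y \<oplus> z"
    using assms(2)[OF x] part_sum[of x] part_hcomp[of x] by blast
qed

end

sublocale superalgebra \<subseteq> graded_group A
  by unfold_locales (rule grading)

locale salg = ring A + superalgebra K A for K :: "('k, 'x) ring_scheme" and A :: "('k, 'a, 'y) gmodule_scheme" (structure)
begin

text \<open>The axioms do not place the unit in degree 0. Write the unit as e + f with e even and f
  odd. Comparing degrees in x = x e + x f gives x f = 0 for every homogeneous x, so f = e f + f f
  vanishes.\<close>

lemma one_hcomp [simp]: "\<one> \<in> hcomp A 0"
proof -
  let ?e = "part 0 \<one>" and ?f = "part 1 \<one>"
  have ef: "?e \<in> hcomp A 0" "?f \<in> hcomp A 1" "\<one> = ?e \<oplus> ?f" by (auto intro: part_sum)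
  have h: "x \<otimes> ?f = \<zero>" if x: "x \<in> hcomp A g" for x g
  proof -
    have xc: "x \<in> carrier A" using x by (rule hcomp_carrier)
    have "x = x \<otimes> (?e \<oplus> ?f)" using xc ef(3) by simp
    then have "x = x \<otimes> ?e \<oplus> x \<otimes> ?f" using xc by (simp add: r_distr)
    moreover have "x \<otimes> ?e \<in> hcomp A g" "x \<otimes> ?f \<in> hcomp A (g + 1)" using hcomp_mult[OF x ef(1)] hcomp_mult[OF x ef(2)] by (simp_all only: add_0_right)
    ultimately show ?thesis using part_unique(2)[of "x \<otimes> ?e" g "x \<otimes> ?f"] part_other[OF x] by simp
  qed
  have "?f = (?e \<oplus> ?f) \<otimes> ?f" using ef(3) by (metis l_one one_closed part_closed)
  also have "\<dots> = ?e \<otimes> ?f \<oplus> ?f \<otimes> ?f" by (simp add: l_distr)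
  also have "\<dots> = \<zero>" using h[OF ef(1)] h[OF ef(2)] by simp
  finally have "\<one> = ?e" using ef(3) by (metis r_zero part_closed one_closed)
  then show ?thesis using ef(1) by metis
qed

lemma part_mult_l:
  assumes x: "x \<in> hcomp A g" and y: "y \<in> carrier A" shows "part (g + h) (x \<otimes> y) = x \<otimes> part h y"
proof -
  have xc: "x \<in> carrier A" using x by (rule hcomp_carrier)
  have "x \<otimes> y = x \<otimes> part h y \<oplus> x \<otimes> part (h + 1) y" using part_sum'[OF y, of h] xc y by (metis r_distr part_closed)
  moreover have "x \<otimes> part h y \<in> hcomp A (g + h)" "x \<otimes> part (h + 1) y \<in> hcomp A (g + h + 1)"
    using hcomp_mult[OF x, of "part h y" h] hcomp_mult[OF x, of "part (h + 1) y" "h + 1"] y by (auto simp: add.assoc)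
  ultimately show ?thesis using part_unique(1) by simp
qed

lemma part_mult_r:
  assumes x: "x \<in> hcomp A g" and y: "y \<in> carrier A" shows "part (h + g) (y \<otimes> x) = part h y \<otimes> x"
proof -
  have xc: "x \<in> carrier A" using x by (rule hcomp_carrier)
  have "y \<otimes> x = part h y \<otimes> x \<oplus> part (h + 1) y \<otimes> x" using part_sum'[OF y, of h] xc y by (metis l_distr part_closed)
  moreover have "part h y \<otimes> x \<in> hcomp A (h + g)" "part (h + 1) y \<otimes> x \<in> hcomp A (h + g + 1)"
    using hcomp_mult[of "part h y" h x g] hcomp_mult[of "part (h + 1) y" "h + 1" x g] x y by (auto simp: add.assoc add.commute add.left_commute)
  ultimately show ?thesis using part_unique(1) by simp
qed

lemma part_smult:
  assumes "c \<in> carrier K" "x \<in> carrier A" shows "part g (c \<odot>\<^bsub>A\<^esub> x) = c \<odot>\<^bsub>A\<^esub> part g x"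
proof -
  have "c \<odot>\<^bsub>A\<^esub> x = c \<odot>\<^bsub>A\<^esub> part g x \<oplus> c \<odot>\<^bsub>A\<^esub> part (g + 1) x"
    using part_sum'[OF assms(2), of g] assms by (metis vs.smult_r_distr part_closed)
  then show ?thesis using part_unique(1)[of "c \<odot>\<^bsub>A\<^esub> part g x" g] hcomp_smult assms by simp
qed

lemma smult_one: "c \<in> carrier K ==> x \<in> carrier A ==> (c \<odot>\<^bsub>A\<^esub> \<one>) \<otimes> x = c \<odot>\<^bsub>A\<^esub> x"
  by (simp add: smult_mult_l)

end

lemma (in ring) ideal_prod_subset: "[| ideal I R; ideal J R |] ==> ideal_prod R I J \<subseteq> carrier R"
  by (rule ideal_prod_in_carrier)

lemma (in ring) ideal_powerI: "ideal I R ==> ideal (ideal_power R I n) R"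
  by (induction n) (auto simp: oneideal ideal_prod_is_ideal)

section \<open>Scalars and degrees on the tensor algebra, and the kernel of the induced map\<close>

locale graded_lift = tensor_lift R M A \<sigma> \<tau> + salg K A
  for K :: "('k, 'w) ring_scheme" and R :: "('k, 'r, 'x) gmodule_scheme" and M :: "('r, 'r, 'm, 'y) gbimodule_scheme"
    and A :: "('k, 'a, 'z) gmodule_scheme" (structure) and \<sigma> :: "'r => 'a" and \<tau> :: "'m => 'a" +
  assumes R_hcomp: "subgroup (hcomp R g) (add_monoid R)"
    and R_dec: "r \<in> carrier R ==> \<exists>a\<in>hcomp R 0. \<exists>b\<in>hcomp R 1. r = a \<oplus>\<^bsub>R\<^esub> b"
    and M_hcomp: "hcomp M g \<subseteq> carrier M"
    and M_dec: "x \<in> carrier M ==> \<exists>a\<in>hcomp M 0. \<exists>b\<in>hcomp M 1. x = a \<oplus>\<^bsub>M\<^esub> b"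
    and R_smult_closed: "[| c \<in> carrier K; r \<in> carrier R |] ==> c \<odot>\<^bsub>R\<^esub> r \<in> carrier R"
    and R_smult_one: "[| c \<in> carrier K; r \<in> carrier R |] ==> c \<odot>\<^bsub>R\<^esub> r = (c \<odot>\<^bsub>R\<^esub> \<one>\<^bsub>R\<^esub>) \<otimes>\<^bsub>R\<^esub> r"
    and sigma_smult: "[| c \<in> carrier K; r \<in> carrier R |] ==> \<sigma> (c \<odot>\<^bsub>R\<^esub> r) = c \<odot> \<sigma> r"
    and sigma_hcomp: "r \<in> hcomp R g ==> \<sigma> r \<in> hcomp A g"
    and tau_hcomp: "x \<in> hcomp M g ==> \<tau> x \<in> hcomp A g"
begin

sublocale T: ring T by (rule ring_T)

text \<open>Scalars act on \<open>T\<close> as left multiplication by the degree 0 element of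
  \<open>c\<close> times the unit of \<open>R\<close>, so compatibility of \<open>\<Phi>\<close>
  with scalars reduces to multiplicativity.\<close>

lemma smult_T:
  assumes c: "c \<in> carrier K" and t: "t \<in> carrier T"
  shows "c \<odot>\<^bsub>T\<^esub> t = rho (c \<odot>\<^bsub>R\<^esub> \<one>\<^bsub>R\<^esub>) \<otimes>\<^sub>T t"
proof -
  have r: "c \<odot>\<^bsub>R\<^esub> \<one>\<^bsub>R\<^esub> \<in> carrier R" by (rule R_smult_closed[OF c R.one_closed])
  have "mcomp n (rho (c \<odot>\<^bsub>R\<^esub> \<one>\<^bsub>R\<^esub>)) t = la n (c \<odot>\<^bsub>R\<^esub> \<one>\<^bsub>R\<^esub>) (snd t n)" if "1 \<le> n" for n
    using that r t by (simp add: mcomp_def finprod_rho_l T_snd T_fst)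
  then show ?thesis
    unfolding mult_T using R_smult_one[OF c T_fst[OF t]]
    by (auto simp: tensor_algebra_def case_prod_beta intro!: restrict_ext)
qed

lemma smult_T_closed [simp]: "[| c \<in> carrier K; t \<in> carrier T |] ==> c \<odot>\<^bsub>T\<^esub> t \<in> carrier T"
  by (simp add: smult_T R_smult_closed)

lemma Phi_smult: "[| c \<in> carrier K; t \<in> carrier T |] ==> \<Phi> (c \<odot>\<^bsub>T\<^esub> t) = c \<odot> \<Phi> t"
  by (simp add: smult_T R_smult_closed Phi_mult Phi_rho sigma_smult ring_hom_one[OF sigma_hom] smult_one)

abbreviation HW where "HW n g \<equiv> {w \<in> W n. \<exists>ds. list_all2 (\<lambda>x d. x \<in> hcomp M d) w ds \<and> sum_list ds = g}"

lemma wval_hcomp: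
  assumes "list_all2 (\<lambda>x d. x \<in> hcomp M d) w ds" shows "wval w \<in> hcomp A (sum_list ds)"
  using assms
proof (induction rule: list_all2_induct)
  case Nil then show ?case by simp
next
  case (Cons x xs d ds)
  then show ?case using hcomp_mult[OF tau_hcomp[of x d] Cons(3)] by (simp only: wval.simps sum_list.Cons)
qed

lemma phi_hcomp:
  assumes "U \<in> tensor_hcomp R M n g" shows "\<phi> n U \<in> hcomp A g"
proof -
  obtain a where a: "U = cl n a" "Poly_Mapping.keys a \<subseteq> HW n g"
    using assms unfolding tensor_hcomp_def by blast
  have sub: "HW n g \<subseteq> W n" by blast
  interpret h: group_hom "P n" G "\<phi> n"
    using phi_hom comm_group.axioms(2)[OF comm_group_G] by (simp add: group_hom_def group_hom_axioms_def)
  from a(2) have "\<phi> n (cl n a) \<in> hcomp A g"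
  proof (rule free_Abelian_group_induct)
    show "\<phi> n (cl n 0) \<in> hcomp A g" using phi_one[of n] by (simp add: one_power)
  next
    fix x y assume *: "Poly_Mapping.keys x \<subseteq> HW n g" "Poly_Mapping.keys y \<subseteq> HW n g"
      "\<phi> n (cl n x) \<in> hcomp A g" "\<phi> n (cl n y) \<in> hcomp A g"
    have k: "Poly_Mapping.keys x \<subseteq> W n" "Poly_Mapping.keys y \<subseteq> W n" using * sub by auto
    have d: "Poly_Mapping.keys (x - y) \<subseteq> W n" using k keys_diff' by blast
    have "cl n x = cl n (x - y) \<otimes>\<^bsub>P n\<^esub> cl n y" using class_mult[OF d k(2)] by simp
    then have "\<phi> n (cl n x) = \<phi> n (cl n (x - y)) \<oplus> \<phi> n (cl n y)"
      using h.hom_mult[OF class_carrier[OF d] class_carrier[OF k(2)]] by simp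
    then have "\<phi> n (cl n (x - y)) = \<phi> n (cl n x) \<ominus> \<phi> n (cl n y)"
      using phi_closed[OF class_carrier[OF d]] phi_closed[OF class_carrier[OF k(2)]]
      by (simp add: A.minus_eq A.a_assoc A.r_neg)
    then show "\<phi> n (cl n (x - y)) \<in> hcomp A g" using *(3,4) by (simp add: hcomp_minus)
  next
    fix w assume w: "w \<in> HW n g"
    then have "\<phi> n (cl n (frag_of w)) = wval w" using phi_om[of w n] by (auto simp: om_def tensor_words_def)
    then show "\<phi> n (cl n (frag_of w)) \<in> hcomp A g" using w wval_hcomp by auto
  qed
  then show ?thesis using a(1) by simp
qed

lemma hcomp_T: "hcomp T g = {x \<in> carrier R \<times> carrier TP. fst x \<in> hcomp R g \<and> (\<forall>n\<ge>1. snd x n \<in> tensor_hcomp R M n g)}"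
  using subgroup.subset[OF R_hcomp[of g]] by (auto simp: tensor_algebra_def)

lemma hcomp_T_closed: "x \<in> hcomp T g ==> x \<in> carrier T"
  by (auto simp: hcomp_T carrier_T)

lemma gfinprod_hcomp:
  assumes "\<And>n. n \<in> I ==> f n \<in> hcomp A g"
  shows "gfinprod G f I \<in> hcomp A g"
proof -
  have 1: "finprod G f F \<in> hcomp A g" if "finite F" "F \<subseteq> I" for F
    using that
  proof (induction F rule: finite_induct)
    case empty show ?case using comm_monoid.finprod_empty[OF comm_group.axioms(1)[OF comm_group_G], of f] by simp
  next
    case (insert n F)
    have "f i \<in> carrier A" if "i \<in> insert n F" for i
      using insert.prems that by (intro hcomp_carrier[of _ g] assms) blast
    then have fc: "f \<in> F \<rightarrow> carrier G" "f n \<in> carrier G" by auto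
    have "finprod G f (insert n F) = f n \<oplus> finprod G f F"
      using comm_monoid.finprod_insert[OF comm_group.axioms(1)[OF comm_group_G] insert.hyps fc] by simp
    then show ?case using insert assms by auto
  qed
  show ?thesis unfolding gfinprod_def using 1 by auto
qed

lemma Phi_hcomp: "x \<in> hcomp T g ==> \<Phi> x \<in> hcomp A g"
  unfolding \<Phi>_def by (intro hcomp_add gfinprod_hcomp phi_hcomp sigma_hcomp) (auto simp: hcomp_T)

lemma tensor_hcomp_mult:
  assumes "U \<in> tensor_hcomp R M n g" "V \<in> tensor_hcomp R M n g" shows "U \<otimes>\<^bsub>P n\<^esub> V \<in> tensor_hcomp R M n g"
proof -
  obtain a b where a: "U = cl n a" "Poly_Mapping.keys a \<subseteq> HW n g" and b: "V = cl n b" "Poly_Mapping.keys b \<subseteq> HW n g"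
    using assms unfolding tensor_hcomp_def by blast
  have "U \<otimes>\<^bsub>P n\<^esub> V = cl n (a + b)" unfolding a b by (rule class_mult) (use a b in auto)
  then show ?thesis unfolding tensor_hcomp_def using keys_add'[OF a(2) b(2)] by blast
qed

lemma hcomp_T_add:
  assumes "x \<in> hcomp T g" "y \<in> hcomp T g" shows "x \<oplus>\<^sub>T y \<in> hcomp T g"
proof -
  have "x \<oplus>\<^sub>T y \<in> carrier T" using assms hcomp_T_closed by blast
  moreover have "fst x \<oplus>\<^bsub>R\<^esub> fst y \<in> hcomp R g"
    using assms subgroup.m_closed[OF R_hcomp[of g]] by (auto simp: hcomp_T)
  ultimately show ?thesis using assms tensor_hcomp_mult by (auto simp: hcomp_T carrier_T)
qed

lemma tensor_hcomp_one: "\<one>\<^bsub>P n\<^esub> \<in> tensor_hcomp R M n g"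
  unfolding tensor_hcomp_def one_power by force

lemma rho_hcomp: "r \<in> hcomp R g ==> rho r \<in> hcomp T g"
  using subgroup.subset[OF R_hcomp[of g]] rho_closed[of r] by (auto simp: hcomp_T tensor_hcomp_one carrier_T)

lemma omT_hcomp:
  assumes "list_all2 (\<lambda>x d. x \<in> hcomp M d) w ds" "w \<noteq> []" shows "omT w \<in> hcomp T (sum_list ds)"
proof -
  have w: "set w \<subseteq> carrier M" using assms(1) M_hcomp by (induction rule: list_all2_induct) auto
  then have "om w \<in> tensor_hcomp R M (length w) (sum_list ds)"
    using assms unfolding tensor_hcomp_def om_def by (auto simp: tensor_words_def intro!: exI[of _ "frag_of w"])
  moreover have "\<zero>\<^bsub>R\<^esub> \<in> hcomp R g" for g using subgroup.one_closed[OF R_hcomp[of g]] by simp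
  ultimately show ?thesis
    using omT_closed[OF w assms(2)] by (auto simp: hcomp_T carrier_T tensor_hcomp_one)
qed

text \<open>Elements of \<open>T\<close> are decomposed by hand; the comparison of components takes
  place in \<open>A\<close>, where the grading axiom supplies uniqueness.\<close>

definition dec where "dec x \<longleftrightarrow> (\<exists>a\<in>hcomp T 0. \<exists>b\<in>hcomp T 1. x = a \<oplus>\<^sub>T b)"

lemma hcomp_T_zero: "\<zero>\<^bsub>T\<^esub> \<in> hcomp T g"
  using rho_hcomp[of "\<zero>\<^bsub>R\<^esub>" g] subgroup.one_closed[OF R_hcomp[of g]] by (simp add: rho_zero)

lemma dec_add:
  assumes "dec x" "dec y" shows "dec (x \<oplus>\<^sub>T y)"
proof -
  obtain a b where 1: "a \<in> hcomp T 0" "b \<in> hcomp T 1" "x = a \<oplus>\<^sub>T b" using assms(1) by (auto simp: dec_def)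
  obtain a' b' where 2: "a' \<in> hcomp T 0" "b' \<in> hcomp T 1" "y = a' \<oplus>\<^sub>T b'" using assms(2) by (auto simp: dec_def)
  have "x \<oplus>\<^sub>T y = (a \<oplus>\<^sub>T a') \<oplus>\<^sub>T (b \<oplus>\<^sub>T b')"
    using 1 2 hcomp_T_closed by (simp add: T.a_ac)
  moreover have "a \<oplus>\<^sub>T a' \<in> hcomp T 0" "b \<oplus>\<^sub>T b' \<in> hcomp T 1" using 1 2 hcomp_T_add by auto
  ultimately show ?thesis unfolding dec_def by blast
qed

lemma dec_hcomp: "x \<in> hcomp T g ==> dec x"
proof -
  assume x: "x \<in> hcomp T g"
  then have "x \<in> carrier T" by (rule hcomp_T_closed)
  then have "x = x \<oplus>\<^sub>T \<zero>\<^bsub>T\<^esub>" "x = \<zero>\<^bsub>T\<^esub> \<oplus>\<^sub>T x" by simp_all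
  then show ?thesis unfolding dec_def using bit_cases[of g] hcomp_T_zero x by blast
qed

text \<open>The word is made homogeneous letter by letter from the left: \<open>u\<close> is the
  part already consisting of homogeneous letters, with degrees \<open>ds\<close>, and the next
  letter is replaced by the sum of its two components.\<close>

lemma dec_omT:
  assumes "list_all2 (\<lambda>x d. x \<in> hcomp M d) u ds" "set w \<subseteq> carrier M" "u @ w \<noteq> []"
  shows "dec (omT (u @ w))"
  using assms
proof (induction w arbitrary: u ds)
  case Nil then show ?case using dec_hcomp[OF omT_hcomp[of u ds]] by simp
next
  case (Cons x w)
  have u: "set u \<subseteq> carrier M" using Cons.prems(1) M_hcomp by (induction rule: list_all2_induct) auto
  obtain a b where ab: "a \<in> hcomp M 0" "b \<in> hcomp M 1" "x = a \<oplus>\<^bsub>M\<^esub> b" using M_dec[of x] Cons.prems by auto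
  have d: "dec (omT (u @ [c] @ w))" if "c \<in> hcomp M d" for c d
  proof -
    have "list_all2 (\<lambda>x d. x \<in> hcomp M d) (u @ [c]) (ds @ [d])"
      using Cons.prems(1) that by (intro list_all2_appendI) auto
    then show ?thesis using Cons.IH[of "u @ [c]" "ds @ [d]"] Cons.prems by simp
  qed
  have "dec (omT (u @ [a] @ w))" "dec (omT (u @ [b] @ w))" using d[OF ab(1)] d[OF ab(2)] .
  then have "dec (omT (u @ [a] @ w) \<oplus>\<^sub>T omT (u @ [b] @ w))" by (rule dec_add)
  moreover have "omT (u @ [x] @ w) = omT (u @ [a] @ w) \<oplus>\<^sub>T omT (u @ [b] @ w)"
    unfolding ab(3) using Cons.prems ab(1,2) M_hcomp by (intro omT_add u) auto
  ultimately show ?case by simp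
qed

lemma T_dec: "x \<in> carrier T ==> dec x"
proof (induction rule: T_induct)
  case zero then show ?case using hcomp_T_zero dec_hcomp by blast
next
  case (add x y) then show ?case by (simp add: dec_add)
next
  case (rho r)
  obtain a b where ab: "a \<in> hcomp R 0" "b \<in> hcomp R 1" "r = a \<oplus>\<^bsub>R\<^esub> b" using R_dec[OF rho] by blast
  then have "rho r = rho a \<oplus>\<^sub>T rho b"
    using subgroup.subset[OF R_hcomp] by (auto intro!: rho_add)
  then show ?case using ab rho_hcomp dec_hcomp dec_add by metis
next
  case (om w) then show ?case using dec_omT[of "[]" "[]" w] by simp
qed

definition ker where "ker = {x \<in> carrier T. \<Phi> x = \<zero>}"

lemma ring_hom_ring_Phi: "ring_hom_ring T A \<Phi>"
  by (rule ring_hom_ringI2[OF ring_T A.ring_axioms Phi_hom])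

lemma ker_kernel: "ker = a_kernel T A \<Phi>"
  by (simp add: ker_def a_kernel_def')

lemma ideal_ker: "ideal ker T"
  unfolding ker_kernel by (rule ring_hom_ring.kernel_is_ideal[OF ring_hom_ring_Phi])

lemma graded_ideal_ker: "graded_ideal T ker"
  unfolding graded_ideal_def graded_subset_def
proof (intro conjI ballI ideal_ker)
  fix x assume x: "x \<in> ker"
  then obtain a b where ab: "a \<in> hcomp T 0" "b \<in> hcomp T 1" "x = a \<oplus>\<^sub>T b"
    using T_dec[of x] by (auto simp: ker_def dec_def)
  \<comment> \<open>The images of the two components have different degrees and add up to zero, so
    both vanish and both components lie in the kernel.\<close>
  have "\<Phi> a \<oplus> \<Phi> b = \<zero> \<oplus> \<zero>" using x ab hcomp_T_closed by (auto simp: ker_def Phi_add)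
  then have "\<Phi> a = \<zero> \<and> \<Phi> b = \<zero>" using hcomp_unique[of "\<Phi> a" "\<zero>" "\<Phi> b" "\<zero>"] Phi_hcomp[OF ab(1)] Phi_hcomp[OF ab(2)] by auto
  then show "\<exists>y\<in>ker \<inter> hcomp T 0. \<exists>z\<in>ker \<inter> hcomp T 1. x = y \<oplus>\<^sub>T z"
    unfolding ker_def using ab hcomp_T_closed[OF ab(1)] hcomp_T_closed[OF ab(2)] by blast
qed

text \<open>The component of degree \<open>g\<close> of any preimage works, since the image of the
  other component has the wrong degree and vanishes. This makes the maps out of \<open>A\<close>,
  which invert \<open>\<Phi>\<close>, degree-preserving.\<close>

lemma Phi_lift_hcomp:
  assumes "t \<in> carrier T" "\<Phi> t \<in> hcomp A g" shows "\<exists>s \<in> hcomp T g. \<Phi> s = \<Phi> t \<and> t \<ominus>\<^bsub>T\<^esub> s \<in> ker"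
proof -
  obtain a b where ab: "a \<in> hcomp T 0" "b \<in> hcomp T 1" "t = a \<oplus>\<^sub>T b"
    using T_dec[OF assms(1)] by (auto simp: dec_def)
  have c: "a \<in> carrier T" "b \<in> carrier T" using ab hcomp_T_closed by auto
  have s: "\<Phi> t = \<Phi> a \<oplus> \<Phi> b" using ab c by (simp add: Phi_add)
  have h: "\<Phi> a \<in> hcomp A 0" "\<Phi> b \<in> hcomp A 1" using ab Phi_hcomp by auto
  show ?thesis
  proof (cases "g = 0")
    case True
    have "\<Phi> b = \<zero>" using part_unique(2)[of "\<Phi> a" 0 "\<Phi> b"] h part_other[OF assms(2)] True s by simp
    moreover have "t \<ominus>\<^bsub>T\<^esub> a = b" unfolding ab(3) T.a_comm[OF c] using c by (simp add: T.minus_eq T.a_assoc T.r_neg)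
    ultimately show ?thesis using ab c True s by (intro bexI[of _ a]) (auto simp: ker_def)
  next
    case False
    then have g: "g = 1" using bit_cases by blast
    have "\<Phi> a = \<zero>" using part_unique(1)[of "\<Phi> a" 0 "\<Phi> b"] h part_other[OF assms(2)] g s by simp
    moreover have "t \<ominus>\<^bsub>T\<^esub> b = a" unfolding ab(3) using c by (simp add: T.minus_eq T.a_assoc T.r_neg)
    ultimately show ?thesis using ab c g s by (intro bexI[of _ b]) (auto simp: ker_def)
  qed
qed

end

context graded_lift begin

text \<open>The isomorphism is taken in the direction from \<open>A\<close> to the quotient: an
  element goes to its fibre, and the fibres over the image are exactly the cosets of the
  kernel.\<close>

definition fib where "fib a = {t \<in> carrier T. \<Phi> t = a}"

lemma fib_coset: assumes t: "t \<in> carrier T" shows "fib (\<Phi> t) = ker +>\<^bsub>T\<^esub> t"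
proof -
  show ?thesis
  proof
    show "fib (\<Phi> t) \<subseteq> ker +>\<^bsub>T\<^esub> t"
    proof
      fix s assume "s \<in> fib (\<Phi> t)"
      then have s: "s \<in> carrier T" "\<Phi> s = \<Phi> t" by (auto simp: fib_def)
      have st: "s \<ominus>\<^bsub>T\<^esub> t \<in> carrier T" "s = (s \<ominus>\<^bsub>T\<^esub> t) \<oplus>\<^sub>T t"
        using s t by (simp_all add: T.minus_eq T.a_assoc T.l_neg)
      have "\<Phi> (s \<ominus>\<^bsub>T\<^esub> t) \<oplus> \<Phi> t = \<Phi> t" using Phi_add[OF st(1) t] st(2) s(2) by simp
      moreover have "\<Phi> (s \<ominus>\<^bsub>T\<^esub> t) = (\<Phi> (s \<ominus>\<^bsub>T\<^esub> t) \<oplus> \<Phi> t) \<ominus> \<Phi> t"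
        using Phi_closed[OF st(1)] Phi_closed[OF t] by (simp add: A.minus_eq A.a_assoc A.r_neg)
      ultimately have "\<Phi> (s \<ominus>\<^bsub>T\<^esub> t) = \<zero>"
        using Phi_closed[OF t] by (simp add: A.minus_eq A.r_neg)
      then have "s \<ominus>\<^bsub>T\<^esub> t \<in> ker" unfolding ker_def using st(1) by blast
      then show "s \<in> ker +>\<^bsub>T\<^esub> t" using st(2) unfolding a_r_coset_def' by blast
    qed
    show "ker +>\<^bsub>T\<^esub> t \<subseteq> fib (\<Phi> t)"
      using t by (auto simp: a_r_coset_def' fib_def ker_def Phi_add)
  qed
qed

lemma graded_isomorphic_quotient:
  assumes surj: "\<Phi> ` carrier T = carrier A"
  shows "graded_isomorphic K A (gquot T ker)"
proof -
  interpret K: ideal ker T by (rule ideal_ker)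
  have pre: "\<exists>t\<in>carrier T. a = \<Phi> t" if "a \<in> carrier A" for a using that surj by blast
  have sm: "(\<Union>x\<in>fib (\<Phi> t). ker +>\<^bsub>T\<^esub> (c \<odot>\<^bsub>T\<^esub> x)) = fib (c \<odot> \<Phi> t)" if "c \<in> carrier K" "t \<in> carrier T" for c t
  proof -
    have "ker +>\<^bsub>T\<^esub> (c \<odot>\<^bsub>T\<^esub> x) = fib (c \<odot> \<Phi> t)" if "x \<in> fib (\<Phi> t)" for x
      using that \<open>c \<in> carrier K\<close> fib_coset[of "c \<odot>\<^bsub>T\<^esub> x"] by (auto simp: fib_def Phi_smult)
    moreover have "t \<in> fib (\<Phi> t)" using that by (simp add: fib_def)
    ultimately show ?thesis by blast
  qed
  have car: "carrier (T Quot ker) = (\<lambda>t. ker +>\<^bsub>T\<^esub> t) ` carrier T"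
    by (auto simp: FactRing_def A_RCOSETS_def')
  have "fib \<in> superalgebra_iso K A (gquot T ker)"
    unfolding superalgebra_iso_def ring_iso_def
  proof (intro CollectI conjI ballI allI)
    show "fib \<in> ring_hom A (gquot T ker)"
    proof (rule ring_hom_memI)
      fix a b assume "a \<in> carrier A" "b \<in> carrier A"
      then obtain t s where ts: "t \<in> carrier T" "a = \<Phi> t" "s \<in> carrier T" "b = \<Phi> s" using pre by metis
      show "fib a \<in> carrier (gquot T ker)" using ts fib_coset by (auto simp: gquot_def car)
      show "fib (a \<otimes> b) = fib a \<otimes>\<^bsub>gquot T ker\<^esub> fib b"
        using ts fib_coset[of "t \<otimes>\<^sub>T s"] by (simp add: gquot_def FactRing_def fib_coset K.rcoset_mult_add Phi_mult)
      show "fib (a \<oplus> b) = fib a \<oplus>\<^bsub>gquot T ker\<^esub> fib b"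
        using ts fib_coset[of "t \<oplus>\<^sub>T s"] by (simp add: gquot_def FactRing_def fib_coset K.a_rcos_sum Phi_add)
    next
      show "fib \<one> = \<one>\<^bsub>gquot T ker\<^esub>"
        using fib_coset[of "\<one>\<^bsub>T\<^esub>"] ring_hom_one[OF Phi_hom] by (simp add: gquot_def FactRing_def)
    qed
    have "inj_on fib (carrier A)"
    proof (rule inj_onI)
      fix a b assume "a \<in> carrier A" "b \<in> carrier A" and e: "fib a = fib b"
      then obtain t where "t \<in> carrier T" "a = \<Phi> t" using pre by metis
      then have "t \<in> fib b" "\<Phi> t = a" using e by (auto simp: fib_def)
      then show "a = b" by (simp add: fib_def)
    qed
    moreover have "fib ` carrier A = carrier (gquot T ker)"
      unfolding surj[symmetric] using fib_coset by (auto simp: gquot_def car image_iff)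
    ultimately show "bij_betw fib (carrier A) (carrier (gquot T ker))" by (simp add: bij_betw_def)
  next
    fix c a assume "c \<in> carrier K" "a \<in> carrier A"
    then obtain t where "t \<in> carrier T" "a = \<Phi> t" using pre by metis
    then show "fib (c \<odot> a) = c \<odot>\<^bsub>gquot T ker\<^esub> fib a"
      using sm \<open>c \<in> carrier K\<close> by (simp add: gquot_def)
  next
    fix g
    show "fib ` hcomp A g \<subseteq> hcomp (gquot T ker) g"
    proof
      fix U assume "U \<in> fib ` hcomp A g"
      then obtain a where a: "a \<in> hcomp A g" "U = fib a" by blast
      then obtain t where t: "t \<in> carrier T" "a = \<Phi> t" using pre hcomp_carrier by metis
      then obtain s where s: "s \<in> hcomp T g" "\<Phi> s = a" using Phi_lift_hcomp[of t g] a by auto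
      then show "U \<in> hcomp (gquot T ker) g" using fib_coset[of s] hcomp_T_closed a by (auto simp: gquot_def)
    qed
  qed
  then show ?thesis unfolding graded_isomorphic_def by blast
qed

lemma ker_trivial_isomorphic:
  assumes surj: "\<Phi> ` carrier T = carrier A" and triv: "ker \<subseteq> {\<zero>\<^bsub>T\<^esub>}" and fd: "vs.fin_dim"
  shows "graded_isomorphic K A T" "vectorspace.fin_dim K T"
proof -
  have inj: "inj_on \<Phi> (carrier T)"
  proof (rule inj_onI)
    fix s t assume *: "s \<in> carrier T" "t \<in> carrier T" "\<Phi> s = \<Phi> t"
    then have "s \<in> ker +>\<^bsub>T\<^esub> t" using fib_coset[of t] by (auto simp: fib_def)
    then show "s = t" using triv * by (auto simp: a_r_coset_def')
  qed
  then have bij: "bij_betw \<Phi> (carrier T) (carrier A)" using surj by (simp add: bij_betw_def)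
  define \<Psi> where "\<Psi> = inv_into (carrier T) \<Phi>"
  have iso: "\<Phi> \<in> ring_iso T A" using Phi_hom bij by (simp add: ring_iso_def)
  have iso': "\<Psi> \<in> ring_iso A T" unfolding \<Psi>_def by (rule ring_iso_set_sym[OF ring_T iso])
  have Psi_Phi: "\<Psi> (\<Phi> t) = t" if "t \<in> carrier T" for t
    unfolding \<Psi>_def by (rule inv_into_f_f[OF inj that])
  have Psi: "\<Psi> a \<in> carrier T" "\<Phi> (\<Psi> a) = a" if "a \<in> carrier A" for a
    using that surj inv_into_into[of a \<Phi> "carrier T"] f_inv_into_f[of a \<Phi> "carrier T"] by (auto simp: \<Psi>_def)
  have Psi_smult: "\<Psi> (c \<odot> a) = c \<odot>\<^bsub>T\<^esub> \<Psi> a" if "c \<in> carrier K" "a \<in> carrier A" for c a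
    using Psi_Phi[of "c \<odot>\<^bsub>T\<^esub> \<Psi> a"] that Psi by (simp add: Phi_smult)
  have "\<Psi> \<in> superalgebra_iso K A T"
    unfolding superalgebra_iso_def
  proof (intro CollectI conjI ballI allI iso' Psi_smult)
    fix g
    show "\<Psi> ` hcomp A g \<subseteq> hcomp T g"
    proof
      fix U assume "U \<in> \<Psi> ` hcomp A g"
      then obtain a where a: "a \<in> hcomp A g" "U = \<Psi> a" by blast
      then have ac: "a \<in> carrier A" using hcomp_carrier by blast
      obtain s where s: "s \<in> hcomp T g" "\<Phi> s = a" using Phi_lift_hcomp[of "\<Psi> a" g] Psi[OF ac] a by auto
      then show "U \<in> hcomp T g" using Psi_Phi[of s] hcomp_T_closed[of s g] a by simp
    qed
  qed
  then show "graded_isomorphic K A T" unfolding graded_isomorphic_def by blast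
  \<comment> \<open>The vector space laws of \<open>T\<close> hold because they hold in
    \<open>A\<close> and \<open>\<Phi>\<close> is injective; finite dimension then passes from
    \<open>A\<close> to \<open>T\<close> along the surjection \<open>\<Psi>\<close>.\<close>
  have eqI: "s = t" if "s \<in> carrier T" "t \<in> carrier T" "\<Phi> s = \<Phi> t" for s t using inj that by (auto simp: inj_on_def)
  have "Module.module K T"
  proof (rule moduleI)
    show "cring K" by (rule vs.R.cring_axioms)
    show "abelian_group T" by (rule abelian_group_T)
  qed (auto intro!: eqI simp: Phi_smult Phi_add vs.smult_l_distr vs.smult_r_distr vs.smult_assoc1)
  then have vT: "vectorspace K T" by (rule vectorspace.intro) (rule vs.field_axioms)
  have "linear_map K A T \<Psi>"
  proof (intro linear_map.intro mod_hom.intro mod_hom_axioms.intro)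
    show "vectorspace K A" by (rule vs.vectorspace_axioms)
    show "vectorspace K T" by (rule vT)
    show "Module.module K A" by (rule vs.module_axioms)
    show "Module.module K T" by fact
    show "\<Psi> \<in> module_hom K A T"
      unfolding module_hom_def using iso' Psi Psi_smult by (auto simp: ring_iso_def ring_hom_def)
  qed
  then show "vectorspace.fin_dim K T"
    by (rule linear_map.surj_fin_dim[OF _ fd]) (use iso' in \<open>auto simp: ring_iso_def bij_betw_def\<close>)
qed

end

text \<open>Through \<open>\<sigma>\<close> the ring \<open>R\<close> is a complement of
  \<open>J\<close> in \<open>A\<close>, and through \<open>\<tau>\<close> the bimodule
  \<open>M\<close> is a complement of the square of \<open>J\<close> in \<open>J\<close>. Together
  with nilpotency of \<open>J\<close> this yields surjectivity and locates the kernel between two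
  powers of the positive part.\<close>

locale presentation = graded_lift K R M A \<sigma> \<tau>
  for K :: "('k, 'w) ring_scheme" and R :: "('k, 'r, 'x) gmodule_scheme" and M :: "('r, 'r, 'm, 'y) gbimodule_scheme"
    and A :: "('k, 'a, 'z) gmodule_scheme" (structure) and \<sigma> :: "'r => 'a" and \<tau> :: "'m => 'a" +
  fixes J :: "'a set" and t0 :: nat
  assumes ideal_J: "ideal J A"
    and nilp: "ideal_power A J t0 \<subseteq> {\<zero>}"
    and sigma_J: "[| r \<in> carrier R; \<sigma> r \<in> J |] ==> r = \<zero>\<^bsub>R\<^esub>"
    and sigma_gen: "a \<in> carrier A ==> \<exists>r\<in>carrier R. a \<ominus> \<sigma> r \<in> J"
    and tau_J: "x \<in> carrier M ==> \<tau> x \<in> J"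
    and tau_J2: "[| x \<in> carrier M; \<tau> x \<in> ideal_prod A J J |] ==> x = \<zero>\<^bsub>M\<^esub>"
    and tau_gen: "j \<in> J ==> \<exists>x\<in>carrier M. j \<ominus> \<tau> x \<in> ideal_prod A J J"
begin

abbreviation Jp where "Jp \<equiv> ideal_power A J"
abbreviation J2 where "J2 \<equiv> ideal_prod A J J"
abbreviation TI where "TI \<equiv> tensor_pos_ideal R M"
abbreviation Tp where "Tp \<equiv> ideal_power T TI"

lemma ideal_Jp: "ideal (Jp n) A" by (rule A.ideal_powerI[OF ideal_J])
lemma ideal_J2: "ideal J2 A" by (rule A.ideal_prod_is_ideal[OF ideal_J ideal_J])

lemma idl:
  assumes "ideal I A"
  shows "x \<in> I ==> x \<in> carrier A" "\<zero> \<in> I" "x \<in> I ==> y \<in> I ==> x \<oplus> y \<in> I" "x \<in> I ==> y \<in> I ==> x \<ominus> y \<in> I"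
    "x \<in> I ==> a \<in> carrier A ==> a \<otimes> x \<in> I" "x \<in> I ==> a \<in> carrier A ==> x \<otimes> a \<in> I"
proof -
  interpret I: ideal I A by (rule assms)
  show "x \<in> I ==> x \<in> carrier A" by (rule I.Icarr)
  show "\<zero> \<in> I" by (rule I.zero_closed)
  show "x \<in> I ==> y \<in> I ==> x \<oplus> y \<in> I" by (rule I.a_closed)
  show "x \<in> I ==> y \<in> I ==> x \<ominus> y \<in> I" unfolding A.minus_eq by (intro I.a_closed I.a_inv_closed)
  show "x \<in> I ==> a \<in> carrier A ==> a \<otimes> x \<in> I" by (rule I.I_l_closed)
  show "x \<in> I ==> a \<in> carrier A ==> x \<otimes> a \<in> I" by (rule I.I_r_closed)
qed

lemma Jp1: "Jp 1 = J"
proof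
  have "x \<in> J" if "x \<in> ideal_prod A (carrier A) J" for x
    using that by (induction rule: ideal_prod.induct) (auto intro: idl(3,5)[OF ideal_J])
  then show "Jp 1 \<subseteq> J" by auto
  have "x \<in> ideal_prod A (carrier A) J" if "x \<in> J" for x
    using ideal_prod.prod[OF A.one_closed that, of A] idl(1)[OF ideal_J that] by simp
  then show "J \<subseteq> Jp 1" by auto
qed

text \<open>Powers of \<open>J\<close> are formed by multiplying by one factor \<open>J\<close> at a
  time on the right, so a product with an element of \<open>J2\<close> has to be rebracketed to
  raise the exponent by two.\<close>

lemma Jp_J2:
  assumes a: "a \<in> Jp k" and b: "b \<in> J2" shows "a \<otimes> b \<in> Jp (Suc (Suc k))"
proof -
  have ac: "a \<in> carrier A" using idl(1)[OF ideal_Jp a] .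
  from b have "b \<in> carrier A \<and> a \<otimes> b \<in> Jp (Suc (Suc k))"
  proof (induction rule: ideal_prod.induct)
    case (prod i j)
    have "(a \<otimes> i) \<otimes> j \<in> Jp (Suc (Suc k))" using prod a by (auto intro!: ideal_prod.prod)
    then show ?case using prod ac idl(1)[OF ideal_J] by (simp add: A.m_assoc)
  next
    case (sum s t) then show ?case using ac idl(3)[OF ideal_Jp] by (simp add: A.r_distr del: ideal_power.simps)
  qed
  then show ?thesis ..
qed

definition S where "S = \<Phi> ` carrier T"

lemma S_add: "a \<in> S ==> b \<in> S ==> a \<oplus> b \<in> S"
proof -
  assume "a \<in> S" "b \<in> S"
  then obtain x y where xy: "x \<in> carrier T" "a = \<Phi> x" "y \<in> carrier T" "b = \<Phi> y" unfolding S_def by blast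
  then have "\<Phi> (x \<oplus>\<^sub>T y) = a \<oplus> b" by (simp only: Phi_add)
  then show ?thesis unfolding S_def using T.a_closed[OF xy(1,3)] by (metis imageI)
qed

lemma S_mult: "a \<in> S ==> b \<in> S ==> a \<otimes> b \<in> S"
proof -
  assume "a \<in> S" "b \<in> S"
  then obtain x y where xy: "x \<in> carrier T" "a = \<Phi> x" "y \<in> carrier T" "b = \<Phi> y" unfolding S_def by blast
  then have "\<Phi> (x \<otimes>\<^sub>T y) = a \<otimes> b" by (simp only: Phi_mult)
  then show ?thesis unfolding S_def using T.m_closed[OF xy(1,3)] by (metis imageI)
qed

lemma S_carrier: "a \<in> S ==> a \<in> carrier A"
  unfolding S_def by auto

lemma tau_S: "x \<in> carrier M ==> \<tau> x \<in> S"
proof -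
  assume x: "x \<in> carrier M"
  then have "\<Phi> (omT [x]) = \<tau> x" "omT [x] \<in> carrier T" using Phi_omT[of "[x]"] omT_closed[of "[x]"] by simp_all
  then show ?thesis unfolding S_def by (metis imageI)
qed

lemma sigma_S: "r \<in> carrier R ==> \<sigma> r \<in> S"
  unfolding S_def using Phi_rho[of r] rho_closed[of r] by (metis imageI)

text \<open>The associated graded ring of the powers of \<open>J\<close> is generated by degrees 0
  and 1. A product \<open>i j\<close> is approximated by the product of approximations,
  \<open>s\<close> for \<open>i\<close> and \<open>\<tau> x\<close> for \<open>j\<close>; keeping
  \<open>s\<close> in the same power of \<open>J\<close> is what makes the error small.\<close>

lemma step: "a \<in> Jp (Suc k) ==> \<exists>s\<in>S \<inter> Jp (Suc k). a \<ominus> s \<in> Jp (Suc (Suc k))"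
proof (induction k arbitrary: a)
  case 0
  then have "a \<in> J" using Jp1 by simp
  then obtain x where "x \<in> carrier M" "a \<ominus> \<tau> x \<in> J2" using tau_gen by blast
  then show ?case using tau_S tau_J Jp1 by (intro bexI[of _ "\<tau> x"]) auto
next
  case (Suc k)
  from Suc.prems have "a \<in> ideal_prod A (Jp (Suc k)) J" by simp
  then have "a \<in> carrier A \<and> (\<exists>s\<in>S \<inter> Jp (Suc (Suc k)). a \<ominus> s \<in> Jp (Suc (Suc (Suc k))))"
  proof (induction rule: ideal_prod.induct)
    case (prod i j)
    obtain s where s: "s \<in> S" "s \<in> Jp (Suc k)" "i \<ominus> s \<in> Jp (Suc (Suc k))" using Suc.IH[OF prod(1)] by blast
    obtain x where x: "x \<in> carrier M" "j \<ominus> \<tau> x \<in> J2" using tau_gen[OF prod(2)] by blast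
    have c: "s \<in> carrier A" "i \<in> carrier A" "j \<in> carrier A" "\<tau> x \<in> carrier A"
      using s prod x S_carrier idl(1)[OF ideal_Jp] idl(1)[OF ideal_J] by (auto simp del: ideal_power.simps)
    \<comment> \<open>The first summand has higher order because \<open>i - s\<close> does, the
      second because \<open>j - \<tau> x\<close> lies in the square of \<open>J\<close>.\<close>
    have "i \<otimes> j \<ominus> s \<otimes> \<tau> x = (i \<ominus> s) \<otimes> j \<oplus> s \<otimes> (j \<ominus> \<tau> x)"
      using c by algebra
    moreover have "(i \<ominus> s) \<otimes> j \<in> Jp (Suc (Suc (Suc k)))"
      using ideal_prod.prod[OF s(3) prod(2)] by simp
    moreover have "s \<otimes> (j \<ominus> \<tau> x) \<in> Jp (Suc (Suc (Suc k)))" by (rule Jp_J2[OF s(2) x(2)])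
    ultimately have "i \<otimes> j \<ominus> s \<otimes> \<tau> x \<in> Jp (Suc (Suc (Suc k)))" using idl(3)[OF ideal_Jp] by metis
    moreover have "s \<otimes> \<tau> x \<in> Jp (Suc (Suc k))" using ideal_prod.prod[OF s(2) tau_J[OF x(1)]] by simp
    ultimately show ?case using S_mult[OF s(1) tau_S[OF x(1)]] c by blast
  next
    case (sum a b)
    then obtain s s' where s: "s \<in> S \<inter> Jp (Suc (Suc k))" "a \<ominus> s \<in> Jp (Suc (Suc (Suc k)))"
       "s' \<in> S \<inter> Jp (Suc (Suc k))" "b \<ominus> s' \<in> Jp (Suc (Suc (Suc k)))" by blast
    have c: "s \<in> carrier A" "s' \<in> carrier A" "a \<in> carrier A" "b \<in> carrier A" using s S_carrier sum by auto
    have "(a \<oplus> b) \<ominus> (s \<oplus> s') = (a \<ominus> s) \<oplus> (b \<ominus> s')" using c by algebra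
    then have "(a \<oplus> b) \<ominus> (s \<oplus> s') \<in> Jp (Suc (Suc (Suc k)))" using idl(3)[OF ideal_Jp s(2) s(4)] by simp
    moreover have "s \<oplus> s' \<in> S \<inter> Jp (Suc (Suc k))" using S_add idl(3)[OF ideal_Jp] s by blast
    ultimately show ?case using c by blast
  qed
  then show ?case ..
qed

lemma approx: "a \<in> carrier A ==> \<exists>s\<in>S. a \<ominus> s \<in> Jp (Suc k)"
proof (induction k)
  case 0
  then show ?case using sigma_gen[OF 0] sigma_S Jp1 by auto
next
  case (Suc k)
  obtain s where s: "s \<in> S" "a \<ominus> s \<in> Jp (Suc k)" using Suc by blast
  obtain s' where s': "s' \<in> S" "(a \<ominus> s) \<ominus> s' \<in> Jp (Suc (Suc k))" using step[OF s(2)] by blast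
  have c: "s \<in> carrier A" "s' \<in> carrier A" using s s' S_carrier by auto
  have "(a \<ominus> s) \<ominus> s' = a \<ominus> (s \<oplus> s')" using c Suc.prems by algebra
  then show ?case using s' S_add[OF s(1) s'(1)] by metis
qed

lemma Jp_zero: "Jp (t0 + k) \<subseteq> {\<zero>}"
proof (induction k)
  case 0 then show ?case using nilp by simp
next
  case (Suc k)
  have "a = \<zero>" if "a \<in> ideal_prod A (Jp (t0 + k)) J" for a
    using that
  proof (induction rule: ideal_prod.induct)
    case (prod i j)
    then have "i = \<zero>" "j \<in> carrier A" using Suc idl(1)[OF ideal_J] by auto
    then show ?case by simp
  qed simp
  then show ?case by auto
qed

lemma Phi_surj: "\<Phi> ` carrier T = carrier A"
proof
  show "carrier A \<subseteq> \<Phi> ` carrier T"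
  proof
    fix a assume a: "a \<in> carrier A"
    \<comment> \<open>Power \<open>t0 + 1\<close> of \<open>J\<close> vanishes, so the approximation
      is exact at this stage.\<close>
    obtain s where s: "s \<in> S" "a \<ominus> s \<in> Jp (Suc t0)" using approx[OF a] by blast
    then have "a \<ominus> s = \<zero>" using Jp_zero[of 1] by auto
    then have "a = s" using a S_carrier[OF s(1)] by simp
    then show "a \<in> \<Phi> ` carrier T" using s by (simp add: S_def)
  qed
qed auto

lemma carrier_TI: "x \<in> TI \<longleftrightarrow> x \<in> carrier T \<and> fst x = \<zero>\<^bsub>R\<^esub>"
  by (cases x) (auto simp: tensor_pos_ideal_def carrier_T)

lemma wval_J: "set w \<subseteq> carrier M ==> w \<noteq> [] ==> wval w \<in> J"
  by (cases w) (auto intro!: idl(6)[OF ideal_J] tau_J)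

lemma pos_induct [consumes 2, case_names zero add om]:
  assumes "x \<in> carrier T" "fst x = \<zero>\<^bsub>R\<^esub>" and zero: "Q \<zero>\<^bsub>T\<^esub>"
    and add: "\<And>x y. [| x \<in> TI; y \<in> TI; Q x; Q y |] ==> Q (x \<oplus>\<^sub>T y)"
    and om: "\<And>w. [| set w \<subseteq> carrier M; w \<noteq> [] |] ==> Q (omT w)"
  shows "Q x"
proof -
  \<comment> \<open>The general induction is applied to the projection that drops the degree 0
    component; it kills \<open>rho r\<close> and leaves pure tensors of positive length
    unchanged.\<close>
  define pp where "pp x = (\<zero>\<^bsub>R\<^esub>, snd x)" for x :: "'r \<times> (nat => ('m list \<Rightarrow>\<^sub>0 int) set)"
  have pc: "pp x \<in> TI" if "x \<in> carrier T" for x using that by (auto simp: carrier_TI pp_def carrier_T)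
  have "Q (pp x)"
    using assms(1)
  proof (induction rule: T_induct)
    case zero then show ?case using assms(3) by (simp add: pp_def zero_T)
  next
    case (add x y)
    have "pp (x \<oplus>\<^sub>T y) = pp x \<oplus>\<^sub>T pp y" by (simp add: pp_def add_T)
    then show ?case using assms(4)[OF pc pc] add by simp
  next
    case (rho r) then show ?case using assms(3) by (simp add: pp_def rho_def zero_T)
  next
    case (om w) then show ?case using assms(5)[of w] by (simp add: pp_def single_def)
  qed
  moreover have "pp x = x" using assms(2) by (simp add: pp_def prod_eq_iff)
  ultimately show ?thesis by simp
qed

lemma Phi_TI: "x \<in> TI ==> \<Phi> x \<in> J"
proof -
  assume "x \<in> TI"
  then have "x \<in> carrier T" "fst x = \<zero>\<^bsub>R\<^esub>" by (auto simp: carrier_TI)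
  then show ?thesis
    by (induction rule: pos_induct) (auto simp: Phi_zero Phi_add Phi_omT wval_J carrier_TI intro!: idl(3)[OF ideal_J] idl(2)[OF ideal_J])
qed

lemma Phi_Tp: "x \<in> Tp k ==> x \<in> carrier T \<and> \<Phi> x \<in> Jp k"
proof (induction k arbitrary: x)
  case 0 then show ?case by simp
next
  case (Suc k)
  then have "x \<in> ideal_prod T (Tp k) TI" by simp
  then show ?case
  proof (induction rule: ideal_prod.induct)
    case (prod i j)
    then show ?case using Suc.IH[OF prod(1)] Phi_TI[OF prod(2)]
      by (auto simp: carrier_TI Phi_mult intro: ideal_prod.prod)
  next
    case (sum a b) then show ?case using idl(3)[OF ideal_Jp] by (simp add: Phi_add del: ideal_power.simps)
  qed
qed

lemma single_om_TI2:
  assumes "set w \<subseteq> carrier M" "2 \<le> length w" shows "omT w \<in> Tp 2"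
proof -
  obtain x v where w: "w = [x] @ v" "v \<noteq> []" using assms by (cases w; cases "tl w") auto
  have "omT [x] \<in> TI" "omT v \<in> TI" using assms w omT_closed[of "[x]"] omT_closed[of v] by (auto simp: carrier_TI)
  moreover have "omT w = omT [x] \<otimes>\<^sub>T omT v" using assms w by (subst omT_omT) auto
  \<comment> \<open>The zeroth power of an ideal is the whole ring, so the square unfolds to
    \<open>(T TI) TI\<close>; a leading factor 1 fills the first place.\<close>
  moreover have "omT [x] = \<one>\<^bsub>T\<^esub> \<otimes>\<^sub>T omT [x]" using \<open>omT [x] \<in> TI\<close> by (simp add: carrier_TI)
  ultimately show ?thesis
    by (auto simp: numeral_2_eq_2 intro!: ideal_prod.prod) (metis T.one_closed ideal_prod.prod)
qed

lemma zero_Tp2: "\<zero>\<^bsub>T\<^esub> \<in> Tp 2"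
proof -
  have z: "\<zero>\<^bsub>T\<^esub> \<in> TI" by (simp add: carrier_TI zero_T[symmetric]) (simp add: zero_T)
  then have "(\<one>\<^bsub>T\<^esub> \<otimes>\<^sub>T \<zero>\<^bsub>T\<^esub>) \<otimes>\<^sub>T \<zero>\<^bsub>T\<^esub> \<in> Tp 2"
    unfolding numeral_2_eq_2 ideal_power.simps by (intro ideal_prod.prod) auto
  then show ?thesis by simp
qed

text \<open>Modulo the square of the positive part only words of length one survive, and a sum of
  such words is again a single letter by additivity.\<close>

lemma TI_split:
  assumes "x \<in> TI" shows "\<exists>m\<in>carrier M. \<exists>y\<in>Tp 2. x = omT [m] \<oplus>\<^sub>T y"
proof -
  have xc: "x \<in> carrier T" "fst x = \<zero>\<^bsub>R\<^esub>" using assms by (auto simp: carrier_TI)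
  have o0: "omT [\<zero>\<^bsub>M\<^esub>] = \<zero>\<^bsub>T\<^esub>" using om_zero[of "[]"] single_one[of 1] by simp
  have cl: "y \<in> Tp 2 ==> y \<in> carrier T" for y using Phi_Tp by blast
  from xc show ?thesis
  proof (induction rule: pos_induct)
    case zero then show ?case using zero_Tp2 o0 by (intro bexI[of _ "\<zero>\<^bsub>M\<^esub>"] bexI[of _ "\<zero>\<^bsub>T\<^esub>"]) auto
  next
    case (add x x')
    then obtain m y m' y' where *: "m \<in> carrier M" "y \<in> Tp 2" "x = omT [m] \<oplus>\<^sub>T y"
      "m' \<in> carrier M" "y' \<in> Tp 2" "x' = omT [m'] \<oplus>\<^sub>T y'" by blast
    have "x \<oplus>\<^sub>T x' = (omT [m] \<oplus>\<^sub>T omT [m']) \<oplus>\<^sub>T (y \<oplus>\<^sub>T y')"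
      using * cl omT_closed[of "[m]"] omT_closed[of "[m']"] by (simp add: T.a_ac)
    also have "omT [m] \<oplus>\<^sub>T omT [m'] = omT [m \<oplus>\<^bsub>M\<^esub> m']" using omT_add[of "[]" "[]" m m'] * by simp
    finally show ?case using * ideal_prod.sum[of y T "Tp 1" TI y'] by (auto simp: numeral_2_eq_2)
  next
    case (om w)
    show ?case
    proof (cases "length w = 1")
      case True
      then obtain m where "w = [m]" by (auto simp: length_Suc_conv)
      then show ?thesis using om zero_Tp2 omT_closed[of "[m]"] by (intro bexI[of _ m] bexI[of _ "\<zero>\<^bsub>T\<^esub>"]) auto
    next
      case False
      then have "2 \<le> length w" using om length_0_conv[of w] by linarith
      then show ?thesis using single_om_TI2[of w] om o0 omT_closed[of w]
        by (intro bexI[of _ "\<zero>\<^bsub>M\<^esub>"] bexI[of _ "omT w"]) auto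
    qed
  qed
qed

lemma Jp2: "Jp 2 = J2" using Jp1 by (simp add: numeral_2_eq_2)

lemma ker_TI: assumes "x \<in> ker" shows "x \<in> TI"
proof -
  have x: "x \<in> carrier T" "\<Phi> x = \<zero>" using assms by (auto simp: ker_def)
  define y where "y = (\<zero>\<^bsub>R\<^esub>, snd x)"
  have y: "y \<in> carrier T" "y \<in> TI" using x by (auto simp: y_def carrier_T carrier_TI)
  have "x = rho (fst x) \<oplus>\<^sub>T y"
    using x T_snd T_fst by (intro T_ext) (auto simp: y, auto simp: y_def)
  \<comment> \<open>The positive part of a kernel element is mapped into \<open>J\<close>, so the
    degree 0 component is mapped into \<open>J\<close> as well, and \<open>sigma_J\<close> makes it
    vanish.\<close>
  then have "\<sigma> (fst x) \<oplus> \<Phi> y = \<zero>"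
    using x Phi_add[OF rho_closed[OF T_fst[OF x(1)]] y(1)] Phi_rho[OF T_fst[OF x(1)]] by simp
  then have "\<sigma> (fst x) = \<ominus> \<Phi> y" using y x T_fst by (simp add: A.minus_equality)
  then have "\<sigma> (fst x) = \<zero> \<ominus> \<Phi> y" using y by (simp add: A.minus_eq)
  then have "\<sigma> (fst x) \<in> J" using idl(4)[OF ideal_J idl(2)[OF ideal_J] Phi_TI[OF y(2)]] by metis
  then have "fst x = \<zero>\<^bsub>R\<^esub>" using sigma_J T_fst[OF x(1)] by blast
  then show ?thesis using x by (simp add: carrier_TI)
qed

lemma ker_Tp2: "ker \<subseteq> Tp 2"
proof
  fix x assume k: "x \<in> ker"
  then have x: "x \<in> carrier T" "\<Phi> x = \<zero>" by (auto simp: ker_def)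
  obtain m y where my: "m \<in> carrier M" "y \<in> Tp 2" "x = omT [m] \<oplus>\<^sub>T y" using TI_split[OF ker_TI[OF k]] by blast
  have y: "y \<in> carrier T" "\<Phi> y \<in> J2" using Phi_Tp[OF my(2)] Jp2 by auto
  \<comment> \<open>The same comparison one power higher: the linear part \<open>m\<close> has its
    image in the square of \<open>J\<close>, hence is zero by \<open>tau_J2\<close>.\<close>
  have "\<tau> m \<oplus> \<Phi> y = \<zero>"
    using x my y omT_closed[of "[m]"] Phi_omT[of "[m]"] Phi_add[of "omT [m]" y] by simp
  then have "\<tau> m = \<ominus> \<Phi> y" using y my by (simp add: A.minus_equality)
  then have "\<tau> m = \<zero> \<ominus> \<Phi> y" using y by (simp add: A.minus_eq)
  then have "\<tau> m \<in> J2" using idl(4)[OF ideal_J2 idl(2)[OF ideal_J2] y(2)] by metis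
  then have "m = \<zero>\<^bsub>M\<^esub>" using tau_J2 my by blast
  then have "omT [m] = \<zero>\<^bsub>T\<^esub>" using om_zero[of "[]"] single_one[of 1] by simp
  then show "x \<in> Tp 2" using my y by simp
qed

lemma admissible_ker: "admissible R M ker"
  unfolding admissible_def
\<comment> \<open>The summand 2 guarantees that the exponent is at least 2 whatever
  \<open>t0\<close> is; power \<open>t0 + 2\<close> of \<open>J\<close> vanishes along with power
  \<open>t0\<close>.\<close>
proof (intro conjI graded_ideal_ker ker_Tp2 exI[of _ "t0 + 2"])
  show "Tp (t0 + 2) \<subseteq> ker" using Phi_Tp[of _ "t0 + 2"] Jp_zero[of 2] unfolding ker_def by blast
qed simp

lemma graded_isomorphic_presentation: "graded_isomorphic K A (gquot T ker)"
  by (rule graded_isomorphic_quotient[OF Phi_surj])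

end

section \<open>Generators of the bimodule and expansions of tensors along them\<close>

locale generated_presentation = presentation K R M A \<sigma> \<tau> J t0
  for K :: "('k, 'w) ring_scheme" and R :: "('k, 'r, 'x) gmodule_scheme" and M :: "('r, 'r, 'm, 'y) gbimodule_scheme"
    and A :: "('k, 'a, 'z) gmodule_scheme" (structure) and \<sigma> :: "'r => 'a" and \<tau> :: "'m => 'a" and J :: "'a set" and t0 :: nat +
  fixes Bs :: "'b set" and m :: "'b => 'm" and e :: "'b => 'r"
  assumes finite_Bs: "finite Bs" and m_closed: "b \<in> Bs ==> m b \<in> carrier M" and e_closed: "b \<in> Bs ==> e b \<in> carrier R"
    and e_idem: "b \<in> Bs ==> e b \<otimes>\<^bsub>R\<^esub> e b = e b" and e_m: "b \<in> Bs ==> e b \<odot>\<^bsub>M\<^esub> m b = m b"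
    and span: "x \<in> carrier M ==> \<exists>r\<in>Bs \<rightarrow> carrier R. x = finsum M (\<lambda>b. r b \<odot>\<^bsub>M\<^esub> m b) Bs"
begin

lemma omT_finsum:
  "finite C ==> x \<in> C \<rightarrow> carrier M ==> omT [finsum M x C] = finsum T (\<lambda>b. omT [x b]) C"
proof (induction C rule: finite_induct)
  case empty
  have "omT [\<zero>\<^bsub>M\<^esub>] = \<zero>\<^bsub>T\<^esub>" using om_zero[of "[]"] single_one[of 1] by simp
  then show ?case by simp
next
  case (insert i C)
  have c: "x \<in> C \<rightarrow> carrier M" "x i \<in> carrier M" using insert.prems by auto
  have o: "omT [y] \<in> carrier T" if "y \<in> carrier M" for y using omT_closed[of "[y]"] that by simp
  have "finsum M x (insert i C) = x i \<oplus>\<^bsub>M\<^esub> finsum M x C" using insert.hyps c by simp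
  then have "omT [finsum M x (insert i C)] = omT [x i] \<oplus>\<^sub>T omT [finsum M x C]"
    using omT_add[of "[]" "[]" "x i" "finsum M x C"] c M.finsum_closed[OF c(1)] by simp
  also have "\<dots> = omT [x i] \<oplus>\<^sub>T finsum T (\<lambda>b. omT [x b]) C" using insert.IH[OF c(1)] by simp
  also have "\<dots> = finsum T (\<lambda>b. omT [x b]) (insert i C)"
    using insert.hyps c o by (intro T.finsum_insert[symmetric]) auto
  finally show ?case .
qed

text \<open>Coefficients are normalised by the idempotents: \<open>e b\<close> fixes
  \<open>m b\<close> from the left, so a coefficient matters only through its product with
  \<open>rho (e b)\<close>. Without the normalisation even independent generators would in general
  admit several expansions.\<close>

definition expansion :: "'r \<times> (nat => ('m list \<Rightarrow>\<^sub>0 int) set) => ('b => 'r \<times> (nat => ('m list \<Rightarrow>\<^sub>0 int) set)) => bool" where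
  "expansion z t \<longleftrightarrow> (\<forall>b\<in>Bs. t b \<in> carrier T \<and> t b \<otimes>\<^sub>T rho (e b) = t b) \<and> z = finsum T (\<lambda>b. t b \<otimes>\<^sub>T omT [m b]) Bs"

lemma omT_m: "b \<in> Bs ==> omT [m b] \<in> carrier T"
  using omT_closed[of "[m b]"] m_closed by simp

lemma expansion_mult:
  assumes y: "y \<in> carrier T" and x: "x \<in> carrier M" shows "\<exists>t. expansion (y \<otimes>\<^sub>T omT [x]) t"
proof -
  obtain r where r: "r \<in> Bs \<rightarrow> carrier R" "x = finsum M (\<lambda>b. r b \<odot>\<^bsub>M\<^esub> m b) Bs" using span[OF x] by blast
  have rc: "b \<in> Bs ==> r b \<in> carrier R" for b using r by blast
  \<comment> \<open>The factor \<open>rho (e b)\<close> normalises the coefficient and changes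
    nothing in the sum, because \<open>e b\<close> fixes \<open>m b\<close>.\<close>
  define t where "t b = y \<otimes>\<^sub>T (rho (r b) \<otimes>\<^sub>T rho (e b))" for b
  have w1: "rho c \<otimes>\<^sub>T omT [z] = omT [c \<odot>\<^bsub>M\<^esub> z]" if "c \<in> carrier R" "z \<in> carrier M" for c z
    using rho_omT[of c "[z]"] that by simp
  have "omT [x] = finsum T (\<lambda>b. omT [r b \<odot>\<^bsub>M\<^esub> m b]) Bs"
    unfolding r(2) by (rule omT_finsum[OF finite_Bs]) (use rc m_closed in auto)
  also have "\<dots> = finsum T (\<lambda>b. rho (r b) \<otimes>\<^sub>T omT [m b]) Bs"
    by (rule T.finsum_cong') (use w1 rc m_closed omT_m in auto)
  finally have "y \<otimes>\<^sub>T omT [x] = y \<otimes>\<^sub>T finsum T (\<lambda>b. rho (r b) \<otimes>\<^sub>T omT [m b]) Bs" by simp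
  also have "\<dots> = finsum T (\<lambda>b. y \<otimes>\<^sub>T (rho (r b) \<otimes>\<^sub>T omT [m b])) Bs"
    by (rule T.finsum_rdistr[OF finite_Bs y]) (use rc omT_m in auto)
  also have "\<dots> = finsum T (\<lambda>b. t b \<otimes>\<^sub>T omT [m b]) Bs"
  proof (rule T.finsum_cong')
    fix b assume b: "b \<in> Bs"
    have "rho (e b) \<otimes>\<^sub>T omT [m b] = omT [m b]" using w1[OF e_closed[OF b] m_closed[OF b]] e_m[OF b] by simp
    then show "y \<otimes>\<^sub>T (rho (r b) \<otimes>\<^sub>T omT [m b]) = t b \<otimes>\<^sub>T omT [m b]"
      using y rc[OF b] e_closed[OF b] omT_m[OF b] by (simp add: t_def T.m_assoc)
  qed (use y rc e_closed omT_m in \<open>auto simp: t_def\<close>)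
  finally have "y \<otimes>\<^sub>T omT [x] = finsum T (\<lambda>b. t b \<otimes>\<^sub>T omT [m b]) Bs" .
  moreover have "t b \<otimes>\<^sub>T rho (e b) = t b" if b: "b \<in> Bs" for b
    using y rc[OF b] e_closed[OF b] e_idem[OF b] by (simp add: t_def T.m_assoc rho_rho R.m_assoc)
  moreover have "t b \<in> carrier T" if "b \<in> Bs" for b using y rc[OF that] e_closed[OF that] by (simp add: t_def)
  ultimately have "expansion (y \<otimes>\<^sub>T omT [x]) t" unfolding expansion_def by blast
  then show ?thesis by blast
qed

lemma expansion_exists: assumes "x \<in> TI" shows "\<exists>t. expansion x t"
proof -
  have x: "x \<in> carrier T" "fst x = \<zero>\<^bsub>R\<^esub>" using assms by (auto simp: carrier_TI)
  then show ?thesis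
  proof (induction rule: pos_induct)
    case zero
    have "finsum T (\<lambda>b. \<zero>\<^bsub>T\<^esub> \<otimes>\<^sub>T omT [m b]) Bs = finsum T (\<lambda>b. \<zero>\<^bsub>T\<^esub>) Bs"
      by (rule T.finsum_cong') (use omT_m in auto)
    then have "expansion \<zero>\<^bsub>T\<^esub> (\<lambda>_. \<zero>\<^bsub>T\<^esub>)" unfolding expansion_def using e_closed by simp
    then show ?case by blast
  next
    case (add x y)
    then obtain t t' where t: "expansion x t" and t': "expansion y t'" by blast
    have tc: "t b \<in> carrier T" "t' b \<in> carrier T" "t b \<otimes>\<^sub>T rho (e b) = t b" "t' b \<otimes>\<^sub>T rho (e b) = t' b" if "b \<in> Bs" for b
      using t t' that by (auto simp: expansion_def)
    have "x \<oplus>\<^sub>T y = finsum T (\<lambda>b. t b \<otimes>\<^sub>T omT [m b] \<oplus>\<^sub>T t' b \<otimes>\<^sub>T omT [m b]) Bs"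
      using t t' tc omT_m unfolding expansion_def by (simp add: T.finsum_addf Pi_iff)
    also have "\<dots> = finsum T (\<lambda>b. (t b \<oplus>\<^sub>T t' b) \<otimes>\<^sub>T omT [m b]) Bs"
      by (rule T.finsum_cong') (use tc omT_m in \<open>auto simp: T.l_distr\<close>)
    finally have "expansion (x \<oplus>\<^sub>T y) (\<lambda>b. t b \<oplus>\<^sub>T t' b)" unfolding expansion_def using tc e_closed by (simp add: T.l_distr)
    then show ?case by blast
  next
    case (om w)
    \<comment> \<open>The last letter is split off, since expansions carry the generator on the
      right.\<close>
    define w' x where "w' = butlast w" and "x = last w"
    have wx: "w = w' @ [x]" "set w' \<subseteq> carrier M" "x \<in> carrier M"
      using om by (auto simp: w'_def x_def dest: in_set_butlastD)
    have xT: "omT [x] \<in> carrier T" using omT_closed[of "[x]"] wx by simp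
    show ?case
    proof (cases "w' = []")
      case True
      then have "omT w = \<one>\<^bsub>T\<^esub> \<otimes>\<^sub>T omT [x]" using wx xT by simp
      then show ?thesis using expansion_mult[OF T.one_closed wx(3)] by simp
    next
      case False
      have "omT w = omT w' \<otimes>\<^sub>T omT [x]" using omT_omT[OF wx(2) False, of "[x]"] wx by simp
      then show ?thesis using expansion_mult[OF omT_closed[OF wx(2) False] wx(3)] by simp
    qed
  qed
qed

lemma Phi_finsum: "finite C ==> x \<in> C \<rightarrow> carrier T ==> \<Phi> (finsum T x C) = finsum A (\<lambda>b. \<Phi> (x b)) C"
proof (induction C rule: finite_induct)
  case (insert i C)
  then have c: "x \<in> C \<rightarrow> carrier T" "x i \<in> carrier T" by auto
  then have "(\<lambda>b. \<Phi> (x b)) \<in> C \<rightarrow> carrier A" by (auto intro: Phi_closed)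
  then show ?case using insert.hyps insert.IH[OF c(1)] c T.finsum_closed[OF c(1)] by (simp add: Phi_add)
qed (simp add: Phi_zero)

lemma Phi_expansion:
  assumes "expansion z t"
  shows "\<Phi> z = finsum A (\<lambda>b. \<Phi> (t b) \<otimes> \<tau> (m b)) Bs" "b \<in> Bs ==> \<Phi> (t b) \<otimes> \<sigma> (e b) = \<Phi> (t b)"
proof -
  have tc: "t b \<in> carrier T" "t b \<otimes>\<^sub>T rho (e b) = t b" if "b \<in> Bs" for b
    using assms that by (auto simp: expansion_def)
  have o: "\<Phi> (omT [m b]) = \<tau> (m b)" if "b \<in> Bs" for b
    using Phi_omT[of "[m b]"] m_closed[OF that] tau_closed[OF m_closed[OF that]] by simp
  have "\<Phi> z = finsum A (\<lambda>b. \<Phi> (t b \<otimes>\<^sub>T omT [m b])) Bs"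
    using assms tc omT_m by (simp add: expansion_def Phi_finsum[OF finite_Bs] Pi_iff)
  also have "\<dots> = finsum A (\<lambda>b. \<Phi> (t b) \<otimes> \<tau> (m b)) Bs"
    by (rule A.finsum_cong') (use tc o omT_m m_closed in \<open>auto simp: Phi_mult intro!: Phi_closed tau_closed\<close>)
  finally show "\<Phi> z = finsum A (\<lambda>b. \<Phi> (t b) \<otimes> \<tau> (m b)) Bs" .
  show "b \<in> Bs ==> \<Phi> (t b) \<otimes> \<sigma> (e b) = \<Phi> (t b)"
    using Phi_mult[OF tc(1) rho_closed[OF e_closed], of b b] tc(2) Phi_rho[OF e_closed] by simp
qed

text \<open>Surjectivity of \<open>\<Phi>\<close> provides a preimage, \<open>sigma_J\<close> forces
  its degree 0 component to vanish, and the expansion of the remaining positive element is mapped to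
  \<open>A\<close>.\<close>

lemma J_generated:
  assumes y: "y \<in> J"
  shows "\<exists>a. (\<forall>b\<in>Bs. a b \<in> carrier A \<and> a b \<otimes> \<sigma> (e b) = a b) \<and> y = finsum A (\<lambda>b. a b \<otimes> \<tau> (m b)) Bs"
proof -
  obtain z where z: "z \<in> carrier T" "\<Phi> z = y" using Phi_surj idl(1)[OF ideal_J y] by (metis imageE)
  define x where "x = (\<zero>\<^bsub>R\<^esub>, snd z)"
  have x: "x \<in> carrier T" "x \<in> TI" using z by (auto simp: x_def carrier_T carrier_TI)
  have "z = rho (fst z) \<oplus>\<^sub>T x" using z T_snd T_fst by (intro T_ext) (auto simp: x, auto simp: x_def)
  then have "y = \<sigma> (fst z) \<oplus> \<Phi> x"
    using z Phi_add[OF rho_closed[OF T_fst[OF z(1)]] x(1)] Phi_rho[OF T_fst[OF z(1)]] by simp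
  then have "\<sigma> (fst z) = y \<ominus> \<Phi> x"
    using sigma_closed[OF T_fst[OF z(1)]] Phi_closed[OF x(1)] by (simp add: A.minus_eq A.a_assoc A.r_neg)
  then have "\<sigma> (fst z) \<in> J" using idl(4)[OF ideal_J y Phi_TI[OF x(2)]] by simp
  then have "z \<in> TI" using sigma_J[OF T_fst[OF z(1)]] z by (simp add: carrier_TI)
  then obtain t where t: "expansion z t" using expansion_exists by blast
  have "t b \<in> carrier T" if "b \<in> Bs" for b using t that by (auto simp: expansion_def)
  then show ?thesis using Phi_expansion[OF t] z(2) by (intro exI[of _ "\<lambda>b. \<Phi> (t b)"]) (auto intro!: Phi_closed)
qed

text \<open>The filtration of the positive part by order of vanishing. The kernel argument climbs
  along it: an element lying in every step has no components.\<close>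

definition below :: "nat => ('r \<times> (nat => ('m list \<Rightarrow>\<^sub>0 int) set)) set" where
  "below k = {x \<in> TI. \<forall>i. 1 \<le> i \<and> i \<le> k \<longrightarrow> snd x i = \<one>\<^bsub>P i\<^esub>}"

lemma below_mult:
  assumes x: "x \<in> below k" and y: "y \<in> carrier M" shows "x \<otimes>\<^sub>T omT [y] \<in> below (Suc k)"
proof -
  have xT: "x \<in> carrier T" "fst x = \<zero>\<^bsub>R\<^esub>" and xk: "\<And>i. 1 \<le> i ==> i \<le> k ==> snd x i = \<one>\<^bsub>P i\<^esub>" using x by (auto simp: below_def carrier_TI)
  have yT: "omT [y] \<in> carrier T" using omT_closed[of "[y]"] y by simp
  have y1: "snd (omT [y]) i = \<one>\<^bsub>P i\<^esub>" if "1 \<le> i" "i \<noteq> 1" for i using that by (simp add: single_def)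
  have "mcomp i x (omT [y]) = \<one>\<^bsub>P i\<^esub>" if i: "1 \<le> i" "i \<le> Suc k" for i
  proof -
    have "finprod (P i) (\<lambda>l. tm l (i - l) (snd x l) (snd (omT [y]) (i - l))) {1..<i} = \<one>\<^bsub>P i\<^esub>"
    proof (rule finprod_all_one)
      fix l assume l: "l \<in> {1..<i}"
      show "tm l (i - l) (snd x l) (snd (omT [y]) (i - l)) = \<one>\<^bsub>P i\<^esub>"
      \<comment> \<open>The right factor lives in degree 1, so degree \<open>i\<close> of the
        product sees only degree \<open>i - 1\<close> of \<open>x\<close>, which vanishes as long as
        \<open>i\<close> is at most \<open>k + 1\<close>.\<close>
      proof (cases "i - l = 1")
        case True
        then have "snd x l = \<one>\<^bsub>P l\<^esub>" using l i by (intro xk) auto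
        moreover have "snd (omT [y]) (i - l) \<in> carrier (P (i - l))" using l by (intro T_snd[OF yT]) auto
        moreover have "l < i" using l by simp
        ultimately show ?thesis by (simp only: tm_1_l')
      next
        case False
        then have "snd (omT [y]) (i - l) = \<one>\<^bsub>P (i - l)\<^esub>" using l by (intro y1) auto
        moreover have "snd x l \<in> carrier (P l)" using l by (intro T_snd[OF xT(1)]) auto
        ultimately show ?thesis using tm_1_r'[of "snd x l" l i] l by simp
      qed
    qed
    moreover have "la i (fst x) (snd (omT [y]) i) = \<one>\<^bsub>P i\<^esub>" using xT(2) la_0[OF i(1) T_snd[OF yT i(1)]] by simp
    moreover have "ra i (snd x i) (fst (omT [y])) = \<one>\<^bsub>P i\<^esub>" using ra_0[OF i(1) T_snd[OF xT(1) i(1)]] by simp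
    ultimately show ?thesis unfolding mcomp_def by simp
  qed
  then show ?thesis using xT yT T.m_closed[OF xT(1) yT] by (simp add: below_def carrier_TI snd_mult)
qed

lemma below_finsum: "finite C ==> (\<And>b. b \<in> C ==> x b \<in> below k) ==> finsum T x C \<in> below k"
proof (induction C rule: finite_induct)
  case empty
  show ?case by (simp add: below_def carrier_TI) (simp add: zero_T)
next
  case (insert i C)
  have c: "x \<in> C \<rightarrow> carrier T" "x i \<in> carrier T" using insert.prems by (auto simp: below_def carrier_TI)
  then show ?case using insert by (simp add: below_def carrier_TI)
qed

text \<open>If the \<open>\<tau> (m b)\<close> are independent over \<open>A\<close>, every coefficient of the expansion of an element of the kernel is again
  in the kernel, so that the lowest component of the element cannot have any degree.\<close>

lemma ker_trivial:
  assumes indep: "\<And>a. [| \<And>b. b \<in> Bs ==> a b \<in> carrier A \<and> a b \<otimes> \<sigma> (e b) = a b;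
      finsum A (\<lambda>b. a b \<otimes> \<tau> (m b)) Bs = \<zero> |] ==> \<forall>b\<in>Bs. a b = \<zero>"
  shows "ker \<subseteq> {\<zero>\<^bsub>T\<^esub>}"
proof
  have low: "\<forall>x\<in>ker. x \<in> below k" for k
  proof (induction k)
    case 0 show ?case using ker_TI by (auto simp: below_def)
  next
    case (Suc k)
    show ?case
    proof
      fix x assume x: "x \<in> ker"
      obtain t where t: "expansion x t" using expansion_exists[OF ker_TI[OF x]] by blast
      have tc: "t b \<in> carrier T" if "b \<in> Bs" for b using t that by (auto simp: expansion_def)
      have "\<Phi> x = \<zero>" using x by (simp add: ker_def)
      then have "\<forall>b\<in>Bs. \<Phi> (t b) = \<zero>"
        using Phi_expansion[OF t] tc by (intro indep) (auto intro: Phi_closed)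
      then have "t b \<in> below k" if "b \<in> Bs" for b
        using bspec[OF Suc, of "t b"] tc[OF that] that unfolding ker_def by simp
      then have "finsum T (\<lambda>b. t b \<otimes>\<^sub>T omT [m b]) Bs \<in> below (Suc k)"
        using below_mult m_closed by (intro below_finsum[OF finite_Bs]) blast
      then show "x \<in> below (Suc k)" using t by (simp add: expansion_def)
    qed
  qed
  fix x assume x: "x \<in> ker"
  have xT: "x \<in> carrier T" using x by (simp add: ker_def)
  have "snd x i = \<one>\<^bsub>P i\<^esub>" if "1 \<le> i" for i using low[of i] x that by (simp add: below_def)
  moreover have "fst x = \<zero>\<^bsub>R\<^esub>" using ker_TI[OF x] by (simp add: carrier_TI)
  ultimately have "x = \<zero>\<^bsub>T\<^esub>" by (intro T_ext[OF xT T.zero_closed]) (simp_all add: zero_T one_TP)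
  then show "x \<in> {\<zero>\<^bsub>T\<^esub>}" by simp
qed

end

section \<open>The graded radical\<close>

lemma (in abelian_group) a_rcoset_eq_iff:
  assumes "additive_subgroup H G" "x \<in> carrier G" "y \<in> carrier G"
  shows "H +> x = H +> y \<longleftrightarrow> x \<ominus> y \<in> H"
proof -
  interpret H: abelian_subgroup H G
    by (rule abelian_subgroupI3[OF assms(1) abelian_group_axioms])
  show ?thesis
  proof
    assume "H +> x = H +> y"
    then have "x \<in> H +> y" using H.a_rcos_self[OF assms(2)] by simp
    then obtain h where h: "h \<in> H" "x = h \<oplus> y" unfolding a_r_coset_def' by blast
    then have "x \<ominus> y = h" using assms H.a_Hcarr by (simp add: a_minus_def a_assoc r_neg)
    then show "x \<ominus> y \<in> H" using h by simp
  next
    assume "x \<ominus> y \<in> H"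
    moreover have "x = (x \<ominus> y) \<oplus> y" using assms by (simp add: a_minus_def a_assoc l_neg)
    ultimately have "x \<in> H +> y" unfolding a_r_coset_def' by blast
    then show "H +> x = H +> y" using H.a_repr_independence'[OF _ assms(3)] by simp
  qed
qed

section \<open>Chain conditions, graded left ideals and nilpotency of the radical\<close>

locale fd_salg = salg K A for K :: "('k, 'x) ring_scheme" and A :: "('k, 'a, 'y) gmodule_scheme" (structure) +
  assumes fd: "vs.fin_dim"
begin

definition ksub :: "'a set => bool" where
  "ksub W \<longleftrightarrow> W \<subseteq> carrier A \<and> \<zero> \<in> W \<and> (\<forall>x\<in>W. \<forall>y\<in>W. x \<oplus> y \<in> W) \<and> (\<forall>c\<in>carrier K. \<forall>x\<in>W. c \<odot> x \<in> W)"

lemma ksub_submodule: "ksub W ==> LinearCombinations.submodule K W A"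
  unfolding ksub_def LinearCombinations.submodule_def using vs.module_axioms by auto

text \<open>Dimension measured inside the ambient space, as the largest size of an independent
  subset; thus no subspace has to be made into a vector space of its own.\<close>

definition rk :: "'a set => nat" where
  "rk W = Max (card ` {B. B \<subseteq> W \<and> vs.lin_indpt B})"

lemma rk_finite: "W \<subseteq> carrier A ==> finite (card ` {B. B \<subseteq> W \<and> vs.lin_indpt B})"
  by (rule finite_subset[of _ "{..vs.dim}"]) (use vs.li_le_dim(2)[OF fd] in auto)

lemma lin_indpt_empty: "vs.lin_indpt {}"
  unfolding vs.lin_dep_def by auto

lemma rk_ge: "W \<subseteq> carrier A ==> B \<subseteq> W ==> vs.lin_indpt B ==> card B \<le> rk W"
  unfolding rk_def by (rule Max_ge[OF rk_finite]) auto

lemma rk_attained: "W \<subseteq> carrier A ==> \<exists>B. B \<subseteq> W \<and> vs.lin_indpt B \<and> card B = rk W"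
proof -
  assume W: "W \<subseteq> carrier A"
  have "{} \<in> {B. B \<subseteq> W \<and> vs.lin_indpt B}" using lin_indpt_empty by simp
  then have "card ` {B. B \<subseteq> W \<and> vs.lin_indpt B} \<noteq> {}" by blast
  then have "rk W \<in> card ` {B. B \<subseteq> W \<and> vs.lin_indpt B}" unfolding rk_def by (rule Max_in[OF rk_finite[OF W]])
  then show ?thesis by (auto simp: image_iff)
qed

lemma rk_le_dim: "W \<subseteq> carrier A ==> rk W \<le> vs.dim"
  using rk_attained vs.li_le_dim(2)[OF fd] by (metis subset_trans)

lemma rk_strict:
  assumes "ksub W" "W \<subset> V" "V \<subseteq> carrier A" shows "rk W < rk V"
proof -
  have Wc: "W \<subseteq> carrier A" using assms by (auto simp: ksub_def)
  obtain B where B: "B \<subseteq> W" "vs.lin_indpt B" "card B = rk W" using rk_attained[OF Wc] by blast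
  obtain x where x: "x \<in> V" "x \<notin> W" using assms by blast
  \<comment> \<open>The span of \<open>B\<close> stays inside the subspace \<open>W\<close>, so a
    vector outside \<open>W\<close> enlarges an independent family of maximal size in
    \<open>W\<close>.\<close>
  have "x \<notin> vs.span B" using vs.span_is_subset[OF B(1) ksub_submodule[OF assms(1)]] x by blast
  then have li: "vs.lin_indpt (B \<union> {x})"
    using vs.lin_dep_iff_in_span[of B x] B x assms Wc by blast
  have "finite B" using vs.li_le_dim(1)[OF fd _ B(2)] B Wc by blast
  then have "card (B \<union> {x}) = Suc (rk W)" using x B by (subst Un_commute, simp, subst card_insert_disjoint) auto
  then show ?thesis using rk_ge[OF assms(3) _ li] B x assms by force
qed

text \<open>Ascending chain condition: rank is bounded by the dimension and grows strictly along
  proper inclusions, so a member of largest rank is maximal. \<open>ksub_minimal\<close> is the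
  descending counterpart.\<close>

lemma ksub_maximal:
  assumes "W0 \<in> \<F>" "\<And>W. W \<in> \<F> ==> ksub W"
  shows "\<exists>W\<in>\<F>. \<forall>V\<in>\<F>. W \<subseteq> V \<longrightarrow> V = W"
proof -
  have c: "W \<in> \<F> ==> W \<subseteq> carrier A" for W using assms(2) by (auto simp: ksub_def)
  obtain W where W: "W \<in> \<F>" "\<forall>V. V \<in> \<F> \<longrightarrow> rk V \<le> rk W"
    using ex_has_greatest_nat[of "\<lambda>W. W \<in> \<F>" W0 rk "Suc vs.dim"] assms(1) rk_le_dim c by (metis less_Suc_eq_le)
  then show ?thesis using rk_strict assms(2) c by (metis leD psubsetI)
qed

lemma ksub_minimal:
  assumes "W0 \<in> \<F>" "\<And>W. W \<in> \<F> ==> ksub W"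
  shows "\<exists>W\<in>\<F>. \<forall>V\<in>\<F>. V \<subseteq> W \<longrightarrow> V = W"
proof -
  have c: "W \<in> \<F> ==> W \<subseteq> carrier A" for W using assms(2) by (auto simp: ksub_def)
  obtain W where W: "W \<in> \<F>" "\<forall>V. V \<in> \<F> \<longrightarrow> rk W \<le> rk V"
    using ex_has_least_nat[of "\<lambda>W. W \<in> \<F>" W0 rk] assms(1) by metis
  then show ?thesis using rk_strict assms(2) c by (metis leD psubsetI)
qed

definition glideal :: "'a set => bool" where
  "glideal L \<longleftrightarrow> graded_submodule A (regular_module A) L"

lemma regular_simps [simp]: "carrier (regular_module A) = carrier A" "ring.add (regular_module A) = ring.add A"
  "\<zero>\<^bsub>regular_module A\<^esub> = \<zero>" "smult (regular_module A) = monoid.mult A" "hcomp (regular_module A) = hcomp A"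
  by (simp_all add: regular_module_def)

lemma add_monoid_regular: "subgroup H (add_monoid (regular_module A)) = subgroup H (add_monoid A)"
  by (simp add: subgroup_def m_inv_def)

lemma subgroup_ai: "subgroup H (add_monoid A) \<longleftrightarrow> H \<subseteq> carrier A \<and> \<zero> \<in> H \<and> (\<forall>x\<in>H. \<forall>y\<in>H. x \<oplus> y \<in> H) \<and> (\<forall>x\<in>H. \<ominus> x \<in> H)"
  by (auto simp: subgroup_def a_inv_def)

lemma glidealD:
  assumes "glideal L"
  shows "L \<subseteq> carrier A" "\<zero> \<in> L" "x \<in> L ==> y \<in> L ==> x \<oplus> y \<in> L" "x \<in> L ==> \<ominus> x \<in> L" "x \<in> L ==> y \<in> L ==> x \<ominus> y \<in> L"
    "a \<in> carrier A ==> x \<in> L ==> a \<otimes> x \<in> L" "x \<in> L ==> part g x \<in> L"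
proof -
  have *: "subgroup L (add_monoid A)" "\<forall>a\<in>carrier A. \<forall>x\<in>L. a \<otimes> x \<in> L" "graded_subset A L"
    using assms unfolding glideal_def graded_submodule_def add_monoid_regular by (auto simp: graded_subset_def)
  note s = *(1)[unfolded subgroup_ai]
  show "L \<subseteq> carrier A" "\<zero> \<in> L" "x \<in> L ==> y \<in> L ==> x \<oplus> y \<in> L" "x \<in> L ==> \<ominus> x \<in> L" "x \<in> L ==> y \<in> L ==> x \<ominus> y \<in> L"
    using s by (auto simp: a_minus_def)
  show "a \<in> carrier A ==> x \<in> L ==> a \<otimes> x \<in> L" using *(2) by blast
  show "x \<in> L ==> part g x \<in> L" using graded_subsetD[OF *(3)] s by blast
qed

lemma glidealI:
  assumes "L \<subseteq> carrier A" "\<zero> \<in> L" "\<And>x y. x \<in> L ==> y \<in> L ==> x \<oplus> y \<in> L"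
    "\<And>a x. a \<in> carrier A ==> x \<in> L ==> a \<otimes> x \<in> L" "\<And>x g. x \<in> L ==> part g x \<in> L"
  shows "glideal L"
proof -
  have "\<ominus> x \<in> L" if "x \<in> L" for x
  proof -
    have "\<ominus> x = (\<ominus> \<one>) \<otimes> x" using that assms(1) by (auto simp: l_minus)
    then show ?thesis using assms(4)[OF _ that] by simp
  qed
  then have "subgroup L (add_monoid A)" unfolding subgroup_ai using assms by auto
  moreover have "graded_subset A L" using graded_subsetI assms by blast
  ultimately show ?thesis
    unfolding glideal_def graded_submodule_def add_monoid_regular using assms(4) by (auto simp: graded_subset_def)
qed

lemma glideal_ksub: assumes "glideal L" shows "ksub L"
proof -
  have "c \<odot> x \<in> L" if "c \<in> carrier K" "x \<in> L" for c x
    using glidealD(6)[OF assms, of "c \<odot> \<one>" x] that glidealD(1)[OF assms] by (auto simp: smult_one)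
  then show ?thesis unfolding ksub_def using glidealD[OF assms] by auto
qed

lemma coset_regular: "L +>\<^bsub>regular_module A\<^esub> x = L +> x"
  by (simp add: a_r_coset_def')

text \<open>Correspondence between graded submodules of the quotient and graded left ideals above
  \<open>L\<close>: the preimage \<open>N'\<close> of a submodule is one of the latter, and
  maximality of \<open>L\<close> leaves only two possibilities for it.\<close>

lemma gr_maximalI:
  assumes L: "glideal L" and ne: "L \<noteq> carrier A" and mx: "\<And>L'. glideal L' ==> L \<subseteq> L' ==> L' = L \<or> L' = carrier A"
  shows "gr_maximal A (regular_module A) L"
  unfolding gr_maximal_def gr_simple_def
proof (intro conjI allI impI)
  note L' = glidealD[OF L]
  let ?Q = "gquot (regular_module A) L"
  interpret L: additive_subgroup L A
    by (rule additive_subgroup.intro) (use L in \<open>auto simp only: glideal_def graded_submodule_def add_monoid_regular\<close>)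
  interpret Lb: abelian_subgroup L A
    by (rule abelian_subgroupI3[OF L.additive_subgroup_axioms abelian_group_axioms])
  have car: "carrier ?Q = (\<lambda>x. L +> x) ` carrier A"
    by (auto simp: gquot_def FactRing_def A_RCOSETS_def' coset_regular)
  have zero: "\<zero>\<^bsub>?Q\<^esub> = L" by (simp add: gquot_def FactRing_def)
  have add: "(L +> x) \<oplus>\<^bsub>?Q\<^esub> (L +> y) = L +> (x \<oplus> y)" if "x \<in> carrier A" "y \<in> carrier A" for x y
    using that Lb.a_rcos_sum by (simp add: gquot_def FactRing_def set_add_def set_mult_def)
  have hc: "hcomp ?Q g = (\<lambda>x. L +> x) ` hcomp A g" for g
    by (simp add: gquot_def coset_regular)
  have memL: "L +> x = L \<longleftrightarrow> x \<in> L" if "x \<in> carrier A" for x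
    using a_rcoset_eq_iff[OF L.additive_subgroup_axioms that zero_closed] that Lb.a_rcos_const[OF L.zero_closed] by (simp add: a_minus_def)
  show "graded_submodule A (regular_module A) L" using L by (simp add: glideal_def)
  show "carrier ?Q \<noteq> {\<zero>\<^bsub>?Q\<^esub>}"
  proof
    assume "carrier ?Q = {\<zero>\<^bsub>?Q\<^esub>}"
    then have e: "(\<lambda>x. L +> x) ` carrier A = {L}" by (simp only: car zero)
    have "x \<in> L" if x: "x \<in> carrier A" for x
    proof -
      have "L +> x \<in> {L}" using e x by blast
      then show ?thesis using memL[OF x] by simp
    qed
    then show False using ne L'(1) by blast
  qed
  fix N assume N: "graded_submodule A ?Q N"
  then have sub: "subgroup N (add_monoid ?Q)" and act: "\<forall>a\<in>carrier A. \<forall>x\<in>N. a \<odot>\<^bsub>?Q\<^esub> x \<in> N" and gr: "graded_subset ?Q N"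
    by (auto simp: graded_submodule_def)
  have Nc: "N \<subseteq> carrier ?Q" using subgroup.subset[OF sub] by simp
  define N' where "N' = {x \<in> carrier A. L +> x \<in> N}"
  have zN: "L \<in> N" using subgroup.one_closed[OF sub] zero by simp
  have eqc: "L +> x = L +> y" if "x \<in> carrier A" "y \<in> carrier A" "x \<ominus> y \<in> L" for x y
    using that a_rcoset_eq_iff[OF L.additive_subgroup_axioms] by blast
  have "glideal N'"
  proof (rule glidealI)
    show "N' \<subseteq> carrier A" by (auto simp: N'_def)
    show "\<zero> \<in> N'" using zN memL[of \<zero>] L' by (simp add: N'_def)
    fix x y assume "x \<in> N'" "y \<in> N'"
    then show "x \<oplus> y \<in> N'" using subgroup.m_closed[OF sub, of "L +> x" "L +> y"] by (auto simp: N'_def add)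
  next
    fix a x assume ax: "a \<in> carrier A" "x \<in> N'"
    then have xc: "x \<in> carrier A" "L +> x \<in> N" by (auto simp: N'_def)
    have "L +> (a \<otimes> z) = L +> (a \<otimes> x)" if "z \<in> L +> x" for z
    proof -
      obtain l where l: "l \<in> L" "z = l \<oplus> x" using \<open>z \<in> L +> x\<close> unfolding a_r_coset_def' by blast
      then have lc: "l \<in> carrier A" using L' by blast
      have "a \<otimes> z \<ominus> a \<otimes> x = a \<otimes> l" using l lc ax xc by (simp add: r_distr a_minus_def a_assoc r_neg)
      then show ?thesis using eqc[of "a \<otimes> z" "a \<otimes> x"] L'(6)[OF ax(1) l(1)] l lc ax xc by simp
    qed
    moreover have "x \<in> L +> x" using xc Lb.a_rcos_self by blast
    ultimately have "(\<Union>z\<in>L +> x. L +> (a \<otimes> z)) = L +> (a \<otimes> x)" by blast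
    moreover have "a \<odot>\<^bsub>?Q\<^esub> (L +> x) = (\<Union>z\<in>L +> x. L +> (a \<otimes> z))" by (simp add: gquot_def coset_regular)
    moreover have "a \<odot>\<^bsub>?Q\<^esub> (L +> x) \<in> N" using act ax(1) xc(2) by blast
    ultimately show "a \<otimes> x \<in> N'" using ax(1) xc(1) by (simp add: N'_def)
  next
    fix x g assume "x \<in> N'"
    then have x: "x \<in> carrier A" "L +> x \<in> N" by (auto simp: N'_def)
    \<comment> \<open>The components of the coset have homogeneous representatives \<open>y\<close>
      and \<open>z\<close>. As \<open>x - (y + z)\<close> lies in the graded \<open>L\<close>, its
      components do too, so the components of \<open>x\<close> represent the same cosets.\<close>
    obtain Y Z where YZ: "Y \<in> N" "Y \<in> hcomp ?Q 0" "Z \<in> N" "Z \<in> hcomp ?Q 1" "L +> x = Y \<oplus>\<^bsub>?Q\<^esub> Z"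
      using gr x unfolding graded_subset_def by blast
    obtain y z where yz: "y \<in> hcomp A 0" "Y = L +> y" "z \<in> hcomp A 1" "Z = L +> z" using YZ hc by auto
    have c: "y \<in> carrier A" "z \<in> carrier A" using yz hcomp_carrier by auto
    have "L +> x = L +> (y \<oplus> z)" using YZ yz add c by simp
    then have d: "x \<ominus> (y \<oplus> z) \<in> L" using a_rcoset_eq_iff[OF L.additive_subgroup_axioms, of x "y \<oplus> z"] x c by simp
    have p: "part 0 (x \<ominus> (y \<oplus> z)) = part 0 x \<ominus> y" "part 1 (x \<ominus> (y \<oplus> z)) = part 1 x \<ominus> z"
      using part_unique[of y 0 z] yz x c by (auto simp: part_minus)
    have "L +> part 0 x = Y" "L +> part 1 x = Z"
      unfolding yz using L'(7)[OF d, of 0] L'(7)[OF d, of 1] c x by (simp_all only: p eqc part_closed)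
    then show "part g x \<in> N'" using YZ x bit_cases[of g] by (auto simp: N'_def)
  qed
  moreover have "L \<subseteq> N'"
  proof
    fix x assume x: "x \<in> L"
    then have "x \<in> carrier A" using L'(1) by blast
    then show "x \<in> N'" using memL[of x] x zN by (simp add: N'_def)
  qed
  ultimately consider "N' = L" | "N' = carrier A" using mx by blast
  then show "N = {\<zero>\<^bsub>?Q\<^esub>} \<or> N = carrier ?Q"
  proof cases
    case 1
    have "N \<subseteq> {L}"
    proof
      fix U assume U: "U \<in> N"
      then obtain x where "x \<in> carrier A" "U = L +> x" using Nc car by blast
      then show "U \<in> {L}" using 1 memL[of x] U by (auto simp: N'_def)
    qed
    then show ?thesis using zN zero by auto
  next
    case 2
    then have "carrier ?Q \<subseteq> N" using car by (auto simp: N'_def)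
    then show ?thesis using Nc by blast
  qed
qed

abbreviation J where "J \<equiv> gr_radical A"

lemma gr_maximal_proper:
  assumes "gr_maximal A (regular_module A) L" shows "glideal L" "L \<noteq> carrier A"
proof -
  show L: "glideal L" using assms by (simp add: gr_maximal_def glideal_def)
  show "L \<noteq> carrier A"
  proof
    assume e: "L = carrier A"
    have "L +> x = L" if "x \<in> carrier A" for x
    proof
      show "L +> x \<subseteq> L" using that e by (auto simp: a_r_coset_def')
      show "L \<subseteq> L +> x"
      proof
        fix y assume "y \<in> L"
        then have "y = (y \<ominus> x) \<oplus> x" "y \<ominus> x \<in> L" using that e by (simp_all add: a_minus_def a_assoc l_neg)
        then show "y \<in> L +> x" unfolding a_r_coset_def' by blast
      qed
    qed
    then have "carrier (gquot (regular_module A) L) = {L}"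
      using zero_closed by (auto simp: gquot_def FactRing_def A_RCOSETS_def' coset_regular)
    moreover have "\<zero>\<^bsub>gquot (regular_module A) L\<^esub> = L" by (simp add: gquot_def FactRing_def)
    ultimately show False using assms by (simp add: gr_maximal_def gr_simple_def)
  qed
qed

lemma glideal_J: "glideal J"
proof (rule glidealI)
  show "J \<subseteq> carrier A" by (auto simp: gr_radical_def)
  show "\<zero> \<in> J" using glidealD(2)[OF gr_maximal_proper(1)] by (auto simp: gr_radical_def)
  show "x \<oplus> y \<in> J" if "x \<in> J" "y \<in> J" for x y
    using that glidealD(3)[OF gr_maximal_proper(1)] by (auto simp: gr_radical_def)
  show "a \<otimes> x \<in> J" if "a \<in> carrier A" "x \<in> J" for a x
    using that glidealD(6)[OF gr_maximal_proper(1)] by (auto simp: gr_radical_def)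
  show "part g x \<in> J" if "x \<in> J" for x g
    using that glidealD(7)[OF gr_maximal_proper(1)] by (auto simp: gr_radical_def)
qed

lemma glideal_carrier: "glideal (carrier A)"
  by (rule glidealI) auto

text \<open>Among the graded left ideals above \<open>L\<close> that avoid the unit, a maximal one
  is gr-maximal: anything larger contains the unit and hence everything.\<close>

lemma proper_in_gr_maximal:
  assumes "glideal L" "\<one> \<notin> L" shows "\<exists>M. gr_maximal A (regular_module A) M \<and> L \<subseteq> M"
proof -
  let ?F = "{M. glideal M \<and> L \<subseteq> M \<and> \<one> \<notin> M}"
  have "L \<in> ?F" using assms by simp
  then obtain M where M: "M \<in> ?F" "\<forall>V\<in>?F. M \<subseteq> V \<longrightarrow> V = M" using ksub_maximal[of L ?F] glideal_ksub by blast
  have "gr_maximal A (regular_module A) M"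
  proof (rule gr_maximalI)
    show "glideal M" "M \<noteq> carrier A" using M by auto
    fix L' assume L': "glideal L'" "M \<subseteq> L'"
    show "L' = M \<or> L' = carrier A"
    proof (cases "\<one> \<in> L'")
      case True
      have "x \<in> L'" if "x \<in> carrier A" for x using glidealD(6)[OF L'(1) that True] that by simp
      then show ?thesis using glidealD(1)[OF L'(1)] by blast
    next
      case False then show ?thesis using M L' by blast
    qed
  qed
  then show ?thesis using M by blast
qed

text \<open>Homogeneity of \<open>x\<close> is what makes the product graded: the component of
  degree \<open>h\<close> of \<open>a x\<close> comes from the component of degree
  \<open>h + g\<close> of \<open>a\<close>, as \<open>g + g = 0\<close>.\<close>

lemma glideal_mult: assumes "x \<in> hcomp A g" "glideal L" shows "glideal ((\<lambda>a. a \<otimes> x) ` L)"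
proof -
  have x: "x \<in> carrier A" using assms hcomp_carrier by blast
  note L = glidealD[OF assms(2)]
  show ?thesis
  proof (rule glidealI)
    show "(\<lambda>a. a \<otimes> x) ` L \<subseteq> carrier A" using L(1) x by auto
    show "\<zero> \<in> (\<lambda>a. a \<otimes> x) ` L" using L(2) x by (auto intro!: image_eqI[of _ _ \<zero>])
    show "u \<oplus> v \<in> (\<lambda>a. a \<otimes> x) ` L" if uv: "u \<in> (\<lambda>a. a \<otimes> x) ` L" "v \<in> (\<lambda>a. a \<otimes> x) ` L" for u v
    proof -
      obtain a b where ab: "a \<in> L" "b \<in> L" "u = a \<otimes> x" "v = b \<otimes> x" using uv by blast
      then have "u \<oplus> v = (a \<oplus> b) \<otimes> x" using subsetD[OF L(1), of a] subsetD[OF L(1), of b] x l_distr[of a b x] by simp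
      then show ?thesis using L(3) ab by blast
    qed
    show "c \<otimes> v \<in> (\<lambda>a. a \<otimes> x) ` L" if cv: "c \<in> carrier A" "v \<in> (\<lambda>a. a \<otimes> x) ` L" for c v
    proof -
      obtain a where a: "a \<in> L" "v = a \<otimes> x" using cv by blast
      then have "c \<otimes> v = (c \<otimes> a) \<otimes> x" using L(1) x cv by (auto simp: m_assoc)
      then show ?thesis using L(6) a cv by blast
    qed
    show "part h v \<in> (\<lambda>a. a \<otimes> x) ` L" if v: "v \<in> (\<lambda>a. a \<otimes> x) ` L" for h v
    proof -
      obtain a where a: "a \<in> L" "v = a \<otimes> x" using v by blast
      have "part (h + g + g) v = part (h + g) a \<otimes> x" using part_mult_r[OF assms(1), of a "h + g"] a L(1) by auto
      moreover have "h + g + g = h" using bit_cases[of g] bit_cases[of h] by auto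
      ultimately show ?thesis using L(7) a by auto
    qed
  qed
qed

text \<open>Graded quasi-regularity. As \<open>n\<close> is even, \<open>1 - n\<close> is
  homogeneous and generates a graded left ideal; were it proper, some gr-maximal left ideal would
  contain it together with \<open>n\<close>, hence the unit.\<close>

lemma J_left_inverse:
  assumes "n \<in> J" "n \<in> hcomp A 0" shows "\<exists>a\<in>carrier A. a \<otimes> (\<one> \<ominus> n) = \<one>"
proof -
  have h: "\<one> \<ominus> n \<in> hcomp A 0" using assms one_hcomp hcomp_minus by blast
  let ?L = "(\<lambda>a. a \<otimes> (\<one> \<ominus> n)) ` carrier A"
  have L: "glideal ?L" by (rule glideal_mult[OF h glideal_carrier])
  have "\<one> \<in> ?L"
  proof (rule ccontr)
    assume "\<one> \<notin> ?L"
    then obtain M where M: "gr_maximal A (regular_module A) M" "?L \<subseteq> M" using proper_in_gr_maximal[OF L] by blast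
    have n: "n \<in> M" using assms M by (auto simp: gr_radical_def)
    have nc: "n \<in> carrier A" using assms hcomp_carrier by blast
    have "\<one> \<otimes> (\<one> \<ominus> n) \<in> M" using M(2) by blast
    then have "(\<one> \<ominus> n) \<oplus> n \<in> M" using glidealD(3)[OF gr_maximal_proper(1)[OF M(1)] _ n] nc by simp
    then have "\<one> \<in> M" using nc by (simp add: a_minus_def a_assoc l_neg)
    then have "carrier A \<subseteq> M" using glidealD(6)[OF gr_maximal_proper(1)[OF M(1)]] by (metis r_one subsetI)
    then show False using gr_maximal_proper[OF M(1)] glidealD(1) by blast
  qed
  then show ?thesis by (metis (no_types, lifting) imageE)
qed

lemma ideal_ksub: assumes "ideal I A" shows "ksub I"
proof -
  interpret I: ideal I A by (rule assms)
  have "c \<odot> x \<in> I" if "c \<in> carrier K" "x \<in> I" for c x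
    using I.I_l_closed[of x "c \<odot> \<one>"] that by (auto simp: smult_one)
  then show ?thesis unfolding ksub_def using I.a_subset by auto
qed

text \<open>The classical argument for Artinian rings, carried out with graded left ideals. If a
  stable power \<open>N\<close> of \<open>J\<close> were nonzero, a minimal graded left ideal not
  killed by \<open>N\<close> would have the form \<open>J x\<close> with \<open>x\<close> in it; so
  \<open>x = j x\<close>, and quasi-regularity kills \<open>x\<close>.\<close>

lemma J_nilpotent:
  assumes idJ: "ideal J A"
  shows "\<exists>t. ideal_power A J t = {\<zero>}"
proof -
  have idp: "ideal (ideal_power A J k) A" for k by (induction k) (auto simp: oneideal ideal_prod_is_ideal idJ)
  have "ideal_power A J 0 \<in> range (ideal_power A J)" by blast
  then obtain k where k: "\<forall>V\<in>range (ideal_power A J). V \<subseteq> ideal_power A J k \<longrightarrow> V = ideal_power A J k"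
    using ksub_minimal[of "ideal_power A J 0" "range (ideal_power A J)"] ideal_ksub[OF idp] by blast
  define N where "N = ideal_power A J k"
  have idN: "ideal N A" using idp by (simp add: N_def)
  have "ideal_prod A N J \<subseteq> N" using ideal_prod_inter[OF idN idJ] by auto
  then have NJ: "ideal_prod A N J = N" using k unfolding N_def by (metis ideal_power.simps(2) rangeI)
  have Nc: "n \<in> N ==> n \<in> carrier A" for n using ideal.Icarr[OF idN] .
  show ?thesis
  proof (cases "N = {\<zero>}")
    case True then show ?thesis unfolding N_def by blast
  next
    case False
    then obtain n0 where n0: "n0 \<in> N" "n0 \<noteq> \<zero>" using additive_subgroup.zero_closed[OF ideal.axioms(1)[OF idN]] by blast
    let ?F = "{L. glideal L \<and> (\<exists>n\<in>N. \<exists>x\<in>L. n \<otimes> x \<noteq> \<zero>)}"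
    have "n0 \<otimes> \<one> \<noteq> \<zero>" using n0 Nc by simp
    then have "carrier A \<in> ?F" using glideal_carrier n0(1) one_closed by blast
    then obtain L where L: "L \<in> ?F" "\<forall>V\<in>?F. V \<subseteq> L \<longrightarrow> V = L"
      using ksub_minimal[of "carrier A" ?F] glideal_ksub by blast
    then have gL: "glideal L" by simp
    obtain n y where ny: "n \<in> N" "y \<in> L" "n \<otimes> y \<noteq> \<zero>" using L by blast
    have yc: "y \<in> carrier A" using ny glidealD(1)[OF gL] by blast
    \<comment> \<open>Some homogeneous component of \<open>y\<close> is not killed by
      \<open>n\<close>. Passing to it is necessary because \<open>J x\<close> is graded only for
      homogeneous \<open>x\<close>.\<close>
    have "\<exists>g. n \<otimes> part g y \<noteq> \<zero>"
    proof (rule ccontr)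
      assume a: "\<nexists>g. n \<otimes> part g y \<noteq> \<zero>"
      have "n \<otimes> y = n \<otimes> (part 0 y \<oplus> part 1 y)" using part_sum[OF yc] by simp
      also have "\<dots> = \<zero>" using yc a Nc ny by (simp add: r_distr)
      finally show False using ny by simp
    qed
    then obtain g where g: "n \<otimes> part g y \<noteq> \<zero>" by blast
    define x where "x = part g y"
    have x: "x \<in> L" "x \<in> hcomp A g" "x \<in> carrier A" "n \<otimes> x \<noteq> \<zero>" using g ny yc glidealD(7)[OF gL] by (auto simp: x_def)
    let ?L = "(\<lambda>j. j \<otimes> x) ` J"
    have gL': "glideal ?L" by (rule glideal_mult[OF x(2) glideal_J])
    have "?L \<subseteq> L" using glidealD(6)[OF gL _ x(1)] glidealD(1)[OF glideal_J] by blast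
    moreover have "\<exists>n\<in>N. \<exists>z\<in>?L. n \<otimes> z \<noteq> \<zero>"
    proof (rule ccontr)
      assume a: "\<not> (\<exists>n\<in>N. \<exists>z\<in>?L. n \<otimes> z \<noteq> \<zero>)"
      have "m \<in> carrier A \<and> m \<otimes> x = \<zero>" if "m \<in> ideal_prod A N J" for m
        using that
      proof (induction rule: ideal_prod.induct)
        case (prod i j)
        have "j \<in> carrier A" using prod glidealD(1)[OF glideal_J] by blast
        then show ?case using a prod x Nc by (auto simp: m_assoc)
      next
        case (sum s t) then show ?case using x by (simp add: l_distr)
      qed
      then show False using ny x NJ by blast
    qed
    ultimately have "?L = L" using L(2) gL' by blast
    then obtain j where j: "j \<in> J" "x = j \<otimes> x" using x(1) by blast
    have jc: "j \<in> carrier A" using j glidealD(1)[OF glideal_J] by blast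
    \<comment> \<open>Since \<open>x\<close> is homogeneous, only the even part of \<open>j\<close>
      contributes to \<open>j x = x\<close>. So \<open>j\<close> may be replaced by its even part,
      to which \<open>J_left_inverse\<close> applies.\<close>
    have "part (0 + g) (j \<otimes> x) = part 0 j \<otimes> x" by (rule part_mult_r[OF x(2) jc])
    moreover have "part (0 + g) (j \<otimes> x) = x" using j(2) part_same[OF x(2)] by (metis add_0)
    ultimately have jx: "part 0 j \<otimes> x = x" by simp
    have j0: "part 0 j \<in> J" "part 0 j \<in> hcomp A 0" "part 0 j \<in> carrier A" using glidealD(7)[OF glideal_J j(1)] jc by auto
    obtain a where a: "a \<in> carrier A" "a \<otimes> (\<one> \<ominus> part 0 j) = \<one>" using J_left_inverse[OF j0(1,2)] by blast
    have "(\<one> \<ominus> part 0 j) \<otimes> x = \<zero>" using jx j0 x by (simp add: a_minus_def l_distr l_minus r_neg)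
    then have "\<zero> = a \<otimes> ((\<one> \<ominus> part 0 j) \<otimes> x)" using a by simp
    also have "\<dots> = x" using a j0 x by (simp add: m_assoc[symmetric])
    finally have "n \<otimes> x = \<zero>" using Nc[OF ny(1)] by (metis r_null)
    then show ?thesis using x by simp
  qed
qed

end

section \<open>Gr-division superalgebras over an algebraically closed field\<close>

lemma algebraically_closed_root:
  assumes "algebraically_closed K" "c \<in> carrier K" "c \<noteq> \<zero>\<^bsub>K\<^esub>" "set p \<subseteq> carrier K" "p \<noteq> []"
  shows "\<exists>x\<in>carrier K. ring.eval K (c # p) x = \<zero>\<^bsub>K\<^esub>"
proof -
  interpret K: algebraically_closed K by (rule assms(1))
  have pol: "c # p \<in> carrier (poly_ring K)"
    using assms unfolding univ_poly_carrier[symmetric] polynomial_def by auto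
  have "size (K.roots (c # p)) = degree (c # p)" using K.roots_over_carrier[OF pol] by (simp add: K.splitted_def)
  then have "size (K.roots (c # p)) \<noteq> 0" using assms by simp
  then obtain x where "x \<in># K.roots (c # p)" by (metis multiset_nonemptyE size_empty)
  then have "K.is_root (c # p) x" using K.roots_mem_iff_is_root[OF pol] by simp
  then show ?thesis by (auto simp: K.is_root_def)
qed

context salg begin

text \<open>Evaluation of a polynomial at an algebra element, with the leading coefficient at the
  head of the list as for \<open>ring.eval\<close>.\<close>

primrec aev :: "'k list => 'a => 'a" where
  "aev [] a = \<zero>"
| "aev (c # p) a = c \<odot> (a [^] length p) \<oplus> aev p a"

lemma aev_closed [simp]: "set p \<subseteq> carrier K ==> a \<in> carrier A ==> aev p a \<in> carrier A"
  by (induction p) auto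

text \<open>Horner's synthetic division by X - \<open>l\<close>: \<open>r\<close> is the running
  coefficient and the list collects the quotient. The last running coefficient, which is the
  remainder, is dropped.\<close>

primrec syn :: "'k => 'k => 'k list => 'k list" where
  "syn l r [] = []"
| "syn l r (c # p) = r # syn l (r \<otimes>\<^bsub>K\<^esub> l \<oplus>\<^bsub>K\<^esub> c) p"

lemma length_syn [simp]: "length (syn l r p) = length p"
  by (induction p arbitrary: r) auto

lemma syn_closed: "[| l \<in> carrier K; r \<in> carrier K; set p \<subseteq> carrier K |] ==> set (syn l r p) \<subseteq> carrier K"
  by (induction p arbitrary: r) auto

text \<open>Division with remainder, evaluated at \<open>a\<close>. The leading term is traded for a
  multiple of \<open>a - l\<close> and a term of one degree less, which merges with the next
  coefficient into \<open>s\<close>.\<close>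

lemma aev_syn:
  assumes a: "a \<in> carrier A" and l: "l \<in> carrier K" and r: "r \<in> carrier K" and p: "set p \<subseteq> carrier K"
  shows "aev (r # p) a = (a \<ominus> l \<odot> \<one>) \<otimes> aev (syn l r p) a \<oplus> ring.eval K (r # p) l \<odot> \<one>"
  using r p
proof (induction p arbitrary: r)
  case Nil
  then show ?case using a l by (simp add: vs.R.eval.simps)
next
  case (Cons c p)
  define s where "s = r \<otimes>\<^bsub>K\<^esub> l \<oplus>\<^bsub>K\<^esub> c"
  have s: "s \<in> carrier K" and c: "c \<in> carrier K" and p: "set p \<subseteq> carrier K" and r: "r \<in> carrier K" using Cons.prems l by (auto simp: s_def)
  define n where "n = length p"
  define Q where "Q = aev (syn l s p) a"
  define E where "E = ring.eval K (s # p) l \<odot> \<one>"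
  define d where "d = a \<ominus> l \<odot> \<one>"
  have ec: "ring.eval K (s # p) l \<in> carrier K" using s p l by (intro vs.R.eval_in_carrier) auto
  have Q: "Q \<in> carrier A" using syn_closed[OF l s p] a by (simp add: Q_def)
  have E: "E \<in> carrier A" using ec by (simp add: E_def)
  have d: "d \<in> carrier A" using a l by (simp add: d_def)
  have IH: "s \<odot> (a [^] n) \<oplus> aev p a = d \<otimes> Q \<oplus> E"
    using Cons.IH[OF s p] by (simp only: aev.simps n_def Q_def E_def d_def)
  have lc: "l [^]\<^bsub>K\<^esub> length p \<otimes>\<^bsub>K\<^esub> l = l \<otimes>\<^bsub>K\<^esub> l [^]\<^bsub>K\<^esub> length p"
    using l by (intro vs.R.m_comm) auto
  have ev: "ring.eval K (r # c # p) l = ring.eval K (s # p) l"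
    using r c l p vs.R.eval_in_carrier[OF p l] unfolding s_def
    by (simp add: vs.R.eval.simps vs.R.l_distr vs.R.m_assoc vs.R.a_assoc lc)
  have pw: "a [^] n \<in> carrier A" "aev p a \<in> carrier A" using a p by auto
  have "d \<otimes> (r \<odot> (a [^] n)) = r \<odot> (d \<otimes> (a [^] n))" using d r pw by (simp add: smult_mult_r)
  also have "d \<otimes> (a [^] n) = a [^] Suc n \<ominus> l \<odot> (a [^] n)"
    using a l pw by (simp add: d_def a_minus_def l_distr l_minus smult_mult_l nat_pow_Suc2[symmetric])
  also have "r \<odot> (a [^] Suc n \<ominus> l \<odot> (a [^] n)) = r \<odot> (a [^] Suc n) \<ominus> (r \<otimes>\<^bsub>K\<^esub> l) \<odot> (a [^] n)"
    using a l r pw by (simp add: a_minus_def vs.smult_r_distr vs.smult_r_minus vs.smult_assoc1 del: nat_pow_Suc)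
  finally have dr: "r \<odot> (a [^] Suc n) = d \<otimes> (r \<odot> (a [^] n)) \<oplus> (r \<otimes>\<^bsub>K\<^esub> l) \<odot> (a [^] n)"
    using a l r pw d by (simp add: a_minus_def a_assoc l_neg del: nat_pow_Suc)
  have "aev (r # c # p) a = r \<odot> (a [^] Suc n) \<oplus> (c \<odot> (a [^] n) \<oplus> aev p a)"
    by (simp add: n_def)
  also have "\<dots> = d \<otimes> (r \<odot> (a [^] n)) \<oplus> (((r \<otimes>\<^bsub>K\<^esub> l) \<odot> (a [^] n) \<oplus> c \<odot> (a [^] n)) \<oplus> aev p a)"
    unfolding dr using a l r c pw d by (simp add: a_assoc)
  also have "(r \<otimes>\<^bsub>K\<^esub> l) \<odot> (a [^] n) \<oplus> c \<odot> (a [^] n) = s \<odot> (a [^] n)"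
    using l r c pw by (simp add: s_def vs.smult_l_distr)
  also have "d \<otimes> (r \<odot> (a [^] n)) \<oplus> (s \<odot> (a [^] n) \<oplus> aev p a) = d \<otimes> (r \<odot> (a [^] n) \<oplus> Q) \<oplus> E"
    unfolding IH using d r pw Q E by (simp add: r_distr a_assoc)
  also have "r \<odot> (a [^] n) \<oplus> Q = aev (syn l r (c # p)) a" by (simp add: n_def Q_def s_def)
  finally show ?case unfolding ev d_def E_def .
qed

text \<open>Induction on the degree. For a root \<open>l\<close> the even element
  \<open>a - l 1\<close> is zero or invertible; in the latter case it cancels, and the quotient,
  which has the same leading coefficient \<open>c\<close>, annihilates \<open>a\<close>. In degree 0
  a nonzero multiple of the unit would vanish.\<close>

lemma gr_division_even:
  assumes ac: "algebraically_closed K" and div: "\<And>x. x \<in> hcomp A 0 ==> x \<noteq> \<zero> ==> x \<in> Units A" and ne: "\<one> \<noteq> \<zero>"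
    and a: "a \<in> hcomp A 0" and c: "c \<in> carrier K" "c \<noteq> \<zero>\<^bsub>K\<^esub>" and p: "set p \<subseteq> carrier K" and z: "aev (c # p) a = \<zero>"
  shows "\<exists>l\<in>carrier K. a = l \<odot> \<one>"
  using p z
proof (induction "length p" arbitrary: p)
  case 0
  then have "c \<odot> \<one> = \<zero>" using c by simp
  then have "inv\<^bsub>K\<^esub> c \<odot> (c \<odot> \<one>) = \<zero>" using c vs.field_Units by (metis vs.R.Units_inv_closed vs.smult_r_null Diff_iff singletonD)
  moreover have cu: "c \<in> Units K" using c vs.field_Units by simp
  ultimately have "\<one> = \<zero>" using c by (simp add: vs.smult_assoc1[symmetric] vs.R.Units_l_inv)
  then show ?case using ne by simp
next
  case (Suc n)
  have ac': "a \<in> carrier A" using a hcomp_carrier by blast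
  obtain l where l: "l \<in> carrier K" "ring.eval K (c # p) l = \<zero>\<^bsub>K\<^esub>"
    using algebraically_closed_root[OF ac c Suc.prems(1)] Suc.hyps(2) by fastforce
  define d where "d = a \<ominus> l \<odot> \<one>"
  have dh: "d \<in> hcomp A 0" using a l by (auto simp: d_def intro!: hcomp_minus hcomp_smult)
  have dc: "d \<in> carrier A" using dh hcomp_carrier by blast
  have qc: "set (syn l c p) \<subseteq> carrier K" using syn_closed[OF l(1) c(1) Suc.prems(1)] .
  have dq: "d \<otimes> aev (syn l c p) a = \<zero>"
    using aev_syn[OF ac' l(1) c(1) Suc.prems(1)] Suc.prems(2) l ac' qc dc by (simp add: d_def del: aev.simps)
  show ?case
  proof (cases "d = \<zero>")
    case True
    then have "a = l \<odot> \<one>" using ac' l unfolding d_def by simp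
    then show ?thesis using l by blast
  next
    case False
    then have "d \<in> Units A" using div dh by blast
    then have q0: "aev (syn l c p) a = \<zero>" using dq aev_closed[OF qc ac'] by (metis Units_l_inv Units_inv_closed l_one m_assoc r_null dc)
    obtain c' p' where p': "p = c' # p'" using Suc.hyps(2) by (cases p) auto
    define q where "q = syn l (c \<otimes>\<^bsub>K\<^esub> l \<oplus>\<^bsub>K\<^esub> c') p'"
    have sq: "syn l c p = c # q" by (simp add: p' q_def)
    have "n = length q" using Suc.hyps(2) by (simp add: q_def p')
    moreover have "set q \<subseteq> carrier K" using qc sq by simp
    ultimately show ?thesis using Suc.hyps(1)[of q] q0 sq by simp
  qed
qed

text \<open>A nonzero odd \<open>w\<close> has a nonzero scalar square \<open>l\<close>; dividing by
  a square root of \<open>l\<close> gives \<open>u\<close> with \<open>u u = 1\<close>, and then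
  \<open>x = (x u) u\<close> with \<open>x u\<close> even and so a scalar. Without odd elements
  \<open>u\<close> is zero, a convention kept from here on.\<close>

lemma gr_division_odd:
  assumes ac: "algebraically_closed K" and div: "\<And>g x. x \<in> hcomp A g ==> x \<noteq> \<zero> ==> x \<in> Units A" and ne: "\<one> \<noteq> \<zero>"
    and even: "\<And>a. a \<in> hcomp A 0 ==> \<exists>l\<in>carrier K. a = l \<odot> \<one>"
  shows "\<exists>u\<in>hcomp A 1. (u \<otimes> u = \<one> \<or> u = \<zero>) \<and> (\<forall>x\<in>hcomp A 1. \<exists>c\<in>carrier K. x = c \<odot> u)"
proof (cases "hcomp A 1 = {\<zero>}")
  case True
  then show ?thesis by (intro bexI[of _ \<zero>]) auto
next
  case False
  then obtain w where w: "w \<in> hcomp A 1" "w \<noteq> \<zero>" using hcomp_zero by blast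
  then have wU: "w \<in> Units A" and wc: "w \<in> carrier A" using div hcomp_carrier by auto
  have "w \<otimes> w \<in> hcomp A 0" using hcomp_mult[OF w(1) w(1)] by simp
  then obtain l where l: "l \<in> carrier K" "w \<otimes> w = l \<odot> \<one>" using even by blast
  have l0: "l \<noteq> \<zero>\<^bsub>K\<^esub>"
  proof
    assume "l = \<zero>\<^bsub>K\<^esub>"
    then have "w \<otimes> w = \<zero>" using l by simp
    then have "w = \<zero>" using wU wc by (metis Units_l_inv Units_inv_closed l_one m_assoc r_null)
    then show False using w by simp
  qed
  \<comment> \<open>A root of X^2 - \<open>l\<close>, written from the leading coefficient
    down.\<close>
  obtain s where s: "s \<in> carrier K" "ring.eval K [\<one>\<^bsub>K\<^esub>, \<zero>\<^bsub>K\<^esub>, \<ominus>\<^bsub>K\<^esub> l] s = \<zero>\<^bsub>K\<^esub>"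
    using algebraically_closed_root[OF ac vs.R.one_closed, of "[\<zero>\<^bsub>K\<^esub>, \<ominus>\<^bsub>K\<^esub> l]"] l vs.one_not_zero by auto
  then have ss: "s \<otimes>\<^bsub>K\<^esub> s = l" using l by (simp add: vs.R.eval.simps numeral_2_eq_2) (metis vs.R.m_closed vs.R.minus_equality vs.R.minus_minus vs.R.a_comm vs.R.a_inv_closed)
  have s0: "s \<noteq> \<zero>\<^bsub>K\<^esub>" using ss l0 s by auto
  have sU: "s \<in> Units K" using s s0 vs.field_Units by simp
  define t where "t = inv\<^bsub>K\<^esub> s"
  have t: "t \<in> carrier K" "t \<otimes>\<^bsub>K\<^esub> s = \<one>\<^bsub>K\<^esub>" using sU by (auto simp: t_def vs.R.Units_l_inv)
  define u where "u = t \<odot> w"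
  have u: "u \<in> hcomp A 1" using w t hcomp_smult by (simp add: u_def)
  then have uc: "u \<in> carrier A" using hcomp_carrier by blast
  have "u \<otimes> u = (t \<otimes>\<^bsub>K\<^esub> t \<otimes>\<^bsub>K\<^esub> l) \<odot> \<one>"
    using t wc l by (simp add: u_def smult_mult_l smult_mult_r vs.smult_assoc1)
  also have "t \<otimes>\<^bsub>K\<^esub> t \<otimes>\<^bsub>K\<^esub> l = (t \<otimes>\<^bsub>K\<^esub> s) \<otimes>\<^bsub>K\<^esub> (t \<otimes>\<^bsub>K\<^esub> s)"
    using t(1) s(1) unfolding ss[symmetric] by (simp add: vs.R.m_ac)
  finally have uu: "u \<otimes> u = \<one>" using t by simp
  moreover have "\<exists>c\<in>carrier K. x = c \<odot> u" if x: "x \<in> hcomp A 1" for x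
  proof -
    have xc: "x \<in> carrier A" using x hcomp_carrier by blast
    have "x \<otimes> u \<in> hcomp A 0" using hcomp_mult[OF x u] by simp
    then obtain c where c: "c \<in> carrier K" "x \<otimes> u = c \<odot> \<one>" using even by blast
    have "x = (x \<otimes> u) \<otimes> u" using uu xc uc by (simp add: m_assoc)
    also have "\<dots> = c \<odot> u" using c uc by (simp add: smult_one)
    finally show ?thesis using c by blast
  qed
  ultimately show ?thesis using u by blast
qed

end

section \<open>Lifting the semisimple quotient\<close>

text \<open>Two-sidedness of \<open>J\<close> is assumed in this locale; for an algebra whose
  quotient decomposes into gr-division superalgebras it is derived in
  \<open>decomp_salg\<close>.\<close>

locale rad_salg = fd_salg K A for K :: "('k, 'x) ring_scheme" and A :: "('k, 'a, 'y) gmodule_scheme" (structure) +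
  assumes idJ: "ideal J A" and char2: "\<one>\<^bsub>K\<^esub> \<oplus>\<^bsub>K\<^esub> \<one>\<^bsub>K\<^esub> \<noteq> \<zero>\<^bsub>K\<^esub>"
begin

abbreviation Jp where "Jp \<equiv> ideal_power A J"

lemma idp: "ideal (Jp k) A"
  by (induction k) (auto simp: oneideal ideal_prod_is_ideal idJ)

lemma idl:
  assumes "ideal I A"
  shows "x \<in> I ==> x \<in> carrier A" "\<zero> \<in> I" "x \<in> I ==> y \<in> I ==> x \<oplus> y \<in> I" "x \<in> I ==> y \<in> I ==> x \<ominus> y \<in> I"
    "x \<in> I ==> a \<in> carrier A ==> a \<otimes> x \<in> I" "x \<in> I ==> a \<in> carrier A ==> x \<otimes> a \<in> I"
    "x \<in> I ==> \<ominus> x \<in> I" "c \<in> carrier K ==> x \<in> I ==> c \<odot> x \<in> I"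
proof -
  interpret I: ideal I A by (rule assms)
  show "x \<in> I ==> x \<in> carrier A" by (rule I.Icarr)
  show "\<zero> \<in> I" by (rule I.zero_closed)
  show "x \<in> I ==> y \<in> I ==> x \<oplus> y \<in> I" by (rule I.a_closed)
  show "x \<in> I ==> y \<in> I ==> x \<ominus> y \<in> I" unfolding a_minus_def by (intro I.a_closed I.a_inv_closed)
  show "x \<in> I ==> a \<in> carrier A ==> a \<otimes> x \<in> I" by (rule I.I_l_closed)
  show "x \<in> I ==> a \<in> carrier A ==> x \<otimes> a \<in> I" by (rule I.I_r_closed)
  show "x \<in> I ==> \<ominus> x \<in> I" by (rule I.a_inv_closed)
  show "c \<in> carrier K ==> x \<in> I ==> c \<odot> x \<in> I" using ideal_ksub[OF assms] by (auto simp: ksub_def)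
qed

lemma Jp1: "Jp 1 = J"
proof
  have "x \<in> J" if "x \<in> ideal_prod A (carrier A) J" for x
    using that by (induction rule: ideal_prod.induct) (auto intro: idl(3,5)[OF idJ])
  then show "Jp 1 \<subseteq> J" by auto
  have "x \<in> ideal_prod A (carrier A) J" if "x \<in> J" for x
    using ideal_prod.prod[OF one_closed that, of A] idl(1)[OF idJ that] by simp
  then show "J \<subseteq> Jp 1" by auto
qed

lemma Jp_Suc_J: "x \<in> Jp (Suc k) ==> x \<in> J"
  using ideal_prod_inter[OF idp[of k] idJ] by auto

lemma Jp_step: "x \<in> Jp (Suc k) ==> y \<in> J ==> x \<otimes> y \<in> Jp (Suc (Suc k))"
  using ideal_prod.prod[of x "Jp (Suc k)" y J A] by simp

lemma J_stable_zero: assumes "\<And>k. x \<in> Jp (Suc k)" shows "x = \<zero>"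
proof -
  obtain t where t: "Jp t = {\<zero>}" using J_nilpotent[OF idJ] by blast
  have "Jp (Suc t) \<subseteq> Jp t" using ideal_prod_inter[OF idp[of t] idJ] by auto
  then show ?thesis using assms[of t] t by blast
qed

text \<open>An idempotent of \<open>J\<close> lies in every power of \<open>J\<close>, hence is zero
  by nilpotency. This turns congruences between idempotents into equalities.\<close>

lemma J_idem_zero: assumes "x \<in> J" "x \<otimes> x = x" shows "x = \<zero>"
proof (rule J_stable_zero)
  show "x \<in> Jp (Suc k)" for k
  proof (induction k)
    case 0 then show ?case using assms(1) Jp1 by simp
  next
    case (Suc k) then show ?case using Jp_step[OF Suc assms(1)] assms(2) by simp
  qed
qed

definition half :: 'k where "half = inv\<^bsub>K\<^esub> (\<one>\<^bsub>K\<^esub> \<oplus>\<^bsub>K\<^esub> \<one>\<^bsub>K\<^esub>)"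

lemma half: "half \<in> carrier K" "half \<oplus>\<^bsub>K\<^esub> half = \<one>\<^bsub>K\<^esub>"
proof -
  have u: "\<one>\<^bsub>K\<^esub> \<oplus>\<^bsub>K\<^esub> \<one>\<^bsub>K\<^esub> \<in> Units K" using char2 vs.field_Units by simp
  then show h: "half \<in> carrier K" by (simp add: half_def)
  have "half \<otimes>\<^bsub>K\<^esub> (\<one>\<^bsub>K\<^esub> \<oplus>\<^bsub>K\<^esub> \<one>\<^bsub>K\<^esub>) = \<one>\<^bsub>K\<^esub>" using u by (simp add: half_def vs.R.Units_l_inv)
  then show "half \<oplus>\<^bsub>K\<^esub> half = \<one>\<^bsub>K\<^esub>" using h by (simp add: vs.R.r_distr)
qed

lemma half_add: "x \<in> carrier A ==> half \<odot> x \<oplus> half \<odot> x = x"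
  using vs.smult_l_distr[of half half x] half by simp

lemma neg_r: "x \<in> carrier A ==> x \<oplus> \<ominus> x = \<zero>"
  by (metis a_minus_def r_right_minus_eq)

lemma cancel_r: "x \<in> carrier A ==> y \<in> carrier A ==> (x \<ominus> y) \<oplus> y = x"
  by (simp add: a_minus_def a_assoc l_neg)

text \<open>One Newton step for \<open>v v = f\<close>: when \<open>v v = f + 2 m\<close>, the new
  approximation is \<open>v (f - m)\<close>, and because \<open>m\<close> commutes with
  \<open>v\<close> its error consists of terms of order at least two in \<open>m\<close>.\<close>

lemma sqrt_step:
  assumes f: "f \<in> carrier A" "f \<otimes> f = f" and v: "v \<in> carrier A" "f \<otimes> v = v" "v \<otimes> f = v"
    and m: "m \<in> carrier A" "v \<otimes> v = f \<oplus> (m \<oplus> m)" "f \<otimes> m = m" "m \<otimes> f = m" "v \<otimes> m = m \<otimes> v"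
  shows "(v \<ominus> v \<otimes> m) \<otimes> (v \<ominus> v \<otimes> m) \<ominus> f = (f \<oplus> (m \<oplus> m)) \<otimes> (m \<otimes> m) \<ominus> (m \<oplus> m) \<otimes> (m \<oplus> m)"
proof -
  define s where "s = f \<ominus> m"
  define w where "w = m \<oplus> m"
  have s: "s \<in> carrier A" and w: "w \<in> carrier A" using f m by (auto simp: s_def w_def)
  have fw: "f \<otimes> w = w" "w \<otimes> f = w" using m f by (simp_all add: w_def r_distr l_distr)
  have vs: "v \<ominus> v \<otimes> m = v \<otimes> s" using v f m by (simp add: s_def a_minus_def r_distr r_minus)
  have c: "s \<otimes> v = v \<otimes> s" using v f m by (simp add: s_def a_minus_def r_distr l_distr r_minus l_minus)
  have ss: "s \<otimes> s = (f \<ominus> w) \<oplus> m \<otimes> m"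
    using f m by (simp add: s_def w_def a_minus_def r_distr l_distr r_minus l_minus minus_add a_assoc)
  have fwfw: "(f \<oplus> w) \<otimes> (f \<ominus> w) = f \<ominus> w \<otimes> w"
  proof -
    have "(f \<oplus> w) \<otimes> (f \<ominus> w) = (f \<ominus> w) \<oplus> (w \<ominus> w \<otimes> w)"
      using f w fw by (simp add: a_minus_def r_distr l_distr r_minus minus_add a_ac)
    also have "\<dots> = ((f \<ominus> w) \<oplus> w) \<ominus> w \<otimes> w" using f w by (simp add: a_minus_def a_assoc)
    finally show ?thesis using cancel_r f w by simp
  qed
  have "(v \<otimes> s) \<otimes> (v \<otimes> s) = v \<otimes> (s \<otimes> v) \<otimes> s" using v s by (simp add: m_assoc)
  also have "\<dots> = (v \<otimes> v) \<otimes> (s \<otimes> s)" unfolding c using v s by (simp add: m_assoc)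
  also have "\<dots> = (f \<oplus> w) \<otimes> ((f \<ominus> w) \<oplus> m \<otimes> m)" by (simp add: m(2) ss w_def)
  also have "\<dots> = (f \<oplus> w) \<otimes> (f \<ominus> w) \<oplus> (f \<oplus> w) \<otimes> (m \<otimes> m)" using f w m by (simp add: r_distr)
  also have "\<dots> = (f \<ominus> w \<otimes> w) \<oplus> (f \<oplus> w) \<otimes> (m \<otimes> m)" by (simp add: fwfw)
  finally have e: "(v \<otimes> s) \<otimes> (v \<otimes> s) = (f \<ominus> w \<otimes> w) \<oplus> (f \<oplus> w) \<otimes> (m \<otimes> m)" .
  define a where "a = w \<otimes> w"
  define b where "b = (f \<oplus> w) \<otimes> (m \<otimes> m)"
  have ab: "a \<in> carrier A" "b \<in> carrier A" using f w m by (auto simp: a_def b_def)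
  have "(f \<ominus> a) \<oplus> b \<ominus> f = b \<ominus> a"
    using ab f neg_r[of f] by (simp add: a_minus_def a_ac r_neg1 r_neg2) (metis a_assoc a_comm a_inv_closed r_zero)
  then show ?thesis unfolding vs e by (simp add: a_def b_def w_def)
qed

text \<open>Newton iteration inside the corner of \<open>f\<close>. The corrections are even, so the
  degree of \<open>v\<close> is kept; they lie in \<open>J\<close>, so the class of \<open>v\<close>
  is kept; and each step moves the error into the next power of \<open>J\<close>, which eventually
  is zero.\<close>

lemma sqrt_lift:
  assumes f: "f \<in> hcomp A 0" "f \<otimes> f = f" and v: "v \<in> hcomp A g" "f \<otimes> v = v" "v \<otimes> f = v" and vv: "v \<otimes> v \<ominus> f \<in> J"
  shows "\<exists>v'\<in>hcomp A g. f \<otimes> v' = v' \<and> v' \<otimes> f = v' \<and> v' \<otimes> v' = f \<and> v' \<ominus> v \<in> J"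
proof -
  have fc: "f \<in> carrier A" using f hcomp_carrier by blast
  have gg: "g + g = (0::bit)" by (cases g) auto
  have "\<exists>v'\<in>hcomp A g. f \<otimes> v' = v' \<and> v' \<otimes> f = v' \<and> v' \<otimes> v' \<ominus> f \<in> Jp (Suc k) \<and> v' \<ominus> v \<in> J" for k
  proof (induction k)
    case 0
    have "v \<ominus> v \<in> J" using v hcomp_carrier[OF v(1)] idl(2)[OF idJ] by (simp add: a_minus_def r_neg)
    then show ?case using v vv Jp1 by auto
  next
    case (Suc k)
    then obtain u where u: "u \<in> hcomp A g" "f \<otimes> u = u" "u \<otimes> f = u" "u \<otimes> u \<ominus> f \<in> Jp (Suc k)" "u \<ominus> v \<in> J" by blast
    have uc: "u \<in> carrier A" and vc: "v \<in> carrier A" using u v hcomp_carrier by auto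
    define d where "d = u \<otimes> u \<ominus> f"
    \<comment> \<open>Half of the error \<open>d\<close>. It is even because
      \<open>g + g = 0\<close>, and it commutes with \<open>u\<close> because \<open>d\<close> is
      built from \<open>u u\<close> and the unit \<open>f\<close> of the corner.\<close>
    define m where "m = half \<odot> d"
    have d: "d \<in> Jp (Suc k)" "d \<in> carrier A" using u(4) uc fc by (auto simp: d_def)
    have mm: "m \<in> Jp (Suc k)" "m \<in> carrier A" using d half idl(8)[OF idp] by (auto simp: m_def simp del: ideal_power.simps)
    have mJ: "m \<in> J" by (rule Jp_Suc_J[OF mm(1)])
    have uu: "u \<otimes> u = f \<oplus> (m \<oplus> m)" using half_add[OF d(2)] cancel_r[of "u \<otimes> u" f] uc fc d(2) by (simp add: m_def d_def a_comm)
    have fm: "f \<otimes> m = m" "m \<otimes> f = m" and um: "u \<otimes> m = m \<otimes> u"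
    proof -
      have "f \<otimes> d = d" "d \<otimes> f = d" "u \<otimes> d = d \<otimes> u"
        using u(2,3) uc fc f by (simp_all add: d_def a_minus_def r_distr l_distr r_minus l_minus m_assoc) (metis m_assoc)
      then show "f \<otimes> m = m" "m \<otimes> f = m" "u \<otimes> m = m \<otimes> u"
        using half(1) fc uc d(2) by (simp_all add: m_def smult_mult_r smult_mult_l)
    qed
    have dh: "d \<in> hcomp A 0" using hcomp_mult[OF u(1) u(1)] f(1) gg by (auto simp: d_def intro!: hcomp_minus)
    then have mh: "m \<in> hcomp A 0" using half hcomp_smult by (simp add: m_def)
    define u' where "u' = u \<ominus> u \<otimes> m"
    have "u \<otimes> m \<in> hcomp A g" using hcomp_mult[OF u(1) mh] by (simp only: add_0_right)
    then have u'h: "u' \<in> hcomp A g" using u(1) by (auto simp: u'_def intro!: hcomp_minus)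
    have fu': "f \<otimes> u' = u'" "u' \<otimes> f = u'"
      using u(2,3) fm uc fc mm by (simp_all add: u'_def a_minus_def r_distr l_distr r_minus l_minus m_assoc[symmetric]) (simp add: m_assoc)
    have "u' \<otimes> u' \<ominus> f = (f \<oplus> (m \<oplus> m)) \<otimes> (m \<otimes> m) \<ominus> (m \<oplus> m) \<otimes> (m \<oplus> m)"
      unfolding u'_def by (rule sqrt_step[OF fc f(2) uc u(2,3) mm(2) uu fm um])
    moreover have "m \<otimes> m \<in> Jp (Suc (Suc k))" by (rule Jp_step[OF mm(1) mJ])
    moreover have "(m \<oplus> m) \<otimes> (m \<oplus> m) \<in> Jp (Suc (Suc k))"
      by (rule Jp_step[OF idl(3)[OF idp mm(1) mm(1)] idl(3)[OF idJ mJ mJ]])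
    ultimately have sq: "u' \<otimes> u' \<ominus> f \<in> Jp (Suc (Suc k))"
      using idl(4)[OF idp idl(5)[OF idp]] fc mm(2) by (simp del: ideal_power.simps)
    have um: "u \<otimes> m \<in> J" using idl(5)[OF idJ mJ uc] .
    have "u' \<ominus> v = (u \<ominus> v) \<ominus> u \<otimes> m" using uc vc mm by (simp add: u'_def a_minus_def a_ac)
    then have "u' \<ominus> v \<in> J" using idl(4)[OF idJ u(5) um] by simp
    then show ?case using u'h fu' sq by blast
  qed
  then have all: "\<And>k. \<exists>v'\<in>hcomp A g. f \<otimes> v' = v' \<and> v' \<otimes> f = v' \<and> v' \<otimes> v' \<ominus> f \<in> Jp (Suc k) \<and> v' \<ominus> v \<in> J" .
  obtain t where t: "Jp t = {\<zero>}" using J_nilpotent[OF idJ] by blast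
  have "Jp (Suc t) \<subseteq> Jp t" using ideal_prod_inter[OF idp[of t] idJ] by auto
  then obtain v' where v': "v' \<in> hcomp A g" "f \<otimes> v' = v'" "v' \<otimes> f = v'" "v' \<otimes> v' \<ominus> f = \<zero>" "v' \<ominus> v \<in> J" using all[of t] t by blast
  then have "v' \<otimes> v' = f" using fc hcomp_carrier by (metis m_closed r_right_minus_eq)
  then show ?thesis using v' by blast
qed

text \<open>Since 2 is invertible, idempotents correspond to involutions, so idempotents lift by \<open>sqrt_lift\<close>.\<close>

lemma idem_lift:
  assumes f: "f \<in> hcomp A 0" "f \<otimes> f = f" and e: "e \<in> hcomp A 0" "f \<otimes> e = e" "e \<otimes> f = e" and ee: "e \<otimes> e \<ominus> e \<in> J"
  shows "\<exists>e'\<in>hcomp A 0. f \<otimes> e' = e' \<and> e' \<otimes> f = e' \<and> e' \<otimes> e' = e' \<and> e' \<ominus> e \<in> J"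
proof -
  have c: "f \<in> carrier A" "e \<in> carrier A" using f e hcomp_carrier by auto
  \<comment> \<open>The involution belonging to \<open>e\<close> in the corner of \<open>f\<close>;
    its defect \<open>s s - f\<close> is four times the defect \<open>e e - e\<close>.\<close>
  define s where "s = f \<ominus> (e \<oplus> e)"
  have s: "s \<in> hcomp A 0" using f e by (auto simp: s_def intro!: hcomp_minus hcomp_add)
  then have sc: "s \<in> carrier A" using hcomp_carrier by blast
  have fs: "f \<otimes> s = s" "s \<otimes> f = s"
    using c e f by (simp_all add: s_def a_minus_def r_distr l_distr r_minus l_minus)
  define d where "d = e \<otimes> e \<ominus> e"
  have d: "d \<in> carrier A" "d \<in> J" using c ee by (auto simp: d_def)
  have ed: "e \<otimes> e = d \<oplus> e" using c cancel_r by (simp add: d_def)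
  have "s \<otimes> s \<ominus> f = (d \<oplus> d) \<oplus> (d \<oplus> d)"
  proof -
    have "s \<otimes> (e \<oplus> e) = (e \<oplus> e) \<ominus> ((e \<otimes> e \<oplus> e \<otimes> e) \<oplus> (e \<otimes> e \<oplus> e \<otimes> e))"
      using c e by (simp add: s_def a_minus_def r_distr l_distr l_minus minus_add a_ac)
    then have "s \<otimes> s = s \<ominus> ((e \<oplus> e) \<ominus> ((e \<otimes> e \<oplus> e \<otimes> e) \<oplus> (e \<otimes> e \<oplus> e \<otimes> e)))"
      using fs(2) sc c by (metis (no_types, lifting) a_minus_def r_distr r_minus s_def a_closed a_inv_closed)
    also have "\<dots> = (d \<oplus> d) \<oplus> (d \<oplus> d) \<oplus> f"
      unfolding ed s_def using c d by (simp add: a_minus_def minus_add a_ac r_neg1 r_neg2 r_neg l_neg)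
    finally show ?thesis using c d by (simp add: a_minus_def a_assoc neg_r)
  qed
  then have "s \<otimes> s \<ominus> f \<in> J" using idl(3)[OF idJ] d by simp
  then obtain s' where s': "s' \<in> hcomp A 0" "f \<otimes> s' = s'" "s' \<otimes> f = s'" "s' \<otimes> s' = f" "s' \<ominus> s \<in> J"
    using sqrt_lift[OF f s fs] by blast
  have s'c: "s' \<in> carrier A" using s' hcomp_carrier by blast
  \<comment> \<open>The way back from an involution to an idempotent; \<open>e'\<close> is exactly
    idempotent because \<open>s'\<close> is an exact square root of \<open>f\<close>.\<close>
  define e' where "e' = half \<odot> (f \<ominus> s')"
  have e'h: "e' \<in> hcomp A 0" using f s' half by (auto simp: e'_def intro!: hcomp_smult hcomp_minus)
  have fe: "f \<otimes> e' = e'" "e' \<otimes> f = e'"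
    using c s' s'c half(1) f by (simp_all add: e'_def smult_mult_l smult_mult_r a_minus_def r_distr l_distr r_minus l_minus)
  have "(f \<ominus> s') \<otimes> (f \<ominus> s') = (f \<ominus> s') \<oplus> (f \<ominus> s')"
    using c s' s'c f by (simp add: a_minus_def r_distr l_distr r_minus l_minus minus_add a_ac)
  then have "e' \<otimes> e' = half \<odot> (half \<odot> (f \<ominus> s') \<oplus> half \<odot> (f \<ominus> s'))"
    using c s'c half(1) by (simp add: e'_def smult_mult_l smult_mult_r vs.smult_r_distr)
  then have ee': "e' \<otimes> e' = e'" using half_add c s'c by (simp add: e'_def)
  have "e = half \<odot> (f \<ominus> s)"
  proof -
    have "f \<ominus> s = e \<oplus> e" using c r_neg2[of f "e \<oplus> e"] by (simp add: s_def a_minus_def minus_add)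
    then show ?thesis using half_add c half(1) by (simp add: vs.smult_r_distr)
  qed
  then have "e' \<ominus> e = half \<odot> ((f \<ominus> s') \<ominus> (f \<ominus> s))"
    using c sc s'c half(1) by (simp add: e'_def a_minus_def vs.smult_r_distr vs.smult_r_minus)
  also have "(f \<ominus> s') \<ominus> (f \<ominus> s) = \<ominus> (s' \<ominus> s)"
    using c sc s'c by (simp add: a_minus_def minus_add a_ac r_neg1 r_neg2)
  finally have "e' \<ominus> e \<in> J" using idl(8)[OF idJ half(1) idl(7)[OF idJ s'(5)]] by simp
  then show ?thesis using e'h fe ee' by blast
qed

end

section \<open>Congruence modulo the radical\<close>

context rad_salg begin

text \<open>Membership in the carrier is part of the relation, so that chains of congruences and
  products of congruences carry no side conditions.\<close>

definition eqJ :: "'a => 'a => bool" (infix "\<doteq>" 50) where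
  "x \<doteq> y \<longleftrightarrow> x \<in> carrier A \<and> y \<in> carrier A \<and> x \<ominus> y \<in> J"

lemma eqJ_closed: "x \<doteq> y ==> x \<in> carrier A" "x \<doteq> y ==> y \<in> carrier A"
  by (auto simp: eqJ_def)

lemma eqJ_refl [simp, intro]: "x \<in> carrier A ==> x \<doteq> x"
  using idl(2)[OF idJ] by (simp add: eqJ_def a_minus_def neg_r)

lemma eqJ_sym: assumes "x \<doteq> y" shows "y \<doteq> x"
proof -
  have "y \<ominus> x = \<ominus> (x \<ominus> y)" using assms by (simp add: eqJ_def a_minus_def minus_add a_comm)
  then show ?thesis using assms idl(7)[OF idJ] by (simp add: eqJ_def)
qed

lemma eqJ_trans [trans]: assumes "x \<doteq> y" "y \<doteq> z" shows "x \<doteq> z"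
proof -
  have "x \<ominus> z = (x \<ominus> y) \<oplus> (y \<ominus> z)" using assms by (simp add: eqJ_def a_minus_def a_assoc r_neg1)
  then show ?thesis using assms idl(3)[OF idJ] by (simp add: eqJ_def)
qed

lemma eqJ_add: assumes "x \<doteq> y" "z \<doteq> w" shows "x \<oplus> z \<doteq> y \<oplus> w"
proof -
  have "x \<oplus> z \<ominus> (y \<oplus> w) = (x \<ominus> y) \<oplus> (z \<ominus> w)" using assms by (simp add: eqJ_def a_minus_def minus_add a_ac)
  then show ?thesis using assms idl(3)[OF idJ] by (simp add: eqJ_def)
qed

lemma eqJ_neg: assumes "x \<doteq> y" shows "\<ominus> x \<doteq> \<ominus> y"
proof -
  have "\<ominus> x \<ominus> \<ominus> y = \<ominus> (x \<ominus> y)" using assms by (simp add: eqJ_def a_minus_def minus_add)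
  then show ?thesis using assms idl(7)[OF idJ] by (simp add: eqJ_def)
qed

lemma eqJ_minus: "x \<doteq> y ==> z \<doteq> w ==> x \<ominus> z \<doteq> y \<ominus> w"
  unfolding a_minus_def by (intro eqJ_add eqJ_neg)

lemma eqJ_mult: assumes "x \<doteq> y" "z \<doteq> w" shows "x \<otimes> z \<doteq> y \<otimes> w"
proof -
  have "x \<otimes> z \<ominus> y \<otimes> w = (x \<ominus> y) \<otimes> z \<oplus> y \<otimes> (z \<ominus> w)"
    using assms by (simp add: eqJ_def a_minus_def l_distr r_distr l_minus r_minus a_assoc r_neg1)
  then show ?thesis using assms idl(3,5,6)[OF idJ] by (simp add: eqJ_def)
qed

lemma eqJ_smult: assumes "c \<in> carrier K" "x \<doteq> y" shows "c \<odot> x \<doteq> c \<odot> y"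
proof -
  have "c \<odot> x \<ominus> c \<odot> y = c \<odot> (x \<ominus> y)" using assms by (simp add: eqJ_def a_minus_def vs.smult_r_distr vs.smult_r_minus)
  then show ?thesis using assms idl(8)[OF idJ] by (simp add: eqJ_def)
qed

lemma eqJ_zero: "x \<doteq> \<zero> \<longleftrightarrow> x \<in> J"
  using idl(1)[OF idJ] by (auto simp: eqJ_def a_minus_def)

lemma eqJ_mem: "x \<doteq> y ==> y \<in> J ==> x \<in> J"
  using eqJ_trans eqJ_zero by blast

lemma eqJ_finsum: "finite I ==> (\<And>i. i \<in> I ==> x i \<doteq> y i) ==> finsum A x I \<doteq> finsum A y I"
proof (induction I rule: finite_induct)
  case (insert i I)
  have c: "x \<in> I \<rightarrow> carrier A" "y \<in> I \<rightarrow> carrier A" "x i \<in> carrier A" "y i \<in> carrier A" using insert.prems eqJ_closed by blast+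
  show ?case using insert c by (simp add: eqJ_add)
qed simp

end

text \<open>The state before any correction: \<open>e i\<close> and \<open>v i\<close> represent the
  identity and the odd generator of the i-th summand, and the relations hold modulo \<open>J\<close>
  only. The alternative \<open>v i = \<zero>\<close> is exact, so a missing odd generator needs no
  lifting.\<close>

locale basic_salg = rad_salg K A for K :: "('k, 'x) ring_scheme" and A :: "('k, 'a, 'y) gmodule_scheme" (structure) +
  fixes n :: nat and e v :: "nat => 'a"
  assumes e_h: "i \<in> {1..n} ==> e i \<in> hcomp A 0" and v_h: "i \<in> {1..n} ==> v i \<in> hcomp A 1"
    and e_idem: "i \<in> {1..n} ==> e i \<otimes> e i \<doteq> e i"
    and e_sum: "finsum A e {1..n} \<doteq> \<one>"
    and e_orth: "[| i \<in> {1..n}; j \<in> {1..n}; i \<noteq> j; x \<in> carrier A |] ==> e i \<otimes> x \<otimes> e j \<doteq> \<zero>"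
    and v_e: "i \<in> {1..n} ==> e i \<otimes> v i \<doteq> v i" "i \<in> {1..n} ==> v i \<otimes> e i \<doteq> v i"
    and vv: "i \<in> {1..n} ==> v i \<otimes> v i \<doteq> e i \<or> v i = \<zero>"
    and gen0: "[| i \<in> {1..n}; x \<in> hcomp A 0 |] ==> \<exists>c\<in>carrier K. e i \<otimes> x \<otimes> e i \<doteq> c \<odot> e i"
    and gen1: "[| i \<in> {1..n}; x \<in> hcomp A 1 |] ==> \<exists>c\<in>carrier K. e i \<otimes> x \<otimes> e i \<doteq> c \<odot> v i"
    and e_nJ: "i \<in> {1..n} ==> e i \<notin> J"
begin

text \<open>Induction on the number of idempotents. The next one is lifted inside the corner of
  \<open>g = 1 - F\<close>, where \<open>F\<close> is the sum of the earlier ones, so exact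
  orthogonality to all of them comes for free.\<close>

lemma orth_idempotents:
  "k \<le> n ==> \<exists>f. (\<forall>i\<in>{1..k}. f i \<in> hcomp A 0 \<and> f i \<otimes> f i = f i \<and> f i \<doteq> e i) \<and>
     (\<forall>i\<in>{1..k}. \<forall>j\<in>{1..k}. i \<noteq> j \<longrightarrow> f i \<otimes> f j = \<zero>)"
proof (induction k)
  case (Suc k)
  obtain f where f0: "(\<forall>i\<in>{1..k}. f i \<in> hcomp A 0 \<and> f i \<otimes> f i = f i \<and> f i \<doteq> e i) \<and>
     (\<forall>i\<in>{1..k}. \<forall>j\<in>{1..k}. i \<noteq> j \<longrightarrow> f i \<otimes> f j = \<zero>)"
    using Suc.IH[OF Suc_leD[OF Suc.prems]] by blast
  have f: "\<And>i. i \<in> {1..k} ==> f i \<in> hcomp A 0" "\<And>i. i \<in> {1..k} ==> f i \<otimes> f i = f i"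
    "\<And>i. i \<in> {1..k} ==> f i \<doteq> e i" "\<And>i j. i \<in> {1..k} ==> j \<in> {1..k} ==> i \<noteq> j ==> f i \<otimes> f j = \<zero>"
    using f0 by blast+
  have fc: "i \<in> {1..k} ==> f i \<in> carrier A" for i using f(1) hcomp_carrier by blast
  define F where "F = finsum A f {1..k}"
  have Fh: "F \<in> hcomp A 0"
  proof -
    have "finsum A f {1..m} \<in> hcomp A 0" if "m \<le> k" for m
      using that
    proof (induction m)
      case (Suc m)
      then have "f \<in> {1..m} \<rightarrow> carrier A" "f (Suc m) \<in> carrier A" using fc by auto
      then have "finsum A f {1..Suc m} = f (Suc m) \<oplus> finsum A f {1..m}" by (simp add: atLeastAtMostSuc_conv)
      then show ?case using Suc f(1)[of "Suc m"] by auto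
    qed simp
    then show ?thesis by (simp add: F_def)
  qed
  have Fc: "F \<in> carrier A" using Fh hcomp_carrier by blast
  have fP: "f \<in> {1..k} \<rightarrow> carrier A" using fc by auto
  have fF: "f i \<otimes> F = f i" "F \<otimes> f i = f i" if i: "i \<in> {1..k}" for i
  proof -
    have "f i \<otimes> F = finsum A (\<lambda>j. f i \<otimes> f j) {1..k}" unfolding F_def using i fP fc by (intro finsum_rdistr) auto
    also have "\<dots> = finsum A (\<lambda>j. if i = j then f j else \<zero>) {1..k}"
      using i fc f(2,4) by (intro finsum_cong') auto
    also have "\<dots> = f i" using i fP by (intro add.finprod_singleton) auto
    finally show "f i \<otimes> F = f i" .
    have "F \<otimes> f i = finsum A (\<lambda>j. f j \<otimes> f i) {1..k}" unfolding F_def using i fP fc by (intro finsum_ldistr) auto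
    also have "\<dots> = finsum A (\<lambda>j. if i = j then f j else \<zero>) {1..k}"
      using i fc f(2,4) by (intro finsum_cong') auto
    also have "\<dots> = f i" using i fP by (intro add.finprod_singleton) auto
    finally show "F \<otimes> f i = f i" .
  qed
  have FF: "F \<otimes> F = F"
  proof -
    have "F \<otimes> F = finsum A (\<lambda>j. F \<otimes> f j) {1..k}" unfolding F_def using fP Fc[unfolded F_def] by (intro finsum_rdistr) auto
    also have "\<dots> = F" unfolding F_def[symmetric] unfolding F_def using fF(2)[unfolded F_def] fP by (intro finsum_cong') auto
    finally show ?thesis .
  qed
  define g where "g = \<one> \<ominus> F"
  have gh: "g \<in> hcomp A 0" using Fh by (auto simp: g_def intro!: hcomp_minus)
  have gc: "g \<in> carrier A" using gh hcomp_carrier by blast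
  have gg: "g \<otimes> g = g" using Fc FF by (simp add: g_def a_minus_def l_distr r_distr l_minus r_minus neg_r)
  have fg: "f i \<otimes> g = \<zero>" "g \<otimes> f i = \<zero>" if "i \<in> {1..k}" for i
    using fF[OF that] Fc fc[OF that] by (simp_all add: g_def a_minus_def l_distr r_distr l_minus r_minus neg_r)
  let ?e = "e (Suc k)"
  have k1: "Suc k \<in> {1..n}" using Suc.prems by simp
  have eh: "?e \<in> hcomp A 0" using e_h k1 by blast
  have ec: "?e \<in> carrier A" using eh hcomp_carrier by blast
  have fe: "f i \<otimes> ?e \<doteq> \<zero>" "?e \<otimes> f i \<doteq> \<zero>" if i: "i \<in> {1..k}" for i
  proof -
    have i1: "i \<in> {1..n}" "i \<noteq> Suc k" using i Suc.prems by auto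
    note i' = i1 hcomp_carrier[OF e_h[OF i1(1)]]
    have "f i \<otimes> ?e \<doteq> e i \<otimes> ?e" using eqJ_mult f(3)[OF i] ec by blast
    also have "e i \<otimes> ?e \<doteq> \<zero>" using e_orth[OF i'(1) k1 i'(2) one_closed] i' by simp
    finally show "f i \<otimes> ?e \<doteq> \<zero>" .
    have "?e \<otimes> f i \<doteq> ?e \<otimes> e i" using eqJ_mult f(3)[OF i] ec by blast
    also have "?e \<otimes> e i \<doteq> \<zero>" using e_orth[OF k1 i'(1) i'(2)[symmetric] one_closed] i' ec by simp
    finally show "?e \<otimes> f i \<doteq> \<zero>" .
  qed
  have Fe: "F \<otimes> ?e \<doteq> \<zero>" "?e \<otimes> F \<doteq> \<zero>"
  proof -
    have z: "finsum A (\<lambda>j. \<zero>) {1..k} = \<zero>" by simp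
    have "F \<otimes> ?e = finsum A (\<lambda>j. f j \<otimes> ?e) {1..k}" unfolding F_def using fP ec by (intro finsum_ldistr) auto
    also have "\<dots> \<doteq> finsum A (\<lambda>j. \<zero>) {1..k}" using fe by (intro eqJ_finsum) auto
    finally show "F \<otimes> ?e \<doteq> \<zero>" using z by simp
    have "?e \<otimes> F = finsum A (\<lambda>j. ?e \<otimes> f j) {1..k}" unfolding F_def using fP ec by (intro finsum_rdistr) auto
    also have "\<dots> \<doteq> finsum A (\<lambda>j. \<zero>) {1..k}" using fe by (intro eqJ_finsum) auto
    finally show "?e \<otimes> F \<doteq> \<zero>" using z by simp
  qed
  \<comment> \<open>Compression into the corner of \<open>g\<close>. It changes the class modulo
    \<open>J\<close> by nothing, because \<open>F\<close> and the new element annihilate each other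
    modulo \<open>J\<close>.\<close>
  define e' where "e' = g \<otimes> ?e \<otimes> g"
  have e'h: "e' \<in> hcomp A 0" using hcomp_mult[OF hcomp_mult[OF gh eh] gh] by (simp add: e'_def)
  have ge: "g \<otimes> ?e \<doteq> ?e" "?e \<otimes> g \<doteq> ?e"
    using eqJ_minus[OF eqJ_refl[OF ec] Fe(1)] eqJ_minus[OF eqJ_refl[OF ec] Fe(2)] ec Fc
    by (simp_all add: g_def a_minus_def l_distr r_distr l_minus r_minus)
  have e'e: "e' \<doteq> ?e" unfolding e'_def using eqJ_mult[OF ge(1) eqJ_refl[OF gc]] ge(2) by (rule eqJ_trans)
  have "e' \<otimes> e' \<doteq> e'" using eqJ_trans[OF eqJ_mult[OF e'e e'e] eqJ_trans[OF e_idem[OF k1] eqJ_sym[OF e'e]]] .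
  moreover have "g \<otimes> e' = e'" "e' \<otimes> g = e'" using gc ec gg by (simp_all add: e'_def m_assoc) (simp add: m_assoc[symmetric])
  ultimately obtain h where h: "h \<in> hcomp A 0" "g \<otimes> h = h" "h \<otimes> g = h" "h \<otimes> h = h" "h \<ominus> e' \<in> J"
    using idem_lift[OF gh gg e'h] by (auto simp: eqJ_def)
  have hc: "h \<in> carrier A" using h hcomp_carrier by blast
  have he: "h \<doteq> ?e" using eqJ_trans[OF _ e'e, of h] h hc eqJ_closed(1)[OF e'e] by (auto simp: eqJ_def)
  have fh: "f i \<otimes> h = \<zero>" "h \<otimes> f i = \<zero>" if i: "i \<in> {1..k}" for i
  proof -
    have "f i \<otimes> h = (f i \<otimes> g) \<otimes> h" using h(2) fc[OF i] gc hc by (simp add: m_assoc)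
    then show "f i \<otimes> h = \<zero>" using fg[OF i] hc by simp
    have "h \<otimes> f i = h \<otimes> (g \<otimes> f i)" using h(3) fc[OF i] gc hc by (simp add: m_assoc[symmetric])
    then show "h \<otimes> f i = \<zero>" using fg[OF i] hc by simp
  qed
  have split: "i \<in> {1..Suc k} \<longleftrightarrow> i \<in> {1..k} \<or> i = Suc k" for i by auto
  show ?case
    by (rule exI[of _ "f(Suc k := h)"]) (use f h he fh in \<open>auto simp: split simp del: atLeastAtMost_iff\<close>, auto)
qed auto

lemma exact_lift:
  obtains f u where
    "\<And>i. i \<in> {1..n} ==> f i \<in> hcomp A 0" "\<And>i. i \<in> {1..n} ==> u i \<in> hcomp A 1"
    "\<And>i. i \<in> {1..n} ==> f i \<otimes> f i = f i" "\<And>i j. [| i \<in> {1..n}; j \<in> {1..n}; i \<noteq> j |] ==> f i \<otimes> f j = \<zero>"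
    "finsum A f {1..n} = \<one>"
    "\<And>i. i \<in> {1..n} ==> f i \<otimes> u i = u i" "\<And>i. i \<in> {1..n} ==> u i \<otimes> f i = u i"
    "\<And>i. i \<in> {1..n} ==> u i \<otimes> u i = f i \<or> u i = \<zero>"
    "\<And>i j x. [| i \<in> {1..n}; j \<in> {1..n}; i \<noteq> j; x \<in> carrier A |] ==> f i \<otimes> x \<otimes> f j \<in> J"
    "\<And>i x. [| i \<in> {1..n}; x \<in> hcomp A 0 |] ==> \<exists>c\<in>carrier K. f i \<otimes> x \<otimes> f i \<doteq> c \<odot> f i"
    "\<And>i x. [| i \<in> {1..n}; x \<in> hcomp A 1 |] ==> \<exists>c\<in>carrier K. f i \<otimes> x \<otimes> f i \<doteq> c \<odot> u i"
    "\<And>i. i \<in> {1..n} ==> f i \<notin> J" "\<And>i. i \<in> {1..n} ==> f i \<doteq> e i"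
proof -
  obtain f where f: "\<And>i. i \<in> {1..n} ==> f i \<in> hcomp A 0" "\<And>i. i \<in> {1..n} ==> f i \<otimes> f i = f i"
    "\<And>i. i \<in> {1..n} ==> f i \<doteq> e i" "\<And>i j. i \<in> {1..n} ==> j \<in> {1..n} ==> i \<noteq> j ==> f i \<otimes> f j = \<zero>"
    using orth_idempotents[OF order_refl] by blast
  have fc: "i \<in> {1..n} ==> f i \<in> carrier A" for i using f(1) hcomp_carrier by blast
  have vc: "i \<in> {1..n} ==> v i \<in> carrier A" for i using v_h hcomp_carrier by blast
  have fP: "f \<in> {1..n} \<rightarrow> carrier A" using fc by auto
  define F where "F = finsum A f {1..n}"
  have Fc: "F \<in> carrier A" using fP by (simp add: F_def)
  have Ff: "F \<otimes> f i = f i" if i: "i \<in> {1..n}" for i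
  proof -
    have "F \<otimes> f i = finsum A (\<lambda>j. f j \<otimes> f i) {1..n}" unfolding F_def using i fP fc by (intro finsum_ldistr) auto
    also have "\<dots> = finsum A (\<lambda>j. if i = j then f j else \<zero>) {1..n}"
      using i fc f(2,4) by (intro finsum_cong') auto
    also have "\<dots> = f i" using i fP by (intro add.finprod_singleton) auto
    finally show "F \<otimes> f i = f i" .
  qed
  have FF: "F \<otimes> F = F"
  proof -
    have "F \<otimes> F = finsum A (\<lambda>j. F \<otimes> f j) {1..n}" unfolding F_def using fP Fc[unfolded F_def] by (intro finsum_rdistr) auto
    also have "\<dots> = F" unfolding F_def[symmetric] unfolding F_def using Ff[unfolded F_def] fP by (intro finsum_cong') auto
    finally show ?thesis .
  qed
  \<comment> \<open>The complement \<open>1 - F\<close> is an idempotent lying in \<open>J\<close>,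
    and such an idempotent is zero; so the lifted idempotents add up exactly to the unit.\<close>
  have F1: "F = \<one>"
  proof -
    have "F \<doteq> finsum A e {1..n}" unfolding F_def using f(3) by (intro eqJ_finsum) auto
    then have "F \<doteq> \<one>" using e_sum by (rule eqJ_trans)
    then have "\<one> \<ominus> F \<in> J" using eqJ_sym by (auto simp: eqJ_def)
    moreover have "(\<one> \<ominus> F) \<otimes> (\<one> \<ominus> F) = \<one> \<ominus> F" using Fc FF by (simp add: a_minus_def l_distr r_distr l_minus r_minus neg_r)
    ultimately have "\<one> \<ominus> F = \<zero>" by (rule J_idem_zero)
    then show ?thesis using Fc by simp
  qed
  have sandwich: "f i \<otimes> x \<otimes> f j \<doteq> e i \<otimes> x \<otimes> e j" if "i \<in> {1..n}" "j \<in> {1..n}" "x \<in> carrier A" for i j x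
    using that f(3) by (intro eqJ_mult) auto
  have "\<exists>u\<in>hcomp A 1. f i \<otimes> u = u \<and> u \<otimes> f i = u \<and> (u \<otimes> u = f i \<or> u = \<zero>) \<and> u \<doteq> v i" if i: "i \<in> {1..n}" for i
  proof (cases "v i = \<zero>")
    case True then show ?thesis using fc[OF i] by (intro bexI[of _ \<zero>]) auto
  next
    case False
    then have vvi: "v i \<otimes> v i \<doteq> e i" using vv[OF i] by blast
    \<comment> \<open>The odd element is compressed into the corner of the exact idempotent before
      its square is corrected, as \<open>sqrt_lift\<close> works inside a corner.\<close>
    define w where "w = f i \<otimes> v i \<otimes> f i"
    have wh: "w \<in> hcomp A 1" using hcomp_mult[OF hcomp_mult[OF f(1)[OF i] v_h[OF i]] f(1)[OF i]] by (simp add: w_def)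
    have fw: "f i \<otimes> w = w" "w \<otimes> f i = w" using fc[OF i] vc[OF i] f(2)[OF i]
      by (simp_all add: w_def m_assoc) (simp add: m_assoc[symmetric])
    have "w \<doteq> e i \<otimes> v i \<otimes> e i" unfolding w_def using sandwich[OF i i vc[OF i]] .
    also have "e i \<otimes> v i \<otimes> e i \<doteq> v i \<otimes> e i" using eqJ_mult[OF v_e(1)[OF i] eqJ_refl] eqJ_closed(2)[OF f(3)[OF i]] by blast
    also have "v i \<otimes> e i \<doteq> v i" by (rule v_e(2)[OF i])
    finally have wv: "w \<doteq> v i" .
    have "w \<otimes> w \<doteq> f i" using eqJ_trans[OF eqJ_mult[OF wv wv] eqJ_trans[OF vvi eqJ_sym[OF f(3)[OF i]]]] .
    then have "w \<otimes> w \<ominus> f i \<in> J" by (simp add: eqJ_def)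
    then obtain u where u: "u \<in> hcomp A 1" "f i \<otimes> u = u" "u \<otimes> f i = u" "u \<otimes> u = f i" "u \<ominus> w \<in> J"
      using sqrt_lift[OF f(1)[OF i] f(2)[OF i] wh fw] by blast
    have "u \<doteq> w" using u wh hcomp_carrier by (auto simp: eqJ_def)
    then show ?thesis using u eqJ_trans[OF _ wv] by blast
  qed
  then obtain u where u: "\<And>i. i \<in> {1..n} ==> u i \<in> hcomp A 1 \<and> f i \<otimes> u i = u i \<and> u i \<otimes> f i = u i \<and> (u i \<otimes> u i = f i \<or> u i = \<zero>) \<and> u i \<doteq> v i"
    by metis
  show thesis
  proof (rule that[of f u])
    show "finsum A f {1..n} = \<one>" using F1 by (simp add: F_def)
    show "f i \<otimes> x \<otimes> f j \<in> J" if "i \<in> {1..n}" "j \<in> {1..n}" "i \<noteq> j" "x \<in> carrier A" for i j x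
      using eqJ_trans[OF sandwich e_orth] that eqJ_zero by blast
    show "\<exists>c\<in>carrier K. f i \<otimes> x \<otimes> f i \<doteq> c \<odot> f i" if i: "i \<in> {1..n}" and x: "x \<in> hcomp A 0" for i x
    proof -
      obtain c where "c \<in> carrier K" "e i \<otimes> x \<otimes> e i \<doteq> c \<odot> e i" using gen0[OF i x] by blast
      then show ?thesis using eqJ_trans[OF sandwich[OF i i hcomp_carrier[OF x]]] eqJ_trans eqJ_smult[OF _ eqJ_sym[OF f(3)[OF i]]] by blast
    qed
    show "\<exists>c\<in>carrier K. f i \<otimes> x \<otimes> f i \<doteq> c \<odot> u i" if i: "i \<in> {1..n}" and x: "x \<in> hcomp A 1" for i x
    proof -
      obtain c where "c \<in> carrier K" "e i \<otimes> x \<otimes> e i \<doteq> c \<odot> v i" using gen1[OF i x] by blast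
      then show ?thesis using eqJ_trans[OF sandwich[OF i i hcomp_carrier[OF x]]] eqJ_trans eqJ_smult[OF _ eqJ_sym] u[OF i] by blast
    qed
    show "f i \<notin> J" if "i \<in> {1..n}" for i using eqJ_mem[OF eqJ_sym[OF f(3)[OF that]]] e_nJ[OF that] by blast
  qed (use f u in blast)+
qed

end

section \<open>The lifted copy of the semisimple quotient and Peirce decomposition\<close>

locale split_salg = rad_salg K A for K :: "('k, 'x) ring_scheme" and A :: "('k, 'a, 'y) gmodule_scheme" (structure) +
  fixes n :: nat and f u :: "nat => 'a"
  assumes f_h: "i \<in> {1..n} ==> f i \<in> hcomp A 0" and u_h: "i \<in> {1..n} ==> u i \<in> hcomp A 1"
    and ff: "i \<in> {1..n} ==> f i \<otimes> f i = f i"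
    and f_orth: "[| i \<in> {1..n}; j \<in> {1..n}; i \<noteq> j |] ==> f i \<otimes> f j = \<zero>"
    and f_sum: "finsum A f {1..n} = \<one>"
    and fu: "i \<in> {1..n} ==> f i \<otimes> u i = u i" and uf: "i \<in> {1..n} ==> u i \<otimes> f i = u i"
    and uu: "i \<in> {1..n} ==> u i \<otimes> u i = f i \<or> u i = \<zero>"
    and fxf: "[| i \<in> {1..n}; j \<in> {1..n}; i \<noteq> j; x \<in> carrier A |] ==> f i \<otimes> x \<otimes> f j \<in> J"
    and f_gen0: "[| i \<in> {1..n}; x \<in> hcomp A 0 |] ==> \<exists>c\<in>carrier K. f i \<otimes> x \<otimes> f i \<doteq> c \<odot> f i"
    and f_gen1: "[| i \<in> {1..n}; x \<in> hcomp A 1 |] ==> \<exists>c\<in>carrier K. f i \<otimes> x \<otimes> f i \<doteq> c \<odot> u i"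
    and f_nJ: "i \<in> {1..n} ==> f i \<notin> J"
begin

lemma f_closed [simp]: "i \<in> {1..n} ==> f i \<in> carrier A"
  using f_h hcomp_carrier by blast

lemma u_closed [simp]: "i \<in> {1..n} ==> u i \<in> carrier A"
  using u_h hcomp_carrier by blast

lemma f_Pi: "f \<in> {1..n} \<rightarrow> carrier A" using f_closed by blast

lemma sum_f_l: assumes "x \<in> carrier A" shows "finsum A (\<lambda>i. f i \<otimes> x) {1..n} = x"
proof -
  have "\<one> \<otimes> x = finsum A (\<lambda>i. f i \<otimes> x) {1..n}" unfolding f_sum[symmetric] using assms f_Pi by (intro finsum_ldistr) auto
  then show ?thesis using assms by simp
qed

lemma sum_f_r: assumes "x \<in> carrier A" shows "finsum A (\<lambda>i. x \<otimes> f i) {1..n} = x"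
proof -
  have "x \<otimes> \<one> = finsum A (\<lambda>i. x \<otimes> f i) {1..n}" unfolding f_sum[symmetric] using assms f_Pi by (intro finsum_rdistr) auto
  then show ?thesis using assms by simp
qed

lemma eq_by_f: assumes "x \<in> carrier A" "y \<in> carrier A" "\<And>i. i \<in> {1..n} ==> f i \<otimes> x = f i \<otimes> y" shows "x = y"
proof -
  have "finsum A (\<lambda>i. f i \<otimes> x) {1..n} = finsum A (\<lambda>i. f i \<otimes> y) {1..n}" using assms by (intro finsum_cong') auto
  then show ?thesis using sum_f_l assms by simp
qed

text \<open>Since the \<open>f i\<close> add up to the unit, \<open>x\<close> is the sum of its rows
  \<open>f i x\<close>; membership in an ideal can be tested row by row.\<close>

lemma ideal_by_f: assumes "ideal I A" "x \<in> carrier A" "\<And>i. i \<in> {1..n} ==> f i \<otimes> x \<in> I" shows "x \<in> I"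
proof -
  interpret I: ideal I A by (rule assms(1))
  have "finsum A (\<lambda>i. f i \<otimes> x) S \<in> I" if "finite S" "S \<subseteq> {1..n}" for S
    using that
  proof (induction S rule: finite_induct)
    case (insert i S)
    have c: "(\<lambda>i. f i \<otimes> x) \<in> S \<rightarrow> carrier A" "f i \<otimes> x \<in> carrier A" using insert.prems assms(2) f_closed by blast+
    have "f i \<otimes> x \<in> I" using assms(3) insert.prems by blast
    then show ?case using insert c I.a_closed by simp
  qed (simp add: I.zero_closed)
  then show ?thesis using sum_f_l[OF assms(2)] by (metis finite_atLeastAtMost order_refl)
qed

text \<open>The lifted copy of the i-th gr-division summand. If \<open>u i\<close> is zero it is a
  line, and the same formula serves both types of summand.\<close>

definition piece :: "nat => 'a set" where
  "piece i = {a \<odot> f i \<oplus> b \<odot> u i | a b. a \<in> carrier K \<and> b \<in> carrier K}"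

text \<open>The Wedderburn complement, that is, the sum of the pieces. It is described by conditions
  on each \<open>f i\<close> so that closure properties are checked one index at a time;
  \<open>wedd_sum_piece\<close> turns families of pieces into elements.\<close>

definition wedd :: "'a set" where
  "wedd = {r \<in> carrier A. \<forall>i\<in>{1..n}. f i \<otimes> r = r \<otimes> f i \<and> f i \<otimes> r \<in> piece i}"

lemma piece_closed: "i \<in> {1..n} ==> x \<in> piece i ==> x \<in> carrier A"
  unfolding piece_def by auto

lemma pieceI: "a \<in> carrier K ==> b \<in> carrier K ==> a \<odot> f i \<oplus> b \<odot> u i \<in> piece i"
  unfolding piece_def by blast

lemma piece_add: assumes i: "i \<in> {1..n}" and "x \<in> piece i" "y \<in> piece i" shows "x \<oplus> y \<in> piece i"
proof -
  obtain a b c d where *: "a \<in> carrier K" "b \<in> carrier K" "c \<in> carrier K" "d \<in> carrier K"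
    "x = a \<odot> f i \<oplus> b \<odot> u i" "y = c \<odot> f i \<oplus> d \<odot> u i" using assms unfolding piece_def by blast
  have "x \<oplus> y = (a \<oplus>\<^bsub>K\<^esub> c) \<odot> f i \<oplus> (b \<oplus>\<^bsub>K\<^esub> d) \<odot> u i"
    using * i by (simp add: vs.smult_l_distr a_ac)
  then show ?thesis using pieceI[of "a \<oplus>\<^bsub>K\<^esub> c" "b \<oplus>\<^bsub>K\<^esub> d" i] * by simp
qed

lemma piece_mult: assumes i: "i \<in> {1..n}" and "x \<in> piece i" "y \<in> piece i" shows "x \<otimes> y \<in> piece i"
proof -
  obtain a b c d where *: "a \<in> carrier K" "b \<in> carrier K" "c \<in> carrier K" "d \<in> carrier K"
    "x = a \<odot> f i \<oplus> b \<odot> u i" "y = c \<odot> f i \<oplus> d \<odot> u i" using assms unfolding piece_def by blast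
  define w where "w = u i \<otimes> u i"
  have w: "w \<in> carrier A" using i by (simp add: w_def)
  have e: "x \<otimes> y = ((a \<otimes>\<^bsub>K\<^esub> c) \<odot> f i \<oplus> (b \<otimes>\<^bsub>K\<^esub> d) \<odot> w) \<oplus> (a \<otimes>\<^bsub>K\<^esub> d \<oplus>\<^bsub>K\<^esub> b \<otimes>\<^bsub>K\<^esub> c) \<odot> u i"
    using * i ff[OF i] fu[OF i] uf[OF i] w
    by (simp add: l_distr r_distr smult_mult_l smult_mult_r vs.smult_assoc1[symmetric] vs.smult_l_distr vs.smult_r_distr a_ac vs.R.m_ac w_def[symmetric])
  from uu[OF i] show ?thesis
  proof
    assume "u i \<otimes> u i = f i"
    then have "x \<otimes> y = (a \<otimes>\<^bsub>K\<^esub> c \<oplus>\<^bsub>K\<^esub> b \<otimes>\<^bsub>K\<^esub> d) \<odot> f i \<oplus> (a \<otimes>\<^bsub>K\<^esub> d \<oplus>\<^bsub>K\<^esub> b \<otimes>\<^bsub>K\<^esub> c) \<odot> u i"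
      unfolding e w_def using * i by (simp add: vs.smult_l_distr)
    then show ?thesis using pieceI * by simp
  next
    assume "u i = \<zero>"
    then have "x \<otimes> y = (a \<otimes>\<^bsub>K\<^esub> c) \<odot> f i \<oplus> (a \<otimes>\<^bsub>K\<^esub> d \<oplus>\<^bsub>K\<^esub> b \<otimes>\<^bsub>K\<^esub> c) \<odot> u i"
      unfolding e w_def using * i by simp
    then show ?thesis using pieceI * by simp
  qed
qed

lemma piece_f: "i \<in> {1..n} ==> f i \<in> piece i"
  using pieceI[of "\<one>\<^bsub>K\<^esub>" "\<zero>\<^bsub>K\<^esub>" i] by simp

lemma piece_smult: assumes i: "i \<in> {1..n}" and c: "c \<in> carrier K" and "x \<in> piece i" shows "c \<odot> x \<in> piece i"
proof -
  obtain a b where *: "a \<in> carrier K" "b \<in> carrier K" "x = a \<odot> f i \<oplus> b \<odot> u i" using assms unfolding piece_def by blast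
  then have "c \<odot> x = (c \<otimes>\<^bsub>K\<^esub> a) \<odot> f i \<oplus> (c \<otimes>\<^bsub>K\<^esub> b) \<odot> u i"
    using c i by (simp add: vs.smult_r_distr vs.smult_assoc1)
  then show ?thesis using pieceI * c by simp
qed

lemma piece_parts: assumes i: "i \<in> {1..n}" and "a \<in> carrier K" "b \<in> carrier K"
  shows "part 0 (a \<odot> f i \<oplus> b \<odot> u i) = a \<odot> f i" "part 1 (a \<odot> f i \<oplus> b \<odot> u i) = b \<odot> u i"
  using part_unique[of "a \<odot> f i" 0 "b \<odot> u i"] hcomp_smult[OF _ f_h[OF i]] hcomp_smult[OF _ u_h[OF i]] assms by auto

lemma piece_part: assumes i: "i \<in> {1..n}" and "x \<in> piece i" shows "part g x \<in> piece i"
proof -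
  obtain a b where *: "a \<in> carrier K" "b \<in> carrier K" "x = a \<odot> f i \<oplus> b \<odot> u i" using assms unfolding piece_def by blast
  then show ?thesis using piece_parts[OF i *(1,2)] bit_cases[of g] pieceI[of a "\<zero>\<^bsub>K\<^esub>" i] pieceI[of "\<zero>\<^bsub>K\<^esub>" b i] i by auto
qed

text \<open>\<open>J\<close> is graded, so both terms lie in \<open>J\<close> separately.
  Multiplying the odd term by \<open>u i\<close> turns it into a multiple of \<open>f i\<close>, and
  no nonzero multiple of \<open>f i\<close> lies in \<open>J\<close>.\<close>

lemma piece_J: assumes i: "i \<in> {1..n}" and "x \<in> piece i" "x \<in> J" shows "x = \<zero>"
proof -
  obtain a b where *: "a \<in> carrier K" "b \<in> carrier K" "x = a \<odot> f i \<oplus> b \<odot> u i" using assms unfolding piece_def by blast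
  have aJ: "a \<odot> f i \<in> J" and bJ: "b \<odot> u i \<in> J"
    using glidealD(7)[OF glideal_J assms(3), of 0] glidealD(7)[OF glideal_J assms(3), of 1] piece_parts[OF i *(1,2)] * by auto
  have z: "c = \<zero>\<^bsub>K\<^esub>" if c: "c \<in> carrier K" "c \<odot> f i \<in> J" for c
  proof (rule ccontr)
    assume "c \<noteq> \<zero>\<^bsub>K\<^esub>"
    then have cu: "c \<in> Units K" using c vs.field_Units by simp
    then have "inv\<^bsub>K\<^esub> c \<odot> (c \<odot> f i) \<in> J" using idl(8)[OF idJ] c by blast
    moreover have "inv\<^bsub>K\<^esub> c \<odot> (c \<odot> f i) = f i"
      using cu c i by (simp add: vs.smult_assoc1[symmetric] vs.R.Units_l_inv)
    ultimately show False using f_nJ[OF i] by simp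
  qed
  have "b \<odot> u i = \<zero>"
    using uu[OF i]
  proof
    assume "u i \<otimes> u i = f i"
    then have "b \<odot> f i = (b \<odot> u i) \<otimes> u i" using * i by (simp add: smult_mult_l)
    then have "b \<odot> f i \<in> J" using idl(6)[OF idJ bJ] i by simp
    then have "b = \<zero>\<^bsub>K\<^esub>" by (rule z[OF *(2)])
    then show ?thesis using i by simp
  qed (use * in simp)
  then show ?thesis using z[OF *(1) aJ] * i by simp
qed

lemma weddD:
  assumes "r \<in> wedd" "i \<in> {1..n}"
  shows "f i \<otimes> r = r \<otimes> f i" "f i \<otimes> r \<in> piece i"
  using assms unfolding wedd_def by blast+

lemma weddI:
  "[| r \<in> carrier A; \<And>i. i \<in> {1..n} ==> f i \<otimes> r = r \<otimes> f i \<and> f i \<otimes> r \<in> piece i |] ==> r \<in> wedd"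
  unfolding wedd_def by blast

lemma wedd_closed: "r \<in> wedd ==> r \<in> carrier A" by (simp add: wedd_def)

lemma wedd_add: "r \<in> wedd ==> s \<in> wedd ==> r \<oplus> s \<in> wedd"
proof -
  assume rs: "r \<in> wedd" "s \<in> wedd"
  show "r \<oplus> s \<in> wedd"
  proof (rule weddI)
    fix i assume i: "i \<in> {1..n}"
    have "f i \<otimes> (r \<oplus> s) = f i \<otimes> r \<oplus> f i \<otimes> s" "(r \<oplus> s) \<otimes> f i = r \<otimes> f i \<oplus> s \<otimes> f i"
      using rs wedd_closed i by (simp_all add: l_distr r_distr)
    then show "f i \<otimes> (r \<oplus> s) = (r \<oplus> s) \<otimes> f i \<and> f i \<otimes> (r \<oplus> s) \<in> piece i"
      using piece_add[OF i weddD(2)[OF rs(1) i] weddD(2)[OF rs(2) i]] weddD(1)[OF rs(1) i] weddD(1)[OF rs(2) i] by simp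
  qed (use rs wedd_closed in simp)
qed

lemma wedd_mult: assumes "r \<in> wedd" "s \<in> wedd" shows "r \<otimes> s \<in> wedd"
proof -
  have c: "r \<in> carrier A" "s \<in> carrier A" using assms by (auto simp: wedd_def)
  have "f i \<otimes> (r \<otimes> s) = (r \<otimes> s) \<otimes> f i \<and> f i \<otimes> (r \<otimes> s) \<in> piece i" if i: "i \<in> {1..n}" for i
  proof -
    have fr: "f i \<otimes> r = r \<otimes> f i" "f i \<otimes> s = s \<otimes> f i" "f i \<otimes> r \<in> piece i" "f i \<otimes> s \<in> piece i" using weddD[OF assms(1) i] weddD[OF assms(2) i] by auto
    have "f i \<otimes> (r \<otimes> s) = (f i \<otimes> r) \<otimes> s" using c i by (simp add: m_assoc)
    also have "\<dots> = (r \<otimes> f i) \<otimes> s" by (simp add: fr)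
    also have "\<dots> = r \<otimes> (f i \<otimes> s)" using c i by (simp add: m_assoc)
    finally have 1: "f i \<otimes> (r \<otimes> s) = r \<otimes> (s \<otimes> f i)" by (simp add: fr)
    have "(f i \<otimes> r) \<otimes> (f i \<otimes> s) = (f i \<otimes> f i) \<otimes> (r \<otimes> s)"
      using c i fr by (metis f_closed m_assoc m_closed)
    then have "f i \<otimes> (r \<otimes> s) = (f i \<otimes> r) \<otimes> (f i \<otimes> s)" using ff[OF i] by simp
    then show ?thesis using 1 c i piece_mult[OF i fr(3,4)] by (simp add: m_assoc)
  qed
  then show ?thesis using c by (intro weddI) (simp, blast)
qed

lemma wedd_one: "\<one> \<in> wedd"
  by (rule weddI) (auto simp: piece_f)

lemma wedd_smult: "c \<in> carrier K ==> r \<in> wedd ==> c \<odot> r \<in> wedd"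
proof -
  assume c: "c \<in> carrier K" and r: "r \<in> wedd"
  show ?thesis
  proof (rule weddI)
    fix i assume i: "i \<in> {1..n}"
    show "f i \<otimes> (c \<odot> r) = (c \<odot> r) \<otimes> f i \<and> f i \<otimes> (c \<odot> r) \<in> piece i"
      using weddD(1)[OF r i] piece_smult[OF i c weddD(2)[OF r i]] c wedd_closed[OF r] i by (simp add: smult_mult_l smult_mult_r)
  qed (use c r wedd_closed in simp)
qed

lemma wedd_zero: "\<zero> \<in> wedd"
  using wedd_smult[OF vs.R.zero_closed wedd_one] by simp

lemma wedd_neg: assumes "r \<in> wedd" shows "\<ominus> r \<in> wedd"
proof -
  have "(\<ominus>\<^bsub>K\<^esub> \<one>\<^bsub>K\<^esub>) \<odot> r = \<ominus> r" using wedd_closed[OF assms] by (simp add: vs.smult_l_minus)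
  then show ?thesis using wedd_smult[OF _ assms, of "\<ominus>\<^bsub>K\<^esub> \<one>\<^bsub>K\<^esub>"] by simp
qed

lemma wedd_minus: "r \<in> wedd ==> s \<in> wedd ==> r \<ominus> s \<in> wedd"
  unfolding a_minus_def by (intro wedd_add wedd_neg)

lemma wedd_part: assumes "r \<in> wedd" shows "part g r \<in> wedd"
proof -
  have c: "r \<in> carrier A" using assms wedd_closed by blast
  have "f i \<otimes> part g r = part g r \<otimes> f i \<and> f i \<otimes> part g r \<in> piece i" if i: "i \<in> {1..n}" for i
  proof -
    have "part (0 + g) (f i \<otimes> r) = f i \<otimes> part g r" by (rule part_mult_l[OF f_h[OF i] c])
    moreover have "part (g + 0) (r \<otimes> f i) = part g r \<otimes> f i" by (rule part_mult_r[OF f_h[OF i] c])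
    moreover have "f i \<otimes> r = r \<otimes> f i" "f i \<otimes> r \<in> piece i" using weddD[OF assms i] by auto
    ultimately show ?thesis using piece_part[OF i, of "f i \<otimes> r" g] by (simp only: add_0_left add_0_right)
  qed
  then show ?thesis using c by (intro weddI) (simp, blast)
qed

text \<open>The complement meets the radical trivially. This gives uniqueness of lifts from the
  quotient, and later exactness of relations known only modulo \<open>J\<close>.\<close>

lemma wedd_J: assumes "r \<in> wedd" "r \<in> J" shows "r = \<zero>"
proof (rule eq_by_f)
  fix i assume i: "i \<in> {1..n}"
  have "f i \<otimes> r \<in> piece i" using weddD(2)[OF assms(1) i] .
  then have "f i \<otimes> r = \<zero>" using piece_J[OF i] idl(5)[OF idJ assms(2)] i by simp
  then show "f i \<otimes> r = f i \<otimes> \<zero>" using i by simp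
qed (use wedd_closed[OF assms(1)] in auto)

lemma wedd_sum_piece:
  assumes r: "\<And>i. i \<in> {1..n} ==> r i \<in> piece i" shows "finsum A r {1..n} \<in> wedd" "i \<in> {1..n} ==> f i \<otimes> finsum A r {1..n} = r i"
proof -
  have fr: "f i \<otimes> r i = r i" "r i \<otimes> f i = r i" if i: "i \<in> {1..n}" for i
    using r[OF i] ff[OF i] fu[OF i] uf[OF i] i unfolding piece_def by (auto simp: r_distr l_distr smult_mult_l smult_mult_r)
  have rc: "i \<in> {1..n} ==> r i \<in> carrier A" for i using r piece_closed by blast
  have frj: "f i \<otimes> r j = \<zero>" "r j \<otimes> f i = \<zero>" if i: "i \<in> {1..n}" "j \<in> {1..n}" "i \<noteq> j" for i j
  proof -
    have "f i \<otimes> r j = (f i \<otimes> f j) \<otimes> r j" using fr(1)[OF i(2)] i rc by (simp add: m_assoc)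
    then show "f i \<otimes> r j = \<zero>" using f_orth i rc by simp
    have "r j \<otimes> f i = r j \<otimes> (f j \<otimes> f i)" using fr(2)[OF i(2)] i rc by (simp add: m_assoc[symmetric])
    then show "r j \<otimes> f i = \<zero>" using f_orth i rc by simp
  qed
  have rP: "r \<in> {1..n} \<rightarrow> carrier A" using rc by blast
  have l: "f i \<otimes> finsum A r {1..n} = r i" if i: "i \<in> {1..n}" for i
  proof -
    have "f i \<otimes> finsum A r {1..n} = finsum A (\<lambda>j. f i \<otimes> r j) {1..n}" using i rP by (intro finsum_rdistr) auto
    also have "\<dots> = finsum A (\<lambda>j. if i = j then r j else \<zero>) {1..n}"
      using i rc fr frj by (intro finsum_cong') auto
    also have "\<dots> = r i" using i rP by (intro add.finprod_singleton) auto
    finally show ?thesis .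
  qed
  have rr: "finsum A r {1..n} \<otimes> f i = r i" if i: "i \<in> {1..n}" for i
  proof -
    have "finsum A r {1..n} \<otimes> f i = finsum A (\<lambda>j. r j \<otimes> f i) {1..n}" using i rP by (intro finsum_ldistr) auto
    also have "\<dots> = finsum A (\<lambda>j. if i = j then r j else \<zero>) {1..n}"
      using i rc fr frj by (intro finsum_cong') auto
    also have "\<dots> = r i" using i rP by (intro add.finprod_singleton) auto
    finally show ?thesis .
  qed
  show "finsum A r {1..n} \<in> wedd" unfolding wedd_def using l rr r rP by auto
  show "i \<in> {1..n} ==> f i \<otimes> finsum A r {1..n} = r i" by (rule l)
qed

text \<open>The off-diagonal Peirce corners of \<open>x\<close> lie in \<open>J\<close>, and each
  diagonal corner is congruent to an element of its piece; the sum of these pieces is the required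
  element.\<close>

lemma wedd_approx: assumes x: "x \<in> carrier A" shows "\<exists>r\<in>wedd. x \<doteq> r"
proof -
  have "\<exists>r\<in>piece i. f i \<otimes> x \<otimes> f i \<doteq> r" if i: "i \<in> {1..n}" for i
  proof -
    obtain a where a: "a \<in> carrier K" "f i \<otimes> part 0 x \<otimes> f i \<doteq> a \<odot> f i" using f_gen0[OF i part_hcomp[OF x]] by blast
    obtain b where b: "b \<in> carrier K" "f i \<otimes> part 1 x \<otimes> f i \<doteq> b \<odot> u i" using f_gen1[OF i part_hcomp[OF x]] by blast
    have "f i \<otimes> x \<otimes> f i = f i \<otimes> (part 0 x \<oplus> part 1 x) \<otimes> f i" using part_sum[OF x] by simp
    also have "\<dots> = f i \<otimes> part 0 x \<otimes> f i \<oplus> f i \<otimes> part 1 x \<otimes> f i" using x i by (simp add: l_distr r_distr)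
    finally show ?thesis using eqJ_add[OF a(2) b(2)] pieceI[OF a(1) b(1), of i] by auto
  qed
  then obtain r where r: "\<And>i. i \<in> {1..n} ==> r i \<in> piece i" "\<And>i. i \<in> {1..n} ==> f i \<otimes> x \<otimes> f i \<doteq> r i" by metis
  define s where "s = finsum A r {1..n}"
  have s: "s \<in> wedd" "\<And>i. i \<in> {1..n} ==> f i \<otimes> s = r i" using wedd_sum_piece[of r] r(1) by (auto simp: s_def)
  have sc: "s \<in> carrier A" using s wedd_closed by blast
  have "x \<ominus> s \<in> J"
  proof (rule ideal_by_f[OF idJ])
    show "x \<ominus> s \<in> carrier A" using x sc by simp
    fix i assume i: "i \<in> {1..n}"
    have "f i \<otimes> x = finsum A (\<lambda>j. f i \<otimes> x \<otimes> f j) {1..n}" using sum_f_r[of "f i \<otimes> x"] i x by simp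
    also have "\<dots> \<doteq> finsum A (\<lambda>j. if i = j then r j else \<zero>) {1..n}"
      using fxf[OF i] r(2) x i eqJ_zero by (intro eqJ_finsum) auto
    also have "finsum A (\<lambda>j. if i = j then r j else \<zero>) {1..n} = r i" using i r(1) piece_closed by (intro add.finprod_singleton) auto
    finally have "f i \<otimes> x \<ominus> f i \<otimes> s \<in> J" using s(2)[OF i] by (simp add: eqJ_def)
    then show "f i \<otimes> (x \<ominus> s) \<in> J" using i x sc by (simp add: a_minus_def r_distr r_minus)
  qed
  then show ?thesis using s(1) x sc by (auto simp: eqJ_def)
qed

lemma f_wedd: "i \<in> {1..n} ==> f i \<in> wedd"
proof -
  assume i: "i \<in> {1..n}"
  have "f j \<otimes> f i = f i \<otimes> f j \<and> f j \<otimes> f i \<in> piece j" if j: "j \<in> {1..n}" for j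
    using i j f_orth[of i j] f_orth[of j i] ff[OF i] piece_f[OF i] pieceI[of "\<zero>\<^bsub>K\<^esub>" "\<zero>\<^bsub>K\<^esub>" j] by (cases "i = j") auto
  then show ?thesis using i by (intro weddI) (simp, blast)
qed

abbreviation J2 where "J2 \<equiv> ideal_prod A J J"

lemma idJ2: "ideal J2 A" by (rule ideal_prod_is_ideal[OF idJ idJ])

lemma J2_J: "x \<in> J2 ==> x \<in> J"
  using ideal_prod_inter[OF idJ idJ] by auto

lemma J_closed: "x \<in> J ==> x \<in> carrier A" using idl(1)[OF idJ] .

lemma J_part: "x \<in> J ==> part g x \<in> J" by (rule glidealD(7)[OF glideal_J])

lemma J2_part: "x \<in> J2 ==> part g x \<in> J2"
proof -
  assume "x \<in> J2"
  then have "x \<in> carrier A \<and> (\<forall>g. part g x \<in> J2)"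
  proof (induction rule: ideal_prod.induct)
    case (prod i j)
    have c: "i \<in> carrier A" "j \<in> carrier A" using prod J_closed by auto
    have "part g (i \<otimes> j) \<in> J2" for g
    proof -
      have "part (0 + (g + 0)) (part 0 i \<otimes> j) = part 0 i \<otimes> part (g + 0) j" by (rule part_mult_l) (use c in auto)
      moreover have "part (1 + (g + 1)) (part 1 i \<otimes> j) = part 1 i \<otimes> part (g + 1) j" by (rule part_mult_l) (use c in auto)
      moreover have "0 + (g + 0) = g" "1 + (g + 1) = g" using bit_cases[of g] by auto
      ultimately have p: "part g (part 0 i \<otimes> j) = part 0 i \<otimes> part g j" "part g (part 1 i \<otimes> j) = part 1 i \<otimes> part (g + 1) j" by simp_all
      \<comment> \<open>Only the left factor is split into homogeneous parts; the right factor then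
        contributes the component of matching degree, and every resulting product is again of the
        form \<open>J\<close> times \<open>J\<close>.\<close>
      have "i \<otimes> j = part 0 i \<otimes> j \<oplus> part 1 i \<otimes> j" using part_sum[OF c(1)] c by (metis l_distr part_closed)
      then have "part g (i \<otimes> j) = part 0 i \<otimes> part g j \<oplus> part 1 i \<otimes> part (g + 1) j" using c p by (simp add: part_add)
      then show ?thesis using J_part prod by (auto intro!: ideal_prod.intros)
    qed
    then show ?case using c by simp
  next
    case (sum s t) then show ?case by (auto simp: part_add intro: ideal_prod.sum)
  qed
  then show ?thesis by blast
qed

end

section \<open>A bimodule section of the radical\<close>

context split_salg begin

text \<open>Weights of the separability idempotent: multiplied out, the terms for \<open>f i\<close>
  and \<open>u i\<close> give twice \<open>f i\<close> when \<open>u i\<close> is nonzero, and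
  \<open>f i\<close> alone otherwise.\<close>

definition wt :: "nat => 'k" where "wt i = (if u i = \<zero> then \<one>\<^bsub>K\<^esub> else half)"

lemma wt_closed [simp]: "wt i \<in> carrier K" using half by (simp add: wt_def)

lemma wt_sum: assumes i: "i \<in> {1..n}" shows "wt i \<odot> (f i \<oplus> u i \<otimes> u i) = f i"
proof (cases "u i = \<zero>")
  case True then show ?thesis using i by (simp add: wt_def)
next
  case False
  then show ?thesis using uu[OF i] half_add[of "f i"] half(1) i by (simp add: wt_def vs.smult_r_distr)
qed

text \<open>A graded linear section of the projection from \<open>J\<close> to its quotient by
  \<open>J2\<close>, encoded on representatives: it kills \<open>J2\<close>, so it depends only on
  the coset.\<close>

definition section_map :: "('a => 'a) => bool" where
  "section_map s \<longleftrightarrow> (\<forall>x\<in>J. s x \<in> J \<and> x \<ominus> s x \<in> J2 \<and> (\<forall>g. part g (s x) = s (part g x))) \<and> (\<forall>x\<in>J2. s x = \<zero>) \<and>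
     (\<forall>x\<in>J. \<forall>y\<in>J. s (x \<oplus> y) = s x \<oplus> s y) \<and> (\<forall>c\<in>carrier K. \<forall>x\<in>J. s (c \<odot> x) = c \<odot> s x)"

lemma section_mapD:
  assumes "section_map s"
  shows "x \<in> J ==> s x \<in> J" "x \<in> J ==> s x \<in> carrier A" "x \<in> J ==> x \<ominus> s x \<in> J2" "x \<in> J ==> part g (s x) = s (part g x)"
    "x \<in> J2 ==> s x = \<zero>" "x \<in> J ==> y \<in> J ==> s (x \<oplus> y) = s x \<oplus> s y" "c \<in> carrier K ==> x \<in> J ==> s (c \<odot> x) = c \<odot> s x"
  using assms J_closed unfolding section_map_def by blast+

lemma J2_zero: "\<zero> \<in> J2" using idl(2)[OF idJ2] .

lemma part_J2: "x \<in> J2 ==> x \<in> carrier A" using J2_J J_closed by blast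

text \<open>A maximal graded subspace \<open>W\<close> of \<open>J\<close> that meets
  \<open>J2\<close> trivially is a graded complement of \<open>J2\<close>, and \<open>s\<close> is
  the projection to \<open>W\<close> along \<open>J2\<close>.\<close>

lemma section_exists: "\<exists>s. section_map s"
proof -
  define \<F> where "\<F> = {W. ksub W \<and> W \<subseteq> J \<and> (\<forall>x\<in>W. \<forall>g. part g x \<in> W) \<and> W \<inter> J2 \<subseteq> {\<zero>}}"
  have "{\<zero>} \<in> \<F>" using idl(2)[OF idJ] by (auto simp: \<F>_def ksub_def)
  moreover have "\<And>W. W \<in> \<F> ==> ksub W" by (simp add: \<F>_def)
  ultimately obtain W where W: "W \<in> \<F>" "\<forall>V\<in>\<F>. W \<subseteq> V \<longrightarrow> V = W" using ksub_maximal[of "{\<zero>}" \<F>] by blast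
  have Wk: "ksub W" and WJ: "\<And>w. w \<in> W ==> w \<in> J" and Wp: "\<And>w g. w \<in> W ==> part g w \<in> W" and W0: "\<And>w. w \<in> W ==> w \<in> J2 ==> w = \<zero>"
    using W(1) by (auto simp: \<F>_def)
  have Wz: "\<zero> \<in> W" and Wa: "\<And>x y. x \<in> W ==> y \<in> W ==> x \<oplus> y \<in> W" and Ws: "\<And>c x. c \<in> carrier K ==> x \<in> W ==> c \<odot> x \<in> W"
    using Wk by (auto simp: ksub_def)
  have Wn: "\<ominus> x \<in> W" if "x \<in> W" for x
    using Ws[of "\<ominus>\<^bsub>K\<^esub> \<one>\<^bsub>K\<^esub>" x] that WJ J_closed by (simp add: vs.smult_l_minus)
  \<comment> \<open>If a homogeneous \<open>y\<close> were congruent to nothing in \<open>W\<close>,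
    then \<open>W\<close> plus the line of \<open>y\<close> would still be graded, because
    \<open>y\<close> is homogeneous, and would still avoid \<open>J2\<close>, against
    maximality.\<close>
  have hom: "\<exists>w\<in>W. y \<ominus> w \<in> J2" if y: "y \<in> J" "y \<in> hcomp A g" for y g
  proof (rule ccontr)
    assume no: "\<not> (\<exists>w\<in>W. y \<ominus> w \<in> J2)"
    have yc: "y \<in> carrier A" using y J_closed by blast
    let ?V = "{w \<oplus> c \<odot> y | w c. w \<in> W \<and> c \<in> carrier K}"
    have "ksub ?V"
      unfolding ksub_def
    proof (intro conjI ballI)
      show "?V \<subseteq> carrier A" using WJ J_closed yc by auto
      show "\<zero> \<in> ?V" using Wz yc by (force intro!: exI[of _ \<zero>] exI[of _ "\<zero>\<^bsub>K\<^esub>"])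
    next
      fix x z assume "x \<in> ?V" "z \<in> ?V"
      then obtain w c w' c' where *: "x = w \<oplus> c \<odot> y" "w \<in> W" "c \<in> carrier K" "z = w' \<oplus> c' \<odot> y" "w' \<in> W" "c' \<in> carrier K" by blast
      have "x \<oplus> z = (w \<oplus> w') \<oplus> (c \<oplus>\<^bsub>K\<^esub> c') \<odot> y"
        using * WJ J_closed yc by (simp add: vs.smult_l_distr a_ac)
      then show "x \<oplus> z \<in> ?V" using Wa * by blast
    next
      fix d x assume d: "d \<in> carrier K" and "x \<in> ?V"
      then obtain w c where *: "x = w \<oplus> c \<odot> y" "w \<in> W" "c \<in> carrier K" by blast
      have "d \<odot> x = d \<odot> w \<oplus> (d \<otimes>\<^bsub>K\<^esub> c) \<odot> y"
        using * d WJ J_closed yc by (simp add: vs.smult_r_distr vs.smult_assoc1)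
      then show "d \<odot> x \<in> ?V" using Ws[OF d *(2)] * d by blast
    qed
    moreover have "?V \<subseteq> J" using WJ y idl(3,8)[OF idJ] by blast
    moreover have "part h x \<in> ?V" if x: "x \<in> ?V" for x h
    proof -
      obtain w c where *: "x = w \<oplus> c \<odot> y" "w \<in> W" "c \<in> carrier K" using x by blast
      have e: "part h x = part h w \<oplus> c \<odot> part h y" using * WJ J_closed yc by (simp add: part_add part_smult)
      show ?thesis
      proof (cases "h = g")
        case True then show ?thesis using e y(2) * Wp by auto
      next
        case False
        then have "part h x = part h w \<oplus> \<zero>\<^bsub>K\<^esub> \<odot> y" using e part_other'[OF y(2)] * yc WJ J_closed by simp
        then show ?thesis using Wp[OF *(2)] by blast
      qed
    qed
    moreover have "?V \<inter> J2 \<subseteq> {\<zero>}"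
    proof
      fix x assume x: "x \<in> ?V \<inter> J2"
      then obtain w c where *: "x = w \<oplus> c \<odot> y" "w \<in> W" "c \<in> carrier K" by blast
      have wc: "w \<in> carrier A" using * WJ J_closed by blast
      \<comment> \<open>A nonzero \<open>c\<close> could be divided away, which would make
        \<open>y\<close> congruent to an element of \<open>W\<close>.\<close>
      have "c = \<zero>\<^bsub>K\<^esub>"
      proof (rule ccontr)
        assume "c \<noteq> \<zero>\<^bsub>K\<^esub>"
        then have cu: "c \<in> Units K" using * vs.field_Units by simp
        define d where "d = inv\<^bsub>K\<^esub> c"
        have d: "d \<in> carrier K" "d \<otimes>\<^bsub>K\<^esub> c = \<one>\<^bsub>K\<^esub>" using cu by (auto simp: d_def vs.R.Units_l_inv)
        have "d \<odot> x = d \<odot> w \<oplus> y" using * d wc yc by (simp add: vs.smult_r_distr vs.smult_assoc1[symmetric])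
        then have "d \<odot> x = y \<ominus> \<ominus> (d \<odot> w)" using d wc yc by (simp add: a_minus_def a_comm)
        moreover have "d \<odot> x \<in> J2" using idl(8)[OF idJ2 d(1)] x by blast
        ultimately show False using no Wn[OF Ws[OF d(1) *(2)]] by auto
      qed
      then have "x = w" using * wc yc by simp
      then show "x \<in> {\<zero>}" using W0 * x by blast
    qed
    ultimately have "?V \<in> \<F>" by (simp add: \<F>_def)
    moreover have "W \<subseteq> ?V"
    proof
      fix w assume "w \<in> W"
      then have "w = w \<oplus> \<zero>\<^bsub>K\<^esub> \<odot> y" using WJ J_closed yc by simp
      then show "w \<in> ?V" using \<open>w \<in> W\<close> by blast
    qed
    ultimately have "?V = W" using W(2) by blast
    moreover have "y = \<zero> \<oplus> \<one>\<^bsub>K\<^esub> \<odot> y" using yc by simp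
    then have "y \<in> ?V" using Wz by blast
    ultimately have "y \<in> W" by simp
    then show False using no yc J2_zero by (auto simp: a_minus_def neg_r)
  qed
  have ex: "\<exists>w\<in>W. x \<ominus> w \<in> J2" if x: "x \<in> J" for x
  proof -
    have xc: "x \<in> carrier A" using x J_closed by blast
    obtain w0 w1 where w: "w0 \<in> W" "part 0 x \<ominus> w0 \<in> J2" "w1 \<in> W" "part 1 x \<ominus> w1 \<in> J2"
      using hom[OF J_part[OF x] part_hcomp[OF xc]] by meson
    have wc: "w0 \<in> carrier A" "w1 \<in> carrier A" using w WJ J_closed by auto
    have "x \<ominus> (w0 \<oplus> w1) = (part 0 x \<oplus> part 1 x) \<ominus> (w0 \<oplus> w1)" using part_sum[OF xc] by simp
    also have "\<dots> = (part 0 x \<ominus> w0) \<oplus> (part 1 x \<ominus> w1)" using wc xc by (simp add: a_minus_def minus_add a_ac)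
    finally have "x \<ominus> (w0 \<oplus> w1) \<in> J2" using idl(3)[OF idJ2] w by simp
    then show ?thesis using Wa w by blast
  qed
  have uniq: "w = w'" if "w \<in> W" "w' \<in> W" "x \<in> J" "x \<ominus> w \<in> J2" "x \<ominus> w' \<in> J2" for x w w'
  proof -
    have c: "w \<in> carrier A" "w' \<in> carrier A" "x \<in> carrier A" using that WJ J_closed by auto
    have "x \<oplus> (\<ominus> w' \<oplus> \<ominus> x) = \<ominus> w'" using a_lcomm[of x "\<ominus> w'" "\<ominus> x"] c by (simp add: neg_r)
    then have "(x \<ominus> w') \<ominus> (x \<ominus> w) = w \<ominus> w'" using c by (simp add: a_minus_def minus_add a_ac)
    then have "w \<ominus> w' = (x \<ominus> w') \<ominus> (x \<ominus> w)" by simp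
    then have "w \<ominus> w' \<in> J2" using idl(4)[OF idJ2] that by simp
    moreover have "w \<ominus> w' \<in> W" using Wa Wn that by (simp add: a_minus_def)
    ultimately have "w \<ominus> w' = \<zero>" using W0 by blast
    then show ?thesis using c by simp
  qed
  \<comment> \<open>The element of \<open>W\<close> is unique because \<open>W\<close> avoids
    \<open>J2\<close>; additivity, homogeneity and linearity of \<open>s\<close> then follow from
    uniqueness alone.\<close>
  define s where "s x = (THE w. w \<in> W \<and> x \<ominus> w \<in> J2)" for x
  have sx: "s x \<in> W" "x \<ominus> s x \<in> J2" if "x \<in> J" for x
    using theI'[of "\<lambda>w. w \<in> W \<and> x \<ominus> w \<in> J2"] ex[OF that] uniq[OF _ _ that] unfolding s_def by blast+
  have seq: "s x = w" if "x \<in> J" "w \<in> W" "x \<ominus> w \<in> J2" for x w using uniq sx that by blast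
  have "section_map s"
    unfolding section_map_def
  proof (intro conjI ballI allI)
    fix x assume x: "x \<in> J"
    then show "s x \<in> J" "x \<ominus> s x \<in> J2" using sx WJ by auto
    fix g
    have "part g x \<ominus> part g (s x) = part g (x \<ominus> s x)" using x J_closed sx WJ by (simp add: part_minus)
    then have "part g x \<ominus> part g (s x) \<in> J2" using J2_part[OF sx(2)[OF x]] by simp
    from seq[OF J_part[OF x] Wp[OF sx(1)[OF x]] this] show "part g (s x) = s (part g x)" by simp
  next
    fix x assume "x \<in> J2" then show "s x = \<zero>" using seq[OF J2_J Wz] part_J2 by (simp add: a_minus_def)
  next
    fix x y assume xy: "x \<in> J" "y \<in> J"
    have c: "x \<in> carrier A" "y \<in> carrier A" "s x \<in> carrier A" "s y \<in> carrier A" using xy sx WJ J_closed by auto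
    have "(x \<oplus> y) \<ominus> (s x \<oplus> s y) = (x \<ominus> s x) \<oplus> (y \<ominus> s y)" using c by (simp add: a_minus_def minus_add a_ac)
    then show "s (x \<oplus> y) = s x \<oplus> s y" using xy sx Wa idl(3)[OF idJ] idl(3)[OF idJ2] by (intro seq) auto
  next
    fix c x assume *: "c \<in> carrier K" "x \<in> J"
    have cc: "x \<in> carrier A" "s x \<in> carrier A" using * sx WJ J_closed by auto
    have "c \<odot> x \<ominus> c \<odot> s x = c \<odot> (x \<ominus> s x)" using cc * by (simp add: a_minus_def vs.smult_r_distr vs.smult_r_minus)
    then show "s (c \<odot> x) = c \<odot> s x" using * sx Ws idl(8)[OF idJ] idl(8)[OF idJ2] by (intro seq) auto
  qed
  then show ?thesis by blast
qed

lemma finsum_mem: assumes "finite S" "\<And>i. i \<in> S ==> h i \<in> I" "ideal I A" shows "finsum A h S \<in> I"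
  using assms(1,2)
proof (induction S rule: finite_induct)
  case (insert i S)
  have "h \<in> S \<rightarrow> carrier A" "h i \<in> carrier A" using insert.prems idl(1)[OF assms(3)] by blast+
  then show ?case using insert idl(3)[OF assms(3)] by simp
qed (simp add: idl(2)[OF assms(3)])

lemma part_finsum: "finite S ==> h \<in> S \<rightarrow> carrier A ==> part g (finsum A h S) = finsum A (\<lambda>i. part g (h i)) S"
proof (induction S rule: finite_induct)
  case (insert i S)
  then have c: "h \<in> S \<rightarrow> carrier A" "h i \<in> carrier A" by auto
  then have "(\<lambda>i. part g (h i)) \<in> S \<rightarrow> carrier A" by (auto intro: part_closed)
  then show ?case using insert c by (simp add: part_add)
qed simp

lemma finsum_smult: "finite S ==> c \<in> carrier K ==> h \<in> S \<rightarrow> carrier A ==> c \<odot> finsum A h S = finsum A (\<lambda>i. c \<odot> h i) S"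
proof (induction S rule: finite_induct)
  case (insert i S)
  then have c: "h \<in> S \<rightarrow> carrier A" "h i \<in> carrier A" by auto
  then have "(\<lambda>i. c \<odot> h i) \<in> S \<rightarrow> carrier A" using insert by auto
  then show ?case using insert c by (simp add: vs.smult_r_distr)
qed simp

lemma finsum_minus: "finite S ==> h \<in> S \<rightarrow> carrier A ==> h' \<in> S \<rightarrow> carrier A ==>
    finsum A h S \<ominus> finsum A h' S = finsum A (\<lambda>i. h i \<ominus> h' i) S"
proof (induction S rule: finite_induct)
  case (insert i S)
  then have c: "h \<in> S \<rightarrow> carrier A" "h i \<in> carrier A" "h' \<in> S \<rightarrow> carrier A" "h' i \<in> carrier A" by auto
  then have d: "(\<lambda>i. h i \<ominus> h' i) \<in> S \<rightarrow> carrier A" by auto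
  have IH: "finsum A h S \<ominus> finsum A h' S = finsum A (\<lambda>i. h i \<ominus> h' i) S" using insert.IH c by simp
  have "finsum A h (insert i S) \<ominus> finsum A h' (insert i S) = (h i \<ominus> h' i) \<oplus> (finsum A h S \<ominus> finsum A h' S)"
    using insert.hyps c by (simp add: a_minus_def minus_add a_ac)
  moreover have "finsum A (\<lambda>i. h i \<ominus> h' i) (insert i S) = (h i \<ominus> h' i) \<oplus> finsum A (\<lambda>i. h i \<ominus> h' i) S"
    using insert.hyps d c by (intro finsum_insert) auto
  ultimately show ?case by (simp only: IH)
qed (simp add: a_minus_def)

text \<open>A section of \<open>J \<rightarrow> J/J\<^sup>2\<close> is made linear by averaging over the separability idempotent
  \<open>\<Sum>\<^sub>i wt\<^sub>i (f\<^sub>i \<otimes> f\<^sub>i + u\<^sub>i \<otimes> u\<^sub>i)\<close> of the span of the \<open>f\<^sub>i\<close> and \<open>u\<^sub>i\<close>, which has degree 0; first on the left,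
  then on the right.\<close>

definition tl_i where "tl_i s i x = wt i \<odot> (f i \<otimes> s (f i \<otimes> x) \<oplus> u i \<otimes> s (u i \<otimes> x))"
definition tr_i where "tr_i s i x = wt i \<odot> (s (x \<otimes> f i) \<otimes> f i \<oplus> s (x \<otimes> u i) \<otimes> u i)"

lemma J_mult: "x \<in> J ==> a \<in> carrier A ==> a \<otimes> x \<in> J" "x \<in> J ==> a \<in> carrier A ==> x \<otimes> a \<in> J"
  using idl(5,6)[OF idJ] by auto

text \<open>Both averages are sums over \<open>i\<close> of maps with the same formal properties, so
  these are collected once. The weights matter only for the congruence \<open>tx\<close>.\<close>

lemma section_average:
  assumes t: "\<And>i x. i \<in> {1..n} ==> x \<in> J ==> t i x \<in> J"
    and t2: "\<And>i x. i \<in> {1..n} ==> x \<in> J2 ==> t i x = \<zero>"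
    and ta: "\<And>i x y. i \<in> {1..n} ==> x \<in> J ==> y \<in> J ==> t i (x \<oplus> y) = t i x \<oplus> t i y"
    and ts: "\<And>i x c. i \<in> {1..n} ==> x \<in> J ==> c \<in> carrier K ==> t i (c \<odot> x) = c \<odot> t i x"
    and tp: "\<And>i x g. i \<in> {1..n} ==> x \<in> J ==> part g (t i x) = t i (part g x)"
    and tx: "\<And>x. x \<in> J ==> x \<ominus> finsum A (\<lambda>i. t i x) {1..n} \<in> J2"
  shows "section_map (\<lambda>x. finsum A (\<lambda>i. t i x) {1..n})"
  unfolding section_map_def
proof (intro conjI ballI allI)
  have tP: "(\<lambda>i. t i x) \<in> {1..n} \<rightarrow> carrier A" if "x \<in> J" for x using t that J_closed by blast
  fix x assume x: "x \<in> J"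
  show "finsum A (\<lambda>i. t i x) {1..n} \<in> J" by (rule finsum_mem[OF _ _ idJ]) (use t x in auto)
  show "x \<ominus> finsum A (\<lambda>i. t i x) {1..n} \<in> J2" by (rule tx[OF x])
  show "part g (finsum A (\<lambda>i. t i x) {1..n}) = finsum A (\<lambda>i. t i (part g x)) {1..n}" for g
    unfolding part_finsum[OF finite_atLeastAtMost tP[OF x]] using tp x tP[OF J_part[OF x]] by (intro finsum_cong') auto
  show "finsum A (\<lambda>i. t i (x \<oplus> y)) {1..n} = finsum A (\<lambda>i. t i x) {1..n} \<oplus> finsum A (\<lambda>i. t i y) {1..n}" if y: "y \<in> J" for y
    unfolding finsum_addf[OF tP[OF x] tP[OF y], symmetric] using ta x y tP[OF x] tP[OF y] by (intro finsum_cong') auto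
next
  fix x assume "x \<in> J2"
  then show "finsum A (\<lambda>i. t i x) {1..n} = \<zero>" using t2 by (intro add.finprod_one_eqI) auto
next
  fix c x assume *: "c \<in> carrier K" "x \<in> J"
  have tP: "(\<lambda>i. t i x) \<in> {1..n} \<rightarrow> carrier A" using t * J_closed by blast
  show "finsum A (\<lambda>i. t i (c \<odot> x)) {1..n} = c \<odot> finsum A (\<lambda>i. t i x) {1..n}"
    unfolding finsum_smult[OF finite_atLeastAtMost *(1) tP] using ts * tP by (intro finsum_cong') auto
qed

lemma part_u_l: "i \<in> {1..n} ==> x \<in> carrier A ==> part g (u i \<otimes> x) = u i \<otimes> part (g + 1) x"
proof -
  assume *: "i \<in> {1..n}" "x \<in> carrier A"
  have "part (1 + (g + 1)) (u i \<otimes> x) = u i \<otimes> part (g + 1) x" by (rule part_mult_l[OF u_h[OF *(1)] *(2)])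
  moreover have "1 + (g + 1) = g" using bit_cases[of g] by auto
  ultimately show ?thesis by simp
qed

lemma part_u_r: "i \<in> {1..n} ==> x \<in> carrier A ==> part g (x \<otimes> u i) = part (g + 1) x \<otimes> u i"
proof -
  assume *: "i \<in> {1..n}" "x \<in> carrier A"
  have "part ((g + 1) + 1) (x \<otimes> u i) = part (g + 1) x \<otimes> u i" by (rule part_mult_r[OF u_h[OF *(1)] *(2)])
  moreover have "(g + 1) + 1 = g" using bit_cases[of g] by auto
  ultimately show ?thesis by simp
qed

lemma part_f_l: "i \<in> {1..n} ==> x \<in> carrier A ==> part g (f i \<otimes> x) = f i \<otimes> part g x"
  using part_mult_l[OF f_h, of i x g] by (simp only: add_0_left)

lemma part_f_r: "i \<in> {1..n} ==> x \<in> carrier A ==> part g (x \<otimes> f i) = part g x \<otimes> f i"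
  using part_mult_r[OF f_h, of i x g] by (simp only: add_0_right)

lemma left_average: assumes s: "section_map s" shows "section_map (\<lambda>x. finsum A (\<lambda>i. tl_i s i x) {1..n})"
proof (rule section_average)
  note S = section_mapD[OF s]
  fix i x assume i: "i \<in> {1..n}"
  show "tl_i s i x \<in> J" if x: "x \<in> J"
    unfolding tl_i_def using i by (intro idl(8)[OF idJ] idl(3)[OF idJ] J_mult S(1) x) auto
  show "tl_i s i x = \<zero>" if x: "x \<in> J2"
    using S(5)[OF idl(5)[OF idJ2 x f_closed[OF i]]] S(5)[OF idl(5)[OF idJ2 x u_closed[OF i]]] i by (simp add: tl_i_def)
  show "tl_i s i (x \<oplus> y) = tl_i s i x \<oplus> tl_i s i y" if "x \<in> J" "y \<in> J" for y
    using that i S(2,6) J_mult J_closed by (simp add: tl_i_def r_distr vs.smult_r_distr a_ac)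
  show "tl_i s i (c \<odot> x) = c \<odot> tl_i s i x" if "x \<in> J" "c \<in> carrier K" for c
    using that i S(2,7) J_mult J_closed by (simp add: tl_i_def smult_mult_r vs.smult_r_distr vs.smult_assoc1[symmetric] vs.R.m_comm)
  show "part g (tl_i s i x) = tl_i s i (part g x)" if "x \<in> J" for g
    using that i S(2,4) J_mult J_closed by (simp add: tl_i_def part_smult part_add part_u_l part_f_l)
next
  note S = section_mapD[OF s]
  fix x assume x: "x \<in> J"
  have xc: "x \<in> carrier A" using x J_closed by blast
  have tc: "tl_i s i x \<in> carrier A" if "i \<in> {1..n}" for i
    unfolding tl_i_def using that S(2) J_mult x by auto
  have d: "f i \<otimes> x \<ominus> tl_i s i x \<in> J2" if i: "i \<in> {1..n}" for i
  proof -
    \<comment> \<open>By \<open>wt_sum\<close>, \<open>f i x\<close> takes the shape of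
      \<open>tl_i\<close> without the section, so the difference involves only terms
      \<open>y - s y\<close>, which lie in \<open>J2\<close>.\<close>
    have "f i \<otimes> x = wt i \<odot> (f i \<otimes> (f i \<otimes> x) \<oplus> u i \<otimes> (u i \<otimes> x))"
    proof -
      have "f i \<otimes> x = (wt i \<odot> (f i \<oplus> u i \<otimes> u i)) \<otimes> x" using wt_sum[OF i] by simp
      also have "\<dots> = wt i \<odot> ((f i \<otimes> f i \<oplus> u i \<otimes> u i) \<otimes> x)" using i xc ff[OF i] by (simp add: smult_mult_l)
      finally show ?thesis using i xc by (simp add: l_distr m_assoc)
    qed
    moreover have "wt i \<odot> (f i \<otimes> (f i \<otimes> x) \<oplus> u i \<otimes> (u i \<otimes> x)) \<ominus> tl_i s i x =
       wt i \<odot> (f i \<otimes> (f i \<otimes> x \<ominus> s (f i \<otimes> x)) \<oplus> u i \<otimes> (u i \<otimes> x \<ominus> s (u i \<otimes> x)))"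
      using i xc S(2)[OF J_mult(1)[OF x]] by (simp add: tl_i_def a_minus_def r_distr r_minus vs.smult_r_distr vs.smult_r_minus minus_add a_ac)
    moreover have "\<dots> \<in> J2" using i by (intro idl(8)[OF idJ2] idl(3)[OF idJ2] idl(5)[OF idJ2] S(3) J_mult(1) x) auto
    ultimately show ?thesis by simp
  qed
  have "x \<ominus> finsum A (\<lambda>i. tl_i s i x) {1..n} = finsum A (\<lambda>i. f i \<otimes> x) {1..n} \<ominus> finsum A (\<lambda>i. tl_i s i x) {1..n}"
    using sum_f_l[OF xc] by simp
  also have "\<dots> = finsum A (\<lambda>i. f i \<otimes> x \<ominus> tl_i s i x) {1..n}" using xc tc by (intro finsum_minus) auto
  also have "\<dots> \<in> J2" using d by (intro finsum_mem idJ2) auto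
  finally show "x \<ominus> finsum A (\<lambda>i. tl_i s i x) {1..n} \<in> J2" .
qed

lemma right_average: assumes s: "section_map s" shows "section_map (\<lambda>x. finsum A (\<lambda>i. tr_i s i x) {1..n})"
proof (rule section_average)
  note S = section_mapD[OF s]
  fix i x assume i: "i \<in> {1..n}"
  show "tr_i s i x \<in> J" if x: "x \<in> J"
    unfolding tr_i_def using i by (intro idl(8)[OF idJ] idl(3)[OF idJ] J_mult S(1) x) auto
  show "tr_i s i x = \<zero>" if x: "x \<in> J2"
    using S(5)[OF idl(6)[OF idJ2 x f_closed[OF i]]] S(5)[OF idl(6)[OF idJ2 x u_closed[OF i]]] i by (simp add: tr_i_def)
  show "tr_i s i (x \<oplus> y) = tr_i s i x \<oplus> tr_i s i y" if "x \<in> J" "y \<in> J" for y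
    using that i S(2,6) J_mult J_closed by (simp add: tr_i_def l_distr vs.smult_r_distr a_ac)
  show "tr_i s i (c \<odot> x) = c \<odot> tr_i s i x" if "x \<in> J" "c \<in> carrier K" for c
    using that i S(2,7) J_mult J_closed by (simp add: tr_i_def smult_mult_l vs.smult_r_distr vs.smult_assoc1[symmetric] vs.R.m_comm)
  show "part g (tr_i s i x) = tr_i s i (part g x)" if "x \<in> J" for g
    using that i S(2,4) J_mult J_closed by (simp add: tr_i_def part_smult part_add part_u_r part_f_r)
next
  note S = section_mapD[OF s]
  fix x assume x: "x \<in> J"
  have xc: "x \<in> carrier A" using x J_closed by blast
  have tc: "tr_i s i x \<in> carrier A" if "i \<in> {1..n}" for i
    unfolding tr_i_def using that S(2) J_mult x by auto
  have d: "x \<otimes> f i \<ominus> tr_i s i x \<in> J2" if i: "i \<in> {1..n}" for i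
  proof -
    have "x \<otimes> f i = wt i \<odot> ((x \<otimes> f i) \<otimes> f i \<oplus> (x \<otimes> u i) \<otimes> u i)"
    proof -
      have "x \<otimes> f i = x \<otimes> (wt i \<odot> (f i \<oplus> u i \<otimes> u i))" using wt_sum[OF i] by simp
      also have "\<dots> = wt i \<odot> (x \<otimes> (f i \<otimes> f i \<oplus> u i \<otimes> u i))" using i xc ff[OF i] by (simp add: smult_mult_r)
      finally have "x \<otimes> f i = wt i \<odot> (x \<otimes> (f i \<otimes> f i \<oplus> u i \<otimes> u i))" .
      also have "x \<otimes> (f i \<otimes> f i \<oplus> u i \<otimes> u i) = (x \<otimes> f i) \<otimes> f i \<oplus> (x \<otimes> u i) \<otimes> u i" using i xc by (simp add: r_distr m_assoc)
      finally show ?thesis .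
    qed
    moreover have "wt i \<odot> ((x \<otimes> f i) \<otimes> f i \<oplus> (x \<otimes> u i) \<otimes> u i) \<ominus> tr_i s i x =
       wt i \<odot> ((x \<otimes> f i \<ominus> s (x \<otimes> f i)) \<otimes> f i \<oplus> (x \<otimes> u i \<ominus> s (x \<otimes> u i)) \<otimes> u i)"
      using i xc S(2)[OF J_mult(2)[OF x]] by (simp add: tr_i_def a_minus_def l_distr l_minus vs.smult_r_distr vs.smult_r_minus minus_add a_ac)
    moreover have "\<dots> \<in> J2" using i by (intro idl(8)[OF idJ2] idl(3)[OF idJ2] idl(6)[OF idJ2] S(3) J_mult(2) x) auto
    ultimately show ?thesis by simp
  qed
  have "x \<ominus> finsum A (\<lambda>i. tr_i s i x) {1..n} = finsum A (\<lambda>i. x \<otimes> f i) {1..n} \<ominus> finsum A (\<lambda>i. tr_i s i x) {1..n}"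
    using sum_f_r[OF xc] by simp
  also have "\<dots> = finsum A (\<lambda>i. x \<otimes> f i \<ominus> tr_i s i x) {1..n}" using xc tc by (intro finsum_minus) auto
  also have "\<dots> \<in> J2" using d by (intro finsum_mem idJ2) auto
  finally show "x \<ominus> finsum A (\<lambda>i. tr_i s i x) {1..n} \<in> J2" .
qed

text \<open>A separability idempotent commutes with the algebra. In the corner of \<open>f i\<close>
  the element \<open>r\<close> is a combination of \<open>f i\<close> and \<open>u i\<close>; its
  odd term interchanges the two summands of \<open>tl_i\<close>, and the value of \<open>u i\<close>
  squared makes the exchange exact.\<close>

lemma left_average_linear:
  assumes s: "section_map s" and r: "r \<in> wedd" and x: "x \<in> J"
  shows "finsum A (\<lambda>i. tl_i s i (r \<otimes> x)) {1..n} = r \<otimes> finsum A (\<lambda>i. tl_i s i x) {1..n}"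
proof -
  note S = section_mapD[OF s]
  have xc: "x \<in> carrier A" using x J_closed by blast
  have rc: "r \<in> carrier A" using r wedd_closed by blast
  have tc: "tl_i s i x \<in> carrier A" if "i \<in> {1..n}" for i
    unfolding tl_i_def using that S(2) J_mult x by auto
  have e: "tl_i s i (r \<otimes> x) = r \<otimes> tl_i s i x" if i: "i \<in> {1..n}" for i
  proof -
    obtain a b where ab: "a \<in> carrier K" "b \<in> carrier K" "f i \<otimes> r = a \<odot> f i \<oplus> b \<odot> u i"
      using weddD(2)[OF r i] unfolding piece_def by blast
    define p where "p = s (f i \<otimes> x)"
    define q where "q = s (u i \<otimes> x)"
    have pq: "p \<in> carrier A" "q \<in> carrier A" using S(2) J_mult x i by (auto simp: p_def q_def)
    have fx: "f i \<otimes> x \<in> J" "u i \<otimes> x \<in> J" "u i \<otimes> u i \<otimes> x \<in> J" using J_mult x i by auto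
    have 1: "f i \<otimes> (r \<otimes> x) = a \<odot> (f i \<otimes> x) \<oplus> b \<odot> (u i \<otimes> x)"
      using ab i rc xc by (simp add: m_assoc[symmetric] l_distr smult_mult_l)
    have "u i \<otimes> (r \<otimes> x) = u i \<otimes> (f i \<otimes> (r \<otimes> x))" using uf[OF i] i rc xc by (simp add: m_assoc[symmetric])
    also have "\<dots> = a \<odot> (u i \<otimes> x) \<oplus> b \<odot> (u i \<otimes> u i \<otimes> x)"
      unfolding 1 using ab i xc uf[OF i] by (simp add: r_distr smult_mult_r m_assoc[symmetric])
    finally have 2: "u i \<otimes> (r \<otimes> x) = a \<odot> (u i \<otimes> x) \<oplus> b \<odot> (u i \<otimes> u i \<otimes> x)" .
    have s1: "s (f i \<otimes> (r \<otimes> x)) = a \<odot> p \<oplus> b \<odot> q"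
      unfolding 1 p_def q_def using ab fx S(6,7) idl(8)[OF idJ] by simp
    have s2: "s (u i \<otimes> (r \<otimes> x)) = a \<odot> q \<oplus> b \<odot> s (u i \<otimes> u i \<otimes> x)"
      unfolding 2 p_def q_def using ab fx S(6,7) idl(8)[OF idJ] by simp
    have sz: "s \<zero> = \<zero>" using S(5)[OF J2_zero] .
    \<comment> \<open>If \<open>u i\<close> is nonzero, its square is \<open>f i\<close>. If it is
      zero, \<open>q\<close> is the value of the section at zero, so both identities read zero
      equals zero.\<close>
    have k1: "f i \<otimes> q = u i \<otimes> (u i \<otimes> q)" and k2: "u i \<otimes> s (u i \<otimes> u i \<otimes> x) = u i \<otimes> p"
      using uu[OF i] pq i xc sz by (auto simp: m_assoc[symmetric] p_def q_def)
    have sc: "s (u i \<otimes> u i \<otimes> x) \<in> carrier A" using S(2) fx by blast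
    have L: "f i \<otimes> s (f i \<otimes> (r \<otimes> x)) \<oplus> u i \<otimes> s (u i \<otimes> (r \<otimes> x)) =
       (a \<odot> (f i \<otimes> p) \<oplus> b \<odot> (f i \<otimes> q)) \<oplus> (a \<odot> (u i \<otimes> q) \<oplus> b \<odot> (u i \<otimes> p))"
      unfolding s1 s2 using ab i pq sc k2 by (simp add: r_distr smult_mult_r)
    have "r \<otimes> (f i \<otimes> p \<oplus> u i \<otimes> q) = (r \<otimes> f i) \<otimes> (p \<oplus> u i \<otimes> q)"
      using rc i pq fu[OF i] by (simp add: r_distr m_assoc) (simp add: m_assoc[symmetric])
    also have "\<dots> = (a \<odot> f i \<oplus> b \<odot> u i) \<otimes> (p \<oplus> u i \<otimes> q)" using weddD(1)[OF r i] ab by simp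
    also have "\<dots> = (a \<odot> (f i \<otimes> p) \<oplus> a \<odot> (u i \<otimes> q)) \<oplus> (b \<odot> (u i \<otimes> p) \<oplus> b \<odot> (u i \<otimes> (u i \<otimes> q)))"
      using ab i pq fu[OF i] by (simp add: l_distr r_distr smult_mult_l m_assoc[symmetric] vs.smult_r_distr a_ac)
    also have "\<dots> = f i \<otimes> s (f i \<otimes> (r \<otimes> x)) \<oplus> u i \<otimes> s (u i \<otimes> (r \<otimes> x))"
      unfolding L k1 using ab i pq by (simp add: a_ac)
    finally show ?thesis using rc i pq by (simp add: tl_i_def p_def q_def smult_mult_r)
  qed
  have "finsum A (\<lambda>i. tl_i s i (r \<otimes> x)) {1..n} = finsum A (\<lambda>i. r \<otimes> tl_i s i x) {1..n}"
    using e tc rc by (intro finsum_cong') auto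
  also have "\<dots> = r \<otimes> finsum A (\<lambda>i. tl_i s i x) {1..n}" using rc tc by (intro finsum_rdistr[symmetric]) auto
  finally show ?thesis .
qed

lemma right_average_linear:
  assumes s: "section_map s" and r: "r \<in> wedd" and x: "x \<in> J"
  shows "finsum A (\<lambda>i. tr_i s i (x \<otimes> r)) {1..n} = finsum A (\<lambda>i. tr_i s i x) {1..n} \<otimes> r"
proof -
  note S = section_mapD[OF s]
  have xc: "x \<in> carrier A" using x J_closed by blast
  have rc: "r \<in> carrier A" using r wedd_closed by blast
  have tc: "tr_i s i x \<in> carrier A" if "i \<in> {1..n}" for i
    unfolding tr_i_def using that S(2) J_mult x by auto
  have e: "tr_i s i (x \<otimes> r) = tr_i s i x \<otimes> r" if i: "i \<in> {1..n}" for i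
  proof -
    obtain a b where ab': "a \<in> carrier K" "b \<in> carrier K" "f i \<otimes> r = a \<odot> f i \<oplus> b \<odot> u i"
      using weddD(2)[OF r i] unfolding piece_def by blast
    have ab: "a \<in> carrier K" "b \<in> carrier K" "r \<otimes> f i = a \<odot> f i \<oplus> b \<odot> u i"
      using ab' weddD(1)[OF r i] by auto
    define p where "p = s (x \<otimes> f i)"
    define q where "q = s (x \<otimes> u i)"
    have pq: "p \<in> carrier A" "q \<in> carrier A" using S(2) J_mult x i by (auto simp: p_def q_def)
    have fx: "x \<otimes> f i \<in> J" "x \<otimes> u i \<in> J" "x \<otimes> (u i \<otimes> u i) \<in> J" using J_mult x i by auto
    have 1: "(x \<otimes> r) \<otimes> f i = a \<odot> (x \<otimes> f i) \<oplus> b \<odot> (x \<otimes> u i)"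
      using ab i rc xc by (simp add: m_assoc r_distr smult_mult_r)
    have "(x \<otimes> r) \<otimes> u i = ((x \<otimes> r) \<otimes> f i) \<otimes> u i" using fu[OF i] i rc xc by (simp add: m_assoc)
    also have "\<dots> = a \<odot> (x \<otimes> u i) \<oplus> b \<odot> (x \<otimes> (u i \<otimes> u i))"
      unfolding 1 using ab i xc fu[OF i] by (simp add: l_distr smult_mult_l m_assoc)
    finally have 2: "(x \<otimes> r) \<otimes> u i = a \<odot> (x \<otimes> u i) \<oplus> b \<odot> (x \<otimes> (u i \<otimes> u i))" .
    have s1: "s ((x \<otimes> r) \<otimes> f i) = a \<odot> p \<oplus> b \<odot> q"
      unfolding 1 p_def q_def using ab fx S(6,7) idl(8)[OF idJ] by simp
    have s2: "s ((x \<otimes> r) \<otimes> u i) = a \<odot> q \<oplus> b \<odot> s (x \<otimes> (u i \<otimes> u i))"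
      unfolding 2 p_def q_def using ab fx S(6,7) idl(8)[OF idJ] by simp
    have sz: "s \<zero> = \<zero>" using S(5)[OF J2_zero] .
    have k1: "q \<otimes> f i = (q \<otimes> u i) \<otimes> u i" and k2: "s (x \<otimes> (u i \<otimes> u i)) \<otimes> u i = p \<otimes> u i"
      using uu[OF i] pq i xc sz by (auto simp: m_assoc p_def q_def)
    have sc: "s (x \<otimes> (u i \<otimes> u i)) \<in> carrier A" using S(2) fx by blast
    have L: "s ((x \<otimes> r) \<otimes> f i) \<otimes> f i \<oplus> s ((x \<otimes> r) \<otimes> u i) \<otimes> u i =
       (a \<odot> (p \<otimes> f i) \<oplus> b \<odot> (q \<otimes> f i)) \<oplus> (a \<odot> (q \<otimes> u i) \<oplus> b \<odot> (p \<otimes> u i))"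
      unfolding s1 s2 using ab i pq sc k2 by (simp add: l_distr smult_mult_l)
    have "(p \<otimes> f i \<oplus> q \<otimes> u i) \<otimes> r = (p \<oplus> q \<otimes> u i) \<otimes> (f i \<otimes> r)"
      using rc i pq uf[OF i] by (simp add: l_distr m_assoc[symmetric]) (simp add: m_assoc)
    also have "\<dots> = (p \<oplus> q \<otimes> u i) \<otimes> (a \<odot> f i \<oplus> b \<odot> u i)" using ab' by simp
    also have "\<dots> = (a \<odot> (p \<otimes> f i) \<oplus> a \<odot> (q \<otimes> u i)) \<oplus> (b \<odot> (p \<otimes> u i) \<oplus> b \<odot> ((q \<otimes> u i) \<otimes> u i))"
      using ab i pq uf[OF i] by (simp add: l_distr r_distr smult_mult_r m_assoc vs.smult_r_distr a_ac)
    also have "\<dots> = s ((x \<otimes> r) \<otimes> f i) \<otimes> f i \<oplus> s ((x \<otimes> r) \<otimes> u i) \<otimes> u i"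
      unfolding L k1 using ab i pq by (simp add: a_ac)
    finally show ?thesis using rc i pq by (simp add: tr_i_def p_def q_def smult_mult_l)
  qed
  have "finsum A (\<lambda>i. tr_i s i (x \<otimes> r)) {1..n} = finsum A (\<lambda>i. tr_i s i x \<otimes> r) {1..n}"
    using e tc rc by (intro finsum_cong') auto
  also have "\<dots> = finsum A (\<lambda>i. tr_i s i x) {1..n} \<otimes> r" using rc tc by (intro finsum_ldistr[symmetric]) auto
  finally show ?thesis .
qed

lemma bilinear_section:
  "\<exists>s. section_map s \<and> (\<forall>r\<in>wedd. \<forall>x\<in>J. s (r \<otimes> x) = r \<otimes> s x \<and> s (x \<otimes> r) = s x \<otimes> r)"
proof -
  obtain s0 where s0: "section_map s0" using section_exists by blast
  define s1 where "s1 x = finsum A (\<lambda>i. tl_i s0 i x) {1..n}" for x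
  have s1: "section_map s1" unfolding s1_def by (rule left_average[OF s0])
  have l1: "s1 (r \<otimes> x) = r \<otimes> s1 x" if "r \<in> wedd" "x \<in> J" for r x
    unfolding s1_def by (rule left_average_linear[OF s0 that])
  define s where "s x = finsum A (\<lambda>i. tr_i s1 i x) {1..n}" for x
  have s: "section_map s" unfolding s_def by (rule right_average[OF s1])
  have r2: "s (x \<otimes> r) = s x \<otimes> r" if "r \<in> wedd" "x \<in> J" for r x
    unfolding s_def by (rule right_average_linear[OF s1 that])
  \<comment> \<open>The right average multiplies on the other side only, so the left linearity
    already achieved survives it.\<close>
  have l2: "s (r \<otimes> x) = r \<otimes> s x" if r: "r \<in> wedd" and x: "x \<in> J" for r x
  proof -
    note S = section_mapD[OF s1]
    have c: "r \<in> carrier A" "x \<in> carrier A" using r x wedd_closed J_closed by auto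
    have tc: "tr_i s1 i x \<in> carrier A" if "i \<in> {1..n}" for i
      unfolding tr_i_def using that S(2) J_mult x by auto
    have "tr_i s1 i (r \<otimes> x) = r \<otimes> tr_i s1 i x" if i: "i \<in> {1..n}" for i
      using l1[OF r J_mult(2)[OF x f_closed[OF i]]] l1[OF r J_mult(2)[OF x u_closed[OF i]]] c i
        S(2)[OF J_mult(2)[OF x f_closed[OF i]]] S(2)[OF J_mult(2)[OF x u_closed[OF i]]]
      by (simp add: tr_i_def m_assoc r_distr smult_mult_r)
    then have "s (r \<otimes> x) = finsum A (\<lambda>i. r \<otimes> tr_i s1 i x) {1..n}" unfolding s_def using tc c by (intro finsum_cong') auto
    also have "\<dots> = r \<otimes> s x" unfolding s_def using c tc by (intro finsum_rdistr[symmetric]) auto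
    finally show ?thesis .
  qed
  show ?thesis using s l2 r2 by blast
qed

end

section \<open>The superspecies of an algebra\<close>

locale decomp_salg = fd_salg K A for K :: "('k, 'x) ring_scheme" and A :: "('k, 'a, 'y) gmodule_scheme" (structure) +
  fixes n :: nat and D :: "nat => ('k, 'a set) gmodule"
  assumes decomp: "gr_division_decomp K (gquot A J) n D"
begin

abbreviation B where "B \<equiv> gquot A J"
abbreviation B_mult (infixl "\<otimes>\<^sub>B" 70) where "x \<otimes>\<^sub>B y \<equiv> x \<otimes>\<^bsub>B\<^esub> y"
abbreviation B_add (infixl "\<oplus>\<^sub>B" 65) where "x \<oplus>\<^sub>B y \<equiv> x \<oplus>\<^bsub>B\<^esub> y"
abbreviation q where "q x \<equiv> J +> x"
abbreviation RD where "RD \<equiv> superalgebra_sum {1..n} D"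

definition h :: "(nat => 'a set) => 'a set" where "h d = (\<Oplus>\<^bsub>B\<^esub>i\<in>{1..n}. d i)"

lemma D_sub: "i \<in> {1..n} ==> U \<in> carrier (D i) ==> U \<in> carrier B"
  and D_eq: "i \<in> {1..n} ==> D i = (gsub B (carrier (D i)))\<lparr>one := \<one>\<^bsub>D i\<^esub>\<rparr>"
  and D_div: "i \<in> {1..n} ==> gr_division K (D i)"
  and h_iso: "h \<in> superalgebra_iso K RD B"
  using decomp unfolding gr_division_decomp_def h_def[abs_def] by blast+

text \<open>Apart from its identity, each summand inherits all its operations from the quotient;
  this is extracted from the record equation in the decomposition, so that products in
  \<open>D i\<close> may be computed on cosets.\<close>

lemma D_ops:
  assumes "i \<in> {1..n}"
  shows "monoid.mult (D i) = monoid.mult B" "ring.add (D i) = ring.add B" "\<zero>\<^bsub>D i\<^esub> = \<zero>\<^bsub>B\<^esub>" "smult (D i) = smult B"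
    "hcomp (D i) g = hcomp B g \<inter> carrier (D i)"
  using arg_cong[OF D_eq[OF assms], of monoid.mult] arg_cong[OF D_eq[OF assms], of ring.add]
    arg_cong[OF D_eq[OF assms], of ring.zero] arg_cong[OF D_eq[OF assms], of smult] arg_cong[OF D_eq[OF assms], of "\<lambda>D. hcomp D g"]
  by (simp_all add: gsub_def)

lemma D_salg: assumes "i \<in> {1..n}" shows "salg K (D i)"
proof -
  have "superalgebra K (D i)" using D_div[OF assms] by (simp add: gr_division_def)
  then show ?thesis by (intro salg.intro) (rule superalgebra.axioms(2))
qed

lemma asJ: "additive_subgroup J A"
  using glidealD[OF glideal_J] by (intro additive_subgroup.intro) (simp add: subgroup_ai)

lemma q_eq: "x \<in> carrier A ==> y \<in> carrier A ==> q x = q y \<longleftrightarrow> x \<ominus> y \<in> J"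
  by (rule a_rcoset_eq_iff[OF asJ])

lemma carrier_B: "carrier B = q ` carrier A"
  by (auto simp: gquot_def FactRing_def A_RCOSETS_def')

lemma h_hom: "h \<in> ring_hom RD B" and h_bij: "bij_betw h (carrier RD) (carrier B)"
  using h_iso unfolding superalgebra_iso_def ring_iso_def by auto

lemma h_surj: assumes "U \<in> carrier B" obtains x where "x \<in> carrier RD" "h x = U"
proof -
  have "U \<in> h ` carrier RD" using bij_betw_imp_surj_on[OF h_bij] assms by simp
  then show ?thesis using that by blast
qed

lemma RD_simps:
  "carrier RD = (\<Pi>\<^sub>E i\<in>{1..n}. carrier (D i))" "i \<in> {1..n} ==> (x \<otimes>\<^bsub>RD\<^esub> y) i = x i \<otimes>\<^bsub>D i\<^esub> y i"
  "i \<in> {1..n} ==> (x \<oplus>\<^bsub>RD\<^esub> y) i = x i \<oplus>\<^bsub>D i\<^esub> y i" "i \<in> {1..n} ==> \<one>\<^bsub>RD\<^esub> i = \<one>\<^bsub>D i\<^esub>" "i \<in> {1..n} ==> \<zero>\<^bsub>RD\<^esub> i = \<zero>\<^bsub>D i\<^esub>"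
  "i \<in> {1..n} ==> (c \<odot>\<^bsub>RD\<^esub> x) i = c \<odot>\<^bsub>D i\<^esub> x i" "hcomp RD g = (\<Pi>\<^sub>E i\<in>{1..n}. hcomp (D i) g)"
  by (simp_all add: superalgebra_sum_def)

lemma RD_at: "x \<in> carrier RD ==> i \<in> {1..n} ==> x i \<in> carrier (D i)"
  unfolding RD_simps(1) by (rule PiE_mem)

lemma RD_closed:
  assumes "x \<in> carrier RD" "y \<in> carrier RD"
  shows "x \<otimes>\<^bsub>RD\<^esub> y \<in> carrier RD" "x \<oplus>\<^bsub>RD\<^esub> y \<in> carrier RD"
proof -
  have "x i \<otimes>\<^bsub>D i\<^esub> y i \<in> carrier (D i) \<and> x i \<oplus>\<^bsub>D i\<^esub> y i \<in> carrier (D i)" if i: "i \<in> {1..n}" for i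
  proof -
    interpret Di: salg K "D i" by (rule D_salg[OF i])
    have "x i \<in> carrier (D i)" "y i \<in> carrier (D i)" using assms i by (auto intro: RD_at)
    then show ?thesis by simp
  qed
  then show "x \<otimes>\<^bsub>RD\<^esub> y \<in> carrier RD" "x \<oplus>\<^bsub>RD\<^esub> y \<in> carrier RD" by (simp_all add: superalgebra_sum_def)
qed

lemma RD_one_zero: "\<one>\<^bsub>RD\<^esub> \<in> carrier RD" "\<zero>\<^bsub>RD\<^esub> \<in> carrier RD"
proof -
  have "\<one>\<^bsub>D i\<^esub> \<in> carrier (D i) \<and> \<zero>\<^bsub>D i\<^esub> \<in> carrier (D i)" if i: "i \<in> {1..n}" for i
  proof -
    interpret Di: salg K "D i" by (rule D_salg[OF i])
    show ?thesis by simp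
  qed
  then show "\<one>\<^bsub>RD\<^esub> \<in> carrier RD" "\<zero>\<^bsub>RD\<^esub> \<in> carrier RD" by (simp_all add: superalgebra_sum_def)
qed

lemma RD_smult_closed: assumes "c \<in> carrier K" "x \<in> carrier RD" shows "c \<odot>\<^bsub>RD\<^esub> x \<in> carrier RD"
proof -
  have "c \<odot>\<^bsub>D i\<^esub> x i \<in> carrier (D i)" if i: "i \<in> {1..n}" for i
  proof -
    interpret Di: salg K "D i" by (rule D_salg[OF i])
    have "x i \<in> carrier (D i)" using assms i by (auto intro: RD_at)
    then show ?thesis using assms by simp
  qed
  then show ?thesis by (simp add: superalgebra_sum_def)
qed

lemma B_mult_closed: assumes "U \<in> carrier B" "Y \<in> carrier B" shows "U \<otimes>\<^sub>B Y \<in> carrier B"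
proof -
  obtain x where x: "x \<in> carrier RD" "h x = U" by (rule h_surj[OF assms(1)])
  obtain y where y: "y \<in> carrier RD" "h y = Y" by (rule h_surj[OF assms(2)])
  note * = x y
  have "h (x \<otimes>\<^bsub>RD\<^esub> y) = U \<otimes>\<^sub>B Y" using ring_hom_mult[OF h_hom *(1,3)] * by simp
  moreover have "h (x \<otimes>\<^bsub>RD\<^esub> y) \<in> carrier B" using ring_hom_closed[OF h_hom RD_closed(1)[OF *(1,3)]] .
  ultimately show ?thesis by simp
qed

text \<open>\<open>J\<close> is a left ideal by construction.  If \<open>J \<cdot> (J + x)\<close>, computed on representatives, is a single coset,
  it is the coset of \<open>0\<close>, so that \<open>J x \<subseteq> J\<close>.\<close>

lemma ideal_J: "ideal J A"
proof -
  have r: "j \<otimes> x \<in> J" if j: "j \<in> J" and x: "x \<in> carrier A" for j x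
  proof -
    have Jc: "\<And>y. y \<in> J ==> y \<in> carrier A" using glidealD(1)[OF glideal_J] by blast
    have q0: "q \<zero> = J" by (rule a_coset_add_zero[OF additive_subgroup.a_subset[OF asJ]])
    have self: "y \<in> q y" if "y \<in> carrier A" for y
      using that glidealD(2)[OF glideal_J] by (auto simp: a_r_coset_def' intro!: bexI[of _ \<zero>])
    have "q \<zero> \<otimes>\<^sub>B q x \<in> carrier B" using x by (intro B_mult_closed) (auto simp: carrier_B)
    then obtain y where y: "y \<in> carrier A" "q \<zero> \<otimes>\<^sub>B q x = q y" by (auto simp: carrier_B)
    have mem: "i \<otimes> x \<in> q y" if "i \<in> J" for i
    proof -
      have "i \<otimes> x \<in> q (i \<otimes> x)" using self Jc[OF that] x by simp
      then have "i \<otimes> x \<in> q \<zero> \<otimes>\<^sub>B q x"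
        using that self[OF x] unfolding gquot_def FactRing_def rcoset_mult_def q0 by auto
      then show ?thesis using y by simp
    qed
    have "\<zero> \<in> q y" using mem[OF glidealD(2)[OF glideal_J]] x by simp
    then obtain i where i: "i \<in> J" "\<zero> = i \<oplus> y" by (auto simp: a_r_coset_def')
    then have "y = \<ominus> i" using y Jc minus_equality[of y i] a_comm[of y i] by simp
    then have "y \<in> J" using glidealD(4)[OF glideal_J i(1)] by simp
    moreover obtain i' where "i' \<in> J" "j \<otimes> x = i' \<oplus> y" using mem[OF j] by (auto simp: a_r_coset_def')
    ultimately show ?thesis using glidealD(3)[OF glideal_J] by simp
  qed
  have l: "x \<otimes> j \<in> J" if j: "j \<in> J" and x: "x \<in> carrier A" for j x
    using glideal_J that unfolding glideal_def by (simp add: graded_submodule_def regular_module_def)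
  show ?thesis
    by (rule idealI) (use asJ additive_subgroup.a_subgroup l r ring_axioms in auto)
qed

sublocale idJ: ideal J A by (rule ideal_J)

lemma q_mult: "x \<in> carrier A ==> y \<in> carrier A ==> q x \<otimes>\<^sub>B q y = q (x \<otimes> y)"
  by (simp add: gquot_def FactRing_def idJ.rcoset_mult_add)
lemma q_add: "x \<in> carrier A ==> y \<in> carrier A ==> q x \<oplus>\<^sub>B q y = q (x \<oplus> y)"
  by (simp add: gquot_def FactRing_def idJ.a_rcos_sum)
lemma q_one: "\<one>\<^bsub>B\<^esub> = q \<one>" by (simp add: gquot_def FactRing_def)
lemma q_zero: "\<zero>\<^bsub>B\<^esub> = q \<zero>"
  using q_eq by (simp add: gquot_def FactRing_def a_coset_add_zero idJ.a_subset)
lemma hcomp_B: "hcomp B g = q ` hcomp A g" by (simp add: gquot_def)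

lemma self: "x \<in> carrier A ==> x \<in> q x"
  by (rule idJ.a_rcos_self)

lemma q_mem: assumes "y \<in> q x" "x \<in> carrier A" shows "y \<in> carrier A \<and> y \<ominus> x \<in> J"
proof -
  obtain j where j: "j \<in> J" "y = j \<oplus> x" using assms(1) unfolding a_r_coset_def' by blast
  have jc: "j \<in> carrier A" by (rule idJ.Icarr[OF j(1)])
  have "y \<ominus> x = j" using j jc assms by (simp add: a_minus_def a_assoc r_neg)
  then show ?thesis using j jc assms by simp
qed

lemma q_smult: assumes "c \<in> carrier K" "x \<in> carrier A" shows "c \<odot>\<^bsub>B\<^esub> q x = q (c \<odot> x)"
proof -
  have "q (c \<odot> y) = q (c \<odot> x)" if "y \<in> q x" for y
  proof -
    have y: "y \<in> carrier A" "y \<ominus> x \<in> J" using q_mem[OF that assms(2)] by auto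
    have "c \<odot> y \<ominus> c \<odot> x = (c \<odot> \<one>) \<otimes> (y \<ominus> x)" using assms y by (simp add: smult_one a_minus_def vs.smult_r_distr vs.smult_r_minus)
    also have "\<dots> \<in> J" using idJ.I_l_closed y assms by simp
    finally show ?thesis using q_eq assms y by simp
  qed
  then have "(\<Union>y\<in>q x. q (c \<odot> y)) = (\<Union>y\<in>q x. q (c \<odot> x))" by (intro SUP_cong) simp_all
  moreover have "q x \<noteq> {}" using self[OF assms(2)] by blast
  ultimately show ?thesis by (simp add: gquot_def)
qed

lemma ring_B: "ring B"
proof (intro ringI abelian_groupI monoidI)
  fix U assume "U \<in> carrier B"
  then obtain x where "x \<in> carrier A" "U = q x" by (auto simp: carrier_B)
  then show "\<exists>Y\<in>carrier B. Y \<oplus>\<^sub>B U = \<zero>\<^bsub>B\<^esub>"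
    by (intro bexI[of _ "q (\<ominus> x)"]) (auto simp: carrier_B q_zero q_add l_neg)
qed (auto simp: carrier_B q_zero q_one q_add q_mult m_assoc a_ac l_distr r_distr)

sublocale B: ring B by (rule ring_B)

lemma q_finsum: "finite S ==> x \<in> S \<rightarrow> carrier A ==> finsum B (\<lambda>i. q (x i)) S = q (finsum A x S)"
proof (induction S rule: finite_induct)
  case (insert i S)
  then have "(\<lambda>i. q (x i)) \<in> S \<rightarrow> carrier B" "q (x i) \<in> carrier B" "x \<in> S \<rightarrow> carrier A" "x i \<in> carrier A" by (auto simp: carrier_B)
  then show ?case using insert by (simp add: q_add)
qed (simp add: q_zero)

definition emb :: "nat => 'a set => nat => 'a set" where
  "emb i U = (\<lambda>j\<in>{1..n}. if j = i then U else \<zero>\<^bsub>D j\<^esub>)"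

lemma emb_closed: assumes "i \<in> {1..n}" "U \<in> carrier (D i)" shows "emb i U \<in> carrier RD"
  using RD_one_zero(2) assms by (auto simp: emb_def RD_simps superalgebra_sum_def)

lemma h_emb: assumes i: "i \<in> {1..n}" and U: "U \<in> carrier (D i)" shows "h (emb i U) = U"
proof -
  have "h (emb i U) = (\<Oplus>\<^bsub>B\<^esub>j\<in>{1..n}. if i = j then U else \<zero>\<^bsub>B\<^esub>)"
    unfolding h_def by (rule B.finsum_cong') (use D_sub[OF i U] in \<open>auto simp: emb_def D_ops\<close>)
  also have "\<dots> = U" by (rule B.add.finprod_singleton[of i "{1..n}" "\<lambda>_. U"]) (use i D_sub[OF i U] in auto)
  finally show ?thesis .
qed

text \<open>Multiplication by the identity of a summand, on either side, extracts the corresponding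
  component; so these identities are central orthogonal idempotents of the quotient.\<close>

lemma eps_h:
  assumes i: "i \<in> {1..n}" and x: "x \<in> carrier RD"
  shows "\<one>\<^bsub>D i\<^esub> \<otimes>\<^sub>B h x = x i" "h x \<otimes>\<^sub>B \<one>\<^bsub>D i\<^esub> = x i"
proof -
  have Dj: "\<one>\<^bsub>D j\<^esub> \<in> carrier (D j) \<and> \<one>\<^bsub>D j\<^esub> \<otimes>\<^bsub>D j\<^esub> x j = x j \<and> x j \<otimes>\<^bsub>D j\<^esub> \<one>\<^bsub>D j\<^esub> = x j \<and>
      \<zero>\<^bsub>D j\<^esub> \<otimes>\<^bsub>D j\<^esub> x j = \<zero>\<^bsub>D j\<^esub> \<and> x j \<otimes>\<^bsub>D j\<^esub> \<zero>\<^bsub>D j\<^esub> = \<zero>\<^bsub>D j\<^esub>" if j: "j \<in> {1..n}" for j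
  proof -
    interpret Dj: salg K "D j" by (rule D_salg[OF j])
    show ?thesis using RD_at[OF x j] by simp
  qed
  have o: "\<one>\<^bsub>D i\<^esub> \<in> carrier (D i)" using Dj[OF i] by simp
  have xi: "x i \<in> carrier (D i)" by (rule RD_at[OF x i])
  have "emb i \<one>\<^bsub>D i\<^esub> \<otimes>\<^bsub>RD\<^esub> x = emb i (x i)" "x \<otimes>\<^bsub>RD\<^esub> emb i \<one>\<^bsub>D i\<^esub> = emb i (x i)"
    using Dj by (auto simp: superalgebra_sum_def emb_def fun_eq_iff restrict_def)
  then show "\<one>\<^bsub>D i\<^esub> \<otimes>\<^sub>B h x = x i" "h x \<otimes>\<^sub>B \<one>\<^bsub>D i\<^esub> = x i"
    using ring_hom_mult[OF h_hom emb_closed[OF i o] x] ring_hom_mult[OF h_hom x emb_closed[OF i o]] h_emb[OF i xi] h_emb[OF i o] by simp_all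
qed

lemma eps:
  assumes i: "i \<in> {1..n}" and U: "U \<in> carrier B"
  shows "\<one>\<^bsub>D i\<^esub> \<otimes>\<^sub>B U \<in> carrier (D i)" "U \<otimes>\<^sub>B \<one>\<^bsub>D i\<^esub> = \<one>\<^bsub>D i\<^esub> \<otimes>\<^sub>B U"
proof -
  obtain x where x: "x \<in> carrier RD" "h x = U" by (rule h_surj[OF U])
  have "x i \<in> carrier (D i)" using RD_at[OF x(1) i] .
  then show "\<one>\<^bsub>D i\<^esub> \<otimes>\<^sub>B U \<in> carrier (D i)" "U \<otimes>\<^sub>B \<one>\<^bsub>D i\<^esub> = \<one>\<^bsub>D i\<^esub> \<otimes>\<^sub>B U"
    using eps_h[OF i x(1)] x by simp_all
qed

lemma eps_in: "i \<in> {1..n} ==> \<one>\<^bsub>D i\<^esub> \<in> carrier (D i)" "i \<in> {1..n} ==> \<one>\<^bsub>D i\<^esub> \<in> hcomp B 0"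
proof -
  assume i: "i \<in> {1..n}"
  interpret Di: salg K "D i" by (rule D_salg[OF i])
  show "\<one>\<^bsub>D i\<^esub> \<in> carrier (D i)" by simp
  show "\<one>\<^bsub>D i\<^esub> \<in> hcomp B 0" using Di.one_hcomp D_ops[OF i] by auto
qed

lemma eps_D: assumes i: "i \<in> {1..n}" and U: "U \<in> carrier (D i)" shows "\<one>\<^bsub>D i\<^esub> \<otimes>\<^sub>B U = U"
proof -
  interpret Di: salg K "D i" by (rule D_salg[OF i])
  show ?thesis using Di.l_one[OF U] D_ops[OF i] by simp
qed

lemma eps_orth: assumes i: "i \<in> {1..n}" and j: "j \<in> {1..n}" and "i \<noteq> j" shows "\<one>\<^bsub>D i\<^esub> \<otimes>\<^sub>B \<one>\<^bsub>D j\<^esub> = \<zero>\<^bsub>B\<^esub>"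
  using eps_h(1)[OF i emb_closed[OF j eps_in(1)[OF j]]] h_emb[OF j eps_in(1)[OF j]] assms by (simp add: emb_def D_ops)

lemma eps_sum: "(\<Oplus>\<^bsub>B\<^esub>i\<in>{1..n}. \<one>\<^bsub>D i\<^esub>) = \<one>\<^bsub>B\<^esub>"
proof -
  have "(\<Oplus>\<^bsub>B\<^esub>i\<in>{1..n}. \<one>\<^bsub>D i\<^esub>) = h \<one>\<^bsub>RD\<^esub>"
    unfolding h_def by (rule B.finsum_cong') (use D_sub[OF _ eps_in(1)] in \<open>simp_all add: superalgebra_sum_def\<close>)
  then show ?thesis using ring_hom_one[OF h_hom] by simp
qed

lemma h_zero: "h \<zero>\<^bsub>RD\<^esub> = \<zero>\<^bsub>B\<^esub>"
proof -
  have "h \<zero>\<^bsub>RD\<^esub> = (\<Oplus>\<^bsub>B\<^esub>i\<in>{1..n}. \<zero>\<^bsub>B\<^esub>)"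
    unfolding h_def by (rule B.finsum_cong') (simp_all add: superalgebra_sum_def D_ops)
  then show ?thesis by simp
qed

text \<open>The spans \<open>V k\<close> of the powers of \<open>a\<close> below \<open>k\<close>
  form an ascending chain, which becomes stationary by finite dimension; then power \<open>k\<close>
  is a combination of lower ones. Combinations are coefficient lists, so the polynomial is read off
  at once.\<close>

lemma monic_annihilator:
  assumes a: "a \<in> carrier A" shows "\<exists>p. set p \<subseteq> carrier K \<and> aev (\<one>\<^bsub>K\<^esub> # p) a = \<zero>"
proof -
  define V where "V k = {aev p a | p. set p \<subseteq> carrier K \<and> length p = k}" for k :: nat
  have aev_add: "\<exists>r. set r \<subseteq> carrier K \<and> length r = length p \<and> aev r a = aev p a \<oplus> aev p' a"
    if "set p \<subseteq> carrier K" "set p' \<subseteq> carrier K" "length p = length p'" for p p'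
    using that
  proof (induction p arbitrary: p')
    case Nil then show ?case by simp
  next
    case (Cons c p)
    then obtain c' r' where p': "p' = c' # r'" by (cases p') auto
    then obtain r where r: "set r \<subseteq> carrier K" "length r = length p" "aev r a = aev p a \<oplus> aev r' a" using Cons.IH[of r'] Cons.prems by auto
    show ?case by (rule exI[of _ "(c \<oplus>\<^bsub>K\<^esub> c') # r"]) (use Cons.prems p' r a in \<open>auto simp: vs.smult_l_distr a_ac\<close>)
  qed
  have aev_smult: "set p \<subseteq> carrier K ==> aev (map (\<lambda>x. c \<otimes>\<^bsub>K\<^esub> x) p) a = c \<odot> aev p a" if "c \<in> carrier K" for c p
    by (induction p) (use that a in \<open>auto simp: vs.smult_r_distr vs.smult_assoc1\<close>)
  have zeros: "aev (replicate k \<zero>\<^bsub>K\<^esub>) a = \<zero>" for k by (induction k) (use a in auto)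
  have VI: "aev p a \<in> V k" if "set p \<subseteq> carrier K" "length p = k" for p k using that unfolding V_def by blast
  have VE: "\<exists>p. set p \<subseteq> carrier K \<and> length p = k \<and> x = aev p a" if "x \<in> V k" for x k using that unfolding V_def by blast
  have ks: "ksub (V k)" for k
    unfolding ksub_def
  proof (intro conjI ballI)
    show "V k \<subseteq> carrier A" using a by (auto simp: V_def)
    have "set (replicate k \<zero>\<^bsub>K\<^esub>) \<subseteq> carrier K" by auto
    from VI[OF this, of k] show "\<zero> \<in> V k" using zeros[of k] by simp
  next
    fix x y assume "x \<in> V k" "y \<in> V k"
    then obtain p p' where p: "set p \<subseteq> carrier K" "length p = k" "x = aev p a" "set p' \<subseteq> carrier K" "length p' = k" "y = aev p' a"
      using VE by meson
    obtain r where "set r \<subseteq> carrier K" "length r = length p" "aev r a = aev p a \<oplus> aev p' a" using aev_add[OF p(1,4)] p by auto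
    then show "x \<oplus> y \<in> V k" using VI[of r k] p by simp
  next
    fix c x assume c: "c \<in> carrier K" and "x \<in> V k"
    then obtain p where p: "set p \<subseteq> carrier K" "length p = k" "x = aev p a" using VE by meson
    have "set (map (\<lambda>x. c \<otimes>\<^bsub>K\<^esub> x) p) \<subseteq> carrier K" using c p by auto
    from VI[OF this, of k] show "c \<odot> x \<in> V k" using p aev_smult[OF c] by simp
  qed
  obtain k where k: "\<forall>W\<in>range V. V k \<subseteq> W \<longrightarrow> W = V k" using ksub_maximal[of "V 0" "range V"] ks by auto
  have "V k \<subseteq> V (Suc k)"
  proof
    fix x assume "x \<in> V k"
    then obtain p where p: "set p \<subseteq> carrier K" "length p = k" "x = aev p a" using VE by meson
    have "aev (\<zero>\<^bsub>K\<^esub> # p) a \<in> V (Suc k)" by (rule VI) (use p in auto)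
    then show "x \<in> V (Suc k)" using a p by simp
  qed
  then have eq: "V (Suc k) = V k" using k by blast
  have "aev (\<one>\<^bsub>K\<^esub> # replicate k \<zero>\<^bsub>K\<^esub>) a \<in> V (Suc k)" by (rule VI) auto
  then have "a [^] k \<in> V k" using zeros[of k] a eq by simp
  then obtain p where p: "set p \<subseteq> carrier K" "length p = k" "a [^] k = aev p a" using VE by meson
  let ?m = "\<ominus>\<^bsub>K\<^esub> \<one>\<^bsub>K\<^esub>"
  have "aev (\<one>\<^bsub>K\<^esub> # map (\<lambda>x. ?m \<otimes>\<^bsub>K\<^esub> x) p) a = a [^] k \<oplus> ?m \<odot> aev p a"
    using p a aev_smult[of ?m p] by simp
  also have "\<dots> = \<zero>" using p(3)[symmetric] a by (simp add: vs.smult_l_minus r_neg)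
  finally show ?thesis using p by (intro exI[of _ "map (\<lambda>x. ?m \<otimes>\<^bsub>K\<^esub> x) p"]) auto
qed

text \<open>Multiplication by the identity of \<open>D i\<close> maps the quotient homomorphically
  onto \<open>D i\<close>, so a polynomial annihilating \<open>x\<close> in \<open>A\<close>
  annihilates the image of \<open>x\<close> in \<open>D i\<close>.\<close>

lemma aev_D:
  assumes i: "i \<in> {1..n}" and x: "x \<in> carrier A" and p: "set p \<subseteq> carrier K"
  shows "salg.aev (D i) p (\<one>\<^bsub>D i\<^esub> \<otimes>\<^sub>B q x) = \<one>\<^bsub>D i\<^esub> \<otimes>\<^sub>B q (aev p x)"
proof -
  interpret Di: salg K "D i" by (rule D_salg[OF i])
  let ?e = "\<one>\<^bsub>D i\<^esub>"
  have eB: "?e \<in> carrier B" using D_sub[OF i] eps_in(1)[OF i] by simp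
  obtain e where e: "e \<in> carrier A" "?e = q e" using eB by (auto simp: carrier_B)
  have qB: "q y \<in> carrier B" if "y \<in> carrier A" for y using that by (simp add: carrier_B)
  have mul: "(?e \<otimes>\<^sub>B q y) \<otimes>\<^sub>B (?e \<otimes>\<^sub>B q z) = ?e \<otimes>\<^sub>B q (y \<otimes> z)" if "y \<in> carrier A" "z \<in> carrier A" for y z
  proof -
    have "(?e \<otimes>\<^sub>B q y) \<otimes>\<^sub>B (?e \<otimes>\<^sub>B q z) = (?e \<otimes>\<^sub>B q y) \<otimes>\<^sub>B ?e \<otimes>\<^sub>B q z" using eB qB that by (simp add: B.m_assoc)
    also have "(?e \<otimes>\<^sub>B q y) \<otimes>\<^sub>B ?e = ?e \<otimes>\<^sub>B q y"
      using eps(2)[OF i, of "?e \<otimes>\<^sub>B q y"] eps_D[OF i eps(1)[OF i]] eB qB that by simp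
    also have "?e \<otimes>\<^sub>B q y \<otimes>\<^sub>B q z = ?e \<otimes>\<^sub>B q (y \<otimes> z)" using eB qB that by (simp add: B.m_assoc q_mult)
    finally show ?thesis .
  qed
  have pow: "(?e \<otimes>\<^sub>B q x) [^]\<^bsub>D i\<^esub> k = ?e \<otimes>\<^sub>B q (x [^] k)" for k :: nat
  proof (induction k)
    case 0 show ?case using eps(2)[OF i B.one_closed] eB by (simp add: q_one[symmetric])
  next
    case (Suc k) show ?case using Suc mul[of "x [^] k" x] x by (simp add: D_ops[OF i])
  qed
  show ?thesis using p
  proof (induction p)
    case Nil show ?case using eB by (simp add: q_zero[symmetric] D_ops[OF i])
  next
    case (Cons c p)
    then have "Di.aev (c # p) (?e \<otimes>\<^sub>B q x) = c \<odot>\<^bsub>B\<^esub> (?e \<otimes>\<^sub>B q (x [^] length p)) \<oplus>\<^sub>B ?e \<otimes>\<^sub>B q (aev p x)"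
      by (simp add: pow D_ops[OF i])
    also have "\<dots> = ?e \<otimes>\<^sub>B q (aev (c # p) x)"
      using Cons.prems x e by (simp add: q_mult q_smult q_add r_distr smult_mult_r)
    finally show ?case .
  qed
qed

text \<open>Both representatives are bundled with all their properties so that one choice per index
  suffices. The alternative \<open>v = \<zero>\<close> is an equation in \<open>A\<close>, as
  \<open>basic_salg\<close> demands.\<close>

definition gen_lift :: "nat => 'a => 'a => bool" where
  "gen_lift i e v \<longleftrightarrow> e \<in> hcomp A 0 \<and> v \<in> hcomp A 1 \<and> q e = \<one>\<^bsub>D i\<^esub> \<and> \<one>\<^bsub>D i\<^esub> \<otimes>\<^sub>B q v = q v \<and> (q v \<otimes>\<^sub>B q v = \<one>\<^bsub>D i\<^esub> \<or> v = \<zero>) \<and>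
    (\<forall>x\<in>hcomp A 0. \<exists>c\<in>carrier K. \<one>\<^bsub>D i\<^esub> \<otimes>\<^sub>B q x = c \<odot>\<^bsub>B\<^esub> \<one>\<^bsub>D i\<^esub>) \<and> (\<forall>x\<in>hcomp A 1. \<exists>c\<in>carrier K. \<one>\<^bsub>D i\<^esub> \<otimes>\<^sub>B q x = c \<odot>\<^bsub>B\<^esub> q v)"

lemma eps_lift:
  assumes ac: "algebraically_closed K" and i: "i \<in> {1..n}"
  shows "\<exists>e v. gen_lift i e v"
proof -
  interpret Di: salg K "D i" by (rule D_salg[OF i])
  have ne: "\<one>\<^bsub>D i\<^esub> \<noteq> \<zero>\<^bsub>D i\<^esub>" and div: "\<And>g x. x \<in> hcomp (D i) g ==> x \<noteq> \<zero>\<^bsub>D i\<^esub> ==> x \<in> Units (D i)"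
    using D_div[OF i] by (auto simp: gr_division_def)
  obtain e where e: "e \<in> hcomp A 0" "q e = \<one>\<^bsub>D i\<^esub>" using eps_in(2)[OF i] unfolding hcomp_B by force
  have ec: "e \<in> carrier A" using hcomp_carrier[OF e(1)] .
  have eq: "\<one>\<^bsub>D i\<^esub> \<otimes>\<^sub>B q x \<in> hcomp (D i) g" if x: "x \<in> hcomp A g" for g x
  proof -
    have "e \<otimes> x \<in> hcomp A g" using hcomp_mult[OF e(1) x] by (simp only: add_0_left)
    then have "\<one>\<^bsub>D i\<^esub> \<otimes>\<^sub>B q x \<in> hcomp B g" using q_mult[OF ec hcomp_carrier[OF x]] e(2) unfolding hcomp_B by auto
    then show ?thesis using eps(1)[OF i, of "q x"] hcomp_carrier[OF x] by (simp add: D_ops[OF i] carrier_B)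
  qed
  have ann: "\<exists>p. set p \<subseteq> carrier K \<and> Di.aev (\<one>\<^bsub>K\<^esub> # p) (\<one>\<^bsub>D i\<^esub> \<otimes>\<^sub>B q x) = \<zero>\<^bsub>D i\<^esub>" if x: "x \<in> carrier A" for x
  proof -
    obtain p where p: "set p \<subseteq> carrier K" "aev (\<one>\<^bsub>K\<^esub> # p) x = \<zero>" using monic_annihilator[OF x] by blast
    have "Di.aev (\<one>\<^bsub>K\<^esub> # p) (\<one>\<^bsub>D i\<^esub> \<otimes>\<^sub>B q x) = \<one>\<^bsub>D i\<^esub> \<otimes>\<^sub>B q \<zero>"
      using aev_D[OF i x, of "\<one>\<^bsub>K\<^esub> # p"] p by simp
    also have "\<dots> = \<zero>\<^bsub>D i\<^esub>" using D_sub[OF i eps_in(1)[OF i]] by (simp add: q_zero[symmetric] D_ops[OF i])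
    finally show ?thesis using p by blast
  qed
  have even: "\<exists>c\<in>carrier K. \<one>\<^bsub>D i\<^esub> \<otimes>\<^sub>B q x = c \<odot>\<^bsub>D i\<^esub> \<one>\<^bsub>D i\<^esub>" if x: "x \<in> hcomp A 0" for x
  proof -
    obtain p where "set p \<subseteq> carrier K" "Di.aev (\<one>\<^bsub>K\<^esub> # p) (\<one>\<^bsub>D i\<^esub> \<otimes>\<^sub>B q x) = \<zero>\<^bsub>D i\<^esub>" using ann[OF hcomp_carrier[OF x]] by blast
    then show ?thesis using Di.gr_division_even[OF ac div ne eq[OF x] vs.R.one_closed] by simp
  qed
  have evenD: "\<exists>c\<in>carrier K. y = c \<odot>\<^bsub>D i\<^esub> \<one>\<^bsub>D i\<^esub>" if y: "y \<in> hcomp (D i) 0" for y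
  proof -
    have "y \<in> q ` hcomp A 0" using y by (simp add: D_ops[OF i] hcomp_B)
    then obtain x where x: "x \<in> hcomp A 0" "y = q x" by blast
    then show ?thesis using even[OF x(1)] eps_D[OF i, of y] y by (simp add: D_ops[OF i])
  qed
  obtain u where uh: "u \<in> hcomp (D i) 1" and u': "(u \<otimes>\<^bsub>D i\<^esub> u = \<one>\<^bsub>D i\<^esub> \<or> u = \<zero>\<^bsub>D i\<^esub>) \<and> (\<forall>x\<in>hcomp (D i) 1. \<exists>c\<in>carrier K. x = c \<odot>\<^bsub>D i\<^esub> u)"
    using Di.gr_division_odd[OF ac div ne evenD] by (rule bexE)
  note u = uh conjunct1[OF u'] bspec[OF conjunct2[OF u']]
  have "u \<in> q ` hcomp A 1" using u(1) by (simp add: D_ops[OF i] hcomp_B)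
  then obtain v0 where v0: "v0 \<in> hcomp A 1" "u = q v0" by blast
  \<comment> \<open>A zero odd generator could be represented by any odd element of
    \<open>J\<close>; it is represented by zero itself.\<close>
  define v where "v = (if u = \<zero>\<^bsub>D i\<^esub> then \<zero> else v0)"
  have v: "v \<in> hcomp A 1" "q v = u" using v0 by (auto simp: v_def D_ops[OF i] q_zero)
  have uD: "u \<in> carrier (D i)" using u(1) Di.hcomp_carrier by blast
  show ?thesis
    unfolding gen_lift_def
  proof (intro exI conjI ballI)
    show "e \<in> hcomp A 0" "v \<in> hcomp A 1" "q e = \<one>\<^bsub>D i\<^esub>" using e v by auto
    show "\<one>\<^bsub>D i\<^esub> \<otimes>\<^sub>B q v = q v" using eps_D[OF i uD] v by simp
    show "q v \<otimes>\<^sub>B q v = \<one>\<^bsub>D i\<^esub> \<or> v = \<zero>" using u(2) v by (auto simp: v_def D_ops[OF i])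
    show "\<exists>c\<in>carrier K. \<one>\<^bsub>D i\<^esub> \<otimes>\<^sub>B q x = c \<odot>\<^bsub>B\<^esub> \<one>\<^bsub>D i\<^esub>" if "x \<in> hcomp A 0" for x using even[OF that] by (simp add: D_ops[OF i])
    show "\<exists>c\<in>carrier K. \<one>\<^bsub>D i\<^esub> \<otimes>\<^sub>B q x = c \<odot>\<^bsub>B\<^esub> q v" if "x \<in> hcomp A 1" for x using u(3)[OF eq[OF that]] v by (simp add: D_ops[OF i])
  qed
qed

lemma q_eqI: "x \<in> carrier A ==> y \<in> carrier A ==> q x = q y ==> x \<ominus> y \<in> J"
  using q_eq by blast

lemma split_exists:
  assumes ac: "algebraically_closed K" and ch: "\<one>\<^bsub>K\<^esub> \<oplus>\<^bsub>K\<^esub> \<one>\<^bsub>K\<^esub> \<noteq> \<zero>\<^bsub>K\<^esub>"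
  shows "\<exists>f u. split_salg K A n f u \<and> (\<forall>i\<in>{1..n}. q (f i) = \<one>\<^bsub>D i\<^esub>)"
proof -
  define g where "g i = (SOME p. gen_lift i (fst p) (snd p))" for i
  define e v where "e i = fst (g i)" and "v i = snd (g i)" for i
  have ev: "gen_lift i (e i) (v i)" if i: "i \<in> {1..n}" for i
  proof -
    obtain e0 v0 where "gen_lift i e0 v0" using eps_lift[OF ac i] by blast
    then have "gen_lift i (fst (e0, v0)) (snd (e0, v0))" by simp
    then show ?thesis unfolding e_def v_def g_def by (rule someI)
  qed
  have
      e: "\<And>i. i \<in> {1..n} ==> e i \<in> hcomp A 0" and v: "\<And>i. i \<in> {1..n} ==> v i \<in> hcomp A 1"
    and qe: "\<And>i. i \<in> {1..n} ==> q (e i) = \<one>\<^bsub>D i\<^esub>" and qv: "\<And>i. i \<in> {1..n} ==> \<one>\<^bsub>D i\<^esub> \<otimes>\<^sub>B q (v i) = q (v i)"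
    and qvv: "\<And>i. i \<in> {1..n} ==> q (v i) \<otimes>\<^sub>B q (v i) = \<one>\<^bsub>D i\<^esub> \<or> v i = \<zero>"
    and g0: "\<And>i x. i \<in> {1..n} ==> x \<in> hcomp A 0 ==> \<exists>c\<in>carrier K. \<one>\<^bsub>D i\<^esub> \<otimes>\<^sub>B q x = c \<odot>\<^bsub>B\<^esub> \<one>\<^bsub>D i\<^esub>"
    and g1: "\<And>i x. i \<in> {1..n} ==> x \<in> hcomp A 1 ==> \<exists>c\<in>carrier K. \<one>\<^bsub>D i\<^esub> \<otimes>\<^sub>B q x = c \<odot>\<^bsub>B\<^esub> q (v i)"
    using ev unfolding gen_lift_def by blast+
  have ec: "e i \<in> carrier A" and vc: "v i \<in> carrier A" if "i \<in> {1..n}" for i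
    using hcomp_carrier e v that by blast+
  interpret rs: rad_salg K A by unfold_locales (rule ch)
  have eqJ: "rs.eqJ x y" if "x \<in> carrier A" "y \<in> carrier A" "q x = q y" for x y
    unfolding rs.eqJ_def using that q_eqI by simp
  have qB: "q x \<in> carrier B" if "x \<in> carrier A" for x using that by (simp add: carrier_B)
  have epsB: "\<one>\<^bsub>D i\<^esub> \<in> carrier B" if "i \<in> {1..n}" for i using D_sub[OF that eps_in(1)[OF that]] .
  \<comment> \<open>The identity of a summand is central, so the right factor moves to the left,
    where it is absorbed.\<close>
  have sand: "q (e i \<otimes> x \<otimes> e i) = \<one>\<^bsub>D i\<^esub> \<otimes>\<^sub>B q x" if i: "i \<in> {1..n}" and x: "x \<in> carrier A" for i x
  proof -
    have "q (e i \<otimes> x \<otimes> e i) = (\<one>\<^bsub>D i\<^esub> \<otimes>\<^sub>B q x) \<otimes>\<^sub>B \<one>\<^bsub>D i\<^esub>" using ec[OF i] x by (simp add: q_mult[symmetric] qe[OF i])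
    also have "\<dots> = \<one>\<^bsub>D i\<^esub> \<otimes>\<^sub>B (\<one>\<^bsub>D i\<^esub> \<otimes>\<^sub>B q x)" using epsB[OF i] qB[OF x] by (intro eps(2)[OF i]) simp
    also have "\<dots> = \<one>\<^bsub>D i\<^esub> \<otimes>\<^sub>B q x" by (rule eps_D[OF i eps(1)[OF i qB[OF x]]])
    finally show ?thesis .
  qed
  have basic: "basic_salg K A n e v"
  proof (intro basic_salg.intro basic_salg_axioms.intro)
    show "rad_salg K A" by unfold_locales
    fix i assume i: "i \<in> {1..n}"
    show "e i \<in> hcomp A 0" "v i \<in> hcomp A 1" using e v i by auto
    show "rs.eqJ (e i \<otimes> e i) (e i)" using eps_D[OF i eps_in(1)[OF i]] ec[OF i] by (intro eqJ) (simp_all add: q_mult[symmetric] qe[OF i])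
    show "rs.eqJ (e i \<otimes> v i) (v i)" using ec[OF i] vc[OF i] qv[OF i] by (intro eqJ) (simp_all add: q_mult[symmetric] qe[OF i])
    show "rs.eqJ (v i \<otimes> e i) (v i)" using ec[OF i] vc[OF i] qv[OF i] eps(2)[OF i qB[OF vc[OF i]]] by (intro eqJ) (simp_all add: q_mult[symmetric] qe[OF i])
    show "rs.eqJ (v i \<otimes> v i) (e i) \<or> v i = \<zero>"
    proof (cases "v i = \<zero>")
      case False
      then have "q (v i \<otimes> v i) = q (e i)" using qvv[OF i] vc[OF i] qe[OF i] by (simp add: q_mult[symmetric])
      then show ?thesis using eqJ vc[OF i] ec[OF i] by simp
    qed simp
    show "e i \<notin> J"
    proof
      assume "e i \<in> J"
      then have "q (e i) = q \<zero>" using q_eq[of "e i" \<zero>] ec[OF i] by (simp add: a_minus_def)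
      then have "\<one>\<^bsub>D i\<^esub> = \<zero>\<^bsub>D i\<^esub>" using qe[OF i] by (simp add: D_ops[OF i] q_zero)
      then show False using D_div[OF i] by (simp add: gr_division_def)
    qed
    show "\<exists>c\<in>carrier K. rs.eqJ (e i \<otimes> x \<otimes> e i) (c \<odot> e i)" if x: "x \<in> hcomp A 0" for x
    proof -
      obtain c where c: "c \<in> carrier K" "\<one>\<^bsub>D i\<^esub> \<otimes>\<^sub>B q x = c \<odot>\<^bsub>B\<^esub> \<one>\<^bsub>D i\<^esub>" using g0[OF i x] by blast
      have "rs.eqJ (e i \<otimes> x \<otimes> e i) (c \<odot> e i)"
        using c ec[OF i] hcomp_carrier[OF x] sand[OF i hcomp_carrier[OF x]] by (intro eqJ) (simp_all add: q_smult[symmetric] qe[OF i])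
      then show ?thesis using c by blast
    qed
    show "\<exists>c\<in>carrier K. rs.eqJ (e i \<otimes> x \<otimes> e i) (c \<odot> v i)" if x: "x \<in> hcomp A 1" for x
    proof -
      obtain c where c: "c \<in> carrier K" "\<one>\<^bsub>D i\<^esub> \<otimes>\<^sub>B q x = c \<odot>\<^bsub>B\<^esub> q (v i)" using g1[OF i x] by blast
      have "rs.eqJ (e i \<otimes> x \<otimes> e i) (c \<odot> v i)"
        using c ec[OF i] vc[OF i] hcomp_carrier[OF x] sand[OF i hcomp_carrier[OF x]] by (intro eqJ) (simp_all add: q_smult[symmetric])
      then show ?thesis using c by blast
    qed
    show "rs.eqJ (e i \<otimes> x \<otimes> e j) \<zero>" if j: "j \<in> {1..n}" and ij: "i \<noteq> j" and x: "x \<in> carrier A" for j x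
    proof -
      have "q (e i \<otimes> x \<otimes> e j) = (q x \<otimes>\<^sub>B \<one>\<^bsub>D i\<^esub>) \<otimes>\<^sub>B \<one>\<^bsub>D j\<^esub>"
        using ec[OF i] ec[OF j] x eps(2)[OF i qB[OF x]] by (simp add: q_mult[symmetric] qe[OF i] qe[OF j])
      also have "\<dots> = q \<zero>" using eps_orth[OF i j ij] epsB[OF i] epsB[OF j] qB[OF x] by (simp add: B.m_assoc q_zero[symmetric])
      finally show ?thesis using ec[OF i] ec[OF j] x by (intro eqJ) simp_all
    qed
  next
    have eP: "e \<in> {1..n} \<rightarrow> carrier A" using ec by blast
    have "q (finsum A e {1..n}) = (\<Oplus>\<^bsub>B\<^esub>i\<in>{1..n}. q (e i))" using q_finsum[OF _ eP] by simp
    also have "\<dots> = (\<Oplus>\<^bsub>B\<^esub>i\<in>{1..n}. \<one>\<^bsub>D i\<^esub>)" by (rule B.finsum_cong') (use qe epsB in auto)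
    also have "\<dots> = q \<one>" by (simp only: eps_sum q_one)
    finally show "rs.eqJ (finsum A e {1..n}) \<one>" using finsum_closed[OF eP] by (intro eqJ) simp_all
  qed
  obtain f u where f: "split_salg K A n f u" "\<And>i. i \<in> {1..n} ==> rs.eqJ (f i) (e i)"
  proof (rule basic_salg.exact_lift[OF basic], goal_cases)
    case (1 f u)
    have "split_salg K A n f u"
      by (intro split_salg.intro split_salg_axioms.intro) (rule rs.rad_salg_axioms | (rule 1; assumption))+
    then show ?case using 1 that by simp
  qed
  have "q (f i) = \<one>\<^bsub>D i\<^esub>" if i: "i \<in> {1..n}" for i
    using f(2)[OF i] q_eq[of "f i" "e i"] qe[OF i] unfolding rs.eqJ_def by simp
  then show ?thesis using f(1) by blast
qed

end

text \<open>A record that embeds into a ring compatibly with its operations, with image closed under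
  negation, is itself a ring. The species ring and, by the following analogue, the species bimodule
  obtain their laws this way.\<close>

lemma (in ring) ring_by_injection:
  fixes R' :: "('r, 'w) ring_scheme"
  assumes cl: "\<And>x y. x \<in> carrier R' ==> y \<in> carrier R' ==> x \<otimes>\<^bsub>R'\<^esub> y \<in> carrier R'" "\<And>x y. x \<in> carrier R' ==> y \<in> carrier R' ==> x \<oplus>\<^bsub>R'\<^esub> y \<in> carrier R'"
      "\<one>\<^bsub>R'\<^esub> \<in> carrier R'" "\<zero>\<^bsub>R'\<^esub> \<in> carrier R'"
    and sc: "\<And>x. x \<in> carrier R' ==> s x \<in> carrier R" and inj: "\<And>x y. x \<in> carrier R' ==> y \<in> carrier R' ==> s x = s y ==> x = y"
    and sm: "\<And>x y. x \<in> carrier R' ==> y \<in> carrier R' ==> s (x \<otimes>\<^bsub>R'\<^esub> y) = s x \<otimes> s y"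
      "\<And>x y. x \<in> carrier R' ==> y \<in> carrier R' ==> s (x \<oplus>\<^bsub>R'\<^esub> y) = s x \<oplus> s y"
      "s \<one>\<^bsub>R'\<^esub> = \<one>" "s \<zero>\<^bsub>R'\<^esub> = \<zero>"
    and neg: "\<And>x. x \<in> carrier R' ==> \<exists>y\<in>carrier R'. s y = \<ominus> s x"
  shows "ring R'"
proof (intro ringI abelian_groupI monoidI)
  fix x assume x: "x \<in> carrier R'"
  then obtain y where y: "y \<in> carrier R'" "s y = \<ominus> s x" using neg by blast
  have "y \<oplus>\<^bsub>R'\<^esub> x = \<zero>\<^bsub>R'\<^esub>" by (rule inj) (use x y cl sm sc l_neg in simp_all)
  then show "\<exists>y\<in>carrier R'. y \<oplus>\<^bsub>R'\<^esub> x = \<zero>\<^bsub>R'\<^esub>" using y by blast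
qed (rule cl, assumption+ | rule cl | (rule inj; simp add: cl sm sc m_assoc a_ac l_distr r_distr))+

lemma bimodule_by_injection:
  fixes R :: "('k, 'r, 'x) gmodule_scheme" and M :: "('r, 'r, 'm, 'y) gbimodule_scheme" and A :: "('a, 'z) ring_scheme"
  assumes A: "ring A" and R: "ring R" and s: "s \<in> ring_hom R A"
    and cl: "\<And>x y. x \<in> carrier M ==> y \<in> carrier M ==> x \<oplus>\<^bsub>M\<^esub> y \<in> carrier M" "\<zero>\<^bsub>M\<^esub> \<in> carrier M"
      "\<And>r x. r \<in> carrier R ==> x \<in> carrier M ==> r \<odot>\<^bsub>M\<^esub> x \<in> carrier M" "\<And>r x. r \<in> carrier R ==> x \<in> carrier M ==> rsmult M x r \<in> carrier M"
    and tc: "\<And>x. x \<in> carrier M ==> t x \<in> carrier A" and inj: "\<And>x y. x \<in> carrier M ==> y \<in> carrier M ==> t x = t y ==> x = y"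
    and tm: "\<And>x y. x \<in> carrier M ==> y \<in> carrier M ==> t (x \<oplus>\<^bsub>M\<^esub> y) = t x \<oplus>\<^bsub>A\<^esub> t y" "t \<zero>\<^bsub>M\<^esub> = \<zero>\<^bsub>A\<^esub>"
      "\<And>r x. r \<in> carrier R ==> x \<in> carrier M ==> t (r \<odot>\<^bsub>M\<^esub> x) = s r \<otimes>\<^bsub>A\<^esub> t x" "\<And>r x. r \<in> carrier R ==> x \<in> carrier M ==> t (rsmult M x r) = t x \<otimes>\<^bsub>A\<^esub> s r"
    and neg: "\<And>x. x \<in> carrier M ==> \<exists>y\<in>carrier M. t y = \<ominus>\<^bsub>A\<^esub> t x"
  shows "bimodule R M"
proof -
  interpret A: ring A by (rule A)
  interpret R: ring R by (rule R)
  note S = ring_hom_closed[OF s] ring_hom_mult[OF s] ring_hom_add[OF s] ring_hom_one[OF s]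
  have M: "abelian_group M"
  proof (rule abelian_groupI)
    fix x assume x: "x \<in> carrier M"
    then obtain y where y: "y \<in> carrier M" "t y = \<ominus>\<^bsub>A\<^esub> t x" using neg by blast
    have "y \<oplus>\<^bsub>M\<^esub> x = \<zero>\<^bsub>M\<^esub>" by (rule inj) (use x y cl tm tc A.l_neg in simp_all)
    then show "\<exists>y\<in>carrier M. y \<oplus>\<^bsub>M\<^esub> x = \<zero>\<^bsub>M\<^esub>" using y by blast
  qed (rule cl, assumption+ | rule cl | (rule inj; simp add: cl tm tc A.a_ac))+
  show ?thesis
    by (intro bimodule.intro bimodule_axioms.intro R M)
      (rule cl, assumption+ | (rule inj; simp add: cl tm tc S A.l_distr A.r_distr A.m_assoc))+
qed

section \<open>The species ring and bimodule realised inside the algebra\<close>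

locale species_salg = split_salg K A "num S" f u + decomp_salg K A "num S" "divalg S"
  for K :: "('k, 'x) ring_scheme" and A :: "('k, 'a, 'y) gmodule_scheme" (structure)
    and S :: "('k, 'a set, 'a set) superspecies" and f u :: "nat => 'a" +
  fixes s :: "'a => 'a"
  assumes q_f: "i \<in> {1..num S} ==> J +> f i = \<one>\<^bsub>divalg S i\<^esub>"
    and bimod_eq: "[| j \<in> {1..num S}; i \<in> {1..num S} |] ==> bimod S j i =
          gsub (radical_bimodule A) {rsmult (radical_bimodule A) (\<one>\<^bsub>divalg S j\<^esub> \<odot>\<^bsub>radical_bimodule A\<^esub> m) \<one>\<^bsub>divalg S i\<^esub> | m. m \<in> carrier (radical_bimodule A)}"
    and section_s: "section_map s"
    and s_l: "[| r \<in> wedd; x \<in> J |] ==> s (r \<otimes> x) = r \<otimes> s x" and s_r: "[| r \<in> wedd; x \<in> J |] ==> s (x \<otimes> r) = s x \<otimes> r"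
begin

abbreviation n where "n \<equiv> num S"
abbreviation D where "D \<equiv> divalg S"
abbreviation R where "R \<equiv> species_ring S"
abbreviation M where "M \<equiv> species_bimodule S"
abbreviation Q where "Q \<equiv> radical_bimodule A"

lemma R_RD: "R = RD" by (simp add: species_ring_def)

lemma wedd_q: assumes "r \<in> wedd" "r' \<in> wedd" "q r = q r'" shows "r = r'"
proof -
  have c: "r \<in> carrier A" "r' \<in> carrier A" using assms wedd_closed by auto
  have "r \<ominus> r' = \<zero>" using wedd_J[OF wedd_minus[OF assms(1,2)] q_eqI[OF c assms(3)]] .
  then show ?thesis using c by simp
qed

text \<open>Inverse of the quotient map on the Wedderburn complement: existence comes from
  \<open>wedd_approx\<close>, uniqueness from \<open>wedd_J\<close>.\<close>

definition lft :: "'a set => 'a" where "lft U = (THE r. r \<in> wedd \<and> q r = U)"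

lemma lft_q: "r \<in> wedd ==> lft (q r) = r"
  unfolding lft_def by (rule the_equality) (use wedd_q in auto)

lemma lft: assumes "U \<in> carrier B" shows "lft U \<in> wedd" "q (lft U) = U"
proof -
  obtain x where x: "x \<in> carrier A" "U = q x" using assms unfolding carrier_B by blast
  obtain r where r: "r \<in> wedd" "x \<doteq> r" using wedd_approx[OF x(1)] by blast
  have "U = q r" using r x q_eq wedd_closed[OF r(1)] by (simp add: eqJ_def)
  then show "lft U \<in> wedd" "q (lft U) = U" using lft_q[OF r(1)] r by auto
qed

text \<open>The map \<open>\<sigma>\<close> of the presentation: the sum of the components in the
  quotient, lifted to the Wedderburn complement.\<close>

definition sg :: "(nat => 'a set) => 'a" where "sg d = lft (h d)"

lemma h_closed: "d \<in> carrier R ==> h d \<in> carrier B"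
  unfolding R_RD by (rule ring_hom_closed[OF h_hom])

lemma sigma_wedd: "d \<in> carrier R ==> sg d \<in> wedd" and q_sigma: "d \<in> carrier R ==> q (sg d) = h d"
  using lft h_closed unfolding sg_def by auto

lemma sigma_closed [simp]: "d \<in> carrier R ==> sg d \<in> carrier A"
  using sigma_wedd wedd_closed by blast

lemma sigma_eqI: "d \<in> carrier R ==> r \<in> wedd ==> q r = h d ==> sg d = r"
  unfolding sg_def using lft_q by metis

lemma sigma_inj: assumes "d \<in> carrier R" "d' \<in> carrier R" "sg d = sg d'" shows "d = d'"
proof -
  have "h d = h d'" using assms q_sigma by metis
  then show ?thesis using bij_betw_imp_inj_on[OF h_bij] assms unfolding R_RD by (auto dest: inj_onD)
qed

lemma sigma_surj: assumes "r \<in> wedd" obtains d where "d \<in> carrier R" "sg d = r"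
proof -
  have "q r \<in> carrier B" using wedd_closed[OF assms] by (simp add: carrier_B)
  then obtain d where "d \<in> carrier RD" "h d = q r" by (rule h_surj)
  then show ?thesis using that sigma_eqI[of d r] assms by (simp add: R_RD)
qed

lemma R_closed: "x \<in> carrier R ==> y \<in> carrier R ==> x \<otimes>\<^bsub>R\<^esub> y \<in> carrier R" "x \<in> carrier R ==> y \<in> carrier R ==> x \<oplus>\<^bsub>R\<^esub> y \<in> carrier R"
  "\<one>\<^bsub>R\<^esub> \<in> carrier R" "\<zero>\<^bsub>R\<^esub> \<in> carrier R" "c \<in> carrier K ==> x \<in> carrier R ==> c \<odot>\<^bsub>R\<^esub> x \<in> carrier R"
  unfolding R_RD by (fact RD_closed RD_one_zero RD_smult_closed)+

lemma sigma_mult: assumes "x \<in> carrier R" "y \<in> carrier R" shows "sg (x \<otimes>\<^bsub>R\<^esub> y) = sg x \<otimes> sg y"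
proof (rule sigma_eqI)
  have "h (x \<otimes>\<^bsub>R\<^esub> y) = h x \<otimes>\<^sub>B h y" using ring_hom_mult[OF h_hom] assms unfolding R_RD by blast
  then show "q (sg x \<otimes> sg y) = h (x \<otimes>\<^bsub>R\<^esub> y)" using assms by (simp add: q_mult[symmetric] q_sigma)
qed (use assms R_closed sigma_wedd wedd_mult in auto)

lemma sigma_add: assumes "x \<in> carrier R" "y \<in> carrier R" shows "sg (x \<oplus>\<^bsub>R\<^esub> y) = sg x \<oplus> sg y"
proof (rule sigma_eqI)
  have "h (x \<oplus>\<^bsub>R\<^esub> y) = h x \<oplus>\<^sub>B h y" using ring_hom_add[OF h_hom] assms unfolding R_RD by blast
  then show "q (sg x \<oplus> sg y) = h (x \<oplus>\<^bsub>R\<^esub> y)" using assms by (simp add: q_add[symmetric] q_sigma)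
qed (use assms R_closed sigma_wedd wedd_add in auto)

lemma sigma_one: "sg \<one>\<^bsub>R\<^esub> = \<one>"
  by (rule sigma_eqI) (use R_closed wedd_one ring_hom_one[OF h_hom] in \<open>simp_all add: R_RD q_one\<close>)

lemma sigma_zero: "sg \<zero>\<^bsub>R\<^esub> = \<zero>"
  by (rule sigma_eqI) (use R_closed wedd_zero h_zero in \<open>simp_all add: R_RD q_zero\<close>)

lemma sigma_smult: assumes "c \<in> carrier K" "x \<in> carrier R" shows "sg (c \<odot>\<^bsub>R\<^esub> x) = c \<odot> sg x"
proof (rule sigma_eqI)
  have "h (c \<odot>\<^bsub>R\<^esub> x) = c \<odot>\<^bsub>B\<^esub> h x" using h_iso assms unfolding R_RD superalgebra_iso_def by blast
  then show "q (c \<odot> sg x) = h (c \<odot>\<^bsub>R\<^esub> x)" using assms by (simp add: q_smult[symmetric] q_sigma)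
qed (use assms R_closed sigma_wedd wedd_smult in auto)

lemma sigma_ring_hom: "sg \<in> ring_hom R A"
  by (rule ring_hom_memI) (simp_all add: sigma_mult sigma_add sigma_one)

lemma ring_R: "ring R"
proof (rule ring_by_injection[where s = sg])
  fix x assume "x \<in> carrier R"
  then show "\<exists>y\<in>carrier R. sg y = \<ominus> sg x" using sigma_surj[OF wedd_neg[OF sigma_wedd]] by blast
qed (use R_closed sigma_mult sigma_add sigma_one sigma_zero sigma_inj in auto)

sublocale R: ring R by (rule ring_R)

lemma sigma_f:
  assumes d: "d \<in> carrier R" and i: "i \<in> {1..n}"
  shows "sg d \<otimes> f i = lft (d i)" "f i \<otimes> sg d = lft (d i)" "d i \<in> carrier B"
proof -
  have "q (sg d \<otimes> f i) = h d \<otimes>\<^sub>B \<one>\<^bsub>D i\<^esub>" using d i by (simp add: q_mult[symmetric] q_sigma q_f)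
  also have "\<dots> = d i" using eps_h(2)[OF i] d by (simp add: R_RD)
  finally have e: "q (sg d \<otimes> f i) = d i" .
  show a: "sg d \<otimes> f i = lft (d i)" using lft_q[OF wedd_mult[OF sigma_wedd[OF d] f_wedd[OF i]]] e by simp
  then show "f i \<otimes> sg d = lft (d i)" using weddD(1)[OF sigma_wedd[OF d] i] by simp
  show "d i \<in> carrier B" using D_sub[OF i] RD_at[OF _ i] d unfolding R_RD by blast
qed

lemma hcomp_R: "r \<in> hcomp R g \<longleftrightarrow> r \<in> carrier R \<and> sg r \<in> hcomp A g"
proof
  assume r: "r \<in> hcomp R g"
  have rc: "r \<in> carrier R"
    using r D_ops(5) unfolding R_RD RD_simps by (auto simp: PiE_iff)
  have "h r \<in> hcomp B g" using h_iso r unfolding R_RD superalgebra_iso_def by blast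
  then obtain x where x: "x \<in> hcomp A g" "h r = q x" unfolding hcomp_B by blast
  have xc: "x \<in> carrier A" using x hcomp_carrier by blast
  have "x \<ominus> sg r \<in> J" using q_eqI[OF xc sigma_closed[OF rc]] q_sigma[OF rc] x by simp
  \<comment> \<open>The class of \<open>sg r\<close> has a homogeneous representative
    \<open>x\<close>. Hence the component of \<open>sg r\<close> of the other degree is congruent to
    zero, and being in \<open>wedd\<close> as well it vanishes.\<close>
  then have "part (g + 1) (x \<ominus> sg r) \<in> J" by (rule J_part)
  then have "part (g + 1) x \<ominus> part (g + 1) (sg r) \<in> J" using xc rc by (simp only: part_minus sigma_closed)
  then have "\<zero> \<ominus> part (g + 1) (sg r) \<in> J" by (simp only: part_other[OF x(1)])
  then have "\<ominus> (\<zero> \<ominus> part (g + 1) (sg r)) \<in> J" by (rule idl(7)[OF idJ])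
  moreover have "\<ominus> (\<zero> \<ominus> part (g + 1) (sg r)) = part (g + 1) (sg r)"
    using part_closed[OF sigma_closed[OF rc], of "g + 1"] by (simp only: a_minus_def l_zero a_inv_closed minus_minus)
  ultimately have "part (g + 1) (sg r) \<in> J" by simp
  then have z: "part (g + 1) (sg r) = \<zero>" using wedd_J[OF wedd_part[OF sigma_wedd[OF rc]]] by blast
  have e: "sg r = part g (sg r)" using part_sum'[OF sigma_closed[OF rc], of g] rc unfolding z by simp
  have "sg r \<in> hcomp A g" by (subst e) (rule part_hcomp[OF sigma_closed[OF rc]])
  then show "r \<in> carrier R \<and> sg r \<in> hcomp A g" using rc by simp
next
  assume r: "r \<in> carrier R \<and> sg r \<in> hcomp A g"
  have "r i \<in> hcomp (D i) g" if i: "i \<in> {1..n}" for i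
  proof -
    \<comment> \<open>Conversely, multiplying by the even \<open>f i\<close> isolates the i-th
      component without changing the degree.\<close>
    have "sg r \<otimes> f i \<in> hcomp A g" using hcomp_mult[OF conjunct2[OF r] f_h[OF i]] by (simp only: add_0_right)
    then have "q (lft (r i)) \<in> hcomp B g" using sigma_f(1)[of r i] r i unfolding hcomp_B by auto
    then have "r i \<in> hcomp B g" using lft(2) sigma_f(3)[of r i] r i by simp
    moreover have "r i \<in> carrier (D i)" using RD_at[OF _ i] r unfolding R_RD by blast
    ultimately show ?thesis by (simp add: D_ops[OF i])
  qed
  then show "r \<in> hcomp R g" using r unfolding R_RD RD_simps by (auto simp: PiE_iff)
qed

lemma R_hcomp: "subgroup (hcomp R g) (add_monoid R)"
proof
  have a: "\<And>x y. x \<in> hcomp R g ==> y \<in> hcomp R g ==> x \<oplus>\<^bsub>R\<^esub> y \<in> hcomp R g"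
    using sigma_add unfolding hcomp_R by auto
  then show "\<And>x y. x \<in> hcomp R g ==> y \<in> hcomp R g ==> x \<otimes>\<^bsub>add_monoid R\<^esub> y \<in> hcomp R g" by simp
  show "hcomp R g \<subseteq> carrier (add_monoid R)" using hcomp_R by auto
  show "\<one>\<^bsub>add_monoid R\<^esub> \<in> hcomp R g" using sigma_zero unfolding hcomp_R by simp
  fix x assume x: "x \<in> hcomp R g"
  then have xc: "x \<in> carrier R" unfolding hcomp_R by blast
  have "sg (\<ominus>\<^bsub>R\<^esub> x) \<oplus> sg x = \<zero>" using sigma_add[of "\<ominus>\<^bsub>R\<^esub> x" x] xc by (simp add: R.l_neg sigma_zero)
  then have "sg (\<ominus>\<^bsub>R\<^esub> x) = \<ominus> sg x" using xc by (intro minus_equality[symmetric]) auto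
  then have "\<ominus>\<^bsub>R\<^esub> x \<in> hcomp R g" using x hcomp_inv unfolding hcomp_R by simp
  then show "inv\<^bsub>add_monoid R\<^esub> x \<in> hcomp R g" by (simp add: a_inv_def)
qed

lemma R_dec: assumes r: "r \<in> carrier R" shows "\<exists>a\<in>hcomp R 0. \<exists>b\<in>hcomp R 1. r = a \<oplus>\<^bsub>R\<^esub> b"
proof -
  obtain a where a: "a \<in> carrier R" "sg a = part 0 (sg r)" using sigma_surj[OF wedd_part[OF sigma_wedd[OF r]]] by blast
  obtain b where b: "b \<in> carrier R" "sg b = part 1 (sg r)" using sigma_surj[OF wedd_part[OF sigma_wedd[OF r]]] by blast
  have "r = a \<oplus>\<^bsub>R\<^esub> b" by (rule sigma_inj) (use r a b part_sum[of "sg r"] in \<open>simp_all add: sigma_add\<close>)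
  moreover have "a \<in> hcomp R 0" "b \<in> hcomp R 1" using a b r unfolding hcomp_R by auto
  ultimately show ?thesis by blast
qed

abbreviation p where "p x \<equiv> J2 +> x"

lemmas S = section_mapD[OF section_s]

lemma p_eq: "x \<in> carrier A ==> y \<in> carrier A ==> p x = p y \<longleftrightarrow> x \<ominus> y \<in> J2"
  by (rule a_rcoset_eq_iff[OF ideal.axioms(1)[OF idJ2]])

lemma s_cong: assumes "x \<in> J" "y \<in> J" "p x = p y" shows "s x = s y"
proof -
  have c: "x \<in> carrier A" "y \<in> carrier A" using assms J_closed by auto
  have d: "x \<ominus> y \<in> J2" using p_eq[OF c] assms by simp
  have "s x = s ((x \<ominus> y) \<oplus> y)" using c by (simp add: cancel_r)
  also have "\<dots> = s (x \<ominus> y) \<oplus> s y" using J2_J[OF d] assms by (intro S(6))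
  also have "\<dots> = s y" using S(5)[OF d] S(2)[OF assms(2)] by simp
  finally show ?thesis .
qed

text \<open>The section descended to cosets of \<open>J2\<close>; by \<open>s_cong\<close> the
  chosen representative is immaterial.\<close>

definition t :: "'a set => 'a" where "t U = s (SOME x. x \<in> J \<and> p x = U)"

lemma t_p: assumes "x \<in> J" shows "t (p x) = s x"
proof -
  define y where "y = (SOME y. y \<in> J \<and> p y = p x)"
  have "y \<in> J \<and> p y = p x" unfolding y_def by (rule someI[of _ x]) (simp add: assms)
  then show ?thesis using s_cong[of y x] assms unfolding t_def y_def by simp
qed

text \<open>The image of the section: a graded \<open>wedd\<close>-bimodule complementary to
  \<open>J2\<close> in \<open>J\<close>, with which the species bimodule is identified.\<close>

definition V where "V = {y \<in> J. s y = y}"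

lemma p_s: assumes "x \<in> J" shows "p (s x) = p x"
proof -
  have "p x = p (s x)" using p_eq[of x "s x"] S(2,3)[OF assms] J_closed[OF assms] by simp
  then show ?thesis by simp
qed

lemma s_V: assumes "x \<in> J" shows "s x \<in> V"
  using s_cong[OF S(1)[OF assms] assms p_s[OF assms]] S(1)[OF assms] by (simp add: V_def)

lemma VD: "y \<in> V ==> y \<in> J" "y \<in> V ==> s y = y" "y \<in> V ==> y \<in> carrier A"
  using J_closed by (auto simp: V_def)

lemma VI: "y \<in> J ==> s y = y ==> y \<in> V" by (simp add: V_def)

lemma t_pV: "y \<in> V ==> t (p y) = y"
  using t_p VD by simp

lemma JmultI: "x \<in> J ==> a \<in> carrier A ==> a \<otimes> x \<in> J" "x \<in> J ==> a \<in> carrier A ==> x \<otimes> a \<in> J"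
  using idJ.I_l_closed idJ.I_r_closed by auto

lemma V_wedd: "y \<in> V ==> r \<in> wedd ==> r \<otimes> y \<in> V" "y \<in> V ==> r \<in> wedd ==> y \<otimes> r \<in> V"
proof -
  show "r \<otimes> y \<in> V" if y: "y \<in> V" and r: "r \<in> wedd"
    by (rule VI[OF JmultI(1)[OF VD(1)[OF y] wedd_closed[OF r]]]) (simp only: s_l[OF r VD(1)[OF y]] VD(2)[OF y])
  show "y \<otimes> r \<in> V" if y: "y \<in> V" and r: "r \<in> wedd"
    by (rule VI[OF JmultI(2)[OF VD(1)[OF y] wedd_closed[OF r]]]) (simp only: s_r[OF r VD(1)[OF y]] VD(2)[OF y])
qed

lemma V_add: "y \<in> V ==> z \<in> V ==> y \<oplus> z \<in> V"
  by (rule VI[OF idl(3)[OF idJ VD(1) VD(1)]]) (simp_all only: S(6) VD)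

lemma V_neg: assumes "y \<in> V" shows "\<ominus> y \<in> V"
  using V_wedd(1)[OF assms wedd_neg[OF wedd_one]] VD(3)[OF assms] by (simp add: l_minus)

lemma V_part: "y \<in> V ==> part g y \<in> V"
  by (rule VI[OF J_part[OF VD(1)]]) (simp_all only: S(4)[symmetric] VD)

lemma Q_carrier: "carrier Q = p ` J"
  by (auto simp: radical_bimodule_def Let_def gquot_def FactRing_def gsub_def A_RCOSETS_def' a_r_coset_def')

lemma Q_zero: "\<zero>\<^bsub>Q\<^esub> = p \<zero>"
  using a_coset_add_zero[OF additive_subgroup.a_subset[OF ideal.axioms(1)[OF idJ2]]] by (simp add: radical_bimodule_def Let_def gquot_def FactRing_def)

lemma Q_add: assumes "x \<in> J" "y \<in> J" shows "p x \<oplus>\<^bsub>Q\<^esub> p y = p (x \<oplus> y)"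
proof -
  interpret i2: ideal J2 A by (rule idJ2)
  have "p x \<oplus>\<^bsub>Q\<^esub> p y = p x <+> p y"
    by (simp add: radical_bimodule_def Let_def gquot_def FactRing_def gsub_def set_add_def set_mult_def)
  then show ?thesis using i2.a_rcos_sum J_closed assms by simp
qed

lemma Q_hcomp: "hcomp Q g = p ` (hcomp A g \<inter> J)"
  by (auto simp: radical_bimodule_def Let_def gquot_def FactRing_def gsub_def a_r_coset_def')

lemma p_mem: assumes "y \<in> p x" "x \<in> carrier A" shows "y \<in> carrier A \<and> y \<ominus> x \<in> J2"
proof -
  obtain j where j: "j \<in> J2" "y = j \<oplus> x" using assms(1) unfolding a_r_coset_def' by blast
  have jc: "j \<in> carrier A" by (rule part_J2[OF j(1)])
  have "y \<ominus> x = j" using j jc assms by (simp add: a_minus_def a_assoc neg_r)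
  then show ?thesis using j jc assms by simp
qed

lemma p_self: "x \<in> carrier A ==> x \<in> p x"
  by (rule abelian_subgroup.a_rcos_self[OF abelian_subgroupI3[OF ideal.axioms(1)[OF idJ2] abelian_group_axioms]])

text \<open>Well-definedness of the actions on the cosets of \<open>J2\<close>: changing
  \<open>a\<close> costs a product of two elements of \<open>J\<close>, changing \<open>x\<close>
  costs a multiple of an element of \<open>J2\<close>.\<close>

lemma p_mult_cong:
  assumes "a' \<in> q a" "x' \<in> p x" "a \<in> carrier A" "x \<in> J"
  shows "p (a' \<otimes> x') = p (a \<otimes> x)" "p (x' \<otimes> a') = p (x \<otimes> a)"
proof -
  have xc: "x \<in> carrier A" using assms J_closed by auto
  have a: "a' \<in> carrier A" "a' \<ominus> a \<in> J" using q_mem[OF assms(1,3)] by auto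
  have x: "x' \<in> carrier A" "x' \<ominus> x \<in> J2" using p_mem[OF assms(2) xc] by auto
  have "x' = (x' \<ominus> x) \<oplus> x" using x xc by (simp add: cancel_r)
  then have xJ: "x' \<in> J" using idl(3)[OF idJ J2_J[OF x(2)] assms(4)] by simp
  have "(a' \<ominus> a) \<otimes> x' \<in> J2" "x' \<otimes> (a' \<ominus> a) \<in> J2" using a xJ by (auto intro: ideal_prod.prod)
  moreover have "a \<otimes> (x' \<ominus> x) \<in> J2" "(x' \<ominus> x) \<otimes> a \<in> J2" using idl(5,6)[OF idJ2 x(2) assms(3)] by auto
  moreover have "a' \<otimes> x' \<ominus> a \<otimes> x = (a' \<ominus> a) \<otimes> x' \<oplus> a \<otimes> (x' \<ominus> x)"
    using a x xc assms(3) by (simp add: a_minus_def l_distr r_distr l_minus r_minus a_assoc r_neg1)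
  moreover have "x' \<otimes> a' \<ominus> x \<otimes> a = x' \<otimes> (a' \<ominus> a) \<oplus> (x' \<ominus> x) \<otimes> a"
    using a x xc assms(3) by (simp add: a_minus_def l_distr r_distr l_minus r_minus a_assoc r_neg1)
  ultimately show "p (a' \<otimes> x') = p (a \<otimes> x)" "p (x' \<otimes> a') = p (x \<otimes> a)"
    using p_eq a x xc assms(3) idl(3)[OF idJ2] by simp_all
qed

lemma Q_smult: assumes "a \<in> carrier A" "x \<in> J" shows "q a \<odot>\<^bsub>Q\<^esub> p x = p (a \<otimes> x)" "rsmult Q (p x) (q a) = p (x \<otimes> a)"
proof -
  have xc: "x \<in> carrier A" using assms J_closed by auto
  have ne: "q a \<noteq> {}" "p x \<noteq> {}" using self[OF assms(1)] p_self[OF xc] by blast+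
  have "(\<Union>a'\<in>q a. \<Union>x'\<in>p x. p (a' \<otimes> x')) = (\<Union>a'\<in>q a. \<Union>x'\<in>p x. p (a \<otimes> x))"
    by (intro SUP_cong refl p_mult_cong(1) assms)
  then show "q a \<odot>\<^bsub>Q\<^esub> p x = p (a \<otimes> x)" using ne by (simp add: radical_bimodule_def Let_def rcoset_mult_def)
  have "(\<Union>x'\<in>p x. \<Union>a'\<in>q a. p (x' \<otimes> a')) = (\<Union>x'\<in>p x. \<Union>a'\<in>q a. p (x \<otimes> a))"
    by (intro SUP_cong refl p_mult_cong(2) assms)
  then show "rsmult Q (p x) (q a) = p (x \<otimes> a)" using ne by (simp add: radical_bimodule_def Let_def rcoset_mult_def)
qed

lemma bimod_simps:
  assumes "j \<in> {1..n}" "i \<in> {1..n}"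
  shows "ring.add (bimod S j i) = ring.add Q" "\<zero>\<^bsub>bimod S j i\<^esub> = p \<zero>" "smult (bimod S j i) = smult Q" "rsmult (bimod S j i) = rsmult Q"
    "carrier (bimod S j i) = {p (f j \<otimes> x \<otimes> f i) | x. x \<in> J}" "hcomp (bimod S j i) g = hcomp Q g \<inter> carrier (bimod S j i)"
proof -
  have "rsmult Q (\<one>\<^bsub>D j\<^esub> \<odot>\<^bsub>Q\<^esub> p x) \<one>\<^bsub>D i\<^esub> = p (f j \<otimes> x \<otimes> f i)" if "x \<in> J" for x
    using that assms Q_smult(1)[of "f j" x] Q_smult(2)[of "f i" "f j \<otimes> x"] JmultI(1)[of x "f j"] by (simp only: q_f[symmetric] f_closed)
  then have e: "{rsmult Q (\<one>\<^bsub>D j\<^esub> \<odot>\<^bsub>Q\<^esub> m) \<one>\<^bsub>D i\<^esub> | m. m \<in> carrier Q} = {p (f j \<otimes> x \<otimes> f i) | x. x \<in> J}"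
    unfolding Q_carrier by (force simp: Bex_def)
  show "ring.add (bimod S j i) = ring.add Q" "\<zero>\<^bsub>bimod S j i\<^esub> = p \<zero>" "smult (bimod S j i) = smult Q" "rsmult (bimod S j i) = rsmult Q"
    "carrier (bimod S j i) = {p (f j \<otimes> x \<otimes> f i) | x. x \<in> J}" "hcomp (bimod S j i) g = hcomp Q g \<inter> carrier (bimod S j i)"
    unfolding bimod_eq[OF assms] e by (simp_all add: gsub_def Q_zero)
qed

text \<open>The \<open>f i\<close> lie in \<open>wedd\<close>, so the section commutes with the
  Peirce projections and a class of the component (j, i) has its representative in \<open>V\<close>
  inside the same corner.\<close>

lemma bimod_mem:
  assumes ji: "j \<in> {1..n}" "i \<in> {1..n}"
  shows "U \<in> carrier (bimod S j i) \<longleftrightarrow> (\<exists>y\<in>V. U = p y \<and> f j \<otimes> y \<otimes> f i = y)"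
proof
  assume "U \<in> carrier (bimod S j i)"
  then obtain x where x: "x \<in> J" "U = p (f j \<otimes> x \<otimes> f i)" unfolding bimod_simps(5)[OF ji] by blast
  have xc: "x \<in> carrier A" using x J_closed by blast
  have fx: "f j \<otimes> x \<in> J" using JmultI(1)[OF x(1)] ji by simp
  have z: "f j \<otimes> x \<otimes> f i \<in> J" using JmultI(2)[OF fx] ji by simp
  have "s (f j \<otimes> x \<otimes> f i) = f j \<otimes> s x \<otimes> f i" using s_r[OF f_wedd[OF ji(2)] fx] s_l[OF f_wedd[OF ji(1)] x(1)] by simp
  moreover have "f j \<otimes> (f j \<otimes> s x \<otimes> f i) \<otimes> f i = f j \<otimes> s x \<otimes> f i"
    using S(2)[OF x(1)] ji ff[OF ji(1)] ff[OF ji(2)] by (simp add: m_assoc) (simp add: m_assoc[symmetric])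
  ultimately have "f j \<otimes> s (f j \<otimes> x \<otimes> f i) \<otimes> f i = s (f j \<otimes> x \<otimes> f i)" by simp
  then show "\<exists>y\<in>V. U = p y \<and> f j \<otimes> y \<otimes> f i = y" using s_V[OF z] p_s[OF z] x(2) by metis
next
  assume "\<exists>y\<in>V. U = p y \<and> f j \<otimes> y \<otimes> f i = y"
  then obtain y where y: "y \<in> V" "U = p y" "f j \<otimes> y \<otimes> f i = y" by blast
  have "U = p (f j \<otimes> y \<otimes> f i)" using y by simp
  then show "U \<in> carrier (bimod S j i)" using VD(1)[OF y(1)] unfolding bimod_simps(5)[OF ji] by blast
qed

abbreviation P where "P \<equiv> {1..n} \<times> {1..n}"

lemma eq_by_ff:
  assumes x: "x \<in> carrier A" and y: "y \<in> carrier A" and e: "\<And>j i. j \<in> {1..n} ==> i \<in> {1..n} ==> f j \<otimes> x \<otimes> f i = f j \<otimes> y \<otimes> f i"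
  shows "x = y"
proof (rule eq_by_f[OF x y])
  fix j assume j: "j \<in> {1..n}"
  have "f j \<otimes> x = finsum A (\<lambda>i. f j \<otimes> x \<otimes> f i) {1..n}" using sum_f_r[of "f j \<otimes> x"] x j by simp
  also have "\<dots> = finsum A (\<lambda>i. f j \<otimes> y \<otimes> f i) {1..n}" by (rule finsum_cong') (use e j y in auto)
  also have "\<dots> = f j \<otimes> y" using sum_f_r[of "f j \<otimes> y"] y j by simp
  finally show "f j \<otimes> x = f j \<otimes> y" .
qed

lemma M_mem: "m \<in> carrier M \<longleftrightarrow> m \<in> extensional P \<and> (\<forall>j\<in>{1..n}. \<forall>i\<in>{1..n}. m (j, i) \<in> carrier (bimod S j i))"
  by (auto simp: species_bimodule_def Let_def PiE_iff)

lemma M_entry: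
  assumes "m \<in> carrier M" "j \<in> {1..n}" "i \<in> {1..n}"
  shows "t (m (j, i)) \<in> V" "m (j, i) = p (t (m (j, i)))" "f j \<otimes> t (m (j, i)) \<otimes> f i = t (m (j, i))" "t (m (j, i)) \<in> carrier A"
proof -
  have "m (j, i) \<in> carrier (bimod S j i)" using assms unfolding M_mem by blast
  then obtain y where "y \<in> V" "m (j, i) = p y" "f j \<otimes> y \<otimes> f i = y" unfolding bimod_mem[OF assms(2,3)] by blast
  then show "t (m (j, i)) \<in> V" "m (j, i) = p (t (m (j, i)))" "f j \<otimes> t (m (j, i)) \<otimes> f i = t (m (j, i))" "t (m (j, i)) \<in> carrier A"
    using t_pV VD by auto
qed

text \<open>The map \<open>\<tau>\<close> of the presentation: a family of classes is read as the
  matrix of Peirce corners of one element of \<open>V\<close>, which is the sum of its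
  corners.\<close>

definition ta :: "(nat \<times> nat => 'a set) => 'a" where "ta m = finsum A (\<lambda>x. t (m x)) P"

lemma t_Pi: "m \<in> carrier M ==> (\<lambda>x. t (m x)) \<in> P \<rightarrow> carrier A" using M_entry(4) by auto

lemma tau_closed [simp]: "m \<in> carrier M ==> ta m \<in> carrier A"
  unfolding ta_def by (rule finsum_closed) (rule t_Pi)

lemma tau_entry:
  assumes m: "m \<in> carrier M" and j: "j \<in> {1..n}" and i: "i \<in> {1..n}"
  shows "f j \<otimes> ta m \<otimes> f i = t (m (j, i))"
proof -
  have c: "(\<lambda>x. f j \<otimes> t (m x)) \<in> P \<rightarrow> carrier A" using t_Pi[OF m] j by auto
  have "f j \<otimes> ta m \<otimes> f i = finsum A (\<lambda>x. f j \<otimes> t (m x)) P \<otimes> f i"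
    unfolding ta_def using finsum_rdistr[OF _ _ t_Pi[OF m], of "f j"] j by simp
  also have "\<dots> = finsum A (\<lambda>x. f j \<otimes> t (m x) \<otimes> f i) P"
    using finsum_ldistr[OF _ _ c, of "f i"] i by simp
  also have "\<dots> = finsum A (\<lambda>x. if (j, i) = x then t (m x) else \<zero>) P"
  proof (rule finsum_cong')
    show "(\<lambda>x. if (j, i) = x then t (m x) else \<zero>) \<in> P \<rightarrow> carrier A" using t_Pi[OF m] by auto
    fix x assume "x \<in> P"
    then obtain a b where x: "x = (a, b)" "a \<in> {1..n}" "b \<in> {1..n}" by blast
    note E = M_entry(3,4)[OF m x(2,3)]
    \<comment> \<open>The entry at (a, b) is written inside its own corner, so that orthogonality of
      the idempotents removes it unless the indices agree.\<close>
    have "f j \<otimes> t (m x) \<otimes> f i = f j \<otimes> (f a \<otimes> t (m x) \<otimes> f b) \<otimes> f i" using E(1) x(1) by simp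
    also have "\<dots> = (f j \<otimes> f a) \<otimes> t (m x) \<otimes> (f b \<otimes> f i)" using E(2) x i j by (simp add: m_assoc)
    also have "\<dots> = (if (j, i) = x then t (m x) else \<zero>)"
    proof (cases "(j, i) = x")
      case True then show ?thesis using E x ff[OF i] ff[OF j] by auto
    next
      case False
      then have "f j \<otimes> f a = \<zero> \<or> f b \<otimes> f i = \<zero>" using f_orth x i j by auto
      then show ?thesis using False E(2) x i j by auto
    qed
    finally show "f j \<otimes> t (m x) \<otimes> f i = (if (j, i) = x then t (m x) else \<zero>)" .
  qed simp
  also have "\<dots> = t (m (j, i))"
    by (rule add.finprod_singleton) (use i j t_Pi[OF m] in auto)
  finally show ?thesis .
qed

lemma tau_eqI:
  assumes "m \<in> carrier M" "y \<in> carrier A" "\<And>j i. j \<in> {1..n} ==> i \<in> {1..n} ==> t (m (j, i)) = f j \<otimes> y \<otimes> f i"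
  shows "ta m = y"
  by (rule eq_by_ff) (use assms tau_entry in auto)

lemma tau_J: assumes m: "m \<in> carrier M" shows "ta m \<in> J"
  unfolding ta_def by (rule finsum_mem[OF _ _ idJ]) (use M_entry(1)[OF m] VD in auto)

lemma tau_V: assumes m: "m \<in> carrier M" shows "ta m \<in> V"
proof -
  have "ta m = s (ta m)"
  proof (rule tau_eqI[OF m S(2)[OF tau_J[OF m]]])
    fix j i assume ji: "j \<in> {1..n}" "i \<in> {1..n}"
    have fx: "f j \<otimes> ta m \<in> J" using JmultI(1)[OF tau_J[OF m]] ji by simp
    have "f j \<otimes> s (ta m) \<otimes> f i = s (f j \<otimes> ta m \<otimes> f i)"
      using s_r[OF f_wedd[OF ji(2)] fx] s_l[OF f_wedd[OF ji(1)] tau_J[OF m]] by simp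
    then show "t (m (j, i)) = f j \<otimes> s (ta m) \<otimes> f i" using tau_entry[OF m ji] VD(2)[OF M_entry(1)[OF m ji]] by simp
  qed
  then show ?thesis using tau_J[OF m] by (simp add: V_def)
qed

lemma tau_inj: assumes "m \<in> carrier M" "m' \<in> carrier M" "ta m = ta m'" shows "m = m'"
proof (rule extensionalityI)
  show "m \<in> extensional P" "m' \<in> extensional P" using assms M_mem by blast+
  fix x assume "x \<in> P"
  then obtain j i where x: "x = (j, i)" "j \<in> {1..n}" "i \<in> {1..n}" by blast
  have "t (m x) = t (m' x)" using tau_entry[OF assms(1) x(2,3)] tau_entry[OF assms(2) x(2,3)] assms(3) x(1) by simp
  then show "m x = m' x" using M_entry(2)[OF assms(1) x(2,3)] M_entry(2)[OF assms(2) x(2,3)] x(1) by simp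
qed

text \<open>The matrix of Peirce corners of an element of \<open>V\<close>, inverse to
  \<open>ta\<close>.\<close>

definition mk :: "'a => nat \<times> nat => 'a set" where "mk y = (\<lambda>x\<in>P. p (f (fst x) \<otimes> y \<otimes> f (snd x)))"

lemma V_ff: assumes y: "y \<in> V" and ji: "j \<in> {1..n}" "i \<in> {1..n}"
  shows "f j \<otimes> y \<otimes> f i \<in> V" "f j \<otimes> (f j \<otimes> y \<otimes> f i) \<otimes> f i = f j \<otimes> y \<otimes> f i"
proof -
  show "f j \<otimes> y \<otimes> f i \<in> V" using V_wedd f_wedd y ji by simp
  show "f j \<otimes> (f j \<otimes> y \<otimes> f i) \<otimes> f i = f j \<otimes> y \<otimes> f i"
    using VD(3)[OF y] ji ff[OF ji(1)] ff[OF ji(2)] by (simp add: m_assoc) (simp add: m_assoc[symmetric])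
qed

lemma mk: assumes y: "y \<in> V" shows "mk y \<in> carrier M" "ta (mk y) = y"
proof -
  have e: "mk y (j, i) = p (f j \<otimes> y \<otimes> f i)" if "j \<in> {1..n}" "i \<in> {1..n}" for j i using that by (simp add: mk_def)
  show m: "mk y \<in> carrier M"
    unfolding M_mem
  proof (intro conjI ballI)
    fix j i assume ji: "j \<in> {1..n}" "i \<in> {1..n}"
    show "mk y (j, i) \<in> carrier (bimod S j i)" unfolding bimod_mem[OF ji] using V_ff[OF y ji] e[OF ji] by blast
  qed (simp add: mk_def)
  show "ta (mk y) = y" by (rule tau_eqI[OF m VD(3)[OF y]]) (use e t_pV V_ff[OF y] in simp)
qed

text \<open>One criterion for all operations: once the entries of a family are recognised as the
  Peirce corners of an element of \<open>V\<close>, membership in \<open>M\<close> and the value of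
  \<open>ta\<close> follow together.\<close>

lemma M_eqI: assumes "m \<in> extensional P" "y \<in> V" "\<And>j i. j \<in> {1..n} ==> i \<in> {1..n} ==> m (j, i) = p (f j \<otimes> y \<otimes> f i)"
  shows "m \<in> carrier M \<and> ta m = y"
proof -
  have "m = mk y" by (rule extensionalityI[OF assms(1), of "mk y"]) (use assms(3) in \<open>auto simp: mk_def\<close>)
  then show ?thesis using mk[OF assms(2)] by simp
qed

lemma M_entry_p: assumes "m \<in> carrier M" "j \<in> {1..n}" "i \<in> {1..n}" shows "m (j, i) = p (f j \<otimes> ta m \<otimes> f i)" "f j \<otimes> ta m \<otimes> f i \<in> J"
  using M_entry[OF assms] tau_entry[OF assms] VD(1) by simp_all

lemma M_add: assumes "m \<in> carrier M" "m' \<in> carrier M" shows "m \<oplus>\<^bsub>M\<^esub> m' \<in> carrier M \<and> ta (m \<oplus>\<^bsub>M\<^esub> m') = ta m \<oplus> ta m'"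
proof (rule M_eqI)
  show "m \<oplus>\<^bsub>M\<^esub> m' \<in> extensional P" by (simp add: species_bimodule_def Let_def)
  show "ta m \<oplus> ta m' \<in> V" using assms by (intro V_add tau_V)
  fix j i assume ji: "j \<in> {1..n}" "i \<in> {1..n}"
  have "(m \<oplus>\<^bsub>M\<^esub> m') (j, i) = m (j, i) \<oplus>\<^bsub>Q\<^esub> m' (j, i)" using ji bimod_simps(1)[OF ji] by (simp add: species_bimodule_def Let_def)
  also have "\<dots> = p (f j \<otimes> ta m \<otimes> f i \<oplus> f j \<otimes> ta m' \<otimes> f i)"
    using M_entry_p[OF assms(1) ji] M_entry_p[OF assms(2) ji] by (simp only: Q_add)
  also have "f j \<otimes> ta m \<otimes> f i \<oplus> f j \<otimes> ta m' \<otimes> f i = f j \<otimes> (ta m \<oplus> ta m') \<otimes> f i" using assms ji by (simp add: l_distr r_distr)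
  finally show "(m \<oplus>\<^bsub>M\<^esub> m') (j, i) = p (f j \<otimes> (ta m \<oplus> ta m') \<otimes> f i)" .
qed

lemma V_zero: "\<zero> \<in> V" using S(5)[OF J2_zero] idl(2)[OF idJ] by (simp add: V_def)

lemma M_zero: "\<zero>\<^bsub>M\<^esub> \<in> carrier M \<and> ta \<zero>\<^bsub>M\<^esub> = \<zero>"
proof (rule M_eqI[OF _ V_zero])
  show "\<zero>\<^bsub>M\<^esub> \<in> extensional P" by (simp add: species_bimodule_def Let_def)
  fix j i assume ji: "j \<in> {1..n}" "i \<in> {1..n}"
  show "\<zero>\<^bsub>M\<^esub> (j, i) = p (f j \<otimes> \<zero> \<otimes> f i)" using ji bimod_simps(2)[OF ji] by (simp add: species_bimodule_def Let_def)
qed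

lemma M_lact: assumes r: "r \<in> carrier R" and m: "m \<in> carrier M" shows "r \<odot>\<^bsub>M\<^esub> m \<in> carrier M \<and> ta (r \<odot>\<^bsub>M\<^esub> m) = sg r \<otimes> ta m"
proof (rule M_eqI)
  show "r \<odot>\<^bsub>M\<^esub> m \<in> extensional P" by (simp add: species_bimodule_def Let_def)
  show "sg r \<otimes> ta m \<in> V" using V_wedd(1)[OF tau_V[OF m] sigma_wedd[OF r]] .
  fix j i assume ji: "j \<in> {1..n}" "i \<in> {1..n}"
  have "(r \<odot>\<^bsub>M\<^esub> m) (j, i) = r j \<odot>\<^bsub>Q\<^esub> m (j, i)" using ji bimod_simps(3)[OF ji] by (simp add: species_bimodule_def Let_def)
  \<comment> \<open>The component of \<open>r\<close> is represented by \<open>f j\<close> times the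
    lift of \<open>r\<close>, so the action can be computed on representatives in
    \<open>A\<close>.\<close>
  also have "r j = q (f j \<otimes> sg r)" using sigma_f(2,3)[OF r ji(1)] lft(2) by simp
  also have "q (f j \<otimes> sg r) \<odot>\<^bsub>Q\<^esub> m (j, i) = p ((f j \<otimes> sg r) \<otimes> (f j \<otimes> ta m \<otimes> f i))"
    using M_entry_p[OF m ji] r ji by (simp only: Q_smult(1) m_closed f_closed sigma_closed)
  also have "(f j \<otimes> sg r) \<otimes> (f j \<otimes> ta m \<otimes> f i) = f j \<otimes> (sg r \<otimes> f j) \<otimes> (ta m \<otimes> f i)"
    using m r ji by (simp add: m_assoc)
  \<comment> \<open>Elements of \<open>wedd\<close> commute with \<open>f j\<close>; this brings the
    two copies of \<open>f j\<close> together.\<close>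
  also have "\<dots> = f j \<otimes> (f j \<otimes> sg r) \<otimes> (ta m \<otimes> f i)" using weddD(1)[OF sigma_wedd[OF r] ji(1)] by simp
  also have "\<dots> = (f j \<otimes> f j) \<otimes> (sg r \<otimes> ta m \<otimes> f i)" using m r ji by (simp add: m_assoc)
  also have "\<dots> = f j \<otimes> (sg r \<otimes> ta m) \<otimes> f i" using m r ji ff[OF ji(1)] by (simp add: m_assoc)
  finally show "(r \<odot>\<^bsub>M\<^esub> m) (j, i) = p (f j \<otimes> (sg r \<otimes> ta m) \<otimes> f i)" .
qed

lemma M_ract: assumes r: "r \<in> carrier R" and m: "m \<in> carrier M" shows "rsmult M m r \<in> carrier M \<and> ta (rsmult M m r) = ta m \<otimes> sg r"
proof (rule M_eqI)
  show "rsmult M m r \<in> extensional P" by (simp add: species_bimodule_def Let_def)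
  show "ta m \<otimes> sg r \<in> V" using V_wedd(2)[OF tau_V[OF m] sigma_wedd[OF r]] .
  fix j i assume ji: "j \<in> {1..n}" "i \<in> {1..n}"
  have "rsmult M m r (j, i) = rsmult Q (m (j, i)) (r i)" using ji bimod_simps(4)[OF ji] by (simp add: species_bimodule_def Let_def)
  also have "r i = q (f i \<otimes> sg r)" using sigma_f(2,3)[OF r ji(2)] lft(2) by simp
  also have "rsmult Q (m (j, i)) (q (f i \<otimes> sg r)) = p ((f j \<otimes> ta m \<otimes> f i) \<otimes> (f i \<otimes> sg r))"
    using M_entry_p[OF m ji] r ji by (simp only: Q_smult(2) m_closed f_closed sigma_closed)
  also have "(f j \<otimes> ta m \<otimes> f i) \<otimes> (f i \<otimes> sg r) = f j \<otimes> ta m \<otimes> ((f i \<otimes> f i) \<otimes> sg r)"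
    using m r ji by (simp add: m_assoc)
  also have "\<dots> = f j \<otimes> ta m \<otimes> (sg r \<otimes> f i)" using ff[OF ji(2)] weddD(1)[OF sigma_wedd[OF r] ji(2)] by simp
  also have "\<dots> = f j \<otimes> (ta m \<otimes> sg r) \<otimes> f i" using m r ji by (simp add: m_assoc)
  finally show "rsmult M m r (j, i) = p (f j \<otimes> (ta m \<otimes> sg r) \<otimes> f i)" .
qed

lemma bimodule_M: "bimodule R M"
proof (rule bimodule_by_injection[OF ring_axioms ring_R sigma_ring_hom, where t = ta])
  fix x assume "x \<in> carrier M"
  then show "\<exists>y\<in>carrier M. ta y = \<ominus> ta x" using mk[OF V_neg[OF tau_V]] by blast
qed (use M_add M_zero M_lact M_ract tau_inj in auto)

lemma hcomp_M: "m \<in> hcomp M g \<longleftrightarrow> m \<in> carrier M \<and> ta m \<in> hcomp A g"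
proof
  assume m: "m \<in> hcomp M g"
  then have e: "m (j, i) \<in> hcomp Q g" "m (j, i) \<in> carrier (bimod S j i)" if "j \<in> {1..n}" "i \<in> {1..n}" for j i
  proof -
    have "m (j, i) \<in> hcomp (bimod S j i) g" using m that by (simp add: species_bimodule_def Let_def PiE_iff)
    then show "m (j, i) \<in> hcomp Q g" "m (j, i) \<in> carrier (bimod S j i)" using bimod_simps(6)[OF that] by auto
  qed
  have "m \<in> extensional P" using m by (simp add: species_bimodule_def Let_def PiE_iff)
  then have mc: "m \<in> carrier M" using e(2) unfolding M_mem by blast
  have th: "t (m x) \<in> hcomp A g" if "x \<in> P" for x
  proof -
    obtain j i where x: "x = (j, i)" "j \<in> {1..n}" "i \<in> {1..n}" using \<open>x \<in> P\<close> by blast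
    have "m x \<in> p ` (hcomp A g \<inter> J)" using e(1)[OF x(2,3)] x(1) Q_hcomp by simp
    then obtain y where y: "y \<in> hcomp A g" "y \<in> J" "m x = p y" by blast
    \<comment> \<open>The section preserves degrees, so a homogeneous representative in
      \<open>J\<close> gives a homogeneous one in \<open>V\<close>.\<close>
    have "part g (s y) = s y" using S(4)[OF y(2)] y(1) by simp
    then have "s y \<in> hcomp A g" using part_hcomp[OF S(2)[OF y(2)], of g] by simp
    then show ?thesis using t_p[OF y(2)] y(3) by simp
  qed
  have "part g (ta m) = finsum A (\<lambda>x. part g (t (m x))) P" unfolding ta_def by (rule part_finsum) (use t_Pi[OF mc] in auto)
  also have "\<dots> = ta m" unfolding ta_def by (rule finsum_cong') (use th t_Pi[OF mc] in auto)
  finally have e: "part g (ta m) = ta m" .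
  have "part g (ta m) \<in> hcomp A g" by (rule part_hcomp[OF tau_closed[OF mc]])
  then show "m \<in> carrier M \<and> ta m \<in> hcomp A g" using mc unfolding e by simp
next
  assume m: "m \<in> carrier M \<and> ta m \<in> hcomp A g"
  have "m (j, i) \<in> hcomp (bimod S j i) g" if ji: "j \<in> {1..n}" "i \<in> {1..n}" for j i
  proof -
    have "f j \<otimes> ta m \<otimes> f i \<in> hcomp A g"
      using hcomp_mult[OF hcomp_mult[OF f_h[OF ji(1)] conjunct2[OF m]] f_h[OF ji(2)]] by (simp only: add_0_left add_0_right)
    then have "m (j, i) \<in> hcomp Q g" using M_entry_p[OF conjunct1[OF m] ji] unfolding Q_hcomp by blast
    then show ?thesis using m ji unfolding bimod_simps(6)[OF ji] M_mem by blast
  qed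
  moreover have "m \<in> extensional P" using m M_mem by blast
  ultimately show "m \<in> hcomp M g" by (auto simp: species_bimodule_def Let_def PiE_iff)
qed

lemma M_dec: assumes m: "m \<in> carrier M" shows "\<exists>a\<in>hcomp M 0. \<exists>b\<in>hcomp M 1. m = a \<oplus>\<^bsub>M\<^esub> b"
proof -
  let ?a = "mk (part 0 (ta m))" and ?b = "mk (part 1 (ta m))"
  note a = mk[OF V_part[OF tau_V[OF m], of 0]] and b = mk[OF V_part[OF tau_V[OF m], of 1]]
  have "m = ?a \<oplus>\<^bsub>M\<^esub> ?b" by (rule tau_inj) (use m M_add[OF a(1) b(1)] a b part_sum[of "ta m"] in simp_all)
  moreover have "?a \<in> hcomp M 0" "?b \<in> hcomp M 1" using a b m unfolding hcomp_M by simp_all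
  ultimately show ?thesis by blast
qed

lemma presentation:
  assumes t0: "ideal_power A J t0 = {\<zero>}"
  shows "presentation K R M A sg ta J t0"
proof -
  have s1: "c \<odot>\<^bsub>R\<^esub> r = (c \<odot>\<^bsub>R\<^esub> \<one>\<^bsub>R\<^esub>) \<otimes>\<^bsub>R\<^esub> r" if "c \<in> carrier K" "r \<in> carrier R" for c r
    by (rule sigma_inj) (use that in \<open>simp_all add: R_closed sigma_mult sigma_smult sigma_one smult_one\<close>)
  have sgen: "\<exists>r\<in>carrier R. a \<ominus> sg r \<in> J" if a: "a \<in> carrier A" for a
  proof -
    obtain r where r: "r \<in> wedd" "a \<doteq> r" using wedd_approx[OF a] by blast
    obtain d where "d \<in> carrier R" "sg d = r" by (rule sigma_surj[OF r(1)])
    then show ?thesis using r(2) unfolding eqJ_def by blast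
  qed
  have sJ: "r = \<zero>\<^bsub>R\<^esub>" if "r \<in> carrier R" "sg r \<in> J" for r
    by (rule sigma_inj) (use that wedd_J[OF sigma_wedd] R_closed sigma_zero in auto)
  have tJ2: "x = \<zero>\<^bsub>M\<^esub>" if "x \<in> carrier M" "ta x \<in> J2" for x
  proof (rule tau_inj)
    \<comment> \<open>On \<open>V\<close> the section is the identity and on \<open>J2\<close> it is
      zero, so the two meet only in zero.\<close>
    have "ta x = \<zero>" using S(5)[OF that(2)] VD(2)[OF tau_V[OF that(1)]] by simp
    then show "ta x = ta \<zero>\<^bsub>M\<^esub>" using M_zero by simp
  qed (use that M_zero in auto)
  have tgen: "\<exists>x\<in>carrier M. j \<ominus> ta x \<in> J2" if "j \<in> J" for j
    using mk[OF s_V[OF that]] S(3)[OF that] by (metis)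
  show ?thesis
    by (intro presentation.intro graded_lift.intro tensor_lift.intro tensor_lift_axioms.intro graded_lift_axioms.intro presentation_axioms.intro
          bimodule_M ring_axioms salg_axioms sigma_ring_hom R_hcomp R_dec M_dec R_closed s1 sigma_smult idJ)
      (use M_add M_lact M_ract hcomp_R hcomp_M t0 sJ sgen tau_J tJ2 tgen in auto)
qed

end

section \<open>Gr-hereditary algebras\<close>

context salg begin

text \<open>Modules of functions with pointwise operations, in the element type over which
  \<open>gr_projective\<close> quantifies. Carrier and degrees are parameters because two instances
  occur: the direct sum that covers \<open>J\<close>, and a copy of \<open>J\<close>.\<close>

definition pwm :: "('a => 'a) set => (bit => ('a => 'a) set) => ('a, 'a => 'a) gmodule" where
  "pwm C H = \<lparr>carrier = C, monoid.mult = undefined, one = undefined, ring.zero = (\<lambda>_. \<zero>), ring.add = (\<lambda>x y b. x b \<oplus> y b),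
     smult = (\<lambda>a x b. a \<otimes> x b), hcomp = H\<rparr>"

lemma pwm_simps [simp]: "carrier (pwm C H) = C" "\<zero>\<^bsub>pwm C H\<^esub> = (\<lambda>_. \<zero>)" "x \<oplus>\<^bsub>pwm C H\<^esub> y = (\<lambda>b. x b \<oplus> y b)"
  "a \<odot>\<^bsub>pwm C H\<^esub> x = (\<lambda>b. a \<otimes> x b)" "hcomp (pwm C H) g = H g"
  by (simp_all add: pwm_def)

lemma pwm_graded_module:
  assumes C: "\<And>x b. x \<in> C ==> x b \<in> carrier A" "(\<lambda>_. \<zero>) \<in> C" "\<And>x y. x \<in> C ==> y \<in> C ==> (\<lambda>b. x b \<oplus> y b) \<in> C"
      "\<And>a x. a \<in> carrier A ==> x \<in> C ==> (\<lambda>b. a \<otimes> x b) \<in> C"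
    and H: "\<And>g x. x \<in> H g ==> x \<in> C" "\<And>g. (\<lambda>_. \<zero>) \<in> H g" "\<And>g x y. x \<in> H g ==> y \<in> H g ==> (\<lambda>b. x b \<oplus> y b) \<in> H g"
      "\<And>g x. x \<in> H g ==> (\<lambda>b. \<ominus> x b) \<in> H g" "\<And>g h a x. a \<in> hcomp A g ==> x \<in> H h ==> (\<lambda>b. a \<otimes> x b) \<in> H (g + h)"
    and dec: "\<And>x. x \<in> C ==> \<exists>y\<in>H 0. \<exists>z\<in>H 1. x = (\<lambda>b. y b \<oplus> z b)" and disj: "\<And>x. x \<in> H 0 ==> x \<in> H 1 ==> x = (\<lambda>_. \<zero>)"
  shows "graded_module A (pwm C H)"
proof -
  have neg: "(\<lambda>b. \<ominus> x b) \<in> C" if x: "x \<in> C" for x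
  proof -
    have "(\<lambda>b. (\<ominus> \<one>) \<otimes> x b) \<in> C" using C(4)[OF _ x, of "\<ominus> \<one>"] by simp
    moreover have "(\<lambda>b. (\<ominus> \<one>) \<otimes> x b) = (\<lambda>b. \<ominus> x b)" using C(1)[OF x] by (simp add: fun_eq_iff l_minus)
    ultimately show ?thesis by simp
  qed
  have ab: "abelian_group (pwm C H)"
  proof (rule abelian_groupI)
    fix x assume x: "x \<in> carrier (pwm C H)"
    then show "\<exists>y\<in>carrier (pwm C H). y \<oplus>\<^bsub>pwm C H\<^esub> x = \<zero>\<^bsub>pwm C H\<^esub>"
      using neg[of x] C(1) by (intro bexI[of _ "\<lambda>b. \<ominus> x b"]) (auto simp: fun_eq_iff l_neg)
  qed (use C in \<open>auto simp: fun_eq_iff a_ac\<close>)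
  interpret P: abelian_group "pwm C H" by (rule ab)
  have inv: "inv\<^bsub>add_monoid (pwm C H)\<^esub> x = (\<lambda>b. \<ominus> x b)" if x: "x \<in> C" for x
  proof -
    have "(\<lambda>b. \<ominus> x b) \<oplus>\<^bsub>pwm C H\<^esub> x = \<zero>\<^bsub>pwm C H\<^esub>" using C(1)[OF x] by (simp add: fun_eq_iff l_neg)
    then have "\<ominus>\<^bsub>pwm C H\<^esub> x = (\<lambda>b. \<ominus> x b)" using P.minus_equality[of "\<lambda>b. \<ominus> x b" x] neg[OF x] x by simp
    then show ?thesis by (simp add: a_inv_def)
  qed
  have sub: "subgroup (H g) (add_monoid (pwm C H))" for g
    by (rule subgroup.intro) (use H inv in auto)
  have "\<exists>!p. p \<in> H 0 \<times> H 1 \<and> x = fst p \<oplus>\<^bsub>pwm C H\<^esub> snd p" if x: "x \<in> C" for x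
  proof -
    obtain y z where yz: "y \<in> H 0" "z \<in> H 1" "x = (\<lambda>b. y b \<oplus> z b)" using dec[OF x] by blast
    have "y' = y \<and> z' = z" if h: "y' \<in> H 0" "z' \<in> H 1" "x = (\<lambda>b. y' b \<oplus> z' b)" for y' z'
    proof -
      have c: "y b \<in> carrier A" "z b \<in> carrier A" "y' b \<in> carrier A" "z' b \<in> carrier A" for b using yz h H(1) C(1) by blast+
      have e: "y b \<oplus> z b = y' b \<oplus> z' b" for b using yz(3) h(3) by metis
      \<comment> \<open>The difference of the even parts equals a difference of odd parts, so it is
        homogeneous of both degrees and vanishes by \<open>disj\<close>.\<close>
      have e2: "y b \<oplus> \<ominus> y' b = z' b \<oplus> \<ominus> z b" for b
      proof -
        have "y b \<oplus> \<ominus> y' b = (y b \<oplus> z b) \<oplus> (\<ominus> z b \<oplus> \<ominus> y' b)" using c[of b] by (simp add: a_assoc r_neg2)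
        also have "\<dots> = (y' b \<oplus> z' b) \<oplus> (\<ominus> z b \<oplus> \<ominus> y' b)" by (simp only: e)
        also have "\<dots> = (z' b \<oplus> \<ominus> z b) \<oplus> (y' b \<oplus> \<ominus> y' b)" using c[of b] by (simp add: a_ac)
        finally show ?thesis using c[of b] by (simp add: r_neg)
      qed
      have "(\<lambda>b. y b \<oplus> \<ominus> y' b) \<in> H 0" using H(3)[OF yz(1) H(4)[OF h(1)]] .
      moreover have "(\<lambda>b. y b \<oplus> \<ominus> y' b) \<in> H 1" unfolding e2 using H(3)[OF h(2) H(4)[OF yz(2)]] .
      ultimately have z: "(\<lambda>b. y b \<oplus> \<ominus> y' b) = (\<lambda>_. \<zero>)" by (rule disj)
      have z1: "y b \<oplus> \<ominus> y' b = \<zero>" for b using fun_cong[OF z, of b] .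
      have "y b \<ominus> y' b = \<zero>" "z' b \<ominus> z b = \<zero>" for b using z1[of b] e2[of b] by (simp_all add: a_minus_def)
      then have "y' b = y b \<and> z' b = z b" for b using c[of b] by (metis r_right_minus_eq)
      then show ?thesis by (simp add: fun_eq_iff)
    qed
    then show ?thesis using yz by (intro ex1I[of _ "(y, z)"]) (auto simp: prod_eq_iff)
  qed
  then have gr: "grading (pwm C H)" using sub by (simp add: grading_def)
  show ?thesis
    by (intro graded_module.intro graded_module_axioms.intro ring_axioms ab gr)
      (use C H(5) in \<open>simp_all add: l_distr r_distr m_assoc fun_eq_iff\<close>)
qed

end

section \<open>Homogeneous bases over the Wedderburn complement\<close>

context species_salg begin

text \<open>Candidates for basis vectors: homogeneous, and fixed on the left by one idempotent
  \<open>f j\<close>, so that right multiplication by \<open>b\<close> maps \<open>A f j\<close>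
  onto \<open>A b\<close>.\<close>

definition hv where "hv = {b \<in> V. (\<exists>g. b \<in> hcomp A g) \<and> (\<exists>j. j \<in> {1..n} \<and> f j \<otimes> b = b)}"
definition jj where "jj b = (SOME j. j \<in> {1..n} \<and> f j \<otimes> b = b)"
definition dg where "dg b = (SOME g. b \<in> hcomp A g)"

lemma hvD: assumes "b \<in> hv"
  shows "b \<in> V" "b \<in> carrier A" "b \<in> hcomp A (dg b)" "jj b \<in> {1..n}" "f (jj b) \<otimes> b = b"
proof -
  show "b \<in> V" "b \<in> carrier A" using assms VD(3) by (auto simp: hv_def)
  have "\<exists>g. b \<in> hcomp A g" "\<exists>j. j \<in> {1..n} \<and> f j \<otimes> b = b" using assms by (auto simp: hv_def)
  then show "b \<in> hcomp A (dg b)" "jj b \<in> {1..n}" "f (jj b) \<otimes> b = b"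
    unfolding dg_def jj_def using someI_ex[of "\<lambda>g. b \<in> hcomp A g"] someI_ex[of "\<lambda>j. j \<in> {1..n} \<and> f j \<otimes> b = b"] by simp_all
qed

definition spn where "spn Cs = {finsum A (\<lambda>b. a b \<otimes> b) Cs | a. \<forall>b\<in>Cs. a b \<in> wedd}"

text \<open>Coefficients are normalised by the idempotent that fixes the basis vector; a coefficient
  killed by that idempotent on its right would act as zero and spoil independence.\<close>

definition ind where "ind Cs \<longleftrightarrow> (\<forall>a. (\<forall>b\<in>Cs. a b \<in> wedd \<and> a b \<otimes> f (jj b) = a b) \<and> finsum A (\<lambda>b. a b \<otimes> b) Cs = \<zero> \<longrightarrow> (\<forall>b\<in>Cs. a b = \<zero>))"

lemma spnI: "(\<And>b. b \<in> Cs ==> a b \<in> wedd) ==> finsum A (\<lambda>b. a b \<otimes> b) Cs \<in> spn Cs"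
  unfolding spn_def by blast

lemma finsum_V: "finite C ==> (\<And>b. b \<in> C ==> x b \<in> V) ==> finsum A x C \<in> V"
proof (induction C rule: finite_induct)
  case (insert i C)
  have "x \<in> C \<rightarrow> carrier A" "x i \<in> carrier A" using insert.prems VD(3) by auto
  then show ?case using insert V_add by simp
qed (simp add: V_zero)

lemma spn_V: assumes "finite Cs" "Cs \<subseteq> hv" shows "spn Cs \<subseteq> V"
proof
  fix x assume "x \<in> spn Cs"
  then obtain a where a: "\<And>b. b \<in> Cs ==> a b \<in> wedd" "x = finsum A (\<lambda>b. a b \<otimes> b) Cs" unfolding spn_def by blast
  have "a b \<otimes> b \<in> V" if "b \<in> Cs" for b using V_wedd(1)[OF hvD(1) a(1)] that assms by blast
  then show "x \<in> V" unfolding a(2) by (rule finsum_V[OF assms(1)])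
qed

lemma spn_add: assumes "finite Cs" "Cs \<subseteq> hv" "x \<in> spn Cs" "y \<in> spn Cs" shows "x \<oplus> y \<in> spn Cs"
proof -
  obtain a where a: "\<And>b. b \<in> Cs ==> a b \<in> wedd" "x = finsum A (\<lambda>b. a b \<otimes> b) Cs" using assms(3) unfolding spn_def by blast
  obtain a' where a': "\<And>b. b \<in> Cs ==> a' b \<in> wedd" "y = finsum A (\<lambda>b. a' b \<otimes> b) Cs" using assms(4) unfolding spn_def by blast
  have c: "b \<in> Cs ==> a b \<in> carrier A" "b \<in> Cs ==> a' b \<in> carrier A" "b \<in> Cs ==> b \<in> carrier A" for b
    using a a' wedd_closed hvD(2) assms(2) by auto
  have "x \<oplus> y = finsum A (\<lambda>b. a b \<otimes> b \<oplus> a' b \<otimes> b) Cs" unfolding a(2) a'(2)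
    by (rule finsum_addf[symmetric]) (use c in auto)
  also have "\<dots> = finsum A (\<lambda>b. (a b \<oplus> a' b) \<otimes> b) Cs" by (rule finsum_cong') (use c in \<open>auto simp: l_distr\<close>)
  finally show ?thesis using spnI[of Cs "\<lambda>b. a b \<oplus> a' b"] wedd_add a a' by simp
qed

lemma spn_wedd: assumes "finite Cs" "Cs \<subseteq> hv" "x \<in> spn Cs" "r \<in> wedd" shows "r \<otimes> x \<in> spn Cs"
proof -
  obtain a where a: "\<And>b. b \<in> Cs ==> a b \<in> wedd" "x = finsum A (\<lambda>b. a b \<otimes> b) Cs" using assms(3) unfolding spn_def by blast
  have c: "b \<in> Cs ==> a b \<in> carrier A" "b \<in> Cs ==> b \<in> carrier A" "r \<in> carrier A" for b
    using a wedd_closed hvD(2) assms by auto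
  have "r \<otimes> x = finsum A (\<lambda>b. r \<otimes> (a b \<otimes> b)) Cs" unfolding a(2)
    by (rule finsum_rdistr[OF assms(1) c(3)]) (use c in auto)
  also have "\<dots> = finsum A (\<lambda>b. (r \<otimes> a b) \<otimes> b) Cs" by (rule finsum_cong') (use c in \<open>auto simp: m_assoc\<close>)
  finally show ?thesis using spnI[of Cs "\<lambda>b. r \<otimes> a b"] wedd_mult a assms(4) by simp
qed

lemma spn_zero: assumes "finite Cs" "Cs \<subseteq> hv" shows "\<zero> \<in> spn Cs"
proof -
  have "finsum A (\<lambda>b. \<zero> \<otimes> b) Cs = finsum A (\<lambda>b. \<zero>) Cs" by (rule finsum_cong') (use assms hvD(2) in auto)
  then show ?thesis using spnI[of Cs "\<lambda>_. \<zero>"] wedd_zero by simp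
qed

lemma spn_smult: assumes "finite Cs" "Cs \<subseteq> hv" "x \<in> spn Cs" "c \<in> carrier K" shows "c \<odot> x \<in> spn Cs"
proof -
  have x: "x \<in> carrier A" using spn_V[OF assms(1,2)] assms(3) VD(3) by blast
  have "(c \<odot> \<one>) \<otimes> x \<in> spn Cs" using assms wedd_smult[OF assms(4) wedd_one] by (intro spn_wedd)
  then show ?thesis using smult_one[OF assms(4) x] by simp
qed

lemma spn_ksub: assumes "finite Cs" "Cs \<subseteq> hv" shows "ksub (spn Cs)"
  unfolding ksub_def using spn_zero[OF assms] spn_add[OF assms] spn_smult[OF assms] spn_V[OF assms] VD(3) by blast

lemma spn_part: assumes "finite Cs" "Cs \<subseteq> hv" "x \<in> spn Cs" shows "part g x \<in> spn Cs"
proof -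
  obtain a where a: "\<And>b. b \<in> Cs ==> a b \<in> wedd" "x = finsum A (\<lambda>b. a b \<otimes> b) Cs" using assms(3) unfolding spn_def by blast
  have c: "b \<in> Cs ==> a b \<in> carrier A" "b \<in> Cs ==> b \<in> carrier A" for b
    using a wedd_closed hvD(2) assms by auto
  have "part g x = finsum A (\<lambda>b. part g (a b \<otimes> b)) Cs" unfolding a(2) by (rule part_finsum[OF assms(1)]) (use c in auto)
  also have "\<dots> = finsum A (\<lambda>b. part (g + dg b) (a b) \<otimes> b) Cs"
  proof (rule finsum_cong')
    fix b assume b: "b \<in> Cs"
    have bh: "b \<in> hcomp A (dg b)" using hvD(3) b assms by blast
    have "g + dg b + dg b = g" by (cases "dg b"; cases g) simp_all
    then show "part g (a b \<otimes> b) = part (g + dg b) (a b) \<otimes> b" using part_mult_r[OF bh c(1)[OF b], of "g + dg b"] by (simp only:)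
  qed (use c in auto)
  finally show ?thesis using spnI[of Cs "\<lambda>b. part (g + dg b) (a b)"] wedd_part[OF a(1)] by simp
qed

lemma spn_insert:
  assumes "finite Cs" "insert y Cs \<subseteq> hv" "y \<notin> Cs" "w \<in> spn Cs" "r \<in> wedd" shows "r \<otimes> y \<oplus> w \<in> spn (insert y Cs)"
proof -
  obtain a where a: "\<And>b. b \<in> Cs ==> a b \<in> wedd" "w = finsum A (\<lambda>b. a b \<otimes> b) Cs" using assms(4) unfolding spn_def by blast
  have c: "b \<in> Cs ==> a b \<in> carrier A" "b \<in> insert y Cs ==> b \<in> carrier A" "r \<in> carrier A" for b
    using a wedd_closed hvD(2) assms by auto
  have "finsum A (\<lambda>b. (a(y := r)) b \<otimes> b) (insert y Cs) = (a(y := r)) y \<otimes> y \<oplus> finsum A (\<lambda>b. (a(y := r)) b \<otimes> b) Cs"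
    by (rule finsum_insert[OF assms(1,3)]) (use c assms(3) in auto)
  also have "finsum A (\<lambda>b. (a(y := r)) b \<otimes> b) Cs = w" unfolding a(2) by (rule finsum_cong') (use c assms(3) in auto)
  finally have "finsum A (\<lambda>b. (a(y := r)) b \<otimes> b) (insert y Cs) = r \<otimes> y \<oplus> w" by simp
  moreover have "finsum A (\<lambda>b. (a(y := r)) b \<otimes> b) (insert y Cs) \<in> spn (insert y Cs)" by (rule spnI) (use a(1) assms(5) in auto)
  ultimately show ?thesis by simp
qed

lemma spn_mem: assumes "finite Cs" "Cs \<subseteq> hv" "y \<in> Cs" shows "y \<in> spn Cs"
proof -
  have "insert y (Cs - {y}) = Cs" using assms by auto
  moreover have h: "finite (Cs - {y})" "Cs - {y} \<subseteq> hv" and y: "y \<in> carrier A" using assms hvD(2) by auto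
  ultimately show ?thesis
    using spn_insert[of "Cs - {y}" y \<zero> \<one>] spn_zero[OF h] wedd_one assms by simp
qed

text \<open>The usual exchange argument, except that the coefficient \<open>r\<close> of
  \<open>y\<close> lies in a piece of dimension up to two and need not be homogeneous. It has to be
  shown to vanish without inverting it: every scalar multiple of \<open>y\<close> in the span must
  be zero.\<close>

lemma ind_insert:
  assumes Cs: "finite Cs" "Cs \<subseteq> hv" and y: "y \<in> hv" "y \<notin> spn Cs" and ind: "ind Cs"
  shows "ind (insert y Cs)"
  unfolding ind_def
proof (intro allI impI, elim conjE)
  fix a assume a: "\<forall>b\<in>insert y Cs. a b \<in> wedd \<and> a b \<otimes> f (jj b) = a b" and z: "finsum A (\<lambda>b. a b \<otimes> b) (insert y Cs) = \<zero>"
  have ny: "y \<notin> Cs" using spn_mem[OF Cs] y by blast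
  have c: "b \<in> insert y Cs ==> a b \<in> carrier A" "b \<in> insert y Cs ==> b \<in> carrier A" for b
    using a wedd_closed hvD(2) assms by auto
  define r where "r = a y"
  define j where "j = jj y"
  have yc: "y \<in> carrier A" and j: "j \<in> {1..n}" and fy: "f j \<otimes> y = y" and yh: "y \<in> hcomp A (dg y)" using hvD[OF y(1)] by (auto simp: j_def)
  have rw: "r \<in> wedd" and rf: "r \<otimes> f j = r" using a by (auto simp: r_def j_def)
  have rc: "r \<in> carrier A" using wedd_closed[OF rw] .
  define w where "w = finsum A (\<lambda>b. a b \<otimes> b) Cs"
  have w: "w \<in> spn Cs" unfolding w_def by (rule spnI) (use a in auto)
  have wc: "w \<in> carrier A" using spn_V[OF Cs] w VD(3) by blast
  have sum: "r \<otimes> y \<oplus> w = \<zero>"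
    using z unfolding w_def r_def by (subst (asm) finsum_insert[OF Cs(1) ny]) (use c in auto)
  have "r \<otimes> y = \<ominus> w" using sum rc yc wc by (intro minus_equality[symmetric]) auto
  also have "\<dots> = (\<ominus> \<one>) \<otimes> w" using wc by (simp add: l_minus)
  finally have ry: "r \<otimes> y \<in> spn Cs" using spn_wedd[OF Cs w wedd_neg[OF wedd_one]] by simp
  have scal: "k = \<zero>\<^bsub>K\<^esub>" if k: "k \<in> carrier K" and ky: "k \<odot> y \<in> spn Cs" for k
  proof (rule ccontr)
    assume "k \<noteq> \<zero>\<^bsub>K\<^esub>"
    then have ku: "k \<in> Units K" using k vs.field_Units by simp
    have "inv\<^bsub>K\<^esub> k \<odot> (k \<odot> y) \<in> spn Cs" using ku by (intro spn_smult[OF Cs ky]) simp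
    moreover have "inv\<^bsub>K\<^esub> k \<odot> (k \<odot> y) = y" using ku k yc by (simp add: vs.smult_assoc1[symmetric] vs.R.Units_l_inv)
    ultimately show False using y by simp
  qed
  obtain al be where ab: "al \<in> carrier K" "be \<in> carrier K" "r = al \<odot> f j \<oplus> be \<odot> u j"
    using weddD[OF rw j] rf unfolding piece_def by auto
  \<comment> \<open>As \<open>y\<close> is homogeneous, taking a component of \<open>r y\<close>
    isolates the even coefficient \<open>al\<close>.\<close>
  have "part (0 + dg y) (r \<otimes> y) = part 0 r \<otimes> y" by (rule part_mult_r[OF yh rc])
  also have "\<dots> = al \<odot> y" unfolding ab(3) piece_parts(1)[OF j ab(1,2)] using ab j yc fy by (simp add: smult_mult_l)
  finally have "al \<odot> y \<in> spn Cs" using spn_part[OF Cs ry, of "0 + dg y"] by simp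
  then have al: "al = \<zero>\<^bsub>K\<^esub>" using scal ab by blast
  then have r: "r = be \<odot> u j" using ab j by simp
  have "r = \<zero>"
  proof (cases "u j = \<zero>")
    case True then show ?thesis using r ab by simp
  next
    case False
    then have "u j \<otimes> u j = f j" using uu[OF j] by simp
    \<comment> \<open>Only the odd term is left. Applying \<open>r\<close> once more gives the
      scalar \<open>be\<close> squared times \<open>y\<close>, which is again in the span.\<close>
    then have "r \<otimes> (r \<otimes> y) = (be \<otimes>\<^bsub>K\<^esub> be) \<odot> y"
      using ab(2) j yc fy unfolding r by (simp add: smult_mult_l smult_mult_r vs.smult_assoc1 m_assoc[symmetric])
    then have bb: "be \<otimes>\<^bsub>K\<^esub> be = \<zero>\<^bsub>K\<^esub>" using spn_wedd[OF Cs ry rw] scal[of "be \<otimes>\<^bsub>K\<^esub> be"] ab by simp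
    have "be = \<zero>\<^bsub>K\<^esub>"
    proof (rule ccontr)
      assume "be \<noteq> \<zero>\<^bsub>K\<^esub>"
      then have "be \<in> Units K" using ab vs.field_Units by simp
      then have "be \<otimes>\<^bsub>K\<^esub> be \<in> Units K" by simp
      then show False using bb vs.field_Units by simp
    qed
    then show ?thesis using r j by simp
  qed
  moreover have "\<forall>b\<in>Cs. a b = \<zero>"
  proof -
    have "w = \<zero>" using sum wc yc unfolding \<open>r = \<zero>\<close> by simp
    then show ?thesis using ind a unfolding ind_def w_def by blast
  qed
  ultimately show "\<forall>b\<in>insert y Cs. a b = \<zero>" by (simp add: r_def)
qed

text \<open>A maximal span among those of finite independent subsets of \<open>hv\<close> contains
  all of \<open>hv\<close> by \<open>ind_insert\<close>. Splitting an element of \<open>V\<close> by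
  the \<open>f j\<close> and by degree writes it as a sum of elements of \<open>hv\<close>, so the
  span is all of \<open>V\<close>.\<close>

lemma basis_exists: obtains Cs where "finite Cs" "Cs \<subseteq> hv" "ind Cs" "spn Cs = V"
proof -
  define \<F> where "\<F> = {spn Cs | Cs. finite Cs \<and> Cs \<subseteq> hv \<and> ind Cs}"
  have "spn {} \<in> \<F>" unfolding \<F>_def by (rule CollectI, rule exI[of _ "{}"]) (simp add: ind_def)
  moreover have "ksub W" if "W \<in> \<F>" for W
  proof -
    obtain Cs where "finite Cs" "Cs \<subseteq> hv" "W = spn Cs" using \<open>W \<in> \<F>\<close> unfolding \<F>_def by blast
    then show ?thesis using spn_ksub by simp
  qed
  ultimately have "\<exists>W\<in>\<F>. \<forall>W'\<in>\<F>. W \<subseteq> W' \<longrightarrow> W' = W" by (rule ksub_maximal)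
  then obtain W where W: "W \<in> \<F>" "\<And>W'. W' \<in> \<F> ==> W \<subseteq> W' ==> W' = W" by blast
  obtain Cs where Cs: "finite Cs" "Cs \<subseteq> hv" and ind: "ind Cs" and WCs: "W = spn Cs" using W(1) unfolding \<F>_def by blast
  have hvW: "y \<in> W" if y: "y \<in> hv" for y
  proof (rule ccontr)
    assume "y \<notin> W"
    then have no: "y \<notin> spn Cs" using WCs by simp
    have ny: "y \<notin> Cs" using spn_mem[OF Cs] no by blast
    have "spn (insert y Cs) \<in> \<F>" unfolding \<F>_def using ind_insert[OF Cs y no ind] Cs y by blast
    moreover have "W \<subseteq> spn (insert y Cs)"
    proof
      fix w assume "w \<in> W"
      then have w: "w \<in> spn Cs" using WCs by simp
      have "w \<in> carrier A" using spn_V[OF Cs] w VD(3) by blast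
      then show "w \<in> spn (insert y Cs)" using spn_insert[OF Cs(1) _ ny w wedd_zero] Cs y hvD(2)[OF y] by simp
    qed
    ultimately have "spn (insert y Cs) = W" by (rule W(2))
    then have "y \<in> W" using spn_mem[of "insert y Cs" y] Cs y by simp
    then show False using \<open>y \<notin> W\<close> by simp
  qed
  have "y \<in> W" if y: "y \<in> V" for y
  proof -
    note yc = VD(3)[OF y]
    have fj: "f j \<otimes> y \<in> W" if j: "j \<in> {1..n}" for j
    proof -
      have fV: "f j \<otimes> y \<in> V" by (rule V_wedd(1)[OF y f_wedd[OF j]])
      note fc = VD(3)[OF fV]
      have "part g (f j \<otimes> y) \<in> hv" for g
      proof -
        have "part (0 + g) (f j \<otimes> (f j \<otimes> y)) = f j \<otimes> part g (f j \<otimes> y)" by (rule part_mult_l[OF f_h[OF j] fc])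
        moreover have "f j \<otimes> (f j \<otimes> y) = f j \<otimes> y" using ff[OF j] j yc by (simp add: m_assoc[symmetric])
        ultimately have "f j \<otimes> part g (f j \<otimes> y) = part g (f j \<otimes> y)" by (simp only: add_0_left)
        then show ?thesis using V_part[OF fV] part_hcomp[OF fc] j unfolding hv_def by blast
      qed
      then have "part 0 (f j \<otimes> y) \<oplus> part 1 (f j \<otimes> y) \<in> W" using hvW spn_add[OF Cs] WCs by simp
      then show ?thesis using part_sum[OF fc] by simp
    qed
    have "finsum A (\<lambda>j. f j \<otimes> y) C \<in> W" if "finite C" "C \<subseteq> {1..n}" for C
      using that
    proof (induction C rule: finite_induct)
      case empty show ?case using spn_zero[OF Cs] WCs by simp
    next
      case (insert j C)
      have "(\<lambda>j. f j \<otimes> y) \<in> C \<rightarrow> carrier A" "f j \<otimes> y \<in> carrier A" using insert.prems yc f_closed by auto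
      then show ?case using insert spn_add[OF Cs] fj WCs by simp
    qed
    from this[of "{1..n}"] show ?thesis unfolding sum_f_l[OF yc] by simp
  qed
  then have "spn Cs = V" using spn_V[OF Cs] WCs by blast
  then show ?thesis using that Cs ind by blast
qed

end

section \<open>Splitting the surjection onto the radical\<close>

context species_salg begin

lemma hereditary_independent:
  assumes her: "gr_hereditary A" and Cs: "finite Cs" "Cs \<subseteq> hv" and ind: "ind Cs"
    and gen: "\<And>y. y \<in> J ==> \<exists>a. (\<forall>b\<in>Cs. a b \<in> carrier A \<and> a b \<otimes> f (jj b) = a b) \<and> y = finsum A (\<lambda>b. a b \<otimes> b) Cs"
    and a: "\<And>b. b \<in> Cs ==> a b \<in> carrier A \<and> a b \<otimes> f (jj b) = a b" and a0: "finsum A (\<lambda>b. a b \<otimes> b) Cs = \<zero>"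
  shows "\<forall>b\<in>Cs. a b = \<zero>"
proof -
  have hb: "b \<in> carrier A" "b \<in> V" "b \<in> J" "jj b \<in> {1..n}" "f (jj b) \<in> carrier A" "f (jj b) \<otimes> f (jj b) = f (jj b)" "f (jj b) \<otimes> b = b" if "b \<in> Cs" for b
    using hvD[of b] Cs that f_closed ff VD(1) by (auto simp: subset_iff)
  \<comment> \<open>Elements are functions supported on \<open>Cs\<close>; the condition at
    \<open>b\<close> singles out the left ideal generated by the idempotent of
    \<open>b\<close>.\<close>
  define F where "F = {x. (\<forall>b\<in>Cs. x b \<in> carrier A \<and> x b \<otimes> f (jj b) = x b) \<and> (\<forall>b. b \<notin> Cs \<longrightarrow> x b = \<zero>)}"
  \<comment> \<open>The unit vector at \<open>b\<close> is mapped to \<open>b\<close>, so it must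
    have degree \<open>dg b\<close>: the degree at each place is shifted accordingly, and
    \<open>sig\<close> preserves degrees.\<close>
  define FH where "FH g = {x \<in> F. \<forall>b\<in>Cs. x b \<in> hcomp A (g + dg b)}" for g
  \<comment> \<open>A copy of \<open>J\<close> in the type of the test modules, as constant
    functions.\<close>
  define N where "N = {\<lambda>_::'a. y | y. y \<in> J}"
  define NH where "NH g = {\<lambda>_::'a. y | y. y \<in> J \<and> y \<in> hcomp A g}" for g
  define sig where "sig x = finsum A (\<lambda>b. x b \<otimes> b) Cs" for x
  let ?P = "gsub (regular_module A) J"
  have FD: "x b \<in> carrier A" "b \<in> Cs ==> x b \<otimes> f (jj b) = x b" "b \<notin> Cs ==> x b = \<zero>" if "x \<in> F" for x b
    using that zero_closed unfolding F_def by (cases "b \<in> Cs"; auto)+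
  have FI: "x \<in> F" if "\<And>b. b \<in> Cs ==> x b \<in> carrier A" "\<And>b. b \<in> Cs ==> x b \<otimes> f (jj b) = x b" "\<And>b. b \<notin> Cs ==> x b = \<zero>" for x
    using that unfolding F_def by blast
  have Fadd: "(\<lambda>b. x b \<oplus> y b) \<in> F" if "x \<in> F" "y \<in> F" for x y
    by (rule FI) (use FD[OF that(1)] FD[OF that(2)] hb in \<open>auto simp: l_distr\<close>)
  have Fact: "(\<lambda>b. c \<otimes> x b) \<in> F" if "c \<in> carrier A" "x \<in> F" for c x
    by (rule FI) (use FD[OF that(2)] that(1) hb in \<open>auto simp: m_assoc\<close>)
  have Fneg: "(\<lambda>b. \<ominus> x b) \<in> F" if "x \<in> F" for x
    by (rule FI) (use FD[OF that] hb in \<open>auto simp: l_minus\<close>)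
  have F0: "(\<lambda>_. \<zero>) \<in> F" by (rule FI) (use hb in auto)
  have Fpart: "(\<lambda>b. part (g + dg b) (x b)) \<in> FH g" if x: "x \<in> F" for x g
  proof -
    have "part (g + dg b) (x b) \<otimes> f (jj b) = part (g + dg b) (x b)" if b: "b \<in> Cs" for b
      using part_mult_r[OF f_h[OF hb(4)[OF b]] FD(1)[OF x, of b], of "g + dg b"] FD(2)[OF x b] by (simp only: add_0_right)
    moreover have "part h \<zero> = \<zero>" for h using part_same[OF hcomp_zero] .
    ultimately have "(\<lambda>b. part (g + dg b) (x b)) \<in> F" using FD[OF x] by (intro FI) auto
    then show ?thesis unfolding FH_def using FD(1)[OF x] part_hcomp by blast
  qed
  have gF: "graded_module A (pwm F FH)"
  proof (rule pwm_graded_module)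
    show "\<exists>y\<in>FH 0. \<exists>z\<in>FH 1. x = (\<lambda>b. y b \<oplus> z b)" if x: "x \<in> F" for x
    proof (intro bexI)
      show "x = (\<lambda>b. part (0 + dg b) (x b) \<oplus> part (1 + dg b) (x b))"
      proof
        fix b show "x b = part (0 + dg b) (x b) \<oplus> part (1 + dg b) (x b)"
          using part_sum'[OF FD(1)[OF x], of b "dg b"] by (simp only: add_0_left add.commute[of 1])
      qed
    qed (rule Fpart[OF x])+
    show "x = (\<lambda>_. \<zero>)" if x: "x \<in> FH 0" "x \<in> FH 1" for x
    proof
      fix b show "x b = \<zero>"
      proof (cases "b \<in> Cs")
        case True
        then have "x b \<in> hcomp A (0 + dg b)" "x b \<in> hcomp A (1 + dg b)" using x unfolding FH_def by blast+
        then have "x b \<in> hcomp A (dg b)" "x b \<in> hcomp A (dg b + 1)" by (simp_all only: add_0_left add.commute[of 1])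
        then show ?thesis by (rule hcomp_disjoint)
      next
        case False then show ?thesis using x FD(3) unfolding FH_def by blast
      qed
    qed
    show "(\<lambda>b. c \<otimes> x b) \<in> FH (g + h)" if c: "c \<in> hcomp A g" and x: "x \<in> FH h" for c x g h
    proof -
      have "c \<otimes> x b \<in> hcomp A (g + h + dg b)" if "b \<in> Cs" for b
        using hcomp_mult[OF c, of "x b" "h + dg b"] x that unfolding FH_def by (simp only: add.assoc mem_Collect_eq)
      then show ?thesis using Fact[OF hcomp_carrier[OF c]] x unfolding FH_def by blast
    qed
    show "(\<lambda>_. \<zero>) \<in> FH g" for g using F0 unfolding FH_def by simp
    show "(\<lambda>b. x b \<oplus> y b) \<in> FH g" if "x \<in> FH g" "y \<in> FH g" for x y g using that Fadd hcomp_add unfolding FH_def by blast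
    show "(\<lambda>b. \<ominus> x b) \<in> FH g" if "x \<in> FH g" for x g using that Fneg hcomp_inv unfolding FH_def by blast
  qed (use FD(1) Fadd Fact F0 FH_def in auto)
  have NI: "(\<lambda>_. y) \<in> N" if "y \<in> J" for y using that unfolding N_def by blast
  have NHI: "(\<lambda>_. y) \<in> NH g" if "y \<in> J" "y \<in> hcomp A g" for y g using that unfolding NH_def by blast
  have NE: "\<exists>y. x = (\<lambda>_. y) \<and> y \<in> J" if "x \<in> N" for x using that unfolding N_def by blast
  have NHE: "\<exists>y. x = (\<lambda>_. y) \<and> y \<in> J \<and> y \<in> hcomp A g" if "x \<in> NH g" for x g using that unfolding NH_def by blast
  have gN: "graded_module A (pwm N NH)"
  proof (rule pwm_graded_module)
    show "\<exists>y\<in>NH 0. \<exists>z\<in>NH 1. x = (\<lambda>b. y b \<oplus> z b)" if xN: "x \<in> N" for x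
    proof -
      obtain y where "x = (\<lambda>_. y)" "y \<in> J" using NE[OF xN] by (elim exE conjE)
      then have y: "y \<in> J" "x = (\<lambda>_. y)" by simp_all
      note yc = J_closed[OF y(1)]
      have "x = (\<lambda>b. (\<lambda>_. part 0 y) b \<oplus> (\<lambda>_. part 1 y) b)" unfolding y(2) by (rule ext) (rule part_sum[OF yc])
      moreover have "(\<lambda>_. part g y) \<in> NH g" for g by (rule NHI[OF J_part[OF y(1)] part_hcomp[OF yc]])
      ultimately show ?thesis by (intro bexI)
    qed
    show "x = (\<lambda>_. \<zero>)" if x: "x \<in> NH 0" "x \<in> NH 1" for x
    proof -
      obtain y where y: "x = (\<lambda>_. y)" "y \<in> hcomp A 0" using NHE[OF x(1)] by (elim exE conjE)
      obtain y' where y': "x = (\<lambda>_. y')" "y' \<in> hcomp A 1" using NHE[OF x(2)] by (elim exE conjE)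
      have "y' = y" using fun_cong[of "\<lambda>_. y'" "\<lambda>_. y" undefined] y y' by simp
      then have "y = \<zero>" using hcomp_disjoint[of y 0] y y' by simp
      then show ?thesis using y by simp
    qed
    show "(\<lambda>b. c \<otimes> x b) \<in> NH (g + h)" if c: "c \<in> hcomp A g" and x: "x \<in> NH h" for c x g h
    proof -
      obtain y where y': "x = (\<lambda>_. y)" "y \<in> J" "y \<in> hcomp A h" using NHE[OF x] by (elim exE conjE)
      note y = y'(1,3,2)
      show ?thesis unfolding y(1) by (rule NHI[OF JmultI(1)[OF y(3) hcomp_carrier[OF c]] hcomp_mult[OF c y(2)]])
    qed
    show "x b \<in> carrier A" if x: "x \<in> N" for x b using NE[OF x] J_closed by auto
    show "(\<lambda>_. \<zero>) \<in> N" by (rule NI[OF idl(2)[OF idJ]])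
    show "(\<lambda>b. x b \<oplus> y b) \<in> N" if x: "x \<in> N" "y \<in> N" for x y
    proof -
      obtain x' y' where "x = (\<lambda>_. x')" "x' \<in> J" "y = (\<lambda>_. y')" "y' \<in> J" using NE[OF x(1)] NE[OF x(2)] by (elim exE conjE)
      then show ?thesis using NI[OF idl(3)[OF idJ]] by simp
    qed
    show "(\<lambda>b. c \<otimes> x b) \<in> N" if c: "c \<in> carrier A" and x: "x \<in> N" for c x
    proof -
      obtain y where y: "x = (\<lambda>_. y)" "y \<in> J" using NE[OF x] by (elim exE conjE)
      show ?thesis unfolding y(1) by (rule NI[OF JmultI(1)[OF y(2) c]])
    qed
    show "x \<in> N" if x: "x \<in> NH g" for x g
    proof -
      obtain y where "x = (\<lambda>_. y)" "y \<in> J" using NHE[OF x] by (elim exE conjE)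
      then show ?thesis using NI by simp
    qed
    show "(\<lambda>_. \<zero>) \<in> NH g" for g by (rule NHI[OF idl(2)[OF idJ] hcomp_zero])
    show "(\<lambda>b. x b \<oplus> y b) \<in> NH g" if x: "x \<in> NH g" "y \<in> NH g" for x y g
    proof -
      obtain x' y' where e: "x = (\<lambda>_. x')" "x' \<in> J" "x' \<in> hcomp A g" "y = (\<lambda>_. y')" "y' \<in> J" "y' \<in> hcomp A g"
        using NHE[OF x(1)] NHE[OF x(2)] by (elim exE conjE)
      show ?thesis unfolding e(1,4) by (rule NHI[OF idl(3)[OF idJ e(2,5)] hcomp_add[OF e(3,6)]])
    qed
    show "(\<lambda>b. \<ominus> x b) \<in> NH g" if x: "x \<in> NH g" for x g
    proof -
      obtain y where y: "x = (\<lambda>_. y)" "y \<in> J" "y \<in> hcomp A g" using NHE[OF x] by (elim exE conjE)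
      show ?thesis unfolding y(1) by (rule NHI[OF idl(7)[OF idJ y(2)] hcomp_inv[OF y(3)]])
    qed
  qed
  have tP: "(\<lambda>b. x b \<otimes> b) \<in> Cs \<rightarrow> carrier A" if "x \<in> F" for x using FD(1)[OF that] hb(1) by auto
  have sigJ: "sig x \<in> J" if "x \<in> F" for x
    unfolding sig_def by (rule finsum_mem[OF Cs(1) JmultI(1)[OF hb(3) FD(1)[OF that]] idJ])
  have sig_add: "sig (\<lambda>b. x b \<oplus> y b) = sig x \<oplus> sig y" if x: "x \<in> F" and y: "y \<in> F" for x y
  proof -
    have "sig x \<oplus> sig y = finsum A (\<lambda>b. x b \<otimes> b \<oplus> y b \<otimes> b) Cs" unfolding sig_def by (rule finsum_addf[symmetric]) (use tP x y in auto)
    also have "\<dots> = sig (\<lambda>b. x b \<oplus> y b)" unfolding sig_def by (rule finsum_cong') (use FD(1)[OF x] FD(1)[OF y] hb(1) in \<open>auto simp: l_distr\<close>)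
    finally show ?thesis by simp
  qed
  have sig_act: "sig (\<lambda>b. c \<otimes> x b) = c \<otimes> sig x" if c: "c \<in> carrier A" and x: "x \<in> F" for c x
  proof -
    have "c \<otimes> sig x = finsum A (\<lambda>b. c \<otimes> (x b \<otimes> b)) Cs" unfolding sig_def by (rule finsum_rdistr[OF Cs(1) c tP[OF x]])
    also have "\<dots> = sig (\<lambda>b. c \<otimes> x b)" unfolding sig_def by (rule finsum_cong') (use FD(1)[OF x] c hb(1) in \<open>auto simp: m_assoc\<close>)
    finally show ?thesis by simp
  qed
  have sig_h: "sig x \<in> hcomp A g" if x: "x \<in> FH g" for x g
  proof -
    have xF: "x \<in> F" using x by (simp add: FH_def)
    have th: "x b \<otimes> b \<in> hcomp A g" if b: "b \<in> Cs" for b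
    proof -
      have e: "g + dg b + dg b = g" by (cases "dg b"; cases g) simp_all
      have "x b \<in> hcomp A (g + dg b)" "b \<in> hcomp A (dg b)" using x b hvD(3) Cs unfolding FH_def by blast+
      then have "x b \<otimes> b \<in> hcomp A (g + dg b + dg b)" by (rule hcomp_mult)
      then show ?thesis unfolding e .
    qed
    have "part g (sig x) = finsum A (\<lambda>b. part g (x b \<otimes> b)) Cs" unfolding sig_def by (rule part_finsum[OF Cs(1) tP[OF xF]])
    also have "\<dots> = sig x" unfolding sig_def by (rule finsum_cong') (use th tP[OF xF] in auto)
    finally have e: "part g (sig x) = sig x" .
    show ?thesis using part_hcomp[OF J_closed[OF sigJ[OF xF]], of g] unfolding e .
  qed
  have Ps: "carrier ?P = J" "ring.add ?P = ring.add A" "smult ?P = monoid.mult A" "hcomp ?P g = hcomp A g \<inter> J" for g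
    by (simp_all add: gsub_def)
  \<comment> \<open>The hypothesis is applied to a single graded left ideal, the radical
    itself.\<close>
  have proj: "gr_projective A ?P" using her glideal_J unfolding gr_hereditary_def glideal_def by blast
  have "(\<lambda>x (_::'a). sig x) \<in> graded_hom A (pwm F FH) (pwm N NH)"
    unfolding graded_hom_def
  proof (intro CollectI conjI allI ballI)
    show "(\<lambda>x _. sig x) \<in> carrier (pwm F FH) \<rightarrow> carrier (pwm N NH)" using NI[OF sigJ] by simp
    show "(\<lambda>x _. sig x) ` hcomp (pwm F FH) g \<subseteq> hcomp (pwm N NH) g" for g
    proof -
      have "(\<lambda>_::'a. sig x) \<in> NH g" if "x \<in> FH g" for x
        by (rule NHI[OF sigJ sig_h[OF that]]) (use that in \<open>simp add: FH_def\<close>)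
      then show ?thesis by auto
    qed
  qed (use sig_add sig_act in \<open>auto simp: fun_eq_iff\<close>)
  moreover have "(\<lambda>x (_::'a). sig x) ` carrier (pwm F FH) = carrier (pwm N NH)"
  proof
    show "(\<lambda>x (_::'a). sig x) ` carrier (pwm F FH) \<subseteq> carrier (pwm N NH)" using NI[OF sigJ] by auto
    show "carrier (pwm N NH) \<subseteq> (\<lambda>x (_::'a). sig x) ` carrier (pwm F FH)"
    proof
      fix z assume "z \<in> carrier (pwm N NH)"
      then have zN: "z \<in> N" by simp
      obtain y where y: "z = (\<lambda>_. y)" "y \<in> J" using NE[OF zN] by (elim exE conjE)
      obtain c where c: "\<forall>b\<in>Cs. c b \<in> carrier A \<and> c b \<otimes> f (jj b) = c b" "y = finsum A (\<lambda>b. c b \<otimes> b) Cs" using gen[OF y(2)] by blast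
      define x where "x b = (if b \<in> Cs then c b else \<zero>)" for b
      have "x \<in> F" by (rule FI) (use c in \<open>auto simp: x_def\<close>)
      moreover have "sig x = y" unfolding sig_def c(2) by (rule finsum_cong') (use c(1) hb(1) in \<open>auto simp: x_def\<close>)
      ultimately show "z \<in> (\<lambda>x (_::'a). sig x) ` carrier (pwm F FH)" using y(1) by auto
    qed
  qed
  moreover have "(\<lambda>y (_::'a). y) \<in> graded_hom A ?P (pwm N NH)"
    unfolding graded_hom_def Ps using NI NHI by auto
  ultimately obtain h where h: "h \<in> graded_hom A ?P (pwm F FH)" and sh: "\<forall>y\<in>carrier ?P. (\<lambda>_::'a. sig (h y)) = (\<lambda>_. y)"
    using conjunct2[OF proj[unfolded gr_projective_def], rule_format, of "pwm F FH" "pwm N NH" "\<lambda>x _. sig x" "\<lambda>y _. y"] gF gN by blast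
  have hF: "h y \<in> F" if "y \<in> J" for y using h that unfolding graded_hom_def Ps by auto
  have h_add: "h (x \<oplus> y) = (\<lambda>b. h x b \<oplus> h y b)" if "x \<in> J" "y \<in> J" for x y using h that unfolding graded_hom_def Ps by auto
  have h_act: "h (c \<otimes> y) = (\<lambda>b. c \<otimes> h y b)" if "c \<in> carrier A" "y \<in> J" for c y using h that unfolding graded_hom_def Ps by auto
  have sh: "sig (h y) = y" if "y \<in> J" for y using sh that fun_cong[of "\<lambda>_::'a. sig (h y)" "\<lambda>_. y" undefined] unfolding Ps by simp
  have h_zero: "h \<zero> b = \<zero>" for b
    using fun_cong[OF h_act[OF zero_closed idl(2)[OF idJ]], of b] FD(1)[OF hF[OF idl(2)[OF idJ]]] by simp
  have h_sum: "h (finsum A (\<lambda>b. x b \<otimes> b) C) c = finsum A (\<lambda>b. x b \<otimes> h b c) C" if x: "x \<in> F" and C: "finite C" "C \<subseteq> Cs" for x C c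
    using C
  proof (induction C rule: finite_induct)
    case empty show ?case using h_zero by simp
  next
    case (insert i C)
    have i: "x i \<otimes> i \<in> J" "i \<in> J" "x i \<in> carrier A" and CJ: "\<And>b. b \<in> C ==> x b \<otimes> b \<in> J" "\<And>b. b \<in> C ==> b \<in> J"
      using insert.prems hb(3) JmultI(1) FD(1)[OF x] by auto
    have hc: "h b c \<in> carrier A" if "b \<in> J" for b using FD(1)[OF hF[OF that]] .
    have sJ: "finsum A (\<lambda>b. x b \<otimes> b) C \<in> J" by (rule finsum_mem[OF insert.hyps(1) CJ(1) idJ])
    have "finsum A (\<lambda>b. x b \<otimes> b) (insert i C) = x i \<otimes> i \<oplus> finsum A (\<lambda>b. x b \<otimes> b) C"
      using insert.hyps CJ i J_closed by (intro finsum_insert) auto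
    then have "h (finsum A (\<lambda>b. x b \<otimes> b) (insert i C)) c = h (x i \<otimes> i) c \<oplus> h (finsum A (\<lambda>b. x b \<otimes> b) C) c"
      using h_add[OF i(1) sJ] by simp
    also have "\<dots> = x i \<otimes> h i c \<oplus> finsum A (\<lambda>b. x b \<otimes> h b c) C" using insert h_act[OF i(3,2)] by simp
    also have "\<dots> = finsum A (\<lambda>b. x b \<otimes> h b c) (insert i C)"
      using insert.hyps CJ(2) i hc FD(1)[OF x] by (intro finsum_insert[symmetric]) auto
    finally show ?case .
  qed
  \<comment> \<open>Coefficients are replaced by congruent elements \<open>w\<close> of
    \<open>wedd\<close>. This changes the sum only within \<open>J2\<close>, while the new sum lies
    in \<open>V\<close>; so it is zero, and independence over \<open>wedd\<close> makes every
    \<open>w\<close> vanish.\<close>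
  have base: "x b \<in> J" if x: "x \<in> F" and x0: "sig x = \<zero>" and b: "b \<in> Cs" for x b
  proof -
    have "\<forall>c\<in>Cs. \<exists>w. w \<in> wedd \<and> w \<otimes> f (jj c) = w \<and> x c \<ominus> w \<in> J"
    proof
      fix c assume c: "c \<in> Cs"
      obtain r where r: "r \<in> wedd" "x c \<doteq> r" using wedd_approx[OF FD(1)[OF x]] by blast
      have rc: "r \<in> carrier A" using wedd_closed[OF r(1)] .
      have "x c \<ominus> r \<otimes> f (jj c) = x c \<otimes> f (jj c) \<ominus> r \<otimes> f (jj c)" using FD(2)[OF x c] by simp
      also have "\<dots> = (x c \<ominus> r) \<otimes> f (jj c)" using rc FD(1)[OF x] hb(5)[OF c] by (simp add: a_minus_def l_distr l_minus)
      also have "\<dots> \<in> J" using r(2) JmultI(2) hb(5)[OF c] by (simp add: eqJ_def)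
      finally show "\<exists>w. w \<in> wedd \<and> w \<otimes> f (jj c) = w \<and> x c \<ominus> w \<in> J" using wedd_mult[OF r(1) f_wedd[OF hb(4)[OF c]]] rc hb(5,6)[OF c]
        by (intro exI[of _ "r \<otimes> f (jj c)"]) (simp add: m_assoc)
    qed
    from bchoice[OF this] obtain w where w0: "\<forall>c\<in>Cs. w c \<in> wedd \<and> w c \<otimes> f (jj c) = w c \<and> x c \<ominus> w c \<in> J" by (elim exE)
    note w = bspec[OF w0]
    have wc: "w c \<in> carrier A" if "c \<in> Cs" for c using w[OF that] wedd_closed by blast
    define y where "y = finsum A (\<lambda>c. w c \<otimes> c) Cs"
    have yV: "y \<in> V" unfolding y_def by (rule finsum_V[OF Cs(1)]) (rule V_wedd(1)[OF hb(2)], simp_all add: w)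
    have "sig x \<ominus> y = finsum A (\<lambda>c. x c \<otimes> c \<ominus> w c \<otimes> c) Cs"
      unfolding sig_def y_def by (rule finsum_minus[OF Cs(1) tP[OF x]]) (use wc hb(1) in auto)
    also have "\<dots> \<in> J2"
    proof (rule finsum_mem[OF Cs(1) _ idJ2])
      fix c assume c: "c \<in> Cs"
      have "x c \<otimes> c \<ominus> w c \<otimes> c = (x c \<ominus> w c) \<otimes> c" using wc[OF c] FD(1)[OF x] hb(1)[OF c] by (simp add: a_minus_def l_distr l_minus)
      also have "\<dots> \<in> J2" using w[OF c] hb(3)[OF c] by (intro ideal_prod.prod) auto
      finally show "x c \<otimes> c \<ominus> w c \<otimes> c \<in> J2" .
    qed
    finally have "\<ominus> (\<zero> \<ominus> y) \<in> J2" using x0 idl(7)[OF idJ2] by simp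
    then have "y \<in> J2" using VD(3)[OF yV] by (simp add: a_minus_def)
    then have "y = \<zero>" using S(5) VD(2)[OF yV] by simp
    then have "\<forall>c\<in>Cs. w c = \<zero>"
      using ind unfolding ind_def by (elim allE[of _ w] impE) (use w in \<open>simp_all add: y_def\<close>)
    then have "w b = \<zero>" using b by simp
    then show ?thesis using w[OF b] FD(1)[OF x] by (simp add: a_minus_def)
  qed
  \<comment> \<open>The unit vector at \<open>b\<close> minus the lift of \<open>b\<close>, that is,
    its projection to the kernel of \<open>sig\<close> along the splitting. By \<open>base\<close>
    its coefficients lie in \<open>J\<close>.\<close>
  define de where "de b c = (if c = b then f (jj b) else \<zero>) \<ominus> h b c" for b c
  have eF: "(\<lambda>c. if c = b then f (jj b) else \<zero>) \<in> F" if "b \<in> Cs" for b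
    by (rule FI) (use hb that in auto)
  have deF: "de b \<in> F" if b: "b \<in> Cs" for b
    unfolding de_def a_minus_def using Fadd[OF eF[OF b] Fneg[OF hF[OF hb(3)[OF b]]]] .
  have de0: "sig (de b) = \<zero>" if b: "b \<in> Cs" for b
  proof -
    have "sig (\<lambda>c. if c = b then f (jj b) else \<zero>) = finsum A (\<lambda>c. if b = c then c else \<zero>) Cs"
      unfolding sig_def by (rule finsum_cong') (use hb b in auto)
    also have "\<dots> = b" by (rule add.finprod_singleton) (use b Cs hb(1) in auto)
    finally have e: "sig (\<lambda>c. if c = b then f (jj b) else \<zero>) = b" .
    have hFb: "h b \<in> F" using hF[OF hb(3)[OF b]] .
    have ng: "(\<lambda>c. \<ominus> h b c) = (\<lambda>c. (\<ominus> \<one>) \<otimes> h b c)" using FD(1)[OF hFb] by (simp add: l_minus fun_eq_iff)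
    have "sig (de b) = b \<oplus> (\<ominus> \<one>) \<otimes> sig (h b)"
      unfolding de_def a_minus_def by (subst sig_add[OF eF[OF b] Fneg[OF hFb]], subst ng, subst sig_act[OF _ hFb]) (simp_all add: e)
    also have "\<dots> = \<zero>" using sh[OF hb(3)[OF b]] hb(1)[OF b] by (simp add: l_minus r_neg)
    finally show ?thesis .
  qed
  have power: "\<forall>b\<in>Cs. x b \<in> Jp (Suc k)" if x: "x \<in> F" and x0: "sig x = \<zero>" for x k
  proof (induction k)
    case 0 show ?case using base[OF x x0] Jp1 by simp
  next
    case (Suc k)
    show ?case
    proof
      fix c assume c: "c \<in> Cs"
      have hc: "h b c \<in> carrier A" if "b \<in> Cs" for b using FD(1)[OF hF[OF hb(3)[OF that]]] .
      have c1: "(\<lambda>b. x b \<otimes> (if c = b then f (jj b) else \<zero>)) \<in> Cs \<rightarrow> carrier A" and c2: "(\<lambda>b. x b \<otimes> h b c) \<in> Cs \<rightarrow> carrier A"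
        using FD(1)[OF x] hb(5) hc by auto
      have "finsum A (\<lambda>b. x b \<otimes> (if c = b then f (jj b) else \<zero>)) Cs = finsum A (\<lambda>b. if c = b then x b else \<zero>) Cs"
        by (rule finsum_cong') (use FD[OF x] in auto)
      also have "\<dots> = x c" by (rule add.finprod_singleton) (use c Cs FD(1)[OF x] in auto)
      finally have e1: "finsum A (\<lambda>b. x b \<otimes> (if c = b then f (jj b) else \<zero>)) Cs = x c" .
      have e2: "finsum A (\<lambda>b. x b \<otimes> h b c) Cs = \<zero>"
        using h_sum[OF x Cs(1) order_refl, of c] x0 h_zero unfolding sig_def by simp
      have "x c = x c \<ominus> \<zero>" using FD(1)[OF x] by (simp add: a_minus_def)
      \<comment> \<open>As \<open>x\<close> is in the kernel, the part of the sum coming from the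
        splitting is zero. So \<open>x\<close> is the combination of the projected unit vectors with
        its own coefficients, each multiplied by an element of \<open>J\<close>.\<close>
      also have "\<dots> = finsum A (\<lambda>b. x b \<otimes> (if c = b then f (jj b) else \<zero>) \<ominus> x b \<otimes> h b c) Cs"
        using finsum_minus[OF Cs(1) c1 c2] unfolding e1 e2 .
      also have "\<dots> \<in> Jp (Suc (Suc k))"
      proof (rule finsum_mem[OF Cs(1) _ idp])
        fix b assume b: "b \<in> Cs"
        have "x b \<otimes> (if c = b then f (jj b) else \<zero>) \<ominus> x b \<otimes> h b c = x b \<otimes> de b c"
          using FD(1)[OF x] hb(5)[OF b] hc[OF b] by (simp add: de_def a_minus_def r_distr r_minus)
        also have "\<dots> \<in> Jp (Suc (Suc k))" using Suc b base[OF deF[OF b] de0[OF b] c] by (intro Jp_step) auto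
        finally show "x b \<otimes> (if c = b then f (jj b) else \<zero>) \<ominus> x b \<otimes> h b c \<in> Jp (Suc (Suc k))" .
      qed
      finally show "x c \<in> Jp (Suc (Suc k))" .
    qed
  qed
  \<comment> \<open>The given coefficients are extended by zero so as to become an element of
    \<open>F\<close>.\<close>
  define x where "x b = (if b \<in> Cs then a b else \<zero>)" for b
  have xF: "x \<in> F" by (rule FI) (use a in \<open>auto simp: x_def\<close>)
  have "sig x = finsum A (\<lambda>b. a b \<otimes> b) Cs" unfolding sig_def by (rule finsum_cong') (use a hb(1) in \<open>auto simp: x_def\<close>)
  then have "x b = \<zero>" if "b \<in> Cs" for b using power[OF xF] a0 that by (intro J_stable_zero) simp
  then show ?thesis by (simp add: x_def)
qed

end

section \<open>The presentation of the algebra by its superspecies\<close>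

context species_salg begin

lemma ta_finsum:
  assumes bm: "bimodule R M" and "finite C" "x \<in> C \<rightarrow> carrier M"
  shows "finsum M x C \<in> carrier M \<and> ta (finsum M x C) = finsum A (\<lambda>b. ta (x b)) C"
proof -
  interpret bm: bimodule R M by (rule bm)
  show ?thesis using assms(2,3)
  proof (induction C rule: finite_induct)
    case empty then show ?case using M_zero by simp
  next
    case (insert i C)
    have c: "x \<in> C \<rightarrow> carrier M" "x i \<in> carrier M" using insert.prems by auto
    have "(\<lambda>b. ta (x b)) \<in> C \<rightarrow> carrier A" using c by (auto intro: tau_closed)
    moreover have "ta (x i) \<in> carrier A" using c by simp
    moreover have "finsum M x C \<in> carrier M" "ta (finsum M x C) = finsum A (\<lambda>b. ta (x b)) C" using insert.IH[OF c(1)] by auto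
    ultimately show ?case using insert.hyps c M_add[OF c(2), of "finsum M x C"] by simp
  qed
qed

theorem species_presentation:
  "(\<exists>I. admissible R M I \<and> graded_isomorphic K A (gquot (tensor_algebra R M) I)) \<and>
   (gr_hereditary A \<longrightarrow> acyclic_species K S \<and> graded_isomorphic K A (tensor_algebra R M))"
proof -
  obtain t0 where t0: "ideal_power A J t0 = {\<zero>}" using J_nilpotent[OF idJ] by blast
  have pres: "presentation K R M A sg ta J t0" by (rule presentation[OF t0])
  obtain Cs where Cs: "finite Cs" "Cs \<subseteq> hv" and ind: "ind Cs" and sp: "spn Cs = V" by (rule basis_exists)
  have hb: "b \<in> V" "b \<in> carrier A" "jj b \<in> {1..n}" "f (jj b) \<otimes> b = b" if "b \<in> Cs" for b
    using hvD[of b] Cs that by (auto simp: subset_iff)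
  \<comment> \<open>The element of the species ring lifting to the idempotent of \<open>b\<close>;
    it exists because \<open>f\<close> takes values in \<open>wedd\<close>, the image of
    \<open>sg\<close>.\<close>
  define ee where "ee b = (SOME d. d \<in> carrier R \<and> sg d = f (jj b))" for b
  have ee: "ee b \<in> carrier R \<and> sg (ee b) = f (jj b)" if b: "b \<in> Cs" for b
  proof -
    obtain d where "d \<in> carrier R" "sg d = f (jj b)" by (rule sigma_surj[OF f_wedd[OF hb(3)[OF b]]])
    then have "d \<in> carrier R \<and> sg d = f (jj b)" by simp
    then show ?thesis unfolding ee_def by (rule someI[where P = "\<lambda>d. d \<in> carrier R \<and> sg d = f (jj b)"])
  qed
  \<comment> \<open>The basis of \<open>V\<close> over \<open>wedd\<close>, carried to the species
    bimodule by \<open>mk\<close>, generates it over the species ring; equations are checked after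
    applying the injections \<open>sg\<close> and \<open>ta\<close>.\<close>
  have gp: "generated_presentation K R M A sg ta J t0 Cs mk ee"
  proof (intro generated_presentation.intro generated_presentation_axioms.intro pres Cs(1))
    fix b assume b: "b \<in> Cs"
    note m = mk[OF hb(1)[OF b]] and e = ee[OF b]
    show "mk b \<in> carrier M" "ee b \<in> carrier R" using m e by auto
    show "ee b \<otimes>\<^bsub>R\<^esub> ee b = ee b"
      by (rule sigma_inj) (use e ff[OF hb(3)[OF b]] R_closed(1) in \<open>simp_all add: sigma_mult\<close>)
    show "ee b \<odot>\<^bsub>M\<^esub> mk b = mk b"
      by (rule tau_inj) (use e m M_lact[of "ee b" "mk b"] hb(4)[OF b] in simp_all)
  next
    fix x assume x: "x \<in> carrier M"
    have "ta x \<in> spn Cs" using tau_V[OF x] sp by simp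
    then obtain a where a: "\<forall>b\<in>Cs. a b \<in> wedd" "ta x = finsum A (\<lambda>b. a b \<otimes> b) Cs" unfolding spn_def by blast
    define r where "r b = (SOME d. d \<in> carrier R \<and> sg d = a b)" for b
    have r: "r b \<in> carrier R \<and> sg (r b) = a b" if b: "b \<in> Cs" for b
    proof -
      obtain d where "d \<in> carrier R" "sg d = a b" by (rule sigma_surj[OF a(1)[rule_format, OF b]])
      then have "d \<in> carrier R \<and> sg d = a b" by simp
      then show ?thesis unfolding r_def by (rule someI[where P = "\<lambda>d. d \<in> carrier R \<and> sg d = a b"])
    qed
    have L: "r b \<odot>\<^bsub>M\<^esub> mk b \<in> carrier M" "ta (r b \<odot>\<^bsub>M\<^esub> mk b) = a b \<otimes> b" if b: "b \<in> Cs" for b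
      using M_lact[of "r b" "mk b"] r[OF b] mk[OF hb(1)[OF b]] by auto
    have P: "(\<lambda>b. r b \<odot>\<^bsub>M\<^esub> mk b) \<in> Cs \<rightarrow> carrier M" using L by auto
    note F = ta_finsum[OF bimodule_M Cs(1) P]
    have "finsum A (\<lambda>b. ta (r b \<odot>\<^bsub>M\<^esub> mk b)) Cs = ta x"
      unfolding a(2) by (rule finsum_cong') (use L a(1) wedd_closed hb(2) in auto)
    then have "x = finsum M (\<lambda>b. r b \<odot>\<^bsub>M\<^esub> mk b) Cs" using F x by (intro tau_inj) auto
    then show "\<exists>r\<in>Cs \<rightarrow> carrier R. x = finsum M (\<lambda>b. r b \<odot>\<^bsub>M\<^esub> mk b) Cs" using r by (intro bexI[of _ r]) auto
  qed
  \<comment> \<open>On \<open>Cs\<close> the map \<open>ta\<close> undoes \<open>mk\<close>, so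
    statements about generators of the bimodule become statements about elements of
    \<open>V\<close>.\<close>
  have conv: "finsum A (\<lambda>b. a b \<otimes> ta (mk b)) Cs = finsum A (\<lambda>b. a b \<otimes> b) Cs" if "\<And>b. b \<in> Cs ==> a b \<in> carrier A" for a
    by (rule finsum_cong') (use that hb(2) mk(2)[OF hb(1)] in auto)
  have gen: "\<exists>a. (\<forall>b\<in>Cs. a b \<in> carrier A \<and> a b \<otimes> f (jj b) = a b) \<and> y = finsum A (\<lambda>b. a b \<otimes> b) Cs" if y: "y \<in> J" for y
  proof -
    obtain a where a: "\<forall>b\<in>Cs. a b \<in> carrier A \<and> a b \<otimes> sg (ee b) = a b" "y = finsum A (\<lambda>b. a b \<otimes> ta (mk b)) Cs"
      using generated_presentation.J_generated[OF gp y] by (elim exE conjE)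
    then show ?thesis using ee conv[of a] by (intro exI[of _ a]) auto
  qed
  show ?thesis
  proof (intro conjI impI exI)
    show "admissible R M (graded_lift.ker R M A sg ta)" by (rule presentation.admissible_ker[OF pres])
    show "graded_isomorphic K A (gquot (tensor_algebra R M) (graded_lift.ker R M A sg ta))"
      by (rule presentation.graded_isomorphic_presentation[OF pres])
    assume her: "gr_hereditary A"
    have triv: "graded_lift.ker R M A sg ta \<subseteq> {\<zero>\<^bsub>tensor_algebra R M\<^esub>}"
    proof (rule generated_presentation.ker_trivial[OF gp])
      fix a assume a: "\<And>b. b \<in> Cs ==> a b \<in> carrier A \<and> a b \<otimes> sg (ee b) = a b" and z: "finsum A (\<lambda>b. a b \<otimes> ta (mk b)) Cs = \<zero>"
      show "\<forall>b\<in>Cs. a b = \<zero>"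
        by (rule hereditary_independent[OF her Cs ind gen]) (use a ee z conv[of a] in auto)
    qed
    have gl: "graded_lift K R M A sg ta" by (rule presentation.axioms(1)[OF pres])
    \<comment> \<open>With trivial kernel, finite dimension of \<open>A\<close> is carried over to
      the tensor algebra, which is acyclicity.\<close>
    note T = graded_lift.ker_trivial_isomorphic[OF gl presentation.Phi_surj[OF pres] triv fd]
    show "graded_isomorphic K A (tensor_algebra R M)" by (rule T(1))
    show "acyclic_species K S" unfolding acyclic_species_def by (rule T(2))
  qed
qed

end

theorem theorem4p3:
  fixes K :: "('k, 'x) ring_scheme"
    and A :: "('k, 'a, 'y) gmodule_scheme"
    and S :: "('k, 'a set, 'a set) superspecies"
  assumes "algebraically_closed K"
    and "\<one>\<^bsub>K\<^esub> \<oplus>\<^bsub>K\<^esub> \<one>\<^bsub>K\<^esub> \<noteq> \<zero>\<^bsub>K\<^esub>"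
    and "superalgebra K A"
    and "vectorspace.fin_dim K A"
    and "gr_basic K A"
    and "superspecies_of K A S"
  shows "(\<exists>I. admissible (species_ring S) (species_bimodule S) I \<and>
              graded_isomorphic K A (gquot (species_tensor_algebra S) I)) \<and>
         (gr_hereditary A \<longrightarrow>
            acyclic_species K S \<and> graded_isomorphic K A (species_tensor_algebra S))"
proof -
  have salg: "salg K A" by (intro salg.intro assms(3) superalgebra.axioms(2)[OF assms(3)])
  have dec: "decomp_salg K A (num S) (divalg S)"
    using assms(4,6) by (intro decomp_salg.intro fd_salg.intro fd_salg_axioms.intro decomp_salg_axioms.intro salg) (auto simp: superspecies_of_def)
  \<comment> \<open>The idempotents are lifted along the enumeration of summands fixed by
    \<open>S\<close>, so each \<open>f i\<close> represents the identity of the given i-th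
    summand.\<close>
  obtain f u where fu: "split_salg K A (num S) f u" and q: "\<forall>i\<in>{1..num S}. gr_radical A +>\<^bsub>A\<^esub> f i = \<one>\<^bsub>divalg S i\<^esub>"
    using decomp_salg.split_exists[OF dec assms(1,2)] by blast
  obtain s where s: "split_salg.section_map K A s" "\<forall>r\<in>split_salg.wedd K A (num S) f u. \<forall>x\<in>gr_radical A. s (r \<otimes>\<^bsub>A\<^esub> x) = r \<otimes>\<^bsub>A\<^esub> s x \<and> s (x \<otimes>\<^bsub>A\<^esub> r) = s x \<otimes>\<^bsub>A\<^esub> r"
    using split_salg.bilinear_section[OF fu] by blast
  have "species_salg K A S f u s"
    by (intro species_salg.intro species_salg_axioms.intro fu dec) (use q s assms(6) in \<open>auto simp: superspecies_of_def Let_def\<close>)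
  then show ?thesis by (rule species_salg.species_presentation)
qed

end
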